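(* Let $\mathbb{K}$ be an algebraically closed field containing $\mathbb{F}_q$, and let $\phi$ and $\psi$ be two almost strictly pure abelian $t$-modules defined over $\mathbb{K}$ of weight $w_\phi$ and $w_\psi$ respectively. Let $\mathsf{M}:=\mathsf{M}_\phi\otimes_{\mathbb{K}[t]}\mathsf{M}_\psi$ be the tensor product of their $t$-motives. Then there is an almost strictly pure $t$-module $\rho$ defined over $\mathbb{K}$ such that $\mathsf{M}\cong\mathsf{M}_\rho$ (as left $\mathbb{K}\{\tau,t\}$-modules). In other words, $\mathsf{M}_\phi\otimes_{\mathbb{K}[t]}\mathsf{M}_\psi$ is almost strictly pure with respect to an appropriate $\mathbb{K}\{\tau\}$-basis. If $1/w_\phi+1/w_\psi\in\mathbb{Z}$, then the $\mathbb{K}\{\tau\}$-basis can be chosen such that $\mathsf{M}_\phi\otimes_{\mathbb{K}[t]}\mathsf{M}_\psi$ is strictly pure with respect to it.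
   Context: $\mathbb{F}_q$ is the finite field with $q$ elements, $\mathbb{K}$ is an algebraically closed field containing $\mathbb{F}_q$, and $\theta\in\mathbb{K}$ is a fixed element. $\mathbb{K}\{\tau\}$ is the skew polynomial ring with $\tau\alpha=\alpha^q\tau$ for $\alpha\in\mathbb{K}$; $\mathbb{K}\{\tau,t\}$ is the skew polynomial ring in $\tau,t$ with in addition $t\alpha=\alpha t$ for $\alpha\in\mathbb{K}$, and $t\tau=\tau t$. For $d>0$, a $d$-dimensional (Anderson) $t$-module over $\mathbb{K}$ is an $\mathbb{F}_q$-algebra homomorphism $\phi:\mathbb{F}_q[t]\to\mathrm{Mat}_d(\mathbb{K}\{\tau\})$, $a\mapsto\phi_a$, such that $\partial\phi_t-\theta\mathbb{I}_d$ is nilpotent, where $\partial(\sum_i B_i\tau^i)=B_0$ for $B_i\in\mathrm{Mat}_d(\mathbb{K})$. Its associated left $\mathbb{K}\{\tau,t\}$-module is $\mathsf{M}_\phi=\mathrm{Mat}_{1\times d}(\mathbb{K}\{\tau\})$ with left multiplication by $\mathbb{K}\{\tau\}$ and $t\cdot x=x\phi_t$. $\phi$ is abelian if $\mathsf{M}_\phi$ is free of finite rank over $\mathbb{K}[t]$; then $\mathsf{M}_\phi$ is called the $t$-motive of $\phi$, and this rank $r$ is the rank of $\phi$. The weight of $\phi$ is $w_\phi=d/r$. (Almost strictly pure abelian $t$-modules are known to be pure.) $\phi$ is almost strictly pure if for some integer $n\ge1$, writing $\phi_{t^n}=B_0+B_1\tau+\cdots+B_s\tau^s$ with $B_j\in\mathrm{Mat}_d(\mathbb{K})$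 and $B_s\ne0$, one has $B_s\in\mathrm{GL}_d(\mathbb{K})$. A left $\mathbb{K}\{\tau,t\}$-module $\mathsf{M}$ that is free of rank $d$ over $\mathbb{K}\{\tau\}$ is almost strictly pure with respect to a $\mathbb{K}\{\tau\}$-basis $\{\kappa_1,\dots,\kappa_d\}$ if for some integer $n\ge 1$ one has $t^n(\kappa_1,\dots,\kappa_d)^{\mathrm{tr}}=D\,(\kappa_1,\dots,\kappa_d)^{\mathrm{tr}}$ with $D=D_0+\cdots+D_s\tau^s$, $D_j\in\mathrm{Mat}_d(\mathbb{K})$ and $D_s\in\mathrm{GL}_d(\mathbb{K})$; it is strictly pure with respect to this basis if this holds with $n=1$. The tensor product $\mathsf{M}_\phi\otimes_{\mathbb{K}[t]}\mathsf{M}_\psi$ carries the diagonal $\tau$-action $\tau(m\otimes m')=\tau m\otimes\tau m'$; it is known to be a pure $t$-motive (in particular free of finite rank over $\mathbb{K}\{\tau\}$) of weight $w_\phi+w_\psi$.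
   Formalization: In the last sentence the condition 1/w_φ+1/w_ψ ∈ ℤ is replaced by 1/(w_φ+w_ψ) ∈ ℤ, since the printed condition fails for the tensor square of the Carlitz module, while the corrected one is necessary for strict purity. *)

theory Defs
  imports
    "HOL-Algebra.Algebraic_Closure_Type"
    "HOL-Algebra.Free_Abelian_Groups"
    "HOL-Algebra.Generated_Groups"
    "HOL-Algebra.UnivPoly"
    "Jordan_Normal_Form.Matrix"
begin

section \<open>Left modules\<close>

text \<open>The library locale \<^term>\<open>Module.module\<close> requires a commutative ring of scalars; its record is reused
  here with the same axioms over an arbitrary ring.\<close>

locale left_module = R?: ring R + M?: abelian_group M
    for R :: "('r, 'x) ring_scheme" (structure) and M :: "('r, 'm, 'y) module_scheme" (structure) +
  assumes smult_closed: "a \<in> carrier R \<Longrightarrow> x \<in> carrier M \<Longrightarrow> a \<odot>\<^bsub>M\<^esub> x \<in> carrier M"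
    and smult_l_distr: "a \<in> carrier R \<Longrightarrow> b \<in> carrier R \<Longrightarrow> x \<in> carrier M \<Longrightarrow>
      (a \<oplus>\<^bsub>R\<^esub> b) \<odot>\<^bsub>M\<^esub> x = a \<odot>\<^bsub>M\<^esub> x \<oplus>\<^bsub>M\<^esub> b \<odot>\<^bsub>M\<^esub> x"
    and smult_r_distr: "a \<in> carrier R \<Longrightarrow> x \<in> carrier M \<Longrightarrow> y \<in> carrier M \<Longrightarrow>
      a \<odot>\<^bsub>M\<^esub> (x \<oplus>\<^bsub>M\<^esub> y) = a \<odot>\<^bsub>M\<^esub> x \<oplus>\<^bsub>M\<^esub> a \<odot>\<^bsub>M\<^esub> y"
    and smult_assoc: "a \<in> carrier R \<Longrightarrow> b \<in> carrier R \<Longrightarrow> x \<in> carrier M \<Longrightarrow>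
      (a \<otimes>\<^bsub>R\<^esub> b) \<odot>\<^bsub>M\<^esub> x = a \<odot>\<^bsub>M\<^esub> (b \<odot>\<^bsub>M\<^esub> x)"
    and smult_one: "x \<in> carrier M \<Longrightarrow> \<one>\<^bsub>R\<^esub> \<odot>\<^bsub>M\<^esub> x = x"

definition isomorphic_modules ::
    "('r, 'x) ring_scheme \<Rightarrow> ('r, 'm, 'y) module_scheme \<Rightarrow> ('r, 'n, 'z) module_scheme \<Rightarrow> bool" where
  "isomorphic_modules R M N \<longleftrightarrow> (\<exists>h. bij_betw h (carrier M) (carrier N) \<and>
     (\<forall>x\<in>carrier M. \<forall>y\<in>carrier M. h (x \<oplus>\<^bsub>M\<^esub> y) = h x \<oplus>\<^bsub>N\<^esub> h y) \<and>
     (\<forall>a\<in>carrier R. \<forall>x\<in>carrier M. h (a \<odot>\<^bsub>M\<^esub> x) = a \<odot>\<^bsub>N\<^esub> h x))"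

text \<open>\<open>b 0, \<dots>, b (r - 1)\<close> is a basis of \<open>M\<close> regarded as a module over the subring \<open>S\<close> of its ring of
  scalars.\<close>

definition free_basis :: "'r set \<Rightarrow> ('r, 'm, 'y) module_scheme \<Rightarrow> nat \<Rightarrow> (nat \<Rightarrow> 'm) \<Rightarrow> bool" where
  "free_basis S M r b \<longleftrightarrow> b \<in> {..<r} \<rightarrow> carrier M \<and>
     (\<forall>x\<in>carrier M. \<exists>!c. c \<in> {..<r} \<rightarrow>\<^sub>E S \<and> x = (\<Oplus>\<^bsub>M\<^esub>i\<in>{..<r}. c i \<odot>\<^bsub>M\<^esub> b i))"

definition free_rank :: "'r set \<Rightarrow> ('r, 'm, 'y) module_scheme \<Rightarrow> nat" where
  "free_rank S M = (THE r. \<exists>b. free_basis S M r b)"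


section \<open>The skew polynomial rings\<close>

text \<open>An element of \<open>K{\<tau>}\<close> is stored as the ordinary polynomial with the same coefficients (written to
  the left of the powers of \<open>\<tau>\<close>); only the product differs from that of \<^typ>\<open>'k poly\<close>.\<close>

definition skew_mult :: "nat \<Rightarrow> 'k::field poly \<Rightarrow> 'k poly \<Rightarrow> 'k poly" where
  "skew_mult q f g = (\<Sum>i\<le>degree f. \<Sum>j\<le>degree g.
     Polynomial.monom (Polynomial.coeff f i * Polynomial.coeff g j ^ (q ^ i)) (i + j))"

definition skew_ring :: "nat \<Rightarrow> 'k::field poly ring" where
  "skew_ring q = \<lparr>carrier = UNIV, monoid.mult = skew_mult q, one = 1, ring.zero = 0, add = (+)\<rparr>"

text \<open>\<open>K{\<tau>,t} = K{\<tau>}[t]\<close> with \<open>t\<close> central. The polynomial ring construction \<^const>\<open>UP\<close> does not need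
  commutative coefficients.\<close>

definition skew_ring_t :: "nat \<Rightarrow> ('k::field poly, nat \<Rightarrow> 'k poly) up_ring" where
  "skew_ring_t q = UP (skew_ring q)"

definition in_tau :: "nat \<Rightarrow> 'k::field poly \<Rightarrow> (nat \<Rightarrow> 'k poly)" where
  "in_tau q f = up_ring.monom (skew_ring_t q) f 0"

definition const_elem :: "nat \<Rightarrow> 'k::field \<Rightarrow> (nat \<Rightarrow> 'k poly)" where
  "const_elem q c = in_tau q [:c:]"

definition tau_elem :: "nat \<Rightarrow> (nat \<Rightarrow> 'k::field poly)" where
  "tau_elem q = in_tau q [:0, 1:]"

definition t_elem :: "nat \<Rightarrow> (nat \<Rightarrow> 'k::field poly)" where
  "t_elem q = up_ring.monom (skew_ring_t q) 1 1"

definition K_tau :: "nat \<Rightarrow> (nat \<Rightarrow> 'k::field poly) set" where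
  "K_tau q = range (in_tau q)"

definition K_t :: "nat \<Rightarrow> (nat \<Rightarrow> 'k::field poly) set" where
  "K_t q = {a \<in> carrier (skew_ring_t q). \<forall>j. degree (a j) = 0}"


section \<open>Matrices over the skew polynomial ring\<close>

definition skew_mat_mult :: "nat \<Rightarrow> 'k::field poly mat \<Rightarrow> 'k poly mat \<Rightarrow> 'k poly mat" where
  "skew_mat_mult q A B = mat (dim_row A) (dim_col B)
     (\<lambda>(i, j). \<Sum>k<dim_col A. skew_mult q (A $$ (i, k)) (B $$ (k, j)))"

definition skew_mat_ring :: "nat \<Rightarrow> nat \<Rightarrow> 'k::field poly mat ring" where
  "skew_mat_ring q d = \<lparr>carrier = carrier_mat d d, monoid.mult = skew_mat_mult q, one = 1\<^sub>m d,
     ring.zero = 0\<^sub>m d d, add = (+)\<rparr>"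

definition coeff_mat :: "'k::field poly mat \<Rightarrow> nat \<Rightarrow> 'k mat" where
  "coeff_mat D j = map_mat (\<lambda>f. Polynomial.coeff f j) D"

definition invertible_leading_coeff :: "'k::field poly mat \<Rightarrow> bool" where
  "invertible_leading_coeff D \<longleftrightarrow> (\<exists>s. (\<forall>j>s. coeff_mat D j = 0\<^sub>m (dim_row D) (dim_col D)) \<and>
     coeff_mat D s \<noteq> 0\<^sub>m (dim_row D) (dim_col D) \<and> invertible_mat (coeff_mat D s))"


section \<open>Anderson t-modules and their motives\<close>

definition poly_ring_over :: "'k::field set \<Rightarrow> 'k poly ring" where
  "poly_ring_over F = \<lparr>carrier = {a. \<forall>i. Polynomial.coeff a i \<in> F}, monoid.mult = (*), one = 1,
     ring.zero = 0, add = (+)\<rparr>"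

text \<open>\<open>F\<close> is the finite subfield of \<open>q\<close> elements; \<open>\<phi>\<close> is only relevant on polynomials over \<open>F\<close>.\<close>

definition t_module :: "'k::field set \<Rightarrow> 'k \<Rightarrow> nat \<Rightarrow> ('k poly \<Rightarrow> 'k poly mat) \<Rightarrow> bool" where
  "t_module F \<theta> d \<phi> \<longleftrightarrow> d > 0 \<and>
     \<phi> \<in> Ring.ring_hom (poly_ring_over F) (skew_mat_ring (card F) d) \<and>
     (\<forall>c\<in>F. \<forall>a\<in>carrier (poly_ring_over F).
        \<phi> (Polynomial.smult c a) = map_mat (Polynomial.smult c) (\<phi> a)) \<and>
     (\<exists>k. (coeff_mat (\<phi> [:0, 1:]) 0 - \<theta> \<cdot>\<^sub>m 1\<^sub>m d) ^\<^sub>m k = 0\<^sub>m d d)"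

definition almost_strictly_pure :: "('k::field poly \<Rightarrow> 'k poly mat) \<Rightarrow> bool" where
  "almost_strictly_pure \<phi> \<longleftrightarrow> (\<exists>n\<ge>1. invertible_leading_coeff (\<phi> (Polynomial.monom 1 n)))"

text \<open>\<open>\<Sum>\<^sub>j a\<^sub>j t\<^sup>j\<close> with \<open>a\<^sub>j \<in> K{\<tau>}\<close> acts on a row vector by \<open>x \<mapsto> \<Sum>\<^sub>j a\<^sub>j (x \<phi>\<^sub>t\<^sup>j)\<close>. The ring
  multiplication and unit in a module record carry no meaning.\<close>

definition motive ::
    "nat \<Rightarrow> nat \<Rightarrow> ('k::field poly \<Rightarrow> 'k poly mat) \<Rightarrow> (nat \<Rightarrow> 'k poly, 'k poly mat) module" where
  "motive q d \<phi> = \<lparr>carrier = carrier_mat 1 d, monoid.mult = undefined, one = undefined,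
     ring.zero = 0\<^sub>m 1 d, add = (+),
     module.smult = (\<lambda>a x. \<Oplus>\<^bsub>module_mat TYPE('k poly) 1 d\<^esub>j\<in>{..deg (skew_ring q) a}.
       map_mat (skew_mult q (a j)) (((\<lambda>y. skew_mat_mult q y (\<phi> [:0, 1:])) ^^ j) x))\<rparr>"

definition abelian_t_module :: "nat \<Rightarrow> nat \<Rightarrow> ('k::field poly \<Rightarrow> 'k poly mat) \<Rightarrow> bool" where
  "abelian_t_module q d \<phi> \<longleftrightarrow> (\<exists>r b. free_basis (K_t q) (motive q d \<phi>) r b)"

definition weight :: "nat \<Rightarrow> nat \<Rightarrow> ('k::field poly \<Rightarrow> 'k poly mat) \<Rightarrow> rat" where
  "weight q d \<phi> = of_nat d / of_nat (free_rank (K_t q) (motive q d \<phi>))"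


section \<open>Purity with respect to a basis\<close>

definition pure_wrt_basis_at ::
    "nat \<Rightarrow> nat \<Rightarrow> (nat \<Rightarrow> 'k::field poly, 'm) module \<Rightarrow> nat \<Rightarrow> (nat \<Rightarrow> 'm) \<Rightarrow> bool" where
  "pure_wrt_basis_at n q M d \<kappa> \<longleftrightarrow>
     left_module (skew_ring_t q) M \<and> free_basis (K_tau q) M d \<kappa> \<and>
     (\<exists>D\<in>carrier_mat d d. invertible_leading_coeff D \<and>
        (\<forall>i<d. (t_elem q [^]\<^bsub>skew_ring_t q\<^esub> n) \<odot>\<^bsub>M\<^esub> \<kappa> i =
           (\<Oplus>\<^bsub>M\<^esub>j\<in>{..<d}. in_tau q (D $$ (i, j)) \<odot>\<^bsub>M\<^esub> \<kappa> j)))"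

definition almost_strictly_pure_wrt ::
    "nat \<Rightarrow> (nat \<Rightarrow> 'k::field poly, 'm) module \<Rightarrow> nat \<Rightarrow> (nat \<Rightarrow> 'm) \<Rightarrow> bool" where
  "almost_strictly_pure_wrt q M d \<kappa> \<longleftrightarrow> (\<exists>n\<ge>1. pure_wrt_basis_at n q M d \<kappa>)"

text \<open>If \<open>M\<close> is strictly pure with leading exponent \<open>s\<close> and has rank \<open>r\<close> over \<open>K[t]\<close> and \<open>d\<close> over
  \<open>K{\<tau>}\<close>, then \<open>M / t M\<close> has \<open>K\<close>-dimension \<open>r = s d\<close>, so the weight \<open>d / r\<close> is \<open>1 / s\<close>. The weight of
  a tensor product is the sum \<open>w + w'\<close> of the weights; hence the integrality condition for strict
  purity is that of \<open>1 / (w + w')\<close>, not of \<open>1 / w + 1 / w'\<close>. For the tensor square of the Carlitz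
  module, \<open>w = w' = 1\<close>, \<open>r = 1\<close>, \<open>d = 2\<close>, so it is not strictly pure although \<open>1 / w + 1 / w' = 2\<close>.\<close>

definition strictly_pure_wrt ::
    "nat \<Rightarrow> (nat \<Rightarrow> 'k::field poly, 'm) module \<Rightarrow> nat \<Rightarrow> (nat \<Rightarrow> 'm) \<Rightarrow> bool" where
  "strictly_pure_wrt q M d \<kappa> \<longleftrightarrow> pure_wrt_basis_at 1 q M d \<kappa>"


section \<open>The tensor product over K[t]\<close>

text \<open>The usual construction: the free abelian group on pairs modulo the relations of a balanced
  biadditive map.\<close>

definition tensor_relations ::
    "'r set \<Rightarrow> ('r, 'm) module \<Rightarrow> ('r, 'n) module \<Rightarrow> ('m \<times> 'n \<Rightarrow>\<^sub>0 int) set" where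
  "tensor_relations S M N =
     {frag_of (x \<oplus>\<^bsub>M\<^esub> x', y) - frag_of (x, y) - frag_of (x', y) | x x' y.
        x \<in> carrier M \<and> x' \<in> carrier M \<and> y \<in> carrier N} \<union>
     {frag_of (x, y \<oplus>\<^bsub>N\<^esub> y') - frag_of (x, y) - frag_of (x, y') | x y y'.
        x \<in> carrier M \<and> y \<in> carrier N \<and> y' \<in> carrier N} \<union>
     {frag_of (a \<odot>\<^bsub>M\<^esub> x, y) - frag_of (x, a \<odot>\<^bsub>N\<^esub> y) | a x y.
        a \<in> S \<and> x \<in> carrier M \<and> y \<in> carrier N}"

definition tensor_kernel ::
    "'r set \<Rightarrow> ('r, 'm) module \<Rightarrow> ('r, 'n) module \<Rightarrow> ('m \<times> 'n \<Rightarrow>\<^sub>0 int) set" where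
  "tensor_kernel S M N =
     generate (free_Abelian_group (carrier M \<times> carrier N)) (tensor_relations S M N)"

definition tensor_group ::
    "'r set \<Rightarrow> ('r, 'm) module \<Rightarrow> ('r, 'n) module \<Rightarrow> ('m \<times> 'n \<Rightarrow>\<^sub>0 int) set monoid" where
  "tensor_group S M N =
     free_Abelian_group (carrier M \<times> carrier N) Mod tensor_kernel S M N"

text \<open>The endomorphism of the tensor product determined by \<open>x \<otimes> y \<mapsto> u x \<otimes> v y\<close>. When it is well
  defined, all members of the union are equal.\<close>

definition tensor_map :: "'r set \<Rightarrow> ('r, 'm) module \<Rightarrow> ('r, 'n) module \<Rightarrow>
    ('m \<Rightarrow> 'm) \<Rightarrow> ('n \<Rightarrow> 'n) \<Rightarrow> ('m \<times> 'n \<Rightarrow>\<^sub>0 int) set \<Rightarrow> ('m \<times> 'n \<Rightarrow>\<^sub>0 int) set" where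
  "tensor_map S M N u v A = (\<Union>z\<in>A.
     r_coset (free_Abelian_group (carrier M \<times> carrier N)) (tensor_kernel S M N)
       (frag_extend (\<lambda>(x, y). frag_of (u x, v y)) z))"

text \<open>\<open>\<tau>\<close> acts diagonally, while \<open>t\<close> and the constants act through one factor (either one, by the
  balancing relations). The element \<open>\<Sum>\<^sub>j \<Sum>\<^sub>i c\<^sub>j\<^sub>i \<tau>\<^sup>i t\<^sup>j\<close> acts accordingly.\<close>

definition motive_tensor ::
    "nat \<Rightarrow> (nat \<Rightarrow> 'k::field poly, 'm) module \<Rightarrow> (nat \<Rightarrow> 'k poly, 'n) module \<Rightarrow>
       (nat \<Rightarrow> 'k poly, ('m \<times> 'n \<Rightarrow>\<^sub>0 int) set) module" where
  "motive_tensor q M N = (let G = tensor_group (K_t q) M N;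
       scal = (\<lambda>c. tensor_map (K_t q) M N (module.smult M (const_elem q c)) id);
       tau = tensor_map (K_t q) M N (module.smult M (tau_elem q)) (module.smult N (tau_elem q));
       t = tensor_map (K_t q) M N (module.smult M (t_elem q)) id
     in \<lparr>carrier = carrier G, monoid.mult = undefined, one = undefined,
       ring.zero = \<one>\<^bsub>G\<^esub>, add = (\<lambda>A B. A \<otimes>\<^bsub>G\<^esub> B),
       module.smult = (\<lambda>a A. \<Otimes>\<^bsub>G\<^esub>j\<in>{..deg (skew_ring q) a}. \<Otimes>\<^bsub>G\<^esub>i\<in>{..degree (a j)}.
         scal (Polynomial.coeff (a j) i) ((tau ^^ i) ((t ^^ j) A)))\<rparr>)"

end

theory Submission
  imports Defs "HOL-Library.Function_Algebras" Jordan_Normal_Form.Determinant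
begin

text \<open>
  In terms of a \<open>K[t]\<close>-basis, a t-motive is \<open>K[t]\<^sup>r\<close> with a Frobenius-semilinear operator \<open>\<tau>\<close>. If the t-module is almost strictly pure
  with \<open>t\<^sup>n\<close> of \<open>\<tau>\<close>-degree \<open>s\<close>, then right division by the matrix of \<open>t\<^sup>n\<close> shows that \<open>\<tau>\<^sup>k\<close> raises \<open>t\<close>-degrees by \<open>k w\<close>, up to an error
  independent of \<open>k\<close>, where \<open>w = n / s\<close>; a dimension count gives \<open>w = d / r\<close>. In this form purity is
  visibly compatible with tensor products: the Kronecker product of two such operators satisfies the same estimate with the
  weight \<open>w + w'\<close>. It remains to recover a \<open>K{\<tau>}\<close>-basis from the estimate.

  Let \<open>N\<close> and \<open>s\<close> be positive integers with \<open>N = s (w + w')\<close>. Counting the degrees of \<open>\<tau>\<^sup>k x\<close> for large \<open>k\<close> gives a filtration of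
  the module \<open>M\<close> by the order of the pole at infinity, which \<open>t\<close> raises by exactly \<open>s\<close> and \<open>\<tau>\<close> by exactly \<open>N\<close>. In the localization
  \<open>V\<close> of \<open>M\<close> at \<open>t\<tau>\<close> this defines lattices at infinity. The operator \<open>\<sigma> = t\<^sup>-\<^sup>N \<tau>\<^sup>s\<close> preserves them and is semilinear for a power of the
  Frobenius map. A lattice with \<open>M \<inter> L = 0\<close> that is stable under \<open>\<tau>\<^sup>-\<^sup>1\<close> and \<open>\<sigma>\<close> can be enlarged, as long as \<open>M + L \<noteq> V\<close>, by a fixed
  vector of \<open>\<sigma>\<close>; such vectors exist in abundance by Lang's theorem, since \<open>K\<close> is algebraically closed
  (\<open>fixed_vectors_span\<close>). Since \<open>V / (M + L)\<close> is finite-dimensional, this ends with \<open>V = M \<oplus> L\<close> and \<open>\<sigma>L = L\<close>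
  (\<open>good_complement_exists\<close>).

  A \<open>K\<close>-basis \<open>\<kappa>\<close> of \<open>M \<inter> \<tau>L\<close> is then a \<open>K{\<tau>}\<close>-basis of \<open>M\<close> for which \<open>M \<inter> \<tau>\<^sup>jL\<close> consists of the combinations of degree less than \<open>j\<close>. As
  \<open>t\<^sup>NL = \<tau>\<^sup>sL\<close>, the matrix of \<open>t\<^sup>N\<close> has degree at most \<open>s\<close> in this basis, and the coefficient of \<open>\<tau>\<^sup>s\<close> is invertible because
  \<open>M \<inter> L = 0\<close> (\<open>strictly_pure_basis\<close>). A common denominator of the weights yields almost strict purity; if
  \<open>1 / (w + w')\<close> is an integer, then \<open>N = 1\<close> is possible. The matrices of the multiplications by \<open>a(t)\<close> in the basis \<open>\<kappa>\<close>
  form the t-module \<open>\<rho>\<close>; nilpotence of \<open>\<partial>\<rho>\<^sub>t - \<theta>\<close> reflects that a power of \<open>t - \<theta>\<close> maps \<open>M\<close> into \<open>\<tau>M\<close>.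

  The tensor product over \<open>K[t]\<close> is a quotient of a free abelian group. The map to \<open>K[t]\<^sup>r\<^sup>r\<^sup>'\<close> given by products of
  coordinates has the group of relations as its kernel (\<open>N_eq_kernel\<close>), and this transports the module structure
  (\<open>motive_tensor_coordinates\<close>).
\<close>

section \<open>The Frobenius endomorphism\<close>

lemma subfield_of_typeD:
  fixes F :: "'k::field set"
  assumes "subfield F (ring_of_type_algebra :: 'k ring)"
  shows "0 \<in> F" "1 \<in> F" "x \<in> F \<Longrightarrow> y \<in> F \<Longrightarrow> x + y \<in> F" "x \<in> F \<Longrightarrow> y \<in> F \<Longrightarrow> x * y \<in> F"
proof -
  interpret R: Ring.field "ring_of_type_algebra :: 'k ring"
    by (rule field_from_type_algebra)
  have sub: "subring F (ring_of_type_algebra :: 'k ring)"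
    using assms by (rule subfieldE(1))
  note E = subringE[OF sub]
  show "0 \<in> F" using E(2) by (simp add: ring_of_type_algebra_def)
  show "1 \<in> F" using E(3) by (simp add: ring_of_type_algebra_def)
  show "x \<in> F \<Longrightarrow> y \<in> F \<Longrightarrow> x + y \<in> F" using E(7)[of x y] by (simp add: ring_of_type_algebra_def)
  show "x \<in> F \<Longrightarrow> y \<in> F \<Longrightarrow> x * y \<in> F" using E(6)[of x y] by (simp add: ring_of_type_algebra_def)
qed

text \<open>Multiplication by a nonzero \<open>c\<close> permutes the nonzero elements of the field; comparing the products of
  all of them gives \<open>c\<^sup>q\<^sup>-\<^sup>1 = 1\<close>.\<close>

lemma finite_subfield_power_card:
  fixes F :: "'k::field set"
  assumes sf: "subfield F (ring_of_type_algebra :: 'k ring)" and fin: "finite F" and c: "c \<in> F"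
  shows "c ^ card F = c"
proof (cases "c = 0")
  case True
  have "card F \<noteq> 0" using fin c by auto
  thus ?thesis using True by simp
next
  case False
  let ?G = "F - {0}"
  have inj: "inj_on ((*) c) ?G" using False by (auto simp: inj_on_def)
  have "(*) c ` ?G \<subseteq> ?G" using subfield_of_typeD(4)[OF sf c] False by auto
  hence im: "(*) c ` ?G = ?G" using inj fin by (simp add: endo_inj_surj)
  have "(\<Prod>x\<in>?G. x) = (\<Prod>x\<in>(*) c ` ?G. x)" using im by simp
  also have "\<dots> = (\<Prod>x\<in>?G. c * x)" using prod.reindex[OF inj] by simp
  also have "\<dots> = c ^ card ?G * (\<Prod>x\<in>?G. x)" by (simp add: prod.distrib)
  finally have "(c ^ card ?G - 1) * (\<Prod>x\<in>?G. x) = 0" by (simp add: algebra_simps)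
  moreover have "(\<Prod>x\<in>?G. x) \<noteq> 0" using fin by simp
  ultimately have 1: "c ^ card ?G = 1" by simp
  have "card F = Suc (card ?G)"
    using card_Suc_Diff1[OF fin subfield_of_typeD(1)[OF sf]] by simp
  thus ?thesis using 1 by simp
qed

text \<open>The polynomial \<open>(X + 1)\<^sup>q - X\<^sup>q - 1\<close> has degree less than \<open>q\<close> and vanishes at the \<open>q\<close> elements of
  \<open>F\<close>, so it is zero; homogenising gives additivity without knowing that \<open>q\<close> is a prime power.\<close>

lemma frobenius_add:
  fixes F :: "'k::field set"
  assumes sf: "subfield F (ring_of_type_algebra :: 'k ring)" and fin: "finite F"
  shows "(x + y) ^ card F = x ^ card F + (y :: 'k) ^ card F"
proof -
  let ?q = "card F"
  note F = subfield_of_typeD[OF sf]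
  have q0: "?q > 0" using F(1) fin by (auto simp: card_gt_0_iff)
  define P where "P = [:1, 1:] ^ ?q - (monom 1 ?q + [:1::'k:])"
  have deg1: "degree ([:1, 1:] ^ ?q :: 'k poly) \<le> ?q"
    using degree_power_le[of "[:1, 1::'k:]" ?q] by simp
  have "P = 0"
  proof (rule ccontr)
    assume "P \<noteq> 0"
    have "degree P < ?q"
    proof -
      have "degree P \<le> ?q" unfolding P_def
        by (intro degree_diff_le degree_add_le deg1) (auto simp: degree_monom_le)
      moreover have "coeff P ?q = 0"
      proof -
        have "coeff ([:1, 1:] ^ ?q) ?q = (1 :: 'k)"
          using lead_coeff_power[of "[:1, 1::'k:]" ?q] by (simp add: degree_linear_power)
        thus ?thesis using q0 unfolding P_def by (cases "?q") (auto)
      qed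
      ultimately show ?thesis using \<open>P \<noteq> 0\<close> by (metis le_neq_implies_less leading_coeff_0_iff)
    qed
    moreover have "F \<subseteq> {z. poly P z = 0}"
    proof
      fix z assume z: "z \<in> F"
      have "(1 + z) ^ ?q = 1 + z" "z ^ ?q = z"
        using finite_subfield_power_card[OF sf fin] F(2,3) z by auto
      thus "z \<in> {z. poly P z = 0}" by (simp add: P_def poly_monom)
    qed
    hence "?q \<le> card {z. poly P z = 0}"
      using poly_roots_finite[OF \<open>P \<noteq> 0\<close>] by (rule card_mono[rotated])
    ultimately show False using card_poly_roots_bound[OF \<open>P \<noteq> 0\<close>] by linarith
  qed
  have one: "(1 + z) ^ ?q = z ^ ?q + 1" for z :: 'k
  proof -
    have "poly P z = (1 + z) ^ ?q - (z ^ ?q + 1)" by (simp add: P_def poly_monom)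
    thus ?thesis using \<open>P = 0\<close> by simp
  qed
  show ?thesis
  proof (cases "y = 0")
    case True thus ?thesis using q0 by simp
  next
    case False
    have "x + y = y * (1 + x / y)" using False by (simp add: field_simps)
    hence "(x + y) ^ ?q = (y * (1 + x / y)) ^ ?q" by simp
    also have "\<dots> = y ^ ?q * ((x / y) ^ ?q + 1)" by (simp only: power_mult_distrib one)
    also have "\<dots> = x ^ ?q + y ^ ?q" using False by (simp add: field_simps)
    finally show ?thesis .
  qed
qed

locale frobenius =
  fixes field_type :: "'k::alg_closed_field itself" and q :: nat
  assumes q_gt_1: "1 < q" and power_q_add: "\<And>x y :: 'k. (x + y) ^ q = x ^ q + y ^ q"
begin

lemma q_power_add: "((x::'k) + y) ^ (q ^ i) = x ^ (q ^ i) + y ^ (q ^ i)"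
  by (induction i) (simp_all add: power_mult power_q_add mult.commute[of q])

lemma q_pos [simp]: "0 < q" using q_gt_1 by simp

lemma q_power_pos [simp]: "0 < q ^ i" using q_gt_1 by simp

lemma zero_q_power [simp]: "(0::'k) ^ (q ^ i) = 0" using q_gt_1 by simp

lemma zero_q [simp]: "(0::'k) ^ q = 0" using q_gt_1 by simp

lemma q_power_sum: "(\<Sum>a\<in>A. f a :: 'k) ^ (q ^ i) = (\<Sum>a\<in>A. f a ^ (q ^ i))"
  by (induction A rule: infinite_finite_induct) (simp_all add: q_power_add)

lemma q_power_surj: "\<exists>y. y ^ (q ^ i) = (x::'k)"
  by (rule nth_root_exists[OF q_power_pos])

end

lemma frobenius_card_subfield:
  fixes F :: "'k::alg_closed_field set"
  assumes sf: "subfield F (ring_of_type_algebra :: 'k ring)" and fin: "finite F"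
  shows "frobenius TYPE('k) (card F)"
proof
  note F = subfield_of_typeD[OF sf]
  have "card {0, 1 :: 'k} \<le> card F" using F(1,2) fin by (intro card_mono) auto
  thus "1 < card F" by simp
qed (rule frobenius_add[OF sf fin])

section \<open>Operators given by skew polynomials\<close>

text \<open>With \<open>D = \<tau>\<close> this is the action of \<open>K{\<tau>}\<close>, with \<open>D = t\<close> that of \<open>K[t]\<close>.\<close>

definition poly_act :: "('k::field \<Rightarrow> 'm::ab_group_add \<Rightarrow> 'm) \<Rightarrow> ('m \<Rightarrow> 'm) \<Rightarrow> 'k poly \<Rightarrow> 'm \<Rightarrow> 'm" where
  "poly_act scale D f x = (\<Sum>i\<le>degree f. scale (coeff f i) ((D ^^ i) x))"

lemma additive_funpow:
  fixes D :: "'m::ab_group_add \<Rightarrow> 'm"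
  assumes "\<And>x y. D (x + y) = D x + D y"
  shows "(D ^^ n) (x + y) = (D ^^ n) x + (D ^^ n) y"
  by (induction n) (simp_all add: assms)

lemma additive_zero:
  fixes D :: "'m::ab_group_add \<Rightarrow> 'n::ab_group_add"
  assumes "\<And>x y. D (x + y) = D x + D y"
  shows "D 0 = 0"
  using assms[of 0 0] by simp

lemma additive_minus:
  fixes D :: "'m::ab_group_add \<Rightarrow> 'n::ab_group_add"
  assumes "\<And>x y. D (x + y) = D x + D y"
  shows "D (- x) = - D x"
  using assms[of x "- x"] additive_zero[of D] assms by (simp add: eq_neg_iff_add_eq_0 add.commute)

lemma additive_diff:
  fixes D :: "'m::ab_group_add \<Rightarrow> 'n::ab_group_add"
  assumes "\<And>x y. D (x + y) = D x + D y"
  shows "D (x - y) = D x - D y"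
  using assms[of x "- y"] additive_minus[of D] assms by simp

lemma additive_sum:
  fixes D :: "'m::ab_group_add \<Rightarrow> 'n::ab_group_add"
  assumes "\<And>x y. D (x + y) = D x + D y"
  shows "D (\<Sum>i\<in>I. f i) = (\<Sum>i\<in>I. D (f i))"
  by (induction I rule: infinite_finite_induct) (simp_all add: assms additive_zero[of D])

context vector_space
begin

lemma poly_act_bound:
  assumes "degree f \<le> n"
  shows "poly_act scale D f x = (\<Sum>i\<le>n. scale (coeff f i) ((D ^^ i) x))"
  unfolding poly_act_def
  by (rule sum.mono_neutral_left) (use assms in \<open>auto simp: coeff_eq_0\<close>)

lemma poly_act_add_left: "poly_act scale D (f + g) x = poly_act scale D f x + poly_act scale D g x"
proof -
  let ?n = "max (degree f) (degree g)"
  have "degree (f + g) \<le> ?n" by (rule degree_add_le_max)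
  thus ?thesis by (simp add: poly_act_bound[of _ ?n] scale_left_distrib sum.distrib)
qed

lemma poly_act_0_left [simp]: "poly_act scale D 0 x = 0"
  by (simp add: poly_act_def)

lemma poly_act_sum_left: "poly_act scale D (\<Sum>i\<in>I. f i) x = (\<Sum>i\<in>I. poly_act scale D (f i) x)"
  by (induction I rule: infinite_finite_induct) (simp_all add: poly_act_add_left)

lemma poly_act_smult: "poly_act scale D (Polynomial.smult c f) x = scale c (poly_act scale D f x)"
  by (simp add: poly_act_bound[OF degree_smult_le] poly_act_def scale_sum_right)

lemma poly_act_monom: "poly_act scale D (Polynomial.monom c n) x = scale c ((D ^^ n) x)"
proof -
  have "poly_act scale D (Polynomial.monom c n) x = (\<Sum>i\<le>n. if n = i then scale c ((D ^^ i) x) else 0)"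
    unfolding poly_act_bound[OF degree_monom_le] by (intro sum.cong) simp_all
  thus ?thesis by simp
qed

lemma poly_act_const [simp]: "poly_act scale D [:c:] x = scale c x"
  using poly_act_monom[of D c 0 x] by (simp add: monom_0)

lemma poly_act_1 [simp]: "poly_act scale D 1 x = x"
  using poly_act_const[of D 1 x] by (simp add: one_pCons)

lemma poly_act_pCons_right: "poly_act scale D (pCons c f) x = scale c x + poly_act scale D f (D x)"
proof -
  have "poly_act scale D (pCons c f) x = (\<Sum>i\<le>Suc (degree f). scale (coeff (pCons c f) i) ((D ^^ i) x))"
    by (rule poly_act_bound) (rule degree_pCons_le)
  also have "\<dots> = scale c x + poly_act scale D f (D x)"
    unfolding poly_act_def by (subst sum.atMost_Suc_shift) (simp add: funpow_swap1)
  finally show ?thesis .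
qed

end

locale semilinear_operator = vector_space scale + frobenius "TYPE('k)" q
  for scale :: "'k::alg_closed_field \<Rightarrow> 'm::ab_group_add \<Rightarrow> 'm" and q :: nat +
  fixes D :: "'m \<Rightarrow> 'm" and e :: nat
  assumes D_add: "D (x + y) = D x + D y" and D_scale: "D (scale c x) = scale (c ^ (q ^ e)) (D x)"
begin

lemmas D_0 [simp] = additive_zero[of D, OF D_add]
lemmas D_diff = additive_diff[of D, OF D_add]
lemmas D_sum = additive_sum[of D, OF D_add]
lemmas Dn_add = additive_funpow[of D, OF D_add]
lemmas Dn_0 [simp] = additive_zero[of "D ^^ n" for n, OF Dn_add]
lemmas Dn_sum = additive_sum[of "D ^^ n" for n, OF Dn_add]

lemma Dn_scale: "(D ^^ n) (scale c x) = scale (c ^ (q ^ (e * n))) ((D ^^ n) x)"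
  by (induction n) (simp_all add: D_scale add.commute flip: power_mult power_add)

lemma poly_act_add_right: "poly_act scale D f (x + y) = poly_act scale D f x + poly_act scale D f y"
  by (simp add: poly_act_def Dn_add scale_right_distrib sum.distrib)

lemmas poly_act_0_right [simp] = additive_zero[of "poly_act scale D f" for f, OF poly_act_add_right]
lemmas poly_act_sum_right = additive_sum[of "poly_act scale D f" for f, OF poly_act_add_right]

end


locale tau_module = semilinear_operator scale q \<tau> 1
  for scale :: "'k::alg_closed_field \<Rightarrow> 'm::ab_group_add \<Rightarrow> 'm" and q and \<tau>
begin

text \<open>The twist in the product of \<open>K{\<tau>}\<close> is exactly the one produced by moving a scalar past a power of a
  semilinear operator.\<close>

lemma poly_act_skew_mult:
  "poly_act scale \<tau> (skew_mult q f g) x = poly_act scale \<tau> f (poly_act scale \<tau> g x)"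
proof -
  have "poly_act scale \<tau> f (poly_act scale \<tau> g x)
      = (\<Sum>i\<le>degree f. scale (coeff f i) (\<Sum>j\<le>degree g. scale (coeff g j ^ (q ^ i)) ((\<tau> ^^ (i + j)) x)))"
    by (simp add: poly_act_def Dn_sum Dn_scale funpow_add)
  also have "\<dots> = poly_act scale \<tau> (skew_mult q f g) x"
    by (simp add: skew_mult_def poly_act_sum_left poly_act_monom scale_sum_right)
  finally show ?thesis ..
qed

end

section \<open>The skew polynomial rings\<close>

definition frob_poly :: "nat \<Rightarrow> 'k::field poly \<Rightarrow> 'k poly" where
  "frob_poly q = map_poly (\<lambda>c. c ^ q)"

definition tau_poly :: "nat \<Rightarrow> 'k::field poly \<Rightarrow> 'k poly" where
  "tau_poly q f = pCons 0 (frob_poly q f)"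

context frobenius
begin

lemma coeff_frob_poly [simp]: "coeff (frob_poly q f) n = coeff (f :: 'k poly) n ^ q"
  by (simp add: frob_poly_def coeff_map_poly)

lemma frob_poly_add: "frob_poly q (f + g :: 'k poly) = frob_poly q f + frob_poly q g"
  by (simp add: poly_eq_iff power_q_add)

lemma coeff_frob_poly_funpow [simp]: "coeff ((frob_poly q ^^ k) f) n = coeff (f :: 'k poly) n ^ (q ^ k)"
  by (induction k) (simp_all add: power_mult[symmetric] mult.commute)

lemmas frob_poly_0 [simp] = additive_zero[of "frob_poly q", OF frob_poly_add]
lemmas frob_poly_sum = additive_sum[of "frob_poly q", OF frob_poly_add]

lemma frob_poly_mult: "frob_poly q (f * g :: 'k poly) = frob_poly q f * frob_poly q g"
  by (simp add: poly_eq_iff coeff_mult power_mult_distrib q_power_sum[where i = 1, simplified])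

lemma frob_poly_funpow_surj: "\<exists>g. (frob_poly q ^^ k) g = (f :: 'k poly)"
proof -
  obtain r where r: "\<And>c :: 'k. r c ^ (q ^ k) = c" using q_power_surj by metis
  have r0: "r 0 = 0" using r[of 0] by simp
  have "(frob_poly q ^^ k) (map_poly r f) = f"
    by (simp add: poly_eq_iff coeff_map_poly r0 r)
  thus ?thesis ..
qed

lemma coeff_tau_poly: "coeff (tau_poly q (f :: 'k poly)) n = (if n = 0 then 0 else coeff f (n - 1) ^ q)"
  by (cases n) (simp_all add: tau_poly_def)

lemma coeff_tau_poly_funpow:
  "coeff ((tau_poly q ^^ i) (f :: 'k poly)) n = (if n < i then 0 else coeff f (n - i) ^ (q ^ i))"
proof (induction i arbitrary: n)
  case (Suc i)
  show ?case
    by (auto simp: coeff_tau_poly Suc.IH power_mult[symmetric] mult.commute simp del: power_Suc)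
       (auto simp: power_Suc2 power_mult)
qed simp

lemma tau_poly_add: "tau_poly q (f + g :: 'k poly) = tau_poly q f + tau_poly q g"
  by (simp add: tau_poly_def frob_poly_add)

lemma tau_poly_smult: "tau_poly q (Polynomial.smult (c :: 'k) f) = Polynomial.smult (c ^ q) (tau_poly q f)"
  by (simp add: poly_eq_iff coeff_tau_poly power_mult_distrib)

end

lemma vector_space_smult: "vector_space (Polynomial.smult :: 'k::field \<Rightarrow> 'k poly \<Rightarrow> 'k poly)"
  by unfold_locales (simp_all add: smult_add_right smult_add_left)

context frobenius
begin

sublocale tau_poly: tau_module "Polynomial.smult :: 'k \<Rightarrow> 'k poly \<Rightarrow> 'k poly" q "tau_poly q"
  by (intro tau_module.intro semilinear_operator.intro vector_space_smult semilinear_operator_axioms.intro)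
     (simp_all add: tau_poly_add tau_poly_smult frobenius_axioms)

text \<open>\<open>K{\<tau>}\<close> acts on itself from the left, with \<open>\<tau>\<close> given by \<open>\<Sum> c\<^sub>i \<tau>\<^sup>i \<mapsto> \<Sum> c\<^sub>i\<^sup>q \<tau>\<^sup>i\<^sup>+\<^sup>1\<close>. Associativity and the other ring
  laws are then instances of the laws of an action.\<close>

lemma skew_mult_eq_act: "skew_mult q f g = poly_act Polynomial.smult (tau_poly q) f (g :: 'k poly)"
proof -
  have "(\<Sum>j\<le>degree g. Polynomial.monom (c * coeff g j ^ (q ^ i)) (i + j))
      = Polynomial.smult c ((tau_poly q ^^ i) g)" for c i
  proof (rule poly_eqI)
    fix n
    have "coeff (\<Sum>j\<le>degree g. Polynomial.monom (c * coeff g j ^ (q ^ i)) (i + j)) n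
        = (\<Sum>j\<le>degree g. if n = i + j then c * coeff g j ^ (q ^ i) else 0)"
      by (simp add: coeff_sum eq_commute)
    also have "\<dots> = (if n < i then 0 else c * coeff g (n - i) ^ (q ^ i))"
    proof (cases "i \<le> n \<and> n - i \<le> degree g")
      case True
      hence "(\<Sum>j\<le>degree g. if n = i + j then c * coeff g j ^ (q ^ i) else 0)
          = (\<Sum>j\<le>degree g. if n - i = j then c * coeff g j ^ (q ^ i) else 0)"
        by (intro sum.cong) auto
      thus ?thesis using True by simp
    next
      case False
      hence "(\<Sum>j\<le>degree g. if n = i + j then c * coeff g j ^ (q ^ i) else 0) = 0"
        by (intro sum.neutral) auto
      thus ?thesis using False by (auto simp: coeff_eq_0)
    qed
    also have "\<dots> = coeff (Polynomial.smult c ((tau_poly q ^^ i) g)) n"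
      by (simp add: coeff_tau_poly_funpow)
    finally show "coeff (\<Sum>j\<le>degree g. Polynomial.monom (c * coeff g j ^ (q ^ i)) (i + j)) n
        = coeff (Polynomial.smult c ((tau_poly q ^^ i) g)) n" .
  qed
  thus ?thesis by (simp add: skew_mult_def poly_act_def)
qed

lemma skew_mult_add_left: "skew_mult q (f + g) h = skew_mult q f h + skew_mult q g (h :: 'k poly)"
  by (simp add: skew_mult_eq_act tau_poly.poly_act_add_left)

lemma skew_mult_add_right: "skew_mult q f (g + h) = skew_mult q f g + skew_mult q f (h :: 'k poly)"
  by (simp add: skew_mult_eq_act tau_poly.poly_act_add_right)

lemmas skew_mult_sum_left = additive_sum[of "\<lambda>f. skew_mult q f g" for g, OF skew_mult_add_left]
lemmas skew_mult_sum_right = additive_sum[of "skew_mult q f" for f, OF skew_mult_add_right]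
lemmas skew_mult_0_left [simp] = additive_zero[of "\<lambda>f. skew_mult q f g" for g, OF skew_mult_add_left]
lemmas skew_mult_0_right [simp] = additive_zero[of "skew_mult q f" for f, OF skew_mult_add_right]

lemma skew_mult_1_left [simp]: "skew_mult q 1 f = (f :: 'k poly)"
  by (simp add: skew_mult_eq_act)

lemma skew_mult_const_left: "skew_mult q [:c:] f = Polynomial.smult c (f :: 'k poly)"
  by (simp add: skew_mult_eq_act)

lemma skew_mult_tau_left: "skew_mult q [:0, 1:] f = tau_poly q (f :: 'k poly)"
  by (simp add: skew_mult_eq_act tau_poly.poly_act_pCons_right)

lemma skew_mult_1_right [simp]: "skew_mult q f 1 = (f :: 'k poly)"
proof -
  have "(tau_poly q ^^ i) 1 = (Polynomial.monom 1 i :: 'k poly)" for i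
    by (auto simp: poly_eq_iff coeff_tau_poly_funpow)
  thus ?thesis
    by (simp add: skew_mult_eq_act poly_act_def smult_monom poly_as_sum_of_monoms)
qed

end

context tau_module
begin

lemma poly_act_tau_left: "poly_act scale \<tau> (tau_poly q f) x = \<tau> (poly_act scale \<tau> f x)"
  using poly_act_skew_mult[of "[:0, 1:]" f x] by (simp add: skew_mult_tau_left poly_act_pCons_right)

lemma poly_act_pCons_frob:
  "poly_act scale \<tau> (pCons c (frob_poly q f)) x = scale c x + \<tau> (poly_act scale \<tau> f x)"
proof -
  have "pCons c (frob_poly q f) = [:c:] + tau_poly q f" by (simp add: tau_poly_def)
  thus ?thesis by (simp add: poly_act_add_left poly_act_tau_left)
qed

end

context frobenius
begin

lemma skew_mult_assoc: "skew_mult q (skew_mult q f g) h = skew_mult q f (skew_mult q g (h :: 'k poly))"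
  using tau_poly.poly_act_skew_mult[of f g h] by (simp only: skew_mult_eq_act)

lemma ring_skew_ring: "ring (skew_ring q :: 'k poly ring)"
proof (rule ringI)
  show "abelian_group (skew_ring q :: 'k poly ring)"
  proof (rule abelian_groupI)
    fix x :: "'k poly"
    show "\<exists>y\<in>carrier (skew_ring q). y \<oplus>\<^bsub>skew_ring q\<^esub> x = \<zero>\<^bsub>skew_ring q\<^esub>"
      unfolding skew_ring_def by (rule bexI[of _ "- x"]) simp_all
  qed (simp_all add: skew_ring_def add.commute add.assoc)
  show "monoid (skew_ring q :: 'k poly ring)"
    unfolding skew_ring_def by (rule monoidI) (simp_all, simp only: skew_mult_assoc)
qed (simp_all add: skew_ring_def skew_mult_add_left skew_mult_add_right)

lemma finsum_skew_ring: "finsum (skew_ring q) f A = (\<Sum>i\<in>A. f i :: 'k poly)"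
proof -
  have am: "abelian_monoid (skew_ring q :: 'k poly ring)"
    using ring_skew_ring by (simp add: ring_def abelian_group_def)
  show ?thesis
  proof (induction A rule: infinite_finite_induct)
    case (infinite A)
    thus ?case by (simp add: abelian_monoid.finsum_infinite[OF am]) (simp add: skew_ring_def)
  next
    case empty
    show ?case by (simp add: abelian_monoid.finsum_empty[OF am]) (simp add: skew_ring_def)
  next
    case (insert a A)
    have "finsum (skew_ring q) f (insert a A) = f a \<oplus>\<^bsub>skew_ring q\<^esub> finsum (skew_ring q) f A"
      by (rule abelian_monoid.finsum_insert[OF am]) (use insert in \<open>auto simp: skew_ring_def\<close>)
    thus ?case using insert by (simp add: skew_ring_def)
  qed
qed

end

lemma carrier_skew_ring_t: "carrier (skew_ring_t q) = {a. \<exists>n. \<forall>m>n. a m = 0}"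
  by (auto simp: skew_ring_t_def UP_def up_def skew_ring_def bound_def)

lemma skew_ring_t_one: "\<one>\<^bsub>skew_ring_t q\<^esub> = (\<lambda>i. if i = 0 then 1 else 0)"
  by (simp add: skew_ring_t_def UP_def skew_ring_def fun_eq_iff)

lemma skew_ring_t_add:
  assumes "a \<in> carrier (skew_ring_t q)" "b \<in> carrier (skew_ring_t q)"
  shows "a \<oplus>\<^bsub>skew_ring_t q\<^esub> b = (\<lambda>i. a i + b i)"
  using assms by (simp add: skew_ring_t_def UP_def skew_ring_def cong: if_cong)

lemma in_tau_eq: "in_tau q f = (\<lambda>i. if i = 0 then f else 0)"
  by (simp add: in_tau_def skew_ring_t_def UP_def skew_ring_def fun_eq_iff)

lemma t_elem_eq: "t_elem q = (\<lambda>i. if i = 1 then 1 else 0)"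
  by (simp add: t_elem_def skew_ring_t_def UP_def skew_ring_def fun_eq_iff)

lemma in_tau_closed [simp]: "in_tau q f \<in> carrier (skew_ring_t q)"
  by (auto simp: in_tau_eq carrier_skew_ring_t)

lemma t_elem_closed [simp]: "t_elem q \<in> carrier (skew_ring_t q)"
  by (auto simp: t_elem_eq carrier_skew_ring_t)

lemma in_tau_inject [simp]: "in_tau q f = in_tau q g \<longleftrightarrow> f = g"
  by (metis in_tau_eq)

context frobenius
begin

lemma ring_skew_ring_t: "ring (skew_ring_t q :: ('k poly, nat \<Rightarrow> 'k poly) up_ring)"
  unfolding skew_ring_t_def by (intro UP_ring.UP_ring UP_ring.intro ring_skew_ring)

lemma skew_ring_t_mult:
  assumes "a \<in> carrier (skew_ring_t q)" "b \<in> carrier (skew_ring_t q :: ('k poly, nat \<Rightarrow> 'k poly) up_ring)"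
  shows "a \<otimes>\<^bsub>skew_ring_t q\<^esub> b = (\<lambda>n. \<Sum>i\<le>n. skew_mult q (a i) (b (n - i)))"
proof -
  have "a \<otimes>\<^bsub>skew_ring_t q\<^esub> b = (\<lambda>n. \<Oplus>\<^bsub>skew_ring q\<^esub>i\<in>{..n}. a i \<otimes>\<^bsub>skew_ring q\<^esub> b (n - i))"
    using assms by (simp add: skew_ring_t_def UP_def)
  thus ?thesis by (simp add: finsum_skew_ring) (simp add: skew_ring_def)
qed

lemma deg_skew_ring_t:
  assumes "a \<in> carrier (skew_ring_t q :: ('k poly, nat \<Rightarrow> 'k poly) up_ring)" "deg (skew_ring q) a < m"
  shows "a m = 0"
proof -
  have R: "UP_ring (skew_ring q :: 'k poly ring)"
    by (intro UP_ring.intro ring_skew_ring)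
  have "up_ring.coeff (skew_ring_t q) a m = \<zero>\<^bsub>skew_ring q\<^esub>"
    using UP_ring.deg_aboveD[OF R, folded skew_ring_t_def, OF assms(2,1)] .
  moreover have "up_ring.coeff (skew_ring_t q) a m = a m"
    using assms(1) by (simp add: skew_ring_t_def UP_def)
  ultimately show ?thesis by (simp add: skew_ring_def)
qed

end

text \<open>The action of \<open>K{\<tau>,t}\<close> on a \<open>K\<close>-space with a Frobenius-semilinear operator \<open>\<tau>\<close> and a linear operator \<open>t\<close>
  that commutes with it. All modules of the development are compared with one of this form.\<close>

definition skew_act :: "('k::field \<Rightarrow> 'm::ab_group_add \<Rightarrow> 'm) \<Rightarrow> ('m \<Rightarrow> 'm) \<Rightarrow> ('m \<Rightarrow> 'm) \<Rightarrow> nat \<Rightarrow>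
    (nat \<Rightarrow> 'k poly) \<Rightarrow> 'm \<Rightarrow> 'm" where
  "skew_act scale \<tau> t q a x = (\<Sum>j\<le>deg (skew_ring q) a. poly_act scale \<tau> (a j) ((t ^^ j) x))"

locale tau_t_module = tau_module scale q \<tau>
  for scale :: "'k::alg_closed_field \<Rightarrow> 'm::ab_group_add \<Rightarrow> 'm" and q and \<tau> +
  fixes t :: "'m \<Rightarrow> 'm"
  assumes t_add: "t (x + y) = t x + t y" and t_scale: "t (scale c x) = scale c (t x)"
    and t_tau: "t (\<tau> x) = \<tau> (t x)"
begin

sublocale t: semilinear_operator scale q t 0
  by unfold_locales (simp_all add: t_add t_scale)

lemma t_funpow_tau: "(t ^^ n) (\<tau> x) = \<tau> ((t ^^ n) x)"
  by (induction n) (simp_all add: t_tau)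

lemma t_tau_funpow: "t ((\<tau> ^^ n) x) = (\<tau> ^^ n) (t x)"
  by (induction n) (simp_all add: t_tau)

lemma t_funpow_scale: "(t ^^ n) (scale c x) = scale c ((t ^^ n) x)"
  by (induction n) (simp_all add: t_scale)

lemma t_poly_act: "t (poly_act scale \<tau> f x) = poly_act scale \<tau> f (t x)"
  by (simp add: poly_act_def t.D_sum t_scale t_tau_funpow)

lemma t_funpow_poly_act: "(t ^^ n) (poly_act scale \<tau> f x) = poly_act scale \<tau> f ((t ^^ n) x)"
  by (induction n) (simp_all add: t_poly_act)

lemma skew_act_bound:
  assumes "a \<in> carrier (skew_ring_t q)" and n: "\<And>m. m > n \<Longrightarrow> a m = 0"
  shows "skew_act scale \<tau> t q a x = (\<Sum>j\<le>n. poly_act scale \<tau> (a j) ((t ^^ j) x))"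
proof -
  let ?k = "max n (deg (skew_ring q) a)"
  have "skew_act scale \<tau> t q a x = (\<Sum>j\<le>?k. poly_act scale \<tau> (a j) ((t ^^ j) x))"
    unfolding skew_act_def
    by (rule sum.mono_neutral_left) (auto simp: deg_skew_ring_t[OF assms(1)])
  also have "\<dots> = (\<Sum>j\<le>n. poly_act scale \<tau> (a j) ((t ^^ j) x))"
    by (rule sum.mono_neutral_right) (auto simp: n)
  finally show ?thesis .
qed

lemma skew_act_in_tau: "skew_act scale \<tau> t q (in_tau q f) x = poly_act scale \<tau> f x"
  by (subst skew_act_bound[of _ 0]) (auto simp: in_tau_eq carrier_skew_ring_t)

lemma skew_act_t_elem: "skew_act scale \<tau> t q (t_elem q) x = t x"
  by (subst skew_act_bound[of _ 1]) (auto simp: t_elem_eq carrier_skew_ring_t)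

lemma skew_act_one: "skew_act scale \<tau> t q \<one>\<^bsub>skew_ring_t q\<^esub> x = x"
  by (subst skew_act_bound[of _ 0]) (auto simp: skew_ring_t_one carrier_skew_ring_t)

lemma skew_act_add_right: "skew_act scale \<tau> t q a (x + y) = skew_act scale \<tau> t q a x + skew_act scale \<tau> t q a y"
  by (simp add: skew_act_def t.Dn_add poly_act_add_right sum.distrib)

lemma skew_act_add_left:
  assumes a: "a \<in> carrier (skew_ring_t q)" and b: "b \<in> carrier (skew_ring_t q)"
  shows "skew_act scale \<tau> t q (a \<oplus>\<^bsub>skew_ring_t q\<^esub> b) x = skew_act scale \<tau> t q a x + skew_act scale \<tau> t q b x"
proof -
  obtain m n where m: "\<And>i. i > m \<Longrightarrow> a i = 0" and n: "\<And>i. i > n \<Longrightarrow> b i = 0"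
    using a b by (auto simp: carrier_skew_ring_t)
  have c: "(\<lambda>i. a i + b i) \<in> carrier (skew_ring_t q)"
    using m n by (auto simp: carrier_skew_ring_t intro!: exI[of _ "max m n"])
  show ?thesis
    by (simp add: skew_ring_t_add[OF a b] skew_act_bound[OF a, of "max m n"] m n
        skew_act_bound[OF b, of "max m n"] skew_act_bound[OF c, of "max m n"] poly_act_add_left sum.distrib)
qed

lemma skew_act_mult:
  assumes a: "a \<in> carrier (skew_ring_t q)" and b: "b \<in> carrier (skew_ring_t q)"
  shows "skew_act scale \<tau> t q (a \<otimes>\<^bsub>skew_ring_t q\<^esub> b) x = skew_act scale \<tau> t q a (skew_act scale \<tau> t q b x)"
proof -
  obtain m n where m: "\<And>i. i > m \<Longrightarrow> a i = 0" and n: "\<And>i. i > n \<Longrightarrow> b i = 0"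
    using a b by (auto simp: carrier_skew_ring_t)
  let ?c = "a \<otimes>\<^bsub>skew_ring_t q\<^esub> b"
  have ceq: "?c = (\<lambda>k. \<Sum>i\<le>k. skew_mult q (a i) (b (k - i)))"
    by (rule skew_ring_t_mult[OF a b])
  have c: "?c \<in> carrier (skew_ring_t q)"
    using a b ring_skew_ring_t by (intro monoid.m_closed ring.is_monoid)
  define H where "H i j = poly_act scale \<tau> (a i) (poly_act scale \<tau> (b j) ((t ^^ (i + j)) x))" for i j
  have H0: "H i j = 0" if "i > m \<or> j > n" for i j
    using that m n by (auto simp: H_def)
  have c0: "?c k = 0" if "k > m + n" for k
    unfolding ceq
  proof (rule sum.neutral, rule ballI)
    fix i assume "i \<in> {..k}"
    hence "i > m \<or> k - i > n" using that by auto
    thus "skew_mult q (a i) (b (k - i)) = 0" using m n by auto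
  qed
  have "skew_act scale \<tau> t q ?c x = (\<Sum>k\<le>m + n. poly_act scale \<tau> (?c k) ((t ^^ k) x))"
    by (rule skew_act_bound[OF c c0])
  also have "\<dots> = (\<Sum>k\<le>m + n. \<Sum>i\<le>k. H i (k - i))"
    unfolding ceq by (simp add: H_def poly_act_sum_left poly_act_skew_mult)
  also have "\<dots> = (\<Sum>(i, j)\<in>{(i, j). i + j \<le> m + n}. H i j)"
    by (rule sum.triangle_reindex_eq[symmetric])
  also have "\<dots> = (\<Sum>(i, j)\<in>{..m} \<times> {..n}. H i j)"
  proof (rule sum.mono_neutral_right)
    show "finite {(i, j). i + j \<le> m + n}"
      by (rule finite_subset[of _ "{..m + n} \<times> {..m + n}"]) auto
    show "\<forall>i\<in>{(i, j). i + j \<le> m + n} - {..m} \<times> {..n}. (case i of (i, j) \<Rightarrow> H i j) = 0"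
      by (auto, (metis H0 not_le)+)
  qed auto
  also have "\<dots> = (\<Sum>i\<le>m. \<Sum>j\<le>n. H i j)"
    by (simp add: sum.cartesian_product)
  also have "\<dots> = skew_act scale \<tau> t q a (skew_act scale \<tau> t q b x)"
    by (simp add: skew_act_bound[OF a m] skew_act_bound[OF b n] H_def t.Dn_sum poly_act_sum_right
        t_funpow_poly_act funpow_add)
  finally show ?thesis .
qed

end


section \<open>Modules over abstract rings transported to groups on a type\<close>

text \<open>The module axioms hold in \<open>M\<close> because they hold for an action on a group that is a type, where equations can be
  proved by rewriting.\<close>

lemma left_module_transport:
  fixes \<Theta> :: "'m \<Rightarrow> 'n::ab_group_add" and act :: "'r \<Rightarrow> 'n \<Rightarrow> 'n"
  assumes R: "ring R" and bij: "bij_betw \<Theta> (carrier M) S" and S_minus: "\<And>x. x \<in> S \<Longrightarrow> - x \<in> S"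
    and zero: "\<zero>\<^bsub>M\<^esub> \<in> carrier M" "\<Theta> \<zero>\<^bsub>M\<^esub> = 0"
    and add_closed: "\<And>x y. x \<in> carrier M \<Longrightarrow> y \<in> carrier M \<Longrightarrow> x \<oplus>\<^bsub>M\<^esub> y \<in> carrier M"
    and add: "\<And>x y. x \<in> carrier M \<Longrightarrow> y \<in> carrier M \<Longrightarrow> \<Theta> (x \<oplus>\<^bsub>M\<^esub> y) = \<Theta> x + \<Theta> y"
    and smult_closed: "\<And>a x. a \<in> carrier R \<Longrightarrow> x \<in> carrier M \<Longrightarrow> a \<odot>\<^bsub>M\<^esub> x \<in> carrier M"
    and smult: "\<And>a x. a \<in> carrier R \<Longrightarrow> x \<in> carrier M \<Longrightarrow> \<Theta> (a \<odot>\<^bsub>M\<^esub> x) = act a (\<Theta> x)"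
    and act_add_left: "\<And>a b x. a \<in> carrier R \<Longrightarrow> b \<in> carrier R \<Longrightarrow> act (a \<oplus>\<^bsub>R\<^esub> b) x = act a x + act b x"
    and act_add_right: "\<And>a x y. a \<in> carrier R \<Longrightarrow> act a (x + y) = act a x + act a y"
    and act_mult: "\<And>a b x. a \<in> carrier R \<Longrightarrow> b \<in> carrier R \<Longrightarrow> act (a \<otimes>\<^bsub>R\<^esub> b) x = act a (act b x)"
    and act_one: "\<And>x. act \<one>\<^bsub>R\<^esub> x = x"
  shows "left_module R M"
proof -
  have inj: "x = y" if "\<Theta> x = \<Theta> y" "x \<in> carrier M" "y \<in> carrier M" for x y
    using that bij_betw_imp_inj_on[OF bij] by (auto dest: inj_onD)
  have ag: "abelian_group M"
  proof (rule abelian_groupI)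
    fix x y z assume "x \<in> carrier M" "y \<in> carrier M" "z \<in> carrier M"
    thus "(x \<oplus>\<^bsub>M\<^esub> y) \<oplus>\<^bsub>M\<^esub> z = x \<oplus>\<^bsub>M\<^esub> (y \<oplus>\<^bsub>M\<^esub> z)"
      by (intro inj) (simp_all add: add add_closed add.assoc)
  next
    fix x y assume "x \<in> carrier M" "y \<in> carrier M"
    thus "x \<oplus>\<^bsub>M\<^esub> y = y \<oplus>\<^bsub>M\<^esub> x" by (intro inj) (simp_all add: add add_closed add.commute)
  next
    fix x assume x: "x \<in> carrier M"
    thus "\<zero>\<^bsub>M\<^esub> \<oplus>\<^bsub>M\<^esub> x = x" by (intro inj) (simp_all add: add add_closed zero)
    have "- \<Theta> x \<in> \<Theta> ` carrier M"
      using S_minus bij x by (auto simp: bij_betw_def)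
    then obtain y where "y \<in> carrier M" "\<Theta> y = - \<Theta> x" by auto
    thus "\<exists>y\<in>carrier M. y \<oplus>\<^bsub>M\<^esub> x = \<zero>\<^bsub>M\<^esub>"
      using x by (intro bexI[of _ y] inj) (simp_all add: add add_closed zero)
  qed (simp_all add: add_closed zero)
  have am: "\<And>a b. a \<in> carrier R \<Longrightarrow> b \<in> carrier R \<Longrightarrow> a \<oplus>\<^bsub>R\<^esub> b \<in> carrier R"
    and mm: "\<And>a b. a \<in> carrier R \<Longrightarrow> b \<in> carrier R \<Longrightarrow> a \<otimes>\<^bsub>R\<^esub> b \<in> carrier R" and om: "\<one>\<^bsub>R\<^esub> \<in> carrier R"
    using R by (simp_all add: ring.ring_simprules)
  show ?thesis
  proof (intro left_module.intro R ag left_module_axioms.intro)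
    fix a x assume "a \<in> carrier R" "x \<in> carrier M"
    thus "a \<odot>\<^bsub>M\<^esub> x \<in> carrier M" by (rule smult_closed)
  next
    fix a b x assume *: "a \<in> carrier R" "b \<in> carrier R" "x \<in> carrier M"
    show "(a \<oplus>\<^bsub>R\<^esub> b) \<odot>\<^bsub>M\<^esub> x = a \<odot>\<^bsub>M\<^esub> x \<oplus>\<^bsub>M\<^esub> b \<odot>\<^bsub>M\<^esub> x"
      by (rule inj) (simp_all add: * am add add_closed smult smult_closed act_add_left)
    show "(a \<otimes>\<^bsub>R\<^esub> b) \<odot>\<^bsub>M\<^esub> x = a \<odot>\<^bsub>M\<^esub> (b \<odot>\<^bsub>M\<^esub> x)"
      by (rule inj) (simp_all add: * mm smult smult_closed act_mult)
  next
    fix a x y assume *: "a \<in> carrier R" "x \<in> carrier M" "y \<in> carrier M"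
    show "a \<odot>\<^bsub>M\<^esub> (x \<oplus>\<^bsub>M\<^esub> y) = a \<odot>\<^bsub>M\<^esub> x \<oplus>\<^bsub>M\<^esub> a \<odot>\<^bsub>M\<^esub> y"
      by (rule inj) (simp_all add: * add add_closed smult smult_closed act_add_right)
  next
    fix x assume "x \<in> carrier M"
    thus "\<one>\<^bsub>R\<^esub> \<odot>\<^bsub>M\<^esub> x = x" by (intro inj) (simp_all add: om smult smult_closed act_one)
  qed
qed

lemma finsum_transport:
  fixes \<Theta> :: "'m \<Rightarrow> 'n::ab_group_add"
  assumes M: "abelian_monoid M" and zero: "\<Theta> \<zero>\<^bsub>M\<^esub> = 0"
    and add: "\<And>x y. x \<in> carrier M \<Longrightarrow> y \<in> carrier M \<Longrightarrow> \<Theta> (x \<oplus>\<^bsub>M\<^esub> y) = \<Theta> x + \<Theta> y"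
    and f: "\<And>i. i \<in> A \<Longrightarrow> f i \<in> carrier M"
  shows "\<Theta> (finsum M f A) = (\<Sum>i\<in>A. \<Theta> (f i))"
  using f
proof (induction A rule: infinite_finite_induct)
  case (infinite A)
  thus ?case by (simp add: abelian_monoid.finsum_infinite[OF M] zero)
next
  case empty
  show ?case by (simp add: abelian_monoid.finsum_empty[OF M] zero)
next
  case (insert a A)
  have "finsum M f (insert a A) = f a \<oplus>\<^bsub>M\<^esub> finsum M f A"
    by (rule abelian_monoid.finsum_insert[OF M]) (use insert in auto)
  moreover have "finsum M f A \<in> carrier M"
    by (rule abelian_monoid.finsum_closed[OF M]) (use insert in auto)
  ultimately show ?case using insert by (simp add: add)
qed

section \<open>Fixed vectors of a semilinear operator\<close>

context vector_space
begin

text \<open>The generators outside \<open>L\<close> can be exchanged one at a time for vectors of the sequence, so after finitely many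
  steps some vector depends on the earlier ones modulo \<open>L\<close>.\<close>

lemma finite_codim_dependence:
  fixes u :: "nat \<Rightarrow> 'b"
  assumes "finite P" and "\<And>i. u i \<in> span (L \<union> P)"
  shows "\<exists>k. u k \<in> span (L \<union> u ` {..<k})"
  using assms
proof (induction P arbitrary: L u rule: finite_induct)
  case empty
  show ?case by (rule exI[of _ 0]) (use empty[of 0] in simp)
next
  case (insert p P)
  show ?case
  proof (cases "\<forall>i. u i \<in> span (L \<union> P)")
    case True
    thus ?thesis by (intro insert.IH) simp
  next
    case False
    then obtain j where j: "u j \<notin> span (L \<union> P)" by blast
    have "u j \<in> span (insert p (L \<union> P))" using insert.prems[of j] by simp
    hence p: "p \<in> span (insert (u j) (L \<union> P))" using j by (rule in_span_insert)
    have "span (L \<union> insert p P) \<subseteq> span (insert (u j) L \<union> P)"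
    proof (rule span_minimal[OF _ subspace_span], rule subsetI)
      fix x assume "x \<in> L \<union> insert p P"
      thus "x \<in> span (insert (u j) L \<union> P)" using p by (cases "x = p") (simp_all add: span_base)
    qed
    hence "u (j + 1 + i) \<in> span (insert (u j) L \<union> P)" for i
      using insert.prems[of "j + 1 + i"] by blast
    from insert.IH[of "\<lambda>i. u (j + 1 + i)", OF this]
    obtain k where k: "u (j + 1 + k) \<in> span (insert (u j) L \<union> (\<lambda>i. u (j + 1 + i)) ` {..<k})"
      by blast
    have "insert (u j) L \<union> (\<lambda>i. u (j + 1 + i)) ` {..<k} \<subseteq> L \<union> u ` {..<j + 1 + k}" by auto
    with k have "u (j + 1 + k) \<in> span (L \<union> u ` {..<j + 1 + k})" using span_mono by blast
    thus ?thesis ..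
  qed
qed

lemma span_subspace_union_image:
  assumes L: "subspace L" and z: "z \<in> span (L \<union> u ` {..<k::nat})"
  shows "\<exists>l\<in>L. \<exists>a. z = l + (\<Sum>i<k. scale (a i) (u i))"
proof -
  let ?S = "{l + (\<Sum>i<k. scale (a i) (u i)) | l a. l \<in> L}"
  have S: "l + (\<Sum>i<k. scale (a i) (u i)) \<in> ?S" if "l \<in> L" for l a using that by blast
  have "subspace ?S"
  proof (rule subspaceI)
    show "0 \<in> ?S" using S[OF subspace_0[OF L], of "\<lambda>_. 0"] by simp
  next
    fix x y assume "x \<in> ?S" "y \<in> ?S"
    then obtain l a l' a' where *: "l \<in> L" "l' \<in> L" "x = l + (\<Sum>i<k. scale (a i) (u i))"
      "y = l' + (\<Sum>i<k. scale (a' i) (u i))" by blast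
    hence "x + y = (l + l') + (\<Sum>i<k. scale (a i + a' i) (u i))"
      by (simp add: scale_left_distrib sum.distrib algebra_simps)
    thus "x + y \<in> ?S" using subspace_add[OF L *(1,2)] by (auto intro!: exI[of _ "l + l'"] exI[of _ "\<lambda>i. a i + a' i"])
  next
    fix c x assume "x \<in> ?S"
    then obtain l a where *: "l \<in> L" "x = l + (\<Sum>i<k. scale (a i) (u i))" by blast
    hence "scale c x = scale c l + (\<Sum>i<k. scale (c * a i) (u i))"
      by (simp add: scale_right_distrib scale_sum_right)
    thus "scale c x \<in> ?S" using subspace_scale[OF L *(1), of c]
      by (auto intro!: exI[of _ "scale c l"] exI[of _ "\<lambda>i. c * a i"])
  qed
  moreover have "L \<union> u ` {..<k} \<subseteq> ?S"
  proof
    fix x assume "x \<in> L \<union> u ` {..<k}"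
    thus "x \<in> ?S"
    proof
      assume "x \<in> L"
      thus ?thesis using S[of x "\<lambda>_. 0"] by simp
    next
      assume "x \<in> u ` {..<k}"
      then obtain j where j: "j < k" "x = u j" by auto
      have "(\<Sum>i<k. scale (if j = i then 1 else 0) (u i)) = (\<Sum>i<k. if j = i then u i else 0)"
        by (intro sum.cong) auto
      thus ?thesis using j S[OF subspace_0[OF L], of "\<lambda>i. if j = i then 1 else 0"] by simp
    qed
  qed
  ultimately have "span (L \<union> u ` {..<k}) \<subseteq> ?S" by (intro span_minimal)
  thus ?thesis using z by blast
qed

text \<open>The exchange step that lets a number of generators serve as a termination measure.\<close>

lemma exchange_generator:
  assumes "finite P" and "v \<in> span (A \<union> P)" and "v \<notin> span A"
  shows "\<exists>p\<in>P. p \<in> span (insert v (A \<union> (P - {p})))"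
  using assms
proof (induction P rule: finite_induct)
  case (insert p P)
  show ?case
  proof (cases "v \<in> span (A \<union> P)")
    case True
    then obtain p' where p': "p' \<in> P" "p' \<in> span (insert v (A \<union> (P - {p'})))"
      using insert by blast
    have "insert v (A \<union> (P - {p'})) \<subseteq> insert v (A \<union> (insert p P - {p'}))" by auto
    thus ?thesis using p' span_mono by blast
  next
    case False
    have "v \<in> span (insert p (A \<union> P))" using insert.prems by simp
    hence "p \<in> span (insert v (A \<union> P))" using False by (rule in_span_insert)
    moreover have "insert p P - {p} = P" using insert.hyps by auto
    ultimately show ?thesis by auto
  qed
qed simp

end

text \<open>Iterating \<open>x \<mapsto> x\<^sub>i\<^sup>Q + a\<^sub>i\<^sub>+\<^sub>1 X\<^sup>Q\<close> and asking for the last value to be \<open>X\<close> again gives a polynomial equation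
  for \<open>X\<close>; it has a nonzero solution because the only term of degree one is \<open>X\<close>.\<close>

lemma frobenius_cycle_solvable:
  fixes a :: "nat \<Rightarrow> 'k::alg_closed_field"
  assumes Q: "1 < Q" and a: "j \<le> n" "a j \<noteq> 0"
  shows "\<exists>x. x n \<noteq> 0 \<and> x 0 = a 0 * x n ^ Q \<and> (\<forall>i<n. x (Suc i) = x i ^ Q + a (Suc i) * x n ^ Q)"
proof -
  define P where "P = rec_nat (monom (a 0) Q) (\<lambda>i p. p ^ Q + monom (a (Suc i)) Q)"
  have P0: "P 0 = monom (a 0) Q" and PS: "P (Suc i) = P i ^ Q + monom (a (Suc i)) Q" for i
    by (simp_all add: P_def)
  have mdvd: "monom 1 Q dvd monom c Q" for c :: 'k
    by (rule dvdI[of _ _ "[:c:]"]) (simp add: mult.commute smult_monom)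
  have dvd: "monom 1 Q dvd P i" for i
  proof (induction i)
    case 0 show ?case by (simp add: P0 mdvd)
  next
    case (Suc i)
    have "P i dvd P i ^ Q" using Q by (intro dvd_power) simp
    hence "monom 1 Q dvd P i ^ Q" using Suc dvd_trans by blast
    thus ?case by (simp add: PS mdvd)
  qed
  have nz: "P i \<noteq> 0 \<or> (\<forall>j\<le>i. a j = 0)" for i
  proof (induction i)
    case 0 show ?case by (simp add: P0 monom_eq_0_iff)
  next
    case (Suc i)
    show ?case
    proof (cases "P i = 0")
      case True
      hence "\<forall>j\<le>i. a j = 0" using Suc by simp
      moreover have "P (Suc i) = monom (a (Suc i)) Q" using True Q by (simp add: PS)
      ultimately show ?thesis by (auto simp: monom_eq_0_iff le_Suc_eq)
    next
      case False
      have "Q \<le> degree (P i)"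
        using dvd_imp_degree_le[OF dvd False] by (simp add: degree_monom_eq)
      hence "Q * Q \<le> degree (P i ^ Q)" using False by (simp add: degree_power_eq)
      moreover have "Q < Q * Q" using Q by simp
      ultimately have "Q < degree (P i ^ Q)" by linarith
      moreover have "degree (monom (a (Suc i)) Q) \<le> Q" by (rule degree_monom_le)
      ultimately have "degree (P (Suc i)) > 0"
        using Q by (simp add: PS degree_add_eq_left)
      thus ?thesis by auto
    qed
  qed
  hence Pn: "P n \<noteq> 0" using a by auto
  obtain H where H: "P n = monom 1 Q * H" using dvd[of n] by (rule dvdE)
  hence H0: "H \<noteq> 0" using Pn by auto
  define G where "G = monom 1 (Q - 1) * H - 1"
  have "degree (monom 1 (Q - 1) * H) = Q - 1 + degree H"
    using H0 by (simp add: degree_mult_eq degree_monom_eq monom_eq_0_iff)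
  hence "degree (monom 1 (Q - 1) * H) > 0" using Q by simp
  hence "degree G > 0" unfolding G_def using degree_add_eq_left[of "- 1" "monom 1 (Q - 1) * H"] by simp
  then obtain z where z: "poly G z = 0" using alg_closed_imp_poly_has_root by blast
  have z0: "z \<noteq> 0" using z Q by (auto simp: G_def poly_monom power_0_left)
  have "z ^ (Q - 1) * poly H z = 1" using z by (simp add: G_def poly_monom)
  moreover have "z ^ Q = z * z ^ (Q - 1)" using Q by (cases Q) auto
  ultimately have Pz: "poly (P n) z = z" by (simp add: H poly_monom mult.assoc)
  show ?thesis
    by (rule exI[of _ "\<lambda>i. poly (P i) z"]) (simp add: Pz z0 P0 PS poly_monom)
qed

text \<open>By this, \<open>D - 1\<close> maps the span of fixed vectors onto itself, so that a vector fixed modulo this span can be corrected to a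
  fixed vector.\<close>

lemma artin_schreier_solvable:
  fixes c :: "'k::alg_closed_field"
  assumes "1 < Q"
  shows "\<exists>x. x ^ Q - x = c"
proof -
  define G where "G = monom 1 Q + [:- c, - 1 :: 'k:]"
  have "degree G = Q"
    unfolding G_def using assms by (subst degree_add_eq_left) (auto simp: degree_monom_eq)
  then obtain x where "poly G x = 0"
    using alg_closed_imp_poly_has_root[of G] assms by auto
  thus ?thesis by (intro exI[of _ x]) (simp add: G_def poly_monom algebra_simps)
qed

context semilinear_operator
begin

lemma Q_gt_1: "0 < e \<Longrightarrow> 1 < q ^ e"
  by (rule one_less_power[OF q_gt_1])

text \<open>Modulo \<open>L\<close>, the vectors \<open>u, D u, D\<^sup>2 u, \<dots>\<close> span a finite-dimensional space on which \<open>D\<close> is given by a companion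
  matrix. For such a matrix the equation \<open>D w = w\<close> is the cyclic system solved above.\<close>

lemma fixed_vector_exists:
  assumes e: "0 < e" and L: "subspace L" and U: "subspace U" and DU: "\<And>x. x \<in> U \<Longrightarrow> D x \<in> U"
    and DL: "\<And>x. x \<in> U \<Longrightarrow> D x \<in> L \<Longrightarrow> x \<in> L" and fin: "finite P" "U \<subseteq> span (L \<union> P)"
    and u: "u \<in> U" "u \<notin> L"
  shows "\<exists>w\<in>U. w \<notin> L \<and> D w - w \<in> L"
proof -
  define v where "v i = (D ^^ i) u" for i
  have vU: "v i \<in> U" for i by (induction i) (simp_all add: v_def u DU)
  define k where "k = (LEAST k. v k \<in> span (L \<union> v ` {..<k}))"
  have "\<exists>k. v k \<in> span (L \<union> v ` {..<k})"
    by (rule finite_codim_dependence[OF fin(1)]) (use vU fin(2) in auto)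
  hence k: "v k \<in> span (L \<union> v ` {..<k})" unfolding k_def by (rule LeastI_ex)
  have min: "\<And>j. j < k \<Longrightarrow> v j \<notin> span (L \<union> v ` {..<j})"
    unfolding k_def by (rule not_less_Least)
  have spL: "span L = L" using L by (simp add: span_eq_iff)
  have "k \<noteq> 0"
  proof
    assume "k = 0"
    with k have "v 0 \<in> L" by (simp add: spL)
    with u show False by (simp add: v_def)
  qed
  then obtain n where n: "k = Suc n" by (cases k) auto
  obtain l a where l: "l \<in> L" and vk: "v k = l + (\<Sum>i<k. scale (a i) (v i))"
    using span_subspace_union_image[OF L k] by blast
  have "\<exists>j\<le>n. a j \<noteq> 0"
  proof (rule ccontr)
    assume "\<not> ?thesis"
    hence "v k = l" using vk by (simp add: n less_Suc_eq_le)
    hence "D (v n) \<in> L" using l by (simp add: n v_def)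
    hence "v n \<in> L" using DL vU by blast
    thus False using min[of n] n by (auto intro: span_base)
  qed
  then obtain x where x: "x n \<noteq> 0" "x 0 = a 0 * x n ^ (q ^ e)"
      "\<And>i. i < n \<Longrightarrow> x (Suc i) = x i ^ (q ^ e) + a (Suc i) * x n ^ (q ^ e)"
    using frobenius_cycle_solvable[OF Q_gt_1[OF e]] by blast
  define w where "w = (\<Sum>i<k. scale (x i) (v i))"
  have Dw: "D w = (\<Sum>i<k. scale (x i ^ (q ^ e)) (v (Suc i)))"
    by (simp add: w_def D_sum D_scale v_def)
  have "D w = (\<Sum>i<n. scale (x i ^ (q ^ e)) (v (Suc i))) + scale (x n ^ (q ^ e)) (v k)"
    by (simp add: Dw n)
  also have "scale (x n ^ (q ^ e)) (v k)
      = scale (x n ^ (q ^ e)) l + (\<Sum>i<k. scale (a i * x n ^ (q ^ e)) (v i))"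
    unfolding vk by (simp add: scale_right_distrib scale_sum_right mult.commute)
  also have "(\<Sum>i<k. scale (a i * x n ^ (q ^ e)) (v i))
      = scale (x 0) (v 0) + (\<Sum>i<n. scale (a (Suc i) * x n ^ (q ^ e)) (v (Suc i)))"
    unfolding n by (subst sum.lessThan_Suc_shift) (simp add: x(2))
  finally have Dw': "D w = scale (x n ^ (q ^ e)) l + (scale (x 0) (v 0) + (\<Sum>i<n. scale (x (Suc i)) (v (Suc i))))"
    by (simp add: x(3) scale_left_distrib sum.distrib add_ac)
  have "w = scale (x 0) (v 0) + (\<Sum>i<n. scale (x (Suc i)) (v (Suc i)))"
    unfolding w_def n by (subst sum.lessThan_Suc_shift) simp
  hence "D w - w = scale (x n ^ (q ^ e)) l" using Dw' by simp
  hence "D w - w \<in> L" using L l by (simp add: subspace_scale)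
  moreover have "w \<in> U" unfolding w_def by (intro subspace_sum[OF U] subspace_scale[OF U] vU)
  moreover have "w \<notin> L"
  proof
    assume "w \<in> L"
    let ?S = "span (L \<union> v ` {..<n})"
    have "(\<Sum>i<n. scale (x i) (v i)) \<in> ?S"
      by (intro span_sum span_scale span_base) auto
    moreover have "w \<in> ?S" using \<open>w \<in> L\<close> by (auto intro: span_base)
    ultimately have "w - (\<Sum>i<n. scale (x i) (v i)) \<in> ?S" by (rule span_diff[rotated])
    hence "scale (x n) (v n) \<in> ?S" by (simp add: w_def n)
    hence "scale (inverse (x n)) (scale (x n) (v n)) \<in> ?S" by (rule span_scale)
    thus False using x(1) min[of n] by (simp add: n)
  qed
  ultimately show ?thesis by blast
qed

text \<open>Lang's theorem for the finite-dimensional space \<open>U / L\<close>. If the vectors fixed by \<open>D\<close> did not span it, there would be a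
  vector outside their span that is fixed modulo the span; corrected by an element of the span it would be fixed, a contradiction.\<close>

lemma fixed_vectors_span:
  assumes e: "0 < e" and L: "subspace L" and U: "subspace U" and G: "subspace G" and LU: "L \<subseteq> U"
    and DU: "\<And>x. x \<in> U \<Longrightarrow> D x \<in> U"
    and DL: "\<And>x. x \<in> U \<Longrightarrow> D x \<in> L \<longleftrightarrow> x \<in> L" and fin: "finite P" "U \<subseteq> span (L \<union> P)"
    and LG: "L \<subseteq> G" and fixed: "\<And>x. x \<in> U \<Longrightarrow> D x - x \<in> L \<Longrightarrow> x \<in> G"
  shows "U \<subseteq> G"
proof -
  define Fix where "Fix = {x \<in> U. D x - x \<in> L}"
  define L' where "L' = span (L \<union> Fix)"
  have L': "subspace L'" "L \<subseteq> L'" "Fix \<subseteq> L'" by (auto simp: L'_def intro: span_base)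
  have L'U: "L' \<subseteq> U" unfolding L'_def by (rule span_minimal) (use LU U Fix_def in auto)
  have root: "\<exists>y\<in>L'. D y - z \<in> L" if "z \<in> L'" for z
    using that unfolding L'_def
  proof (induction rule: span_induct_alt)
    case base
    show ?case by (rule bexI[of _ 0]) (simp_all add: span_zero subspace_0[OF L])
  next
    case (step c x y)
    then obtain y' where y': "y' \<in> span (L \<union> Fix)" "D y' - y \<in> L" by blast
    show ?case
    proof (cases "x \<in> L")
      case True
      have "D y' - (scale c x + y) = (D y' - y) - scale c x" by (simp add: algebra_simps)
      also have "\<dots> \<in> L" by (rule subspace_diff[OF L y'(2) subspace_scale[OF L True]])
      finally show ?thesis using y' by blast
    next
      case False
      hence "x \<in> Fix" using step(1) by blast
      hence x: "x \<in> U" "D x - x \<in> L" unfolding Fix_def by simp_all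
      obtain r where r: "r ^ (q ^ e) = c" using q_power_surj by blast
      have "D (scale r x + y') - (scale c x + y) = scale c (D x - x) + (D y' - y)"
        by (simp add: D_add D_scale r scale_right_diff_distrib)
      also have "\<dots> \<in> L" using y'(2) x L by (intro subspace_add subspace_scale)
      finally show ?thesis
        by (rule bexI) (intro span_add span_scale span_base[OF step(1)] y'(1))
    qed
  qed
  have as: "\<exists>y\<in>L'. D y - y - z \<in> L" if "z \<in> L'" for z
    using that unfolding L'_def
  proof (induction rule: span_induct_alt)
    case base
    show ?case by (rule bexI[of _ 0]) (simp_all add: span_zero subspace_0[OF L])
  next
    case (step c x y)
    then obtain y' where y': "y' \<in> span (L \<union> Fix)" "D y' - y' - y \<in> L" by blast
    show ?case
    proof (cases "x \<in> L")
      case True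
      have "D y' - y' - (scale c x + y) = (D y' - y' - y) - scale c x" by (simp add: algebra_simps)
      also have "\<dots> \<in> L" by (rule subspace_diff[OF L y'(2) subspace_scale[OF L True]])
      finally show ?thesis using y' by blast
    next
      case False
      hence "x \<in> Fix" using step(1) by blast
      hence x: "x \<in> U" "D x - x \<in> L" unfolding Fix_def by simp_all
      obtain r where r: "r ^ (q ^ e) - r = c" using artin_schreier_solvable[OF Q_gt_1[OF e]] by blast
      have "D (scale r x + y') - (scale r x + y') - (scale c x + y)
          = scale (r ^ (q ^ e)) (D x - x) + (D y' - y' - y)"
        by (simp add: D_add D_scale scale_right_diff_distrib scale_left_diff_distrib flip: r)
      also have "\<dots> \<in> L" using y'(2) x L by (intro subspace_add subspace_scale)
      finally show ?thesis
        by (rule bexI) (intro span_add span_scale span_base[OF step(1)] y'(1))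
    qed
  qed
  have "U \<subseteq> L'"
  proof
    fix u assume u: "u \<in> U"
    show "u \<in> L'"
    proof (rule ccontr)
      assume "u \<notin> L'"
      have "\<exists>w\<in>U. w \<notin> L' \<and> D w - w \<in> L'"
      proof (rule fixed_vector_exists[OF e L'(1) U DU _ fin(1) _ u \<open>u \<notin> L'\<close>])
        fix x assume x: "x \<in> U" "D x \<in> L'"
        then obtain y where y: "y \<in> L'" "D y - D x \<in> L" using root by blast
        hence "D (y - x) \<in> L" by (simp add: D_diff)
        moreover have "y - x \<in> U" using x y L'U by (intro subspace_diff[OF U]) auto
        ultimately have "y - x \<in> L" using DL by blast
        hence "y - x \<in> L'" using L'(2) by blast
        hence "y - (y - x) \<in> L'" by (rule subspace_diff[OF L'(1) y(1)])
        moreover have "y - (y - x) = x" by simp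
        ultimately show "x \<in> L'" by metis
      next
        show "U \<subseteq> span (L' \<union> P)" using fin(2) span_mono[of "L \<union> P" "L' \<union> P"] L'(2) by blast
      qed
      then obtain w where w: "w \<in> U" "w \<notin> L'" "D w - w \<in> L'" by blast
      then obtain y where y: "y \<in> L'" "D y - y - (D w - w) \<in> L" using as by blast
      have "D (y - w) - (y - w) \<in> L" using y(2) by (simp add: D_diff algebra_simps)
      moreover have "y - w \<in> U" using w y L'U by (intro subspace_diff[OF U]) auto
      ultimately have "y - w \<in> L'" using L'(3) by (auto simp: Fix_def)
      hence "y - (y - w) \<in> L'" by (rule subspace_diff[OF L'(1) y(1)])
      moreover have "y - (y - w) = w" by simp
      ultimately show False using w by metis
    qed
  qed
  moreover have "L' \<subseteq> G" unfolding L'_def by (rule span_minimal[OF _ G]) (use LG fixed Fix_def in auto)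
  ultimately show ?thesis by blast
qed

end

section \<open>Lattices at infinity\<close>

text \<open>The setting of the main argument. The ascending filtration \<open>B\<close> measures the order of a pole at infinity, in units in
  which \<open>t\<close> has order \<open>s\<close> and \<open>\<tau>\<close> has order \<open>N\<close>. The condition \<open>B 0 = {0}\<close> is a normalization of the indexing; finite
  dimensionality of each \<open>B m\<close> says that a pole of bounded order leaves only finitely many parameters, and the last
  condition says that \<open>t\<tau>M\<close> has finite codimension in \<open>M\<close>, in a form compatible with the filtration.\<close>

locale filtered_t_module = tau_t_module scale q \<tau> t
  for scale :: "'k::alg_closed_field \<Rightarrow> 'm::ab_group_add \<Rightarrow> 'm" and q and \<tau> t +
  fixes M :: "'m set" and B :: "int \<Rightarrow> 'm set" and N s :: nat
  assumes M_sub: "subspace M" and t_M: "x \<in> M \<Longrightarrow> t x \<in> M" and tau_M: "x \<in> M \<Longrightarrow> \<tau> x \<in> M"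
    and N_pos: "0 < N" and s_pos: "0 < s"
    and B_sub: "subspace (B m)" and B_M: "B m \<subseteq> M" and B_mono: "m \<le> m' \<Longrightarrow> B m \<subseteq> B m'"
    and B_t: "x \<in> M \<Longrightarrow> t x \<in> B (m + int s) \<longleftrightarrow> x \<in> B m"
    and B_tau: "x \<in> M \<Longrightarrow> \<tau> x \<in> B (m + int N) \<longleftrightarrow> x \<in> B m"
    and B_0: "B 0 = {0}" and B_exhaust: "x \<in> M \<Longrightarrow> \<exists>m. x \<in> B m"
    and B_fin: "\<exists>P. finite P \<and> B m \<subseteq> span P"
    and cover: "\<exists>c. \<forall>x\<in>M. \<exists>y\<in>M. x - t (\<tau> y) \<in> B c"
begin

definition T :: "'m \<Rightarrow> 'm" where "T x = t (\<tau> x)"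

definition W :: int where "W = int N + int s"

lemma W_pos: "0 < W" using N_pos by (simp add: W_def)

sublocale T: semilinear_operator scale q T 1
  by unfold_locales (simp_all add: T_def D_add t_add D_scale t_scale)

lemma T_t: "T (t x) = t (T x)" by (simp add: T_def t_tau)
lemma T_tau: "T (\<tau> x) = \<tau> (T x)" by (simp add: T_def t_tau)
lemma T_M: "x \<in> M \<Longrightarrow> T x \<in> M" by (simp add: T_def t_M tau_M)
lemma Tn_M: "x \<in> M \<Longrightarrow> (T ^^ n) x \<in> M" by (induction n) (simp_all add: T_M)
lemma Tn_tau: "(T ^^ n) (\<tau> x) = \<tau> ((T ^^ n) x)" by (induction n) (simp_all add: T_tau)

lemma B_T: "x \<in> M \<Longrightarrow> T x \<in> B (m + W) \<longleftrightarrow> x \<in> B m"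
  using B_t[of "\<tau> x" "m + int N"] B_tau[of x m] tau_M by (simp add: T_def W_def add.assoc)

lemma B_Tn: "x \<in> M \<Longrightarrow> (T ^^ n) x \<in> B (m + int n * W) \<longleftrightarrow> x \<in> B m"
proof (induction n)
  case (Suc n)
  have "(T ^^ Suc n) x \<in> B (m + int (Suc n) * W) \<longleftrightarrow> T ((T ^^ n) x) \<in> B (m + int n * W + W)"
    by (simp add: algebra_simps)
  thus ?case using Suc B_T Tn_M by simp
qed simp

lemma B_taun: "x \<in> M \<Longrightarrow> (\<tau> ^^ n) x \<in> B (m + int n * int N) \<longleftrightarrow> x \<in> B m"
proof (induction n)
  case (Suc n)
  have "(\<tau> ^^ n) x \<in> M" using Suc.prems by (induction n) (simp_all add: tau_M)
  moreover have "(\<tau> ^^ Suc n) x \<in> B (m + int (Suc n) * int N) \<longleftrightarrow> \<tau> ((\<tau> ^^ n) x) \<in> B (m + int n * int N + int N)"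
    by (simp add: algebra_simps)
  ultimately show ?case using Suc B_tau by simp
qed simp

lemma taun_M: "x \<in> M \<Longrightarrow> (\<tau> ^^ n) x \<in> M" by (induction n) (simp_all add: tau_M)
lemma tn_M: "x \<in> M \<Longrightarrow> (t ^^ n) x \<in> M" by (induction n) (simp_all add: t_M)

lemma zero_B [simp]: "0 \<in> B m" by (rule subspace_0[OF B_sub])

text \<open>A sequence \<open>f\<close> that eventually satisfies \<open>f (k + 1) = T (f k)\<close> stands for the element \<open>T\<^sup>-\<^sup>k (f k)\<close>
  of the localization of \<open>M\<close> at \<open>t\<close> and \<open>\<tau>\<close>; scalars are twisted accordingly.\<close>

definition sscale :: "'k \<Rightarrow> (nat \<Rightarrow> 'm) \<Rightarrow> (nat \<Rightarrow> 'm)" where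
  "sscale c f = (\<lambda>k. scale (c ^ (q ^ k)) (f k))"

text \<open>On the element represented by \<open>f\<close> this is \<open>t\<^sup>-\<^sup>N \<tau>\<^sup>s\<close>, an operator of order \<open>0\<close> at infinity, since
  \<open>T\<^sup>-\<^sup>k \<tau>\<^sup>N\<^sup>+\<^sup>s = T\<^sup>-\<^sup>(\<^sup>k\<^sup>-\<^sup>N\<^sup>) t\<^sup>-\<^sup>N \<tau>\<^sup>s\<close>.\<close>

definition sig :: "(nat \<Rightarrow> 'm) \<Rightarrow> (nat \<Rightarrow> 'm)" where
  "sig f = (\<lambda>k. if k < N then 0 else (\<tau> ^^ (N + s)) (f (k - N)))"

text \<open>On the element represented by \<open>f\<close> this is \<open>\<tau>\<^sup>-\<^sup>1\<close>, since \<open>T\<^sup>-\<^sup>k t = T\<^sup>-\<^sup>(\<^sup>k\<^sup>-\<^sup>1\<^sup>) \<tau>\<^sup>-\<^sup>1\<close>.\<close>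

definition rho :: "(nat \<Rightarrow> 'm) \<Rightarrow> (nat \<Rightarrow> 'm)" where
  "rho f = (\<lambda>k. if k = 0 then 0 else t (f (k - 1)))"

definition stau :: "(nat \<Rightarrow> 'm) \<Rightarrow> (nat \<Rightarrow> 'm)" where
  "stau f = (\<lambda>k. \<tau> (f k))"

definition emb :: "'m \<Rightarrow> (nat \<Rightarrow> 'm)" where
  "emb x = (\<lambda>k. (T ^^ k) x)"

text \<open>Only the eventual behaviour of a sequence matters. Working with sequences instead of their classes avoids the
  quotient; the sequences that vanish eventually lie in every \<open>Lam c\<close> and thereby play the part of zero.\<close>

definition V :: "(nat \<Rightarrow> 'm) set" where
  "V = {f. \<exists>k0. \<forall>k\<ge>k0. f k \<in> M \<and> f (Suc k) = T (f k)}"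

text \<open>The elements of the localization whose pole at infinity has order at most \<open>c\<close>.\<close>

definition Lam :: "int \<Rightarrow> (nat \<Rightarrow> 'm) set" where
  "Lam c = {f \<in> V. \<exists>k0. \<forall>k\<ge>k0. f k \<in> B (int k * W + c)}"

lemma vector_space_sscale: "vector_space sscale"
  by unfold_locales
     (simp_all add: sscale_def fun_eq_iff scale_right_distrib scale_left_distrib q_power_add power_mult_distrib)

lemma sig_add: "sig (f + g) = sig f + sig g"
  by (auto simp: sig_def fun_eq_iff Dn_add)

lemma sig_scale: "sig (sscale c f) = sscale (c ^ (q ^ s)) (sig f)"
  by (auto simp: sig_def sscale_def fun_eq_iff Dn_scale simp flip: power_mult power_add)
     (simp add: add.commute)

sublocale S: semilinear_operator sscale q sig s
  by (intro semilinear_operator.intro vector_space_sscale semilinear_operator_axioms.intro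
      sig_add sig_scale frobenius_axioms)

lemma rho_add: "rho (f + g) = rho f + rho g" by (auto simp: rho_def fun_eq_iff t_add)
lemmas rho_diff = additive_diff[of rho, OF rho_add]
lemma rho_scale: "rho (sscale (c ^ q) f) = sscale c (rho f)"
  by (auto simp: rho_def sscale_def fun_eq_iff t_scale gr0_conv_Suc simp flip: power_mult)
lemma rho_n_add: "(rho ^^ n) (f + g) = (rho ^^ n) f + (rho ^^ n) g" by (rule additive_funpow[OF rho_add])
lemmas rho_n_diff = additive_diff[of "rho ^^ n" for n, OF rho_n_add]
lemma rho_sig: "rho (sig f) = sig (rho f)"
  by (auto simp: rho_def sig_def fun_eq_iff t_tau_funpow diff_right_commute)
lemma stau_add: "stau (f + g) = stau f + stau g" by (auto simp: stau_def fun_eq_iff D_add)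
lemma emb_add: "emb (x + y) = emb x + emb y" by (auto simp: emb_def fun_eq_iff T.Dn_add)
lemmas emb_diff = additive_diff[of emb, OF emb_add]
lemmas emb_zero = additive_zero[of emb, OF emb_add]
lemma emb_scale: "emb (scale c x) = sscale c (emb x)"
  by (auto simp: emb_def sscale_def fun_eq_iff T.Dn_scale)
lemma stau_emb: "stau (emb x) = emb (\<tau> x)" by (auto simp: emb_def stau_def fun_eq_iff Tn_tau)
lemma emb_V: "x \<in> M \<Longrightarrow> emb x \<in> V" by (auto simp: V_def emb_def Tn_M)

lemma VE:
  assumes "f \<in> V"
  obtains k0 where "\<And>k. k \<ge> k0 \<Longrightarrow> f k \<in> M" "\<And>k. k \<ge> k0 \<Longrightarrow> f (Suc k) = T (f k)"
  using assms by (auto simp: V_def)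

lemma V_sub: "S.subspace V"
proof (rule S.subspaceI)
  show "0 \<in> V" using subspace_0[OF M_sub] by (simp add: V_def)
next
  fix f g assume "f \<in> V" "g \<in> V"
  then obtain k l where "\<forall>n\<ge>k. f n \<in> M \<and> f (Suc n) = T (f n)" "\<forall>n\<ge>l. g n \<in> M \<and> g (Suc n) = T (g n)"
    by (auto simp: V_def)
  thus "f + g \<in> V"
    unfolding V_def by (auto intro!: exI[of _ "max k l"] subspace_add[OF M_sub] simp: T.D_add)
next
  fix c f assume "f \<in> V"
  thus "sscale c f \<in> V"
    by (auto simp: V_def sscale_def T.D_scale power_mult[symmetric] mult.commute intro!: subspace_scale[OF M_sub])
qed

lemma VI: "(\<And>k. k \<ge> k0 \<Longrightarrow> f k \<in> M \<and> f (Suc k) = T (f k)) \<Longrightarrow> f \<in> V"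
  unfolding V_def by blast

lemma LamI: "f \<in> V \<Longrightarrow> (\<And>k. k \<ge> k0 \<Longrightarrow> f k \<in> B (int k * W + c)) \<Longrightarrow> f \<in> Lam c"
  unfolding Lam_def by blast

lemma LamE:
  assumes "f \<in> Lam c"
  obtains k0 where "\<And>k. k \<ge> k0 \<Longrightarrow> f k \<in> B (int k * W + c)"
  using assms unfolding Lam_def by blast

lemma Lam_V: "Lam c \<subseteq> V" by (auto simp: Lam_def)

lemma Lam_sub: "S.subspace (Lam c)"
proof (rule S.subspaceI)
  show "0 \<in> Lam c" using S.subspace_0[OF V_sub] by (simp add: Lam_def)
next
  fix f g assume fg: "f \<in> Lam c" "g \<in> Lam c"
  then obtain k l where "\<forall>n\<ge>k. f n \<in> B (int n * W + c)" "\<forall>n\<ge>l. g n \<in> B (int n * W + c)"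
    by (auto simp: Lam_def)
  hence *: "\<And>n. n \<ge> max k l \<Longrightarrow> (f + g) n \<in> B (int n * W + c)" by (auto intro!: subspace_add[OF B_sub])
  have "f \<in> V" "g \<in> V" using fg by (auto simp: Lam_def)
  hence "f + g \<in> V" by (rule S.subspace_add[OF V_sub])
  moreover have "\<exists>k0. \<forall>n\<ge>k0. (f + g) n \<in> B (int n * W + c)" using * by blast
  ultimately show "f + g \<in> Lam c" unfolding Lam_def by (intro CollectI conjI)
next
  fix a f assume f: "f \<in> Lam c"
  thus "sscale a f \<in> Lam c"
    using S.subspace_scale[OF V_sub, of f a]
    by (auto simp: Lam_def) (auto simp: sscale_def intro!: subspace_scale[OF B_sub])
qed

lemma Lam_mono:
  assumes "c \<le> c'"
  shows "Lam c \<subseteq> Lam c'"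
proof -
  have "B (int k * W + c) \<subseteq> B (int k * W + c')" for k
    by (rule B_mono) (use assms in simp)
  thus ?thesis unfolding Lam_def by blast
qed

lemma Lam_ex: 
  assumes "f \<in> V"
  shows "\<exists>c\<ge>0. f \<in> Lam c"
proof -
  obtain k0 where k0: "\<And>k. k \<ge> k0 \<Longrightarrow> f k \<in> M" "\<And>k. k \<ge> k0 \<Longrightarrow> f (Suc k) = T (f k)"
    by (rule VE[OF assms]) blast
  obtain m where "f k0 \<in> B m" using B_exhaust k0(1) by blast
  define c where "c = max 0 (m - int k0 * W)"
  have "f (k0 + j) \<in> B (int (k0 + j) * W + c)" for j
  proof (induction j)
    case 0
    have "m \<le> int k0 * W + c" by (simp add: c_def)
    thus ?case using \<open>f k0 \<in> B m\<close> B_mono by auto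
  next
    case (Suc j)
    have "T (f (k0 + j)) \<in> B (int (k0 + j) * W + c + W)" using Suc B_T k0(1) by simp
    thus ?case using k0(2)[of "k0 + j"] by (simp add: algebra_simps)
  qed
  hence "\<forall>k\<ge>k0. f k \<in> B (int k * W + c)" by (metis le_iff_add)
  hence "f \<in> Lam c" using LamI[OF assms] by blast
  thus ?thesis by (intro exI[of _ c]) (simp add: c_def)
qed

lemma eventually_zero_Lam: "(\<And>k. k \<ge> k0 \<Longrightarrow> f k = 0) \<Longrightarrow> f \<in> Lam c"
  using subspace_0[OF M_sub] by (intro LamI[of _ k0] VI[of k0]) simp_all

lemma emb_Lam: "x \<in> M \<Longrightarrow> emb x \<in> Lam c \<longleftrightarrow> x \<in> B c"
proof
  assume x: "x \<in> M" "emb x \<in> Lam c"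
  then obtain k where "(T ^^ k) x \<in> B (int k * W + c)" unfolding emb_def using LamE[OF x(2)] by (metis emb_def order_refl)
  thus "x \<in> B c" using B_Tn[OF x(1), of k c] by (simp add: add.commute)
next
  assume x: "x \<in> M" "x \<in> B c"
  show "emb x \<in> Lam c"
    by (rule LamI[OF emb_V[OF x(1)]]) (use B_Tn[OF x(1), of _ c] x(2) in \<open>simp add: emb_def add.commute\<close>)
qed

lemma rho_V: assumes "f \<in> V" shows "rho f \<in> V"
proof -
  obtain k0 where k0: "\<And>k. k \<ge> k0 \<Longrightarrow> f k \<in> M" "\<And>k. k \<ge> k0 \<Longrightarrow> f (Suc k) = T (f k)"
    by (rule VE[OF assms]) blast
  have "rho f k \<in> M \<and> rho f (Suc k) = T (rho f k)" if "k \<ge> Suc k0" for k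
    using that k0(1)[of "k - 1"] k0(2)[of "k - 1"] t_M by (cases k) (auto simp: rho_def T_t)
  thus ?thesis by (rule VI)
qed

lemma rho_Lam: assumes f: "f \<in> V" shows "rho f \<in> Lam (c - int N) \<longleftrightarrow> f \<in> Lam c"
proof -
  obtain k0 where k0: "\<And>k. k \<ge> k0 \<Longrightarrow> f k \<in> M" "\<And>k. k \<ge> k0 \<Longrightarrow> f (Suc k) = T (f k)"
    by (rule VE[OF f]) blast
  have *: "rho f (Suc k) \<in> B (int (Suc k) * W + (c - int N)) \<longleftrightarrow> f k \<in> B (int k * W + c)" if "k \<ge> k0" for k
  proof -
    have "int (Suc k) * W + (c - int N) = (int k * W + c) + int s" by (simp add: W_def algebra_simps)
    thus ?thesis using B_t[OF k0(1)[OF that]] by (simp only: rho_def) simp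
  qed
  show ?thesis
  proof
    assume "rho f \<in> Lam (c - int N)"
    then obtain k1 where k1: "\<And>k. k \<ge> k1 \<Longrightarrow> rho f k \<in> B (int k * W + (c - int N))" by (rule LamE) blast
    have "f k \<in> B (int k * W + c)" if "k \<ge> max k0 k1" for k
      using that *[of k] k1[of "Suc k"] by simp
    thus "f \<in> Lam c" by (rule LamI[OF f])
  next
    assume "f \<in> Lam c"
    then obtain k1 where k1: "\<And>k. k \<ge> k1 \<Longrightarrow> f k \<in> B (int k * W + c)" by (rule LamE) blast
    have "rho f k \<in> B (int k * W + (c - int N))" if "k \<ge> Suc (max k0 k1)" for k
      using that *[of "k - 1"] k1[of "k - 1"] by (cases k) auto
    thus "rho f \<in> Lam (c - int N)" by (rule LamI[OF rho_V[OF f]])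
  qed
qed

lemma rho_n_V: "f \<in> V \<Longrightarrow> (rho ^^ n) f \<in> V" by (induction n) (simp_all add: rho_V)

lemma rho_n_Lam: "f \<in> Lam c \<Longrightarrow> (rho ^^ n) f \<in> Lam (c - int n * int N)"
proof (induction n)
  case (Suc n)
  have "rho ((rho ^^ n) f) \<in> Lam (c - int n * int N - int N)"
    using Suc rho_n_V Lam_V by (subst rho_Lam) blast+
  thus ?case by (simp add: algebra_simps)
qed simp

lemma rho_n_eventually:
  assumes f: "f \<in> V"
  shows "\<exists>k. (rho ^^ k) f \<in> Lam 0"
proof -
  obtain c where c: "c \<ge> 0" "f \<in> Lam c" using Lam_ex[OF f] by blast
  have "1 \<le> int N" using N_pos by simp
  hence "c \<le> c * int N" using mult_left_mono[of 1 "int N" c] c(1) by simp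
  hence "c - int (nat c) * int N \<le> 0" using c(1) by simp
  moreover have "(rho ^^ nat c) f \<in> Lam (c - int (nat c) * int N)" by (rule rho_n_Lam[OF c(2)])
  ultimately have "(rho ^^ nat c) f \<in> Lam 0" using Lam_mono by blast
  thus ?thesis ..
qed

lemma sig_V: assumes "f \<in> V" shows "sig f \<in> V"
proof -
  obtain k0 where k0: "\<And>k. k \<ge> k0 \<Longrightarrow> f k \<in> M" "\<And>k. k \<ge> k0 \<Longrightarrow> f (Suc k) = T (f k)"
    by (rule VE[OF assms]) blast
  have "T ((\<tau> ^^ n) x) = (\<tau> ^^ n) (T x)" for n x by (induction n) (simp_all add: T_tau)
  hence "sig f k \<in> M \<and> sig f (Suc k) = T (sig f k)" if "k \<ge> N + k0" for k
    using that k0(1)[of "k - N"] k0(2)[of "k - N"] taun_M by (auto simp: sig_def Suc_diff_le simp del: funpow.simps)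
  thus ?thesis by (rule VI)
qed

lemma sig_Lam: assumes f: "f \<in> V" shows "sig f \<in> Lam c \<longleftrightarrow> f \<in> Lam c"
proof -
  obtain k0 where k0: "\<And>k. k \<ge> k0 \<Longrightarrow> f k \<in> M" "\<And>k. k \<ge> k0 \<Longrightarrow> f (Suc k) = T (f k)"
    by (rule VE[OF f]) blast
  have *: "sig f (N + k) \<in> B (int (N + k) * W + c) \<longleftrightarrow> f k \<in> B (int k * W + c)" if "k \<ge> k0" for k
  proof -
    have "int (N + k) * W + c = (int k * W + c) + int (N + s) * int N" by (simp add: W_def algebra_simps)
    thus ?thesis using B_taun[OF k0(1)[OF that], of "N + s"] by (simp only: sig_def) simp
  qed
  show ?thesis
  proof
    assume "sig f \<in> Lam c"
    then obtain k1 where k1: "\<And>k. k \<ge> k1 \<Longrightarrow> sig f k \<in> B (int k * W + c)" by (rule LamE) blast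
    have "f k \<in> B (int k * W + c)" if "k \<ge> max k0 k1" for k
      using that *[of k] k1[of "N + k"] by simp
    thus "f \<in> Lam c" by (rule LamI[OF f])
  next
    assume "f \<in> Lam c"
    then obtain k1 where k1: "\<And>k. k \<ge> k1 \<Longrightarrow> f k \<in> B (int k * W + c)" by (rule LamE) blast
    have "sig f k \<in> B (int k * W + c)" if "k \<ge> N + max k0 k1" for k
      using that *[of "k - N"] k1[of "k - N"] by simp
    thus "sig f \<in> Lam c" by (rule LamI[OF sig_V[OF f]])
  qed
qed

lemma stau_V: assumes "f \<in> V" shows "stau f \<in> V"
proof -
  obtain k0 where k0: "\<And>k. k \<ge> k0 \<Longrightarrow> f k \<in> M" "\<And>k. k \<ge> k0 \<Longrightarrow> f (Suc k) = T (f k)"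
    by (rule VE[OF assms]) blast
  show ?thesis by (rule VI[of k0]) (simp add: stau_def k0 tau_M T_tau)
qed

lemma rho_stau: assumes "f \<in> V" shows "f - rho (stau f) \<in> Lam c" "rho (stau f) = stau (rho f)"
proof -
  obtain k0 where k0: "\<And>k. k \<ge> k0 \<Longrightarrow> f (Suc k) = T (f k)"
    by (rule VE[OF assms]) blast
  have "(f - rho (stau f)) k = 0" if "k \<ge> Suc k0" for k
    using that k0[of "k - 1"] by (cases k) (auto simp: rho_def stau_def T_def)
  thus "f - rho (stau f) \<in> Lam c" by (rule eventually_zero_Lam)
  show "rho (stau f) = stau (rho f)" by (auto simp: rho_def stau_def fun_eq_iff t_tau)
qed

text \<open>By the covering condition every \<open>x\<close> in \<open>M\<close> is \<open>T y\<close> up to an element of bounded order. Iterating this, \<open>T\<^sup>-\<^sup>k x\<close> is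
  an element of \<open>M\<close> plus an error; the errors stay bounded because \<open>T\<^sup>-\<^sup>1\<close> lowers the order by \<open>N + s\<close>.\<close>

lemma V_eq_emb_plus_Lam: "\<exists>c\<ge>0. \<forall>f\<in>V. \<exists>x\<in>M. f - emb x \<in> Lam c"
proof -
  obtain c' where c': "\<And>x. x \<in> M \<Longrightarrow> \<exists>y\<in>M. x - T y \<in> B c'" using cover by (auto simp: T_def)
  define c where "c = max 0 c'"
  have c: "\<exists>y\<in>M. x - T y \<in> B c" if "x \<in> M" for x
  proof -
    have "B c' \<subseteq> B c" by (rule B_mono) (simp add: c_def)
    thus ?thesis using c'[OF that] by blast
  qed
  have step: "\<exists>y\<in>M. x - (T ^^ k) y \<in> B (int k * W + c)" if "x \<in> M" for x k
    using that
  proof (induction k arbitrary: x)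
    case 0
    show ?case by (rule bexI[OF _ 0]) simp
  next
    case (Suc k)
    obtain y where y: "y \<in> M" "x - T y \<in> B c" using c Suc.prems by blast
    obtain z where z: "z \<in> M" "y - (T ^^ k) z \<in> B (int k * W + c)" using Suc.IH y by blast
    have "y - (T ^^ k) z \<in> M" using y z Tn_M by (intro subspace_diff[OF M_sub])
    hence "T (y - (T ^^ k) z) \<in> B (int k * W + c + W)" using z B_T by blast
    moreover have "c \<le> int k * W + c + W" using W_pos by simp
    hence "x - T y \<in> B (int k * W + c + W)" using y(2) B_mono by blast
    ultimately have "(x - T y) + T (y - (T ^^ k) z) \<in> B (int k * W + c + W)"
      by (intro subspace_add[OF B_sub])
    thus ?case using z(1) by (intro bexI[of _ z]) (simp_all add: T.D_diff algebra_simps)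
  qed
  show ?thesis
  proof (intro exI[of _ c] conjI ballI)
    fix f assume f: "f \<in> V"
    obtain k0 where k0: "\<And>k. k \<ge> k0 \<Longrightarrow> f k \<in> M" "\<And>k. k \<ge> k0 \<Longrightarrow> f (Suc k) = T (f k)"
    by (rule VE[OF f]) blast
    obtain y where y: "y \<in> M" "f k0 - (T ^^ k0) y \<in> B (int k0 * W + c)" using step k0(1) by blast
    have "f (k0 + j) - (T ^^ (k0 + j)) y \<in> B (int (k0 + j) * W + c)" for j
    proof (induction j)
      case (Suc j)
      have "f (k0 + j) - (T ^^ (k0 + j)) y \<in> M"
        using k0(1) y Tn_M by (intro subspace_diff[OF M_sub]) auto
      hence "T (f (k0 + j) - (T ^^ (k0 + j)) y) \<in> B (int (k0 + j) * W + c + W)"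
        using Suc B_T by blast
      thus ?case using k0(2)[of "k0 + j"] by (simp add: T.D_diff algebra_simps)
    qed (use y in simp)
    note * = this
    have "f - emb y \<in> Lam c"
    proof (rule LamI[of _ k0])
      show "f - emb y \<in> V" by (rule S.subspace_diff[OF V_sub f emb_V[OF y(1)]])
      fix k assume "k \<ge> k0"
      thus "(f - emb y) k \<in> B (int k * W + c)" using *[of "k - k0"] by (simp add: emb_def)
    qed
    thus "\<exists>x\<in>M. f - emb x \<in> Lam c" using y(1) by blast
  qed (simp add: c_def)
qed

text \<open>Write \<open>T\<^sup>j f = y + g\<close> with \<open>y\<close> in \<open>M\<close> and \<open>g\<close> of order at most \<open>c\<^sub>0\<close>, where \<open>c\<^sub>0\<close> depends only on \<open>M\<close>. For large \<open>j\<close> the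
  element \<open>T\<^sup>-\<^sup>j g\<close> lies in \<open>Lam 0\<close>, and \<open>y\<close> ranges over a finite-dimensional space because its order is bounded.\<close>

lemma Lam_finite_codim: "\<exists>P. finite P \<and> Lam c \<subseteq> S.span (Lam 0 \<union> P)"
proof -
  obtain c0 where c0: "c0 \<ge> 0" "\<And>f. f \<in> V \<Longrightarrow> \<exists>x\<in>M. f - emb x \<in> Lam c0"
    using V_eq_emb_plus_Lam by blast
  define j where "j = nat c0"
  have jW: "c0 \<le> int j * W" using W_pos c0(1) mult_left_mono[of 1 W c0] by (simp add: j_def)
  \<comment> \<open>\<open>sh\<close> represents \<open>T\<^sup>-\<^sup>j\<close>, and \<open>up\<close> represents \<open>T\<^sup>j\<close>.\<close>
  define sh where "sh f = (\<lambda>k. if k < j then 0 else f (k - j))" for f :: "nat \<Rightarrow> 'm"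
  define up where "up f = (\<lambda>k. (T ^^ j) (f k))" for f :: "nat \<Rightarrow> 'm"
  have sh_add: "sh (f + g) = sh f + sh g" for f g by (auto simp: sh_def fun_eq_iff)
  have sh_scale: "sh (sscale (c ^ (q ^ j)) f) = sscale c (sh f)" for c f
    by (auto simp: sh_def sscale_def fun_eq_iff simp flip: power_mult power_add)
  have sh_V: "sh f \<in> V" if f: "f \<in> V" for f
  proof -
    obtain k0 where k0: "\<And>k. k \<ge> k0 \<Longrightarrow> f k \<in> M" "\<And>k. k \<ge> k0 \<Longrightarrow> f (Suc k) = T (f k)"
    by (rule VE[OF f]) blast
    have "sh f k \<in> M \<and> sh f (Suc k) = T (sh f k)" if "k \<ge> j + k0" for k
      using that k0[of "k - j"] by (auto simp: sh_def Suc_diff_le)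
    thus ?thesis by (rule VI)
  qed
  have sh_Lam: "sh f \<in> Lam (c - int j * W) \<longleftrightarrow> f \<in> Lam c" if f: "f \<in> V" for f c
  proof
    assume "sh f \<in> Lam (c - int j * W)"
    then obtain k1 where k1: "\<And>k. k \<ge> k1 \<Longrightarrow> sh f k \<in> B (int k * W + (c - int j * W))"
      by (rule LamE) blast
    have "f k \<in> B (int k * W + c)" if "k \<ge> k1" for k
      using that k1[of "k + j"] by (simp add: sh_def algebra_simps)
    thus "f \<in> Lam c" by (rule LamI[OF f])
  next
    assume "f \<in> Lam c"
    then obtain k1 where k1: "\<And>k. k \<ge> k1 \<Longrightarrow> f k \<in> B (int k * W + c)" by (rule LamE) blast
    have "sh f k \<in> B (int k * W + (c - int j * W))" if "k \<ge> k1 + j" for k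
      using that k1[of "k - j"] by (simp add: sh_def algebra_simps of_nat_diff)
    thus "sh f \<in> Lam (c - int j * W)" by (rule LamI[OF sh_V[OF f]])
  qed
  have up_V: "up f \<in> V" if f: "f \<in> V" for f
  proof -
    obtain k0 where k0: "\<And>k. k \<ge> k0 \<Longrightarrow> f k \<in> M" "\<And>k. k \<ge> k0 \<Longrightarrow> f (Suc k) = T (f k)"
      by (rule VE[OF f]) blast
    show ?thesis by (rule VI[of k0]) (simp add: up_def k0 Tn_M funpow_swap1)
  qed
  have sh_up: "f - sh (up f) \<in> Lam c" if f: "f \<in> V" for f c
  proof -
    obtain k0 where k0: "\<And>k. k \<ge> k0 \<Longrightarrow> f (Suc k) = T (f k)"
    by (rule VE[OF f]) blast
    have "f (k + i) = (T ^^ i) (f k)" if "k \<ge> k0" for k i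
      using that by (induction i) (simp_all add: k0)
    note * = this
    have "(f - sh (up f)) k = 0" if k: "k \<ge> k0 + j" for k
    proof -
      have "f k = (T ^^ j) (f (k - j))" using *[of "k - j" j] k by simp
      thus ?thesis using k by (simp add: sh_def up_def)
    qed
    thus ?thesis by (rule eventually_zero_Lam)
  qed
  define e where "e = max c 0"
  obtain P0 where P0: "finite P0" "B (e + int j * W) \<subseteq> span P0" using B_fin by blast
  define P where "P = (\<lambda>y. sh (emb y)) ` P0"
  have P: "sh (emb y) \<in> S.span P" if "y \<in> span P0" for y
    using that
  proof (induction rule: span_induct_alt)
    case base
    have "sh (emb 0) = 0" by (simp add: emb_zero sh_def fun_eq_iff)
    thus ?case by (simp only: S.span_zero)
  next
    case (step a x y)
    obtain r where r: "r ^ (q ^ j) = a" using q_power_surj by blast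
    have "sh (emb (scale a x + y)) = sscale r (sh (emb x)) + sh (emb y)"
      by (simp add: emb_add emb_scale sh_add flip: r sh_scale)
    also have "\<dots> \<in> S.span P"
      using step by (intro S.span_add S.span_scale) (auto simp: P_def intro: S.span_base)
    finally show ?case .
  qed
  have "Lam c \<subseteq> S.span (Lam 0 \<union> P)"
  proof
    fix f assume f: "f \<in> Lam c"
    hence fV: "f \<in> V" using Lam_V by blast
    obtain y where y: "y \<in> M" "up f - emb y \<in> Lam c0" using c0(2) up_V[OF fV] by blast
    define g where "g = up f - emb y"
    have gV: "g \<in> V" using y(2) Lam_V by (auto simp: g_def)
    have "sh g \<in> Lam (c0 - int j * W)" using sh_Lam gV y(2) by (simp add: g_def)
    hence shg: "sh g \<in> Lam 0" using Lam_mono[of "c0 - int j * W" 0] jW by auto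
    have "up f = emb y + g" by (simp add: g_def)
    hence f_eq: "f = sh (emb y) + (sh g + (f - sh (up f)))" by (simp add: sh_add)
    have rest: "sh g + (f - sh (up f)) \<in> Lam 0" by (intro S.subspace_add[OF Lam_sub] shg sh_up fV)
    have "sh (emb y) = f - (sh g + (f - sh (up f)))" using f_eq by (simp add: algebra_simps)
    also have "\<dots> \<in> Lam e"
      using f rest Lam_mono[of c e] Lam_mono[of 0 e] by (intro S.subspace_diff[OF Lam_sub]) (auto simp: e_def)
    finally have "sh (emb y) \<in> Lam (e + int j * W - int j * W)" by simp
    hence "emb y \<in> Lam (e + int j * W)" using sh_Lam emb_V y(1) by blast
    hence "y \<in> span P0" using emb_Lam y(1) P0(2) by blast
    hence "sh (emb y) \<in> S.span (Lam 0 \<union> P)" using P S.span_mono[of P "Lam 0 \<union> P"] by blast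
    moreover have "sh g + (f - sh (up f)) \<in> S.span (Lam 0 \<union> P)" using rest by (auto intro: S.span_base)
    ultimately show "f \<in> S.span (Lam 0 \<union> P)" using f_eq S.span_add by metis
  qed
  moreover have "finite P" using P0 by (simp add: P_def)
  ultimately show ?thesis by blast
qed


text \<open>Lattices at infinity that contain the standard one, are stable under \<open>\<tau>\<^sup>-\<^sup>1\<close>, are preserved by \<open>t\<^sup>-\<^sup>N \<tau>\<^sup>s\<close>, and meet
  \<open>M\<close> trivially. Geometrically, \<open>M\<close> and such a lattice glue to a sheaf without global sections.\<close>

definition good :: "(nat \<Rightarrow> 'm) set \<Rightarrow> bool" where
  "good L \<longleftrightarrow> S.subspace L \<and> Lam 0 \<subseteq> L \<and> (\<exists>c. L \<subseteq> Lam c) \<and> (\<forall>f\<in>L. rho f \<in> L) \<and>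
     (\<forall>f\<in>V. sig f \<in> L \<longleftrightarrow> f \<in> L) \<and> (\<forall>x\<in>M. emb x \<in> L \<longrightarrow> x = 0)"

definition emb_plus :: "(nat \<Rightarrow> 'm) set \<Rightarrow> (nat \<Rightarrow> 'm) set" where
  "emb_plus L = {emb x + l | x l. x \<in> M \<and> l \<in> L}"

lemma good_Lam_0: "good (Lam 0)"
proof -
  have "rho f \<in> Lam 0" if f: "f \<in> Lam 0" for f
  proof -
    have "rho f \<in> Lam (0 - int N)" using f Lam_V by (subst rho_Lam) blast+
    thus ?thesis using Lam_mono[of "0 - int N" 0] by auto
  qed
  moreover have "x = 0" if "x \<in> M" "emb x \<in> Lam 0" for x
    using that emb_Lam[of x 0] B_0 by simp
  ultimately show ?thesis unfolding good_def using Lam_sub sig_Lam by blast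
qed

lemma goodD:
  assumes "good L"
  shows "S.subspace L" "Lam 0 \<subseteq> L" "L \<subseteq> V" "\<And>f. f \<in> L \<Longrightarrow> rho f \<in> L"
    "\<And>f. f \<in> V \<Longrightarrow> sig f \<in> L \<longleftrightarrow> f \<in> L" "\<And>x. x \<in> M \<Longrightarrow> emb x \<in> L \<Longrightarrow> x = 0"
  using assms Lam_V unfolding good_def by blast+

lemma good_bounded: "good L \<Longrightarrow> \<exists>c. L \<subseteq> Lam c"
  unfolding good_def by blast

lemma emb_plusI: "x \<in> M \<Longrightarrow> f - emb x \<in> L \<Longrightarrow> f \<in> emb_plus L"
proof -
  assume "x \<in> M" "f - emb x \<in> L"
  moreover have "f = emb x + (f - emb x)" by simp
  ultimately show ?thesis unfolding emb_plus_def by blast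
qed

lemma emb_plusE:
  assumes "f \<in> emb_plus L"
  obtains x l where "x \<in> M" "l \<in> L" "f = emb x + l"
  using assms unfolding emb_plus_def by blast

lemma emb_plus_sub:
  assumes L: "S.subspace L"
  shows "S.subspace (emb_plus L)"
proof (rule S.subspaceI)
  show "0 \<in> emb_plus L"
    by (rule emb_plusI[of 0]) (simp_all only: subspace_0[OF M_sub] emb_zero diff_self S.subspace_0[OF L])
next
  fix f g assume f: "f \<in> emb_plus L" and g: "g \<in> emb_plus L"
  obtain x l where x: "x \<in> M" "l \<in> L" "f = emb x + l" by (rule emb_plusE[OF f])
  obtain y m where y: "y \<in> M" "m \<in> L" "g = emb y + m" by (rule emb_plusE[OF g])
  have "f + g - emb (x + y) = l + m" by (simp add: x y emb_add)
  thus "f + g \<in> emb_plus L"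
    using S.subspace_add[OF L x(2) y(2)] subspace_add[OF M_sub x(1) y(1)] by (intro emb_plusI[of "x + y"]) simp_all
next
  fix c f assume f: "f \<in> emb_plus L"
  obtain x l where x: "x \<in> M" "l \<in> L" "f = emb x + l" by (rule emb_plusE[OF f])
  have "sscale c f - emb (scale c x) = sscale c l" by (simp add: x emb_scale S.scale_right_distrib)
  thus "sscale c f \<in> emb_plus L"
    using S.subspace_scale[OF L x(2)] subspace_scale[OF M_sub x(1)] by (intro emb_plusI[of "scale c x"]) simp_all
qed

lemma sub_emb_plus: "L \<subseteq> emb_plus L"
proof
  fix l assume "l \<in> L"
  thus "l \<in> emb_plus L" by (intro emb_plusI[of 0]) (simp_all add: subspace_0[OF M_sub] emb_zero)
qed

text \<open>If \<open>\<tau>L\<close> is contained in \<open>M + L\<close>, then so is \<open>\<tau>\<^sup>k L\<close> for all \<open>k\<close>, and these exhaust \<open>V\<close>.\<close>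

lemma emb_plus_exhausts:
  assumes L: "good L" and step: "{f \<in> V. rho f \<in> L} \<subseteq> emb_plus L"
  shows "V \<subseteq> emb_plus L"
proof -
  have sub: "S.subspace (emb_plus L)" by (rule emb_plus_sub[OF goodD(1)[OF L]])
  have ind: "f \<in> emb_plus L" if "f \<in> V" "(rho ^^ k) f \<in> L" for k f
    using that
  proof (induction k arbitrary: f)
    case 0
    thus ?case using sub_emb_plus by auto
  next
    case (Suc k)
    have "(rho ^^ k) (rho f) \<in> L" using Suc.prems(2) by (simp add: funpow_swap1)
    hence "rho f \<in> emb_plus L" using Suc.IH rho_V[OF Suc.prems(1)] by blast
    then obtain x l where x: "x \<in> M" "l \<in> L" "rho f = emb x + l" by (rule emb_plusE)
    have lV: "l \<in> V" using x(2) goodD(3)[OF L] by blast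
    have "l - rho (stau l) \<in> L" using rho_stau(1)[OF lV, of 0] goodD(2)[OF L] by blast
    with x(2) have "l - (l - rho (stau l)) \<in> L" by (rule S.subspace_diff[OF goodD(1)[OF L]])
    hence "rho (stau l) \<in> L" by simp
    hence l: "stau l \<in> emb_plus L" using stau_V[OF lV] step by blast
    have "f - rho (stau f) \<in> Lam 0" by (rule rho_stau(1)[OF Suc.prems(1)])
    hence "f - rho (stau f) \<in> emb_plus L" using goodD(2)[OF L] sub_emb_plus by blast
    moreover have "rho (stau f) = emb (\<tau> x) + stau l"
      by (simp add: rho_stau(2)[OF Suc.prems(1)] x(3) stau_add stau_emb)
    moreover have "emb (\<tau> x) \<in> emb_plus L"
      by (rule emb_plusI[of "\<tau> x"]) (use tau_M[OF x(1)] S.subspace_0[OF goodD(1)[OF L]] in simp_all)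
    ultimately have "(f - rho (stau f)) + rho (stau f) \<in> emb_plus L"
      using l S.subspace_add[OF sub] by metis
    thus ?case by simp
  qed
  show ?thesis
  proof
    fix f assume f: "f \<in> V"
    then obtain k where "(rho ^^ k) f \<in> Lam 0" using rho_n_eventually by blast
    hence "(rho ^^ k) f \<in> L" using goodD(2)[OF L] by blast
    thus "f \<in> emb_plus L" by (rule ind[OF f])
  qed
qed

lemma rho_scale': "\<exists>r. rho (sscale c f) = sscale r (rho f)"
proof -
  obtain r where "r ^ (q ^ 1) = c" using q_power_surj by blast
  thus ?thesis using rho_scale[of r f] by auto
qed

text \<open>The elements \<open>v\<close> with \<open>\<tau>\<^sup>-\<^sup>1 v\<close> in \<open>L\<close> form a space \<open>U\<close> that is finite-dimensional modulo \<open>L\<close>, and \<open>\<sigma> = t\<^sup>-\<^sup>N \<tau>\<^sup>s\<close> acts on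
  \<open>U / L\<close> injectively and semilinearly. By Lang's theorem \<open>U / L\<close> is spanned by fixed vectors of \<open>\<sigma>\<close>. They cannot all
  lie in \<open>M + L\<close>, since otherwise \<open>M + L\<close> would be everything. Adding the line through a fixed vector outside \<open>M + L\<close>
  keeps the lattice stable under \<open>\<tau>\<^sup>-\<^sup>1\<close> and \<open>\<sigma>\<close>, and it keeps the intersection with \<open>M\<close> trivial.\<close>

lemma good_extend:
  assumes L: "good L" and nV: "\<not> V \<subseteq> emb_plus L"
  shows "\<exists>v L'. v \<in> V \<and> v \<notin> emb_plus L \<and> v \<in> L' \<and> L \<subseteq> L' \<and> good L'"
proof -
  note g = goodD[OF L]
  define U where "U = {f \<in> V. rho f \<in> L}"
  obtain c where c: "L \<subseteq> Lam c" using good_bounded[OF L] by blast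
  obtain P where P: "finite P" "Lam (c + int N) \<subseteq> S.span (Lam 0 \<union> P)" using Lam_finite_codim by blast
  have U_sub: "S.subspace U"
  proof (rule S.subspaceI)
    have "rho 0 = 0" using rho_add[of 0 0] by simp
    thus "0 \<in> U" unfolding U_def using S.subspace_0[OF V_sub] S.subspace_0[OF g(1)] by simp
  next
    fix f h assume "f \<in> U" "h \<in> U"
    thus "f + h \<in> U" unfolding U_def
      using S.subspace_add[OF V_sub] S.subspace_add[OF g(1)] by (simp add: rho_add)
  next
    fix a f assume f: "f \<in> U"
    obtain r where "rho (sscale a f) = sscale r (rho f)" using rho_scale' by blast
    thus "sscale a f \<in> U" using f unfolding U_def
      using S.subspace_scale[OF V_sub] S.subspace_scale[OF g(1)] by simp
  qed
  have "\<exists>v\<in>U. sig v - v \<in> L \<and> v \<notin> emb_plus L"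
  proof (rule ccontr)
    assume "\<not> ?thesis"
    hence fixed: "\<And>v. v \<in> U \<Longrightarrow> sig v - v \<in> L \<Longrightarrow> v \<in> emb_plus L" by blast
    have "U \<subseteq> emb_plus L"
    proof (rule S.fixed_vectors_span[OF s_pos g(1) U_sub emb_plus_sub[OF g(1)] _ _ _ P(1) _ sub_emb_plus fixed])
      show "L \<subseteq> U" unfolding U_def using g(3,4) by blast
      show "sig f \<in> U" if "f \<in> U" for f
        using that sig_V g(5)[of "rho f"] rho_V unfolding U_def by (simp add: rho_sig)
      show "sig f \<in> L \<longleftrightarrow> f \<in> L" if "f \<in> U" for f
        using that g(5) unfolding U_def by blast
      have "U \<subseteq> Lam (c + int N)"
      proof
        fix f assume "f \<in> U"
        hence f: "f \<in> V" "rho f \<in> Lam (c + int N - int N)" using c unfolding U_def by auto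
        thus "f \<in> Lam (c + int N)" using rho_Lam by blast
      qed
      moreover have "S.span (Lam 0 \<union> P) \<subseteq> S.span (L \<union> P)" by (rule S.span_mono) (use g(2) in blast)
      ultimately show "U \<subseteq> S.span (L \<union> P)" using P(2) by blast
    qed
    hence "V \<subseteq> emb_plus L" unfolding U_def by (rule emb_plus_exhausts[OF L])
    thus False using nV by blast
  qed
  then obtain v where v: "v \<in> V" "rho v \<in> L" "sig v - v \<in> L" "v \<notin> emb_plus L" unfolding U_def by blast
  define L' where "L' = {l + sscale a v | l a. l \<in> L}"
  have LI: "f \<in> L'" if "f - sscale a v \<in> L" for f a
  proof -
    have "f = (f - sscale a v) + sscale a v" by simp
    thus ?thesis using that unfolding L'_def by blast
  qed
  have LE: "\<exists>a l. l \<in> L \<and> f = l + sscale a v" if "f \<in> L'" for f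
    using that unfolding L'_def by blast
  have L_L': "L \<subseteq> L'"
  proof
    fix l assume "l \<in> L" thus "l \<in> L'" by (intro LI[of _ 0]) simp
  qed
  have vL': "v \<in> L'"
    by (rule LI[of _ 1]) (simp only: S.scale_one diff_self S.subspace_0[OF g(1)])
  have L'V: "L' \<subseteq> V"
  proof
    fix f assume "f \<in> L'"
    then obtain a l where "l \<in> L" "f = l + sscale a v" using LE by blast
    thus "f \<in> V" using g(3) v(1) by (auto intro!: S.subspace_add[OF V_sub] S.subspace_scale[OF V_sub])
  qed
  have "good L'"
    unfolding good_def
  proof (intro conjI ballI impI)
    show "S.subspace L'"
    proof (rule S.subspaceI)
      show "0 \<in> L'" using L_L' S.subspace_0[OF g(1)] by blast
    next
      fix f h assume f: "f \<in> L'" and h: "h \<in> L'"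
      obtain a l where f: "l \<in> L" "f = l + sscale a v" using LE[OF f] by blast
      obtain b m where h: "m \<in> L" "h = m + sscale b v" using LE[OF h] by blast
      have "f + h - sscale (a + b) v = l + m" by (simp add: f h S.scale_left_distrib)
      thus "f + h \<in> L'" using S.subspace_add[OF g(1) f(1) h(1)] by (intro LI[of _ "a + b"]) simp
    next
      fix b f assume f: "f \<in> L'"
      obtain a l where f: "l \<in> L" "f = l + sscale a v" using LE[OF f] by blast
      have "sscale b f - sscale (b * a) v = sscale b l" by (simp add: f S.scale_right_distrib)
      thus "sscale b f \<in> L'" using S.subspace_scale[OF g(1) f(1)] by (intro LI[of _ "b * a"]) simp
    qed
    show "Lam 0 \<subseteq> L'" using g(2) L_L' by blast
    show "\<exists>c. L' \<subseteq> Lam c"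
    proof -
      obtain c' where c': "v \<in> Lam c'" using Lam_ex[OF v(1)] by blast
      have "L' \<subseteq> Lam (max c c')"
      proof
        fix f assume "f \<in> L'"
        then obtain a l where f: "l \<in> L" "f = l + sscale a v" using LE by blast
        have "l \<in> Lam (max c c')" using f(1) c Lam_mono[of c "max c c'"] by auto
        moreover have "v \<in> Lam (max c c')" using c' Lam_mono[of c' "max c c'"] by auto
        ultimately show "f \<in> Lam (max c c')"
          unfolding f(2) by (intro S.subspace_add[OF Lam_sub] S.subspace_scale[OF Lam_sub])
      qed
      thus ?thesis by blast
    qed
    show "rho f \<in> L'" if fL: "f \<in> L'" for f
    proof -
      obtain a l where f: "l \<in> L" "f = l + sscale a v" using LE[OF fL] by blast
      obtain r where r: "rho (sscale a v) = sscale r (rho v)" using rho_scale' by blast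
      have "rho f \<in> L" unfolding f(2) rho_add r
        by (intro S.subspace_add[OF g(1)] S.subspace_scale[OF g(1)] g(4) f(1) v(2))
      thus ?thesis using L_L' by blast
    qed
    show "sig f \<in> L' \<longleftrightarrow> f \<in> L'" if fV: "f \<in> V" for f
    proof
      assume "sig f \<in> L'"
      then obtain a l where f: "l \<in> L" "sig f = l + sscale a v" using LE by blast
      obtain r where r: "r ^ (q ^ s) = a" using q_power_surj by blast
      have "sig (f - sscale r v) = l - sscale a (sig v - v)"
        by (simp only: S.D_diff S.D_scale r f(2) S.scale_right_diff_distrib) simp
      moreover have "\<dots> \<in> L"
        by (intro S.subspace_diff[OF g(1)] S.subspace_scale[OF g(1)] f(1) v(3))
      ultimately have "sig (f - sscale r v) \<in> L" by metis
      moreover have "f - sscale r v \<in> V"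
        by (intro S.subspace_diff[OF V_sub] S.subspace_scale[OF V_sub] fV v(1))
      ultimately have "f - sscale r v \<in> L" using g(5) by blast
      thus "f \<in> L'" by (rule LI)
    next
      assume "f \<in> L'"
      then obtain a l where f: "l \<in> L" "f = l + sscale a v" using LE by blast
      have "sig f - sscale (a ^ (q ^ s)) v = sig l + sscale (a ^ (q ^ s)) (sig v - v)"
        by (simp only: f(2) S.D_add S.D_scale S.scale_right_diff_distrib) simp
      moreover have "sig l \<in> L" using f(1) g(3,5) by blast
      hence "sig l + sscale (a ^ (q ^ s)) (sig v - v) \<in> L"
        by (intro S.subspace_add[OF g(1)] S.subspace_scale[OF g(1)] v(3))
      ultimately have "sig f - sscale (a ^ (q ^ s)) v \<in> L" by metis
      thus "sig f \<in> L'" by (rule LI)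
    qed
    show "x = 0" if x: "x \<in> M" "emb x \<in> L'" for x
    proof -
      obtain a l where f: "l \<in> L" "emb x = l + sscale a v" using LE[OF x(2)] by blast
      show ?thesis
      proof (cases "a = 0")
        case True
        hence "emb x = l" using f(2) by simp
        thus ?thesis using g(6) x(1) f(1) by blast
      next
        case False
        have "sscale a v - emb x = - l" by (simp add: f(2))
        hence "sscale a v - emb x \<in> L" using S.subspace_neg[OF g(1) f(1)] by metis
        hence "sscale a v \<in> emb_plus L" by (rule emb_plusI[OF x(1)])
        hence "sscale (inverse a) (sscale a v) \<in> emb_plus L"
          by (rule S.subspace_scale[OF emb_plus_sub[OF g(1)]])
        thus ?thesis using False v(4) by simp
      qed
    qed
  qed
  thus ?thesis using v(1,4) vL' L_L' by blast
qed

lemma emb_plus_mono: "L \<subseteq> L' \<Longrightarrow> emb_plus L \<subseteq> emb_plus L'"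
  unfolding emb_plus_def by blast

text \<open>\<open>V / (M + Lam 0)\<close> is finite-dimensional, so the standard lattice can be enlarged only finitely often. The process
  stops at a lattice that is a complement of \<open>M\<close>: the glued sheaf has then neither global sections nor first cohomology.\<close>

theorem good_complement_exists: "\<exists>L. good L \<and> V \<subseteq> emb_plus L"
proof -
  have ind: "\<exists>L. good L \<and> V \<subseteq> emb_plus L"
    if "good L" "finite P" "card P = n" "V \<subseteq> S.span (emb_plus L \<union> P)" for n L P
    using that
  proof (induction n arbitrary: L P)
    case 0
    hence "V \<subseteq> S.span (emb_plus L)" by simp
    moreover have "S.span (emb_plus L) = emb_plus L"
      using emb_plus_sub[OF goodD(1)[OF 0(1)]] by (simp add: S.span_eq_iff)
    ultimately show ?case using 0(1) by blast
  next
    case (Suc n)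
    show ?case
    proof (cases "V \<subseteq> emb_plus L")
      case True
      thus ?thesis using Suc.prems(1) by blast
    next
      case False
      obtain v L' where v: "v \<in> V" "v \<notin> emb_plus L" "v \<in> L'" "L \<subseteq> L'" "good L'"
        using good_extend[OF Suc.prems(1) False] by blast
      have "S.span (emb_plus L) = emb_plus L"
        using emb_plus_sub[OF goodD(1)[OF Suc.prems(1)]] by (simp add: S.span_eq_iff)
      hence "v \<notin> S.span (emb_plus L)" using v(2) by metis
      moreover have "v \<in> S.span (emb_plus L \<union> P)" using v(1) Suc.prems(4) by blast
      ultimately obtain p where p: "p \<in> P" "p \<in> S.span (insert v (emb_plus L \<union> (P - {p})))"
        using S.exchange_generator[OF Suc.prems(2)] by blast
      have "insert v (emb_plus L \<union> (P - {p})) \<subseteq> emb_plus L' \<union> (P - {p})"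
        using v(3) sub_emb_plus[of L'] emb_plus_mono[OF v(4)] by blast
      hence "S.span (insert v (emb_plus L \<union> (P - {p}))) \<subseteq> S.span (emb_plus L' \<union> (P - {p}))"
        by (rule S.span_mono)
      hence p': "p \<in> S.span (emb_plus L' \<union> (P - {p}))" using p(2) by blast
      have "emb_plus L \<union> P \<subseteq> S.span (emb_plus L' \<union> (P - {p}))"
      proof
        fix x assume "x \<in> emb_plus L \<union> P"
        hence "x = p \<or> x \<in> emb_plus L' \<union> (P - {p})" using emb_plus_mono[OF v(4)] by blast
        thus "x \<in> S.span (emb_plus L' \<union> (P - {p}))"
          by (rule disjE) (simp_all only: p' S.span_base)
      qed
      hence "S.span (emb_plus L \<union> P) \<subseteq> S.span (emb_plus L' \<union> (P - {p}))"
        by (rule S.span_minimal[OF _ S.subspace_span])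
      hence "V \<subseteq> S.span (emb_plus L' \<union> (P - {p}))" using Suc.prems(4) by blast
      moreover have "card (P - {p}) = n" using p(1) Suc.prems(2,3) by simp
      moreover have "finite (P - {p})" using Suc.prems(2) by simp
      ultimately show ?thesis by (intro Suc.IH[OF v(5)])
    qed
  qed
  obtain c where c: "\<And>f. f \<in> V \<Longrightarrow> \<exists>x\<in>M. f - emb x \<in> Lam c" using V_eq_emb_plus_Lam by blast
  obtain P where P: "finite P" "Lam c \<subseteq> S.span (Lam 0 \<union> P)" using Lam_finite_codim by blast
  have "V \<subseteq> S.span (emb_plus (Lam 0) \<union> P)"
  proof
    fix f assume "f \<in> V"
    then obtain x where x: "x \<in> M" "f - emb x \<in> Lam c" using c by blast
    have "Lam 0 \<union> P \<subseteq> emb_plus (Lam 0) \<union> P" using sub_emb_plus by blast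
    hence "S.span (Lam 0 \<union> P) \<subseteq> S.span (emb_plus (Lam 0) \<union> P)" by (rule S.span_mono)
    hence "f - emb x \<in> S.span (emb_plus (Lam 0) \<union> P)" using x(2) P(2) by blast
    moreover have "emb x \<in> emb_plus (Lam 0)"
      by (rule emb_plusI[OF x(1)]) (simp only: diff_self S.subspace_0[OF Lam_sub])
    hence "emb x \<in> S.span (emb_plus (Lam 0) \<union> P)" by (intro S.span_base UnI1)
    ultimately have "f - emb x + emb x \<in> S.span (emb_plus (Lam 0) \<union> P)" by (rule S.span_add)
    thus "f \<in> S.span (emb_plus (Lam 0) \<union> P)" by simp
  qed
  thus ?thesis using ind[OF good_Lam_0 P(1) refl] by blast
qed

end

context vector_space
begin

lemma finite_basis_enumeration:
  assumes W: "subspace W" and P: "finite P" "W \<subseteq> span P"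
  shows "\<exists>d \<kappa>. (\<forall>i<d::nat. \<kappa> i \<in> W) \<and> (\<forall>x\<in>W. \<exists>c. x = (\<Sum>i<d. scale (c i) (\<kappa> i))) \<and>
    (\<forall>c. (\<Sum>i<d. scale (c i) (\<kappa> i)) = 0 \<longrightarrow> (\<forall>i<d. c i = 0))"
proof -
  obtain b where b: "b \<subseteq> W" "independent b" "W \<subseteq> span b"
    using maximal_independent_subset by blast
  have fin: "finite b"
    using independent_span_bound[OF P(1) b(2)] b(1) P(2) by blast
  obtain h where h: "bij_betw h {0..<card b} b" using ex_bij_betw_nat_finite[OF fin] by blast
  hence h: "bij_betw h {..<card b} b" by (simp add: atLeast0LessThan)
  have re: "(\<Sum>i<card b. scale (u (h i)) (h i)) = (\<Sum>v\<in>b. scale (u v) v)" for u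
    by (rule sum.reindex_bij_betw[OF h])
  show ?thesis
  proof (rule exI[of _ "card b"], rule exI[of _ h], intro conjI allI ballI impI)
    fix i assume "i < card b"
    thus "h i \<in> W" using h b(1) by (auto simp: bij_betw_def)
  next
    fix x assume "x \<in> W"
    hence "x \<in> span b" using b(3) by blast
    then obtain u where "x = (\<Sum>v\<in>b. scale (u v) v)" using span_finite[OF fin] by auto
    hence "x = (\<Sum>i<card b. scale (u (h i)) (h i))" by (simp add: re)
    thus "\<exists>c. x = (\<Sum>i<card b. scale (c i) (h i))" by (rule exI[of _ "\<lambda>i. u (h i)"])
  next
    fix c i assume c: "(\<Sum>i<card b. scale (c i) (h i)) = 0" and i: "i < card b"
    define u where "u v = c (the_inv_into {..<card b} h v)" for v
    have u: "u (h j) = c j" if "j < card b" for j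
      using that h by (simp add: u_def the_inv_into_f_f bij_betw_def)
    have "(\<Sum>v\<in>b. scale (u v) v) = (\<Sum>i<card b. scale (c i) (h i))"
      unfolding re[symmetric] by (intro sum.cong) (simp_all add: u)
    hence "(\<Sum>v\<in>b. scale (u v) v) = 0" using c by simp
    moreover have "h i \<in> b" using h i by (auto simp: bij_betw_def)
    ultimately have "u (h i) = 0" using independentD[OF b(2) fin subset_refl] by blast
    thus "c i = 0" using u i by simp
  qed
qed

end

context filtered_t_module
begin

lemma taun_tn: "(\<tau> ^^ n) ((t ^^ n) x) = (T ^^ n) x"
proof (induction n arbitrary: x)
  case (Suc n)
  have "(\<tau> ^^ Suc n) ((t ^^ Suc n) x) = \<tau> ((\<tau> ^^ n) (t ((t ^^ n) x)))" by simp
  also have "\<dots> = t (\<tau> ((\<tau> ^^ n) ((t ^^ n) x)))" by (simp add: t_tau t_tau_funpow)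
  also have "\<dots> = T ((T ^^ n) x)" by (simp only: Suc T_def[symmetric])
  also have "\<dots> = (T ^^ Suc n) x" by simp
  finally show ?case .
qed simp

lemma rho_n_apply: "(rho ^^ n) f k = (if k < n then 0 else (t ^^ n) (f (k - n)))"
proof (induction n arbitrary: k)
  case (Suc n)
  have "(rho ^^ Suc n) f k = (if k = 0 then 0 else t ((rho ^^ n) f (k - 1)))"
    by (simp add: rho_def[of "(rho ^^ n) f"])
  thus ?case by (cases k) (simp_all add: Suc)
qed simp

text \<open>The identity \<open>x = (t\<^sup>-\<^sup>N \<tau>\<^sup>s) (\<tau>\<^sup>-\<^sup>s t\<^sup>N x)\<close>, in terms of representing sequences.\<close>

lemma sig_rho_emb:
  assumes x: "x \<in> M"
  shows "emb x - sig ((rho ^^ s) (emb ((t ^^ N) x))) \<in> Lam 0"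
proof (rule eventually_zero_Lam[of "N + s"])
  fix k assume k: "k \<ge> N + s"
  have tT: "t ((T ^^ n) y) = (T ^^ n) (t y)" for n y
    by (induction n) (simp_all flip: T_t)
  have "(t ^^ m) ((T ^^ n) y) = (T ^^ n) ((t ^^ m) y)" for m n y
    by (induction m) (simp_all add: tT)
  from this have "sig ((rho ^^ s) (emb ((t ^^ N) x))) k = (\<tau> ^^ (N + s)) ((t ^^ (s + N)) ((T ^^ (k - N - s)) x))"
  proof -
    assume *: "\<And>m n y. (t ^^ m) ((T ^^ n) y) = (T ^^ n) ((t ^^ m) y)"
    have "\<not> k < N" "\<not> k - N < s" using k by auto
    thus ?thesis unfolding sig_def rho_n_apply emb_def by (simp only: if_False funpow_add o_apply *)
  qed
  also have "\<dots> = (T ^^ (N + s)) ((T ^^ (k - N - s)) x)"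
    using taun_tn[of "N + s"] by (simp add: add.commute)
  also have "\<dots> = (T ^^ (N + s + (k - N - s))) x" by (simp only: funpow_add o_apply)
  also have "N + s + (k - N - s) = k" using k by simp
  finally show "(emb x - sig ((rho ^^ s) (emb ((t ^^ N) x)))) k = 0" by (simp add: emb_def)
qed

lemma rho_n_scale: "\<exists>r. (rho ^^ n) (sscale c f) = sscale r ((rho ^^ n) f)"
proof (induction n)
  case 0
  show ?case by (rule exI[of _ c]) simp
next
  case (Suc n)
  then obtain r where "(rho ^^ n) (sscale c f) = sscale r ((rho ^^ n) f)" ..
  moreover obtain r' where "rho (sscale r ((rho ^^ n) f)) = sscale r' (rho ((rho ^^ n) f))"
    using rho_scale' ..
  ultimately show ?case by (intro exI[of _ r']) simp
qed

end

text \<open>From a complement \<open>L\<close> of \<open>M\<close> the basis can be read off: \<open>M\<close> is filtered by the spaces \<open>W\<^sub>j = M \<inter> \<tau>\<^sup>jL\<close>, and the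
  decomposition \<open>V = M + L\<close> splits off one factor \<open>\<tau>\<close> at a time.\<close>

locale complemented_t_module = filtered_t_module +
  fixes L
  assumes L: "good L" and VL: "V \<subseteq> emb_plus L"
begin

lemmas g = goodD[OF L]

definition Wf :: "nat \<Rightarrow> 'b set" where "Wf j = {x \<in> M. (rho ^^ j) (emb x) \<in> L}"

lemma Wf_M: "x \<in> Wf j \<Longrightarrow> x \<in> M" by (simp add: Wf_def)

lemma WfI: "x \<in> M \<Longrightarrow> (rho ^^ j) (emb x) \<in> L \<Longrightarrow> x \<in> Wf j" by (simp add: Wf_def)

lemma WfD: "x \<in> Wf j \<Longrightarrow> (rho ^^ j) (emb x) \<in> L" by (simp add: Wf_def)

lemma Wf_sub: "subspace (Wf j)"
proof (rule subspaceI)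
  show "0 \<in> Wf j"
    by (rule WfI[OF subspace_0[OF M_sub]])
      (simp only: emb_zero additive_zero[of "rho ^^ j", OF rho_n_add] S.subspace_0[OF g(1)])
next
  fix x y assume "x \<in> Wf j" "y \<in> Wf j"
  thus "x + y \<in> Wf j" unfolding Wf_def
    using subspace_add[OF M_sub] S.subspace_add[OF g(1)] by (simp add: emb_add rho_n_add)
next
  fix c x assume x: "x \<in> Wf j"
  obtain r where "(rho ^^ j) (sscale c (emb x)) = sscale r ((rho ^^ j) (emb x))" using rho_n_scale by blast
  thus "scale c x \<in> Wf j" using x unfolding Wf_def
    using subspace_scale[OF M_sub] S.subspace_scale[OF g(1)] by (simp add: emb_scale)
qed

lemma rho_n_L: "f \<in> L \<Longrightarrow> (rho ^^ j) f \<in> L" by (induction j) (simp_all add: g(4))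

lemma Wf_mono: "i \<le> j \<Longrightarrow> Wf i \<subseteq> Wf j"
proof
  fix x assume "i \<le> j" "x \<in> Wf i"
  hence "(rho ^^ (j - i)) ((rho ^^ i) (emb x)) \<in> L" "x \<in> M" using rho_n_L WfD Wf_M by blast+
  hence "x \<in> M" "(rho ^^ ((j - i) + i)) (emb x) \<in> L" by (simp_all only: funpow_add o_apply)
  thus "x \<in> Wf j" using \<open>i \<le> j\<close> by (intro WfI) simp_all
qed

lemma Wf_0: "x \<in> Wf 0 \<Longrightarrow> x = 0" using g(6) by (simp add: Wf_def)

lemma Wf_exhaust: "x \<in> M \<Longrightarrow> \<exists>j. x \<in> Wf j"
  using rho_n_eventually[OF emb_V[of x]] g(2) unfolding Wf_def by blast

lemma rho_emb_tau:
  assumes "z \<in> M"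
  shows "\<exists>l\<in>L. rho (emb (\<tau> z)) = emb z - l"
proof
  show "emb z - rho (stau (emb z)) \<in> L" using rho_stau(1)[OF emb_V[OF assms], of 0] g(2) by blast
  show "rho (emb (\<tau> z)) = emb z - (emb z - rho (stau (emb z)))" by (simp add: stau_emb)
qed

text \<open>Write \<open>\<tau>\<^sup>-\<^sup>1 x = z + l\<close> along \<open>V = M + L\<close>. Then \<open>x - \<tau>z\<close> lies in \<open>\<tau>L\<close>.\<close>

lemma Wf_decompose:
  assumes x: "x \<in> Wf (Suc j)"
  shows "\<exists>y\<in>Wf 1. \<exists>z\<in>Wf j. x = y + \<tau> z"
proof -
  have "rho (emb x) \<in> emb_plus L" using VL rho_V emb_V Wf_M[OF x] by blast
  then obtain z l where z: "z \<in> M" "l \<in> L" "rho (emb x) = emb z + l" by (rule emb_plusE)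
  have "(rho ^^ j) (emb z) = (rho ^^ j) (rho (emb x)) - (rho ^^ j) l"
    unfolding z(3) by (simp only: rho_n_add) simp
  also have "(rho ^^ j) (rho (emb x)) = (rho ^^ Suc j) (emb x)" by (simp add: funpow_swap1)
  also have "(rho ^^ Suc j) (emb x) - (rho ^^ j) l \<in> L"
    by (rule S.subspace_diff[OF g(1) WfD[OF x] rho_n_L[OF z(2)]])
  finally have zW: "z \<in> Wf j" by (rule WfI[OF z(1)])
  obtain l' where l': "l' \<in> L" "rho (emb (\<tau> z)) = emb z - l'" using rho_emb_tau[OF z(1)] by blast
  have "rho (emb (x - \<tau> z)) = l + l'" by (simp add: emb_diff rho_diff z(3) l'(2))
  also have "\<dots> \<in> L" by (rule S.subspace_add[OF g(1) z(2) l'(1)])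
  finally have "x - \<tau> z \<in> Wf 1"
    by (intro WfI subspace_diff[OF M_sub Wf_M[OF x] tau_M[OF z(1)]]) simp
  moreover have "x = (x - \<tau> z) + \<tau> z" by simp
  ultimately show ?thesis using zW by blast
qed

lemma Wf_tau: assumes z: "z \<in> Wf j" shows "\<tau> z \<in> Wf (Suc j)"
proof (rule WfI[OF tau_M[OF Wf_M[OF z]]])
  obtain l where l: "l \<in> L" "rho (emb (\<tau> z)) = emb z - l" using rho_emb_tau[OF Wf_M[OF z]] by blast
  have "(rho ^^ Suc j) (emb (\<tau> z)) = (rho ^^ j) (emb z) - (rho ^^ j) l"
    by (simp add: funpow_swap1 l(2) rho_n_diff)
  also have "\<dots> \<in> L" by (rule S.subspace_diff[OF g(1) WfD[OF z] rho_n_L[OF l(1)]])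
  finally show "(rho ^^ Suc j) (emb (\<tau> z)) \<in> L" .
qed

text \<open>If \<open>\<tau>y\<close> lies in \<open>\<tau>L\<close>, then \<open>y\<close> lies in \<open>M \<inter> L = 0\<close>. With the decomposition above, a \<open>K\<close>-basis of \<open>W\<^sub>1\<close> is thus a
  \<open>K{\<tau>}\<close>-basis of \<open>M\<close>, and \<open>W\<^sub>j\<close> consists of the combinations of \<open>\<tau>\<close>-degree less than \<open>j\<close>.\<close>

lemma Wf_1_tau: assumes y: "y \<in> M" "\<tau> y \<in> Wf 1" shows "y = 0"
proof -
  obtain l where l: "l \<in> L" "rho (emb (\<tau> y)) = emb y - l" using rho_emb_tau[OF y(1)] by blast
  have "emb y - l \<in> L" using WfD[OF y(2)] l(2) by simp
  hence "emb y - l + l \<in> L" using l(1) by (rule S.subspace_add[OF g(1)])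
  thus ?thesis using g(6)[OF y(1)] by simp
qed

lemma Wf_1_finite: "\<exists>P. finite P \<and> Wf 1 \<subseteq> span P"
proof -
  obtain c where c: "L \<subseteq> Lam c" using good_bounded[OF L] by blast
  obtain P where P: "finite P" "B (c + int N) \<subseteq> span P" using B_fin by blast
  have "Wf 1 \<subseteq> B (c + int N)"
  proof
    fix x assume x: "x \<in> Wf 1"
    have "rho (emb x) \<in> Lam (c + int N - int N)" using WfD[OF x] c by auto
    hence "emb x \<in> Lam (c + int N)" using rho_Lam[OF emb_V[OF Wf_M[OF x]]] by blast
    thus "x \<in> B (c + int N)" using emb_Lam[OF Wf_M[OF x]] by blast
  qed
  thus ?thesis using P by blast
qed

text \<open>As \<open>t\<^sup>-\<^sup>N \<tau>\<^sup>s\<close> preserves \<open>L\<close>, the spaces \<open>t\<^sup>NL\<close> and \<open>\<tau>\<^sup>sL\<close> agree. Hence \<open>t\<^sup>N W\<^sub>1\<close> is contained in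
  \<open>M \<inter> \<tau>\<^sup>s\<^sup>+\<^sup>1L\<close>: the power \<open>t\<^sup>N\<close> has \<open>\<tau>\<close>-degree at most \<open>s\<close> in the basis.\<close>

lemma t_Wf: assumes x: "x \<in> Wf 1" shows "(t ^^ N) x \<in> Wf (Suc s)"
proof (rule WfI[OF tn_M[OF Wf_M[OF x]]])
  let ?f = "(rho ^^ s) (emb ((t ^^ N) x))"
  have fV: "?f \<in> V" using rho_n_V emb_V tn_M Wf_M[OF x] by blast
  have d: "emb x - sig ?f \<in> L" using sig_rho_emb[OF Wf_M[OF x]] g(2) by blast
  have "sig (rho ?f) = rho (emb x) - rho (emb x - sig ?f)" by (simp add: rho_diff rho_sig)
  also have "\<dots> \<in> L" using WfD[OF x] g(4)[OF d] by (intro S.subspace_diff[OF g(1)]) simp_all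
  finally have "rho ?f \<in> L" using g(5)[OF rho_V[OF fV]] by blast
  thus "(rho ^^ Suc s) (emb ((t ^^ N) x)) \<in> L" by simp
qed

text \<open>The same equality of lattices gives \<open>x \<in> M \<inter> L = 0\<close>. It makes the coefficient of \<open>\<tau>\<^sup>s\<close> invertible.\<close>

lemma t_Wf_leading: assumes x: "x \<in> M" "(t ^^ N) x \<in> Wf s" shows "x = 0"
proof -
  let ?f = "(rho ^^ s) (emb ((t ^^ N) x))"
  have fV: "?f \<in> V" using rho_n_V emb_V tn_M x(1) by blast
  have "sig ?f \<in> L" using g(5)[OF fV] WfD[OF x(2)] by blast
  moreover have "emb x - sig ?f \<in> L" using sig_rho_emb[OF x(1)] g(2) by blast
  ultimately have "emb x - sig ?f + sig ?f \<in> L" by (intro S.subspace_add[OF g(1)])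
  thus ?thesis using g(6)[OF x(1)] by simp
qed

text \<open>A \<open>K\<close>-basis of \<open>W\<^sub>1 = M \<inter> \<tau>L\<close> has all the required properties. The clause on the coefficients of degree \<open>s\<close> is
  invertibility of the leading matrix, in the form that its left kernel vanishes.\<close>

theorem strictly_pure_basis:
  "\<exists>d \<kappa> D. (\<forall>i<d. \<kappa> i \<in> M) \<and> (\<forall>x\<in>M. \<exists>f. x = (\<Sum>i<d::nat. poly_act scale \<tau> (f i) (\<kappa> i))) \<and>
     (\<forall>f. (\<Sum>i<d. poly_act scale \<tau> (f i) (\<kappa> i)) = 0 \<longrightarrow> (\<forall>i<d. f i = 0)) \<and>
     (\<forall>i<d. (t ^^ N) (\<kappa> i) = (\<Sum>j<d. poly_act scale \<tau> (D i j) (\<kappa> j))) \<and>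
     (\<forall>i<d. \<forall>j<d. \<forall>n>s. coeff (D i j) n = 0) \<and>
     (\<forall>c. (\<forall>j<d. (\<Sum>i<d. c i * coeff (D i j) s) = 0) \<longrightarrow> (\<forall>i<d. c i = 0))"
proof -
  obtain P where P: "finite P" "Wf 1 \<subseteq> span P" using Wf_1_finite by blast
  obtain d :: nat and \<kappa> where \<kappa>: "\<And>i. i < d \<Longrightarrow> \<kappa> i \<in> Wf 1"
    and span: "\<And>x. x \<in> Wf 1 \<Longrightarrow> \<exists>c. x = (\<Sum>i<d. scale (c i) (\<kappa> i))"
    and ind: "\<And>c i. (\<Sum>i<d. scale (c i) (\<kappa> i)) = 0 \<Longrightarrow> i < d \<Longrightarrow> c i = 0"
    using finite_basis_enumeration[OF Wf_sub P] by blast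
  define comb where "comb f = (\<Sum>i<d. poly_act scale \<tau> (f i) (\<kappa> i))" for f
  have \<kappa>M: "\<kappa> i \<in> M" if "i < d" for i using Wf_M[OF \<kappa>[OF that]] .
  have comb_pCons: "comb (\<lambda>i. pCons (c i) (frob_poly q (f i))) = (\<Sum>i<d. scale (c i) (\<kappa> i)) + \<tau> (comb f)" for c f
    by (simp add: comb_def poly_act_pCons_frob sum.distrib D_sum)
  have ex: "\<exists>f. x = comb f \<and> (\<forall>i. \<forall>n\<ge>j. coeff (f i) n = 0)" if "x \<in> Wf j" for x j
    using that
  proof (induction j arbitrary: x)
    case 0
    hence "x = comb (\<lambda>_. 0)" using Wf_0 by (simp add: comb_def)
    thus ?case by (intro exI[of _ "\<lambda>_. 0"]) simp
  next
    case (Suc j)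
    obtain y z where yz: "y \<in> Wf 1" "z \<in> Wf j" "x = y + \<tau> z" using Wf_decompose[OF Suc.prems] by blast
    obtain f where f: "z = comb f" "\<forall>i. \<forall>n\<ge>j. coeff (f i) n = 0" using Suc.IH[OF yz(2)] by blast
    obtain c where c: "y = (\<Sum>i<d. scale (c i) (\<kappa> i))" using span[OF yz(1)] by blast
    have "x = comb (\<lambda>i. pCons (c i) (frob_poly q (f i)))" by (simp add: comb_pCons yz(3) c f(1))
    moreover have "coeff (pCons (c i) (frob_poly q (f i))) n = 0" if "n \<ge> Suc j" for i n
      using that f(2) by (cases n) auto
    ultimately show ?case by blast
  qed
  have uniq: "\<forall>i<d. f i = 0" if "comb f = 0" "\<forall>i<d. \<forall>k\<ge>n. coeff (f i) k = 0" for n f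
    using that
  proof (induction n arbitrary: f)
    case 0
    thus ?case by (auto simp: poly_eq_iff)
  next
    case (Suc n)
    have "\<exists>h. f i = pCons (coeff (f i) 0) (frob_poly q h)" for i
    proof -
      obtain c p where cp: "f i = pCons c p" by (cases "f i") auto
      obtain h where "(frob_poly q ^^ 1) h = p" using frob_poly_funpow_surj by blast
      thus ?thesis using cp by auto
    qed
    hence "\<forall>i. \<exists>h. f i = pCons (coeff (f i) 0) (frob_poly q h)" ..
    from choice[OF this] obtain h where "\<forall>i. f i = pCons (coeff (f i) 0) (frob_poly q (h i))" ..
    hence h: "f i = pCons (coeff (f i) 0) (frob_poly q (h i))" for i by (rule spec)
    have hM: "comb h \<in> M" unfolding comb_def poly_act_def
      by (intro subspace_sum[OF M_sub] subspace_scale[OF M_sub] taun_M \<kappa>M) simp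
    have eq0: "(\<Sum>i<d. scale (coeff (f i) 0) (\<kappa> i)) + \<tau> (comb h) = 0"
    proof -
      have "comb f = comb (\<lambda>i. pCons (coeff (f i) 0) (frob_poly q (h i)))"
        by (rule arg_cong[of _ _ comb], rule ext, rule h)
      thus ?thesis using Suc.prems(1) comb_pCons[of "\<lambda>i. coeff (f i) 0" h] by metis
    qed
    have y: "(\<Sum>i<d. scale (coeff (f i) 0) (\<kappa> i)) \<in> Wf 1"
      by (intro subspace_sum[OF Wf_sub] subspace_scale[OF Wf_sub] \<kappa>) simp
    have "\<tau> (comb h) = - (\<Sum>i<d. scale (coeff (f i) 0) (\<kappa> i))" using eq0 by (simp add: eq_neg_iff_add_eq_0 add.commute)
    hence "\<tau> (comb h) \<in> Wf 1" using subspace_neg[OF Wf_sub y] by simp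
    hence h0: "comb h = 0" by (rule Wf_1_tau[OF hM])
    have "\<forall>i<d. h i = 0"
    proof (rule Suc.IH[OF h0], intro allI impI)
      fix i k assume "i < d" "k \<ge> n"
      hence "coeff (f i) (Suc k) = 0" using Suc.prems(2) by simp
      moreover have "coeff (f i) (Suc k) = coeff (h i) k ^ q"
        using arg_cong[OF h[of i], of "\<lambda>p. coeff p (Suc k)"] by simp
      ultimately have "coeff (h i) k ^ q = 0" by simp
      thus "coeff (h i) k = 0" by simp
    qed
    note hi = this
    have c0: "\<forall>i<d. coeff (f i) 0 = 0" using eq0 h0 ind[of "\<lambda>i. coeff (f i) 0"] by simp
    show ?case
    proof (intro allI impI)
      fix i assume i: "i < d"
      have "f i = pCons (coeff (f i) 0) (frob_poly q (h i))" by (rule h)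
      also have "\<dots> = pCons 0 (frob_poly q 0)" using hi c0 i by simp
      finally show "f i = 0" by simp
    qed
  qed
  have uniq': "\<forall>i<d. f i = 0" if "comb f = 0" for f
  proof (rule uniq[OF that])
    show "\<forall>i<d. \<forall>k\<ge>Suc (Max ((\<lambda>i. degree (f i)) ` {..<d})). coeff (f i) k = 0"
    proof (intro allI impI coeff_eq_0)
      fix i k assume i: "i < d" and k: "k \<ge> Suc (Max ((\<lambda>i. degree (f i)) ` {..<d}))"
      have "degree (f i) \<le> Max ((\<lambda>i. degree (f i)) ` {..<d})" by (rule Max_ge) (use i in auto)
      also have "\<dots> < k" using k by (rule Suc_le_lessD)
      finally show "degree (f i) < k" .
    qed
  qed
  have comb_in_Wf: "comb f \<in> Wf j" if f: "\<And>i n. i < d \<Longrightarrow> n \<ge> j \<Longrightarrow> coeff (f i) n = 0" for f j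
  proof -
    have tk: "(\<tau> ^^ n) x \<in> Wf (Suc n)" if "x \<in> Wf 1" for x n
      using that by (induction n) (use Wf_tau in simp_all)
    have "scale (coeff (f i) n) ((\<tau> ^^ n) (\<kappa> i)) \<in> Wf j" if i: "i < d" for i n
    proof (cases "n < j")
      case True
      hence "(\<tau> ^^ n) (\<kappa> i) \<in> Wf j" using tk[OF \<kappa>[OF i], of n] Wf_mono[of "Suc n" j] by auto
      thus ?thesis by (rule subspace_scale[OF Wf_sub])
    next
      case False
      hence "scale (coeff (f i) n) ((\<tau> ^^ n) (\<kappa> i)) = 0" using f[OF i] by simp
      thus ?thesis by (simp only: subspace_0[OF Wf_sub])
    qed
    thus ?thesis unfolding comb_def poly_act_def by (intro subspace_sum[OF Wf_sub]) auto
  qed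
  have "\<exists>f. (t ^^ N) (\<kappa> i) = comb f \<and> (\<forall>j. \<forall>n>s. coeff (f j) n = 0)" if i: "i < d" for i
    using ex[OF t_Wf[OF \<kappa>[OF i]]] by (simp add: Suc_le_eq)
  hence "\<forall>i. \<exists>f. i < d \<longrightarrow> ((t ^^ N) (\<kappa> i) = comb f \<and> (\<forall>j. \<forall>n>s. coeff (f j) n = 0))" by blast
  from choice[OF this] obtain D
    where "\<forall>i. i < d \<longrightarrow> ((t ^^ N) (\<kappa> i) = comb (D i) \<and> (\<forall>j. \<forall>n>s. coeff (D i j) n = 0))" ..
  hence D: "(t ^^ N) (\<kappa> i) = comb (D i)" "n > s \<Longrightarrow> coeff (D i j) n = 0" if "i < d" for i j n
    using that by blast+
  have lead: "c i = 0" if c: "\<forall>j<d. (\<Sum>i<d. c i * coeff (D i j) s) = 0" and i: "i < d" for c i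
  proof -
    define x where "x = (\<Sum>i<d. scale (c i) (\<kappa> i))"
    have xM: "x \<in> M" unfolding x_def
      by (intro subspace_sum[OF M_sub] subspace_scale[OF M_sub] \<kappa>M) simp
    have "(t ^^ N) x = (\<Sum>i<d. scale (c i) (comb (D i)))"
      by (simp add: x_def t.Dn_sum t_funpow_scale D(1))
    also have "\<dots> = (\<Sum>i<d. \<Sum>j<d. poly_act scale \<tau> (Polynomial.smult (c i) (D i j)) (\<kappa> j))"
      by (simp add: comb_def scale_sum_right poly_act_smult)
    also have "\<dots> = comb (\<lambda>j. \<Sum>i<d. Polynomial.smult (c i) (D i j))"
      unfolding comb_def by (subst sum.swap) (simp add: poly_act_sum_left)
    also have "\<dots> \<in> Wf s"
    proof (rule comb_in_Wf)
      fix j n assume j: "j < d" and n: "n \<ge> s"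
      show "coeff (\<Sum>i<d. Polynomial.smult (c i) (D i j)) n = 0"
      proof (cases "n = s")
        case True
        thus ?thesis using c j by (simp add: coeff_sum)
      next
        case False
        hence "\<And>i. i < d \<Longrightarrow> coeff (D i j) n = 0" using D(2) n by simp
        thus ?thesis by (simp add: coeff_sum)
      qed
    qed
    finally have "x = 0" by (rule t_Wf_leading[OF xM])
    thus ?thesis using ind[of c i] i by (simp add: x_def)
  qed
  have gen: "\<exists>f. x = comb f" if "x \<in> M" for x using Wf_exhaust[OF that] ex by blast
  have "(\<forall>i<d. \<kappa> i \<in> M) \<and> (\<forall>x\<in>M. \<exists>f. x = comb f) \<and> (\<forall>f. comb f = 0 \<longrightarrow> (\<forall>i<d. f i = 0)) \<and>
     (\<forall>i<d. (t ^^ N) (\<kappa> i) = comb (D i)) \<and> (\<forall>i<d. \<forall>j<d. \<forall>n>s. coeff (D i j) n = 0) \<and>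
     (\<forall>c. (\<forall>j<d. (\<Sum>i<d. c i * coeff (D i j) s) = 0) \<longrightarrow> (\<forall>i<d. c i = 0))"
    using \<kappa>M gen uniq' D lead by (intro conjI allI ballI impI) auto
  thus ?thesis unfolding comb_def by (intro exI)
qed

end

section \<open>Vectors of polynomials\<close>

definition fscale :: "'k::field \<Rightarrow> (nat \<Rightarrow> 'k poly) \<Rightarrow> (nat \<Rightarrow> 'k poly)" where
  "fscale c f = (\<lambda>i. Polynomial.smult c (f i))"

text \<open>Vectors of length \<open>d\<close> are stored as functions on all natural numbers that vanish from \<open>d\<close> on, so that vectors of all lengths
  belong to one type with pointwise operations.\<close>

definition supp_below :: "nat \<Rightarrow> (nat \<Rightarrow> 'k::field poly) set" where
  "supp_below d = {f. \<forall>i\<ge>d. f i = 0}"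

definition unit_vec_poly :: "nat \<Rightarrow> 'k::field poly \<Rightarrow> (nat \<Rightarrow> 'k poly)" where
  "unit_vec_poly k p = (\<lambda>j. if j = k then p else 0)"

text \<open>Degree bounds are real numbers because the bounds for powers of \<open>\<tau>\<close> grow by the weight, which need not be an
  integer.\<close>

definition deg_le :: "real \<Rightarrow> (nat \<Rightarrow> 'k::field poly) \<Rightarrow> bool" where
  "deg_le b f \<longleftrightarrow> (\<forall>i n. coeff (f i) n \<noteq> 0 \<longrightarrow> real n \<le> b)"

interpretation fscale: vector_space "fscale :: 'k::field \<Rightarrow> (nat \<Rightarrow> 'k poly) \<Rightarrow> (nat \<Rightarrow> 'k poly)"
  by unfold_locales (simp_all add: fscale_def fun_eq_iff smult_add_right smult_add_left)

lemma fscale_sum_apply: "(\<Sum>x\<in>A. f x) i = (\<Sum>x\<in>A. f x (i :: 'a) :: 'b :: comm_monoid_add)"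
  by (induction A rule: infinite_finite_induct) simp_all

lemma supp_below_sub: "fscale.subspace (supp_below d)"
  by (intro fscale.subspaceI) (auto simp: supp_below_def fscale_def)

lemma zero_supp_below [simp]: "0 \<in> supp_below d" by (simp add: supp_below_def)

lemma supp_belowD: "f \<in> supp_below d \<Longrightarrow> i \<ge> d \<Longrightarrow> f i = 0" by (simp add: supp_below_def)

lemma deg_le_mono: "deg_le b f \<Longrightarrow> b \<le> b' \<Longrightarrow> deg_le b' f"
  unfolding deg_le_def by (blast intro: order_trans)

lemma deg_le_0 [simp]: "deg_le b 0" by (simp add: deg_le_def)

lemma deg_le_zero_fun [simp]: "deg_le b (\<lambda>_. 0)" by (simp add: deg_le_def)

lemma deg_le_add:
  assumes "deg_le b f" "deg_le b g"
  shows "deg_le b (f + g)"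
  unfolding deg_le_def
proof (intro allI impI)
  fix i n assume "coeff ((f + g) i) n \<noteq> 0"
  hence "coeff (f i) n \<noteq> 0 \<or> coeff (g i) n \<noteq> 0" by auto
  thus "real n \<le> b" using assms unfolding deg_le_def by auto
qed

lemma deg_le_fscale: "deg_le b f \<Longrightarrow> deg_le b (fscale c f)"
  by (auto simp: deg_le_def fscale_def)

lemma deg_le_sum: "(\<And>x. x \<in> A \<Longrightarrow> deg_le b (f x)) \<Longrightarrow> deg_le b (\<Sum>x\<in>A. f x)"
  by (induction A rule: infinite_finite_induct) (simp_all add: deg_le_add)

lemma deg_le_exists: "f \<in> supp_below d \<Longrightarrow> \<exists>b. deg_le b f"
proof
  assume f: "f \<in> supp_below d"
  show "deg_le (\<Sum>i<d. real (degree (f i))) f"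
    unfolding deg_le_def
  proof (intro allI impI)
    fix i n assume c: "coeff (f i) n \<noteq> 0"
    hence "f i \<noteq> 0" by auto
    hence i: "i < d" using supp_belowD[OF f, of i] by (meson not_le)
    have "real n \<le> real (degree (f i))" using le_degree[OF c] by simp
    also have "\<dots> \<le> (\<Sum>i<d. real (degree (f i)))" by (rule member_le_sum) (use i in auto)
    finally show "real n \<le> (\<Sum>i<d. real (degree (f i)))" .
  qed
qed

lemma deg_le_common:
  assumes "finite I" "\<And>p. p \<in> I \<Longrightarrow> \<exists>b. deg_le b (x p)"
  shows "\<exists>C\<ge>0. \<forall>p\<in>I. deg_le C (x p)"
  using assms
proof (induction I rule: finite_induct)
  case (insert p I)
  obtain C where C: "C \<ge> 0" "\<forall>p\<in>I. deg_le C (x p)" using insert by blast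
  obtain b where b: "deg_le b (x p)" using insert.prems by blast
  have "deg_le (max C b) (x p')" if "p' \<in> insert p I" for p'
  proof (cases "p' = p")
    case True thus ?thesis using deg_le_mono[OF b, of "max C b"] by simp
  next
    case False
    hence "deg_le C (x p')" using that C(2) by blast
    thus ?thesis by (rule deg_le_mono) simp
  qed
  thus ?case using C(1) by (intro exI[of _ "max C b"]) simp
next
  case empty
  show ?case by (rule exI[of _ 0]) simp
qed

lemma vector_expand:
  assumes f: "f \<in> supp_below d" and deg: "\<And>k i. i \<ge> m \<Longrightarrow> coeff (f k) i = 0"
  shows "f = (\<Sum>p\<in>{..<d} \<times> {..<m}. fscale (coeff (f (fst p)) (snd p)) (unit_vec_poly (fst p) (monom 1 (snd p))))"
proof
  fix j
  have pj: "f j = (\<Sum>i<m. monom (coeff (f j) i) i)"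
    by (rule poly_eqI) (auto simp: coeff_sum deg not_less)
  have "(\<Sum>p\<in>{..<d} \<times> {..<m}. fscale (coeff (f (fst p)) (snd p)) (unit_vec_poly (fst p) (monom 1 (snd p)))) j
      = (\<Sum>k<d. \<Sum>i<m. if k = j then monom (coeff (f k) i) i else 0)"
    unfolding fscale_sum_apply sum.cartesian_product
    by (intro sum.cong) (auto simp: fscale_def unit_vec_poly_def smult_monom)
  also have "\<dots> = (\<Sum>k<d. if k = j then (\<Sum>i<m. monom (coeff (f k) i) i) else 0)"
    by (intro sum.cong) auto
  also have "\<dots> = (if j < d then (\<Sum>i<m. monom (coeff (f j) i) i) else 0)"
    by simp
  also have "\<dots> = f j" using pj supp_belowD[OF f, of j] by auto
  finally show "f j = (\<Sum>p\<in>{..<d} \<times> {..<m}. fscale (coeff (f (fst p)) (snd p)) (unit_vec_poly (fst p) (monom 1 (snd p)))) j" ..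
qed

lemma unit_vec_poly_supp: "k < d \<Longrightarrow> unit_vec_poly k p \<in> supp_below d"
  by (auto simp: unit_vec_poly_def supp_below_def)

text \<open>An injective linear map from the vectors of \<open>a\<close> polynomials of degree less than \<open>m\<close> to those of \<open>b\<close> polynomials of
  degree less than \<open>m'\<close> compares the dimensions.\<close>

lemma dimension_le:
  fixes h :: "(nat \<Rightarrow> 'k::field poly) \<Rightarrow> (nat \<Rightarrow> 'k poly)"
  assumes add: "\<And>x y. x \<in> supp_below a \<Longrightarrow> y \<in> supp_below a \<Longrightarrow> h (x + y) = h x + h y"
    and scale: "\<And>c x. x \<in> supp_below a \<Longrightarrow> h (fscale c x) = fscale c (h x)"
    and inj: "\<And>x. x \<in> supp_below a \<Longrightarrow> h x = 0 \<Longrightarrow> x = 0"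
    and im: "\<And>f. f \<in> supp_below a \<Longrightarrow> (\<And>k i. i \<ge> m \<Longrightarrow> coeff (f k) i = 0) \<Longrightarrow>
       h f \<in> supp_below b \<and> (\<forall>k. \<forall>i\<ge>m'. coeff (h f k) i = 0)"
  shows "a * m \<le> b * m'"
proof -
  let ?u = "\<lambda>p. unit_vec_poly (fst p) (monom 1 (snd p)) :: nat \<Rightarrow> 'k poly"
  let ?I = "{..<a} \<times> {..<m}" and ?J = "{..<b} \<times> {..<m'}"
  have "h (fscale 0 0) = fscale 0 (h 0)" by (rule scale[OF fscale.subspace_0[OF supp_below_sub]])
  hence h0: "h 0 = 0" by (simp only: fscale.scale_zero_left)
  have u_supp: "?u p \<in> supp_below a" if "p \<in> ?I" for p using that by (intro unit_vec_poly_supp) auto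
  have comb_supp: "(\<Sum>p\<in>A. fscale (c p) (?u p)) \<in> supp_below a" if "A \<subseteq> ?I" for A c
    using that u_supp by (intro fscale.subspace_sum[OF supp_below_sub] fscale.subspace_scale[OF supp_below_sub]) blast
  have h_sum: "h (\<Sum>p\<in>A. fscale (c p) (?u p)) = (\<Sum>p\<in>A. fscale (c p) (h (?u p)))"
    if "finite A" "A \<subseteq> ?I" for A c
    using that
  proof (induction A rule: finite_induct)
    case (insert p A)
    have pI: "p \<in> ?I" and AI: "A \<subseteq> ?I" using insert.prems by blast+
    have "h (fscale (c p) (?u p) + (\<Sum>p\<in>A. fscale (c p) (?u p)))
        = fscale (c p) (h (?u p)) + h (\<Sum>p\<in>A. fscale (c p) (?u p))"
      by (simp only: add[OF fscale.subspace_scale[OF supp_below_sub u_supp[OF pI]] comb_supp[OF AI]]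
          scale[OF u_supp[OF pI]])
    moreover have "h (\<Sum>p\<in>A. fscale (c p) (?u p)) = (\<Sum>p\<in>A. fscale (c p) (h (?u p)))"
      by (rule insert.IH[OF AI])
    ultimately show ?case by (simp only: sum.insert[OF insert.hyps])
  qed (simp only: sum.empty h0)
  have coef: "c p = 0" if s0: "(\<Sum>p\<in>?I. fscale (c p) (h (?u p))) = 0" and pI: "p \<in> ?I" for c p
  proof -
    have "finite ?I" by simp
    hence "h (\<Sum>p\<in>?I. fscale (c p) (?u p)) = 0" by (simp only: h_sum[OF _ subset_refl] s0)
    hence z: "(\<Sum>p\<in>?I. fscale (c p) (?u p)) = 0" by (rule inj[OF comb_supp[OF subset_refl]])
    obtain k i where p: "p = (k, i)" "k < a" "i < m" using pI by auto
    have "coeff ((\<Sum>p\<in>?I. fscale (c p) (?u p)) k) i = (\<Sum>p\<in>?I. if p = (k, i) then c p else 0)"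
      unfolding fscale_sum_apply coeff_sum
      by (intro sum.cong) (auto simp: fscale_def unit_vec_poly_def)
    also have "\<dots> = c (k, i)" using p by simp
    finally have "c (k, i) = coeff ((0 :: nat \<Rightarrow> 'k poly) k) i" unfolding z by (rule sym)
    thus ?thesis using p by simp
  qed
  have inj_y: "inj_on (\<lambda>p. h (?u p)) ?I"
  proof (rule inj_onI, rule ccontr)
    fix p p' assume *: "p \<in> ?I" "p' \<in> ?I" "h (?u p) = h (?u p')" "p \<noteq> p'"
    define c where "c x = (if x = p then 1 else if x = p' then - 1 else 0 :: 'k)" for x
    have "(\<Sum>x\<in>?I. fscale (c x) (h (?u x))) = (\<Sum>x\<in>{p, p'}. fscale (c x) (h (?u x)))"
    proof (rule sum.mono_neutral_right)
      show "\<forall>x\<in>?I - {p, p'}. fscale (c x) (h (?u x)) = 0"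
        by (simp only: c_def) (auto simp: fscale_def)
    qed (use *(1,2) in auto)
    also have "\<dots> = fscale (c p) (h (?u p')) + fscale (c p') (h (?u p'))"
      using *(3,4) by simp
    also have "\<dots> = 0" using *(4) by (simp add: c_def)
    finally have "c p = 0" using *(1) by (rule coef)
    thus False by (simp add: c_def)
  qed
  have "fscale.independent ((\<lambda>p. h (?u p)) ` ?I)"
  proof (rule fscale.independent_if_scalars_zero)
    fix c v assume c: "(\<Sum>x\<in>(\<lambda>p. h (?u p)) ` ?I. fscale (c x) x) = 0" and v: "v \<in> (\<lambda>p. h (?u p)) ` ?I"
    have "(\<Sum>p\<in>?I. fscale (c (h (?u p))) (h (?u p))) = 0"
      using c sum.reindex[OF inj_y, of "\<lambda>x. fscale (c x) x"] by (simp add: o_def)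
    moreover obtain p where p: "p \<in> ?I" "v = h (?u p)" using v by (rule imageE)
    ultimately have "c (h (?u p)) = 0" by (intro coef[of "\<lambda>p. c (h (?u p))"])
    thus "c v = 0" using p(2) by simp
  qed simp
  moreover have "(\<lambda>p. h (?u p)) ` ?I \<subseteq> fscale.span (?u ` ?J)"
  proof (rule image_subsetI)
    fix p assume p: "p \<in> ?I"
    have "coeff (?u p k) i = 0" if "i \<ge> m" for k i using p that by (auto simp: unit_vec_poly_def)
    hence *: "h (?u p) \<in> supp_below b" "\<And>k i. i \<ge> m' \<Longrightarrow> coeff (h (?u p) k) i = 0"
      using im[OF u_supp[OF p]] by blast+
    have "h (?u p) = (\<Sum>p'\<in>?J. fscale (coeff (h (?u p) (fst p')) (snd p')) (?u p'))"
      by (rule vector_expand[OF *])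
    also have "\<dots> \<in> fscale.span (?u ` ?J)"
      by (intro fscale.span_sum fscale.span_scale fscale.span_base) auto
    finally show "h (?u p) \<in> fscale.span (?u ` ?J)" .
  qed
  ultimately have "card ((\<lambda>p. h (?u p)) ` ?I) \<le> card (?u ` ?J)"
    by (rule conjunct2[OF fscale.independent_span_bound[rotated]]) simp
  also have "\<dots> \<le> card ?J" by (rule card_image_le) simp
  finally show ?thesis using card_image[OF inj_y] by (simp add: card_cartesian_product)
qed

section \<open>Almost strictly pure t-modules\<close>

context tau_t_module
begin

lemma poly_act_t_mult: "poly_act scale t (p * r) x = poly_act scale t p (poly_act scale t r x)"
proof (induction p arbitrary: x)
  case (pCons c p)
  have "poly_act scale t (pCons c p * r) x = scale c (poly_act scale t r x) + poly_act scale t (pCons 0 (p * r)) x"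
    by (simp add: poly_act_add_left poly_act_smult)
  also have "poly_act scale t (pCons 0 (p * r)) x = poly_act scale t p (poly_act scale t r (t x))"
    by (simp add: poly_act_pCons_right pCons.IH)
  also have "poly_act scale t r (t x) = t (poly_act scale t r x)"
    by (simp add: poly_act_def t.D_sum t_scale funpow_swap1)
  finally show ?case by (simp add: poly_act_pCons_right)
qed simp

lemma tau_poly_act_t: "\<tau> (poly_act scale t p x) = poly_act scale t (frob_poly q p) (\<tau> x)"
proof -
  have "degree (frob_poly q p) \<le> degree p" by (intro degree_le) (simp add: coeff_eq_0)
  thus ?thesis
    by (simp add: poly_act_bound[of "frob_poly q p" "degree p"])
      (simp add: poly_act_def D_sum D_scale t_funpow_tau)
qed

end

definition vec_tau :: "nat \<Rightarrow> (nat \<Rightarrow> 'k::field poly) \<Rightarrow> (nat \<Rightarrow> 'k poly)" where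
  "vec_tau q f = (\<lambda>i. tau_poly q (f i))"

text \<open>The row vector \<open>f\<close> times a matrix over \<open>K{\<tau>}\<close>: the action of \<open>t\<close> on a motive.\<close>

definition row_mult :: "nat \<Rightarrow> nat \<Rightarrow> (nat \<Rightarrow> nat \<Rightarrow> 'k::field poly) \<Rightarrow> (nat \<Rightarrow> 'k poly) \<Rightarrow> (nat \<Rightarrow> 'k poly)" where
  "row_mult q d P f = (\<lambda>j. if j < d then \<Sum>k<d. skew_mult q (f k) (P k j) else 0)"

text \<open>A Frobenius-semilinear operator on \<open>K[t]\<^sup>r\<close>, whose value on the \<open>i\<close>-th basis vector is \<open>A i\<close>: the action of \<open>\<tau>\<close> in
  coordinates with respect to a \<open>K[t]\<close>-basis.\<close>

definition matrix_tau :: "nat \<Rightarrow> nat \<Rightarrow> (nat \<Rightarrow> nat \<Rightarrow> 'k::field poly) \<Rightarrow> (nat \<Rightarrow> 'k poly) \<Rightarrow> (nat \<Rightarrow> 'k poly)" where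
  "matrix_tau q r A f = (\<lambda>a. \<Sum>i<r. A i a * frob_poly q (f i))"

lemma row_mult_supp: "row_mult q d P f \<in> supp_below d"
  by (simp add: row_mult_def supp_below_def)

context frobenius
begin

lemma tau_t_module_row_mult: "tau_t_module (fscale :: 'k \<Rightarrow> _) q (vec_tau q) (row_mult q d P)"
proof (intro tau_t_module.intro tau_module.intro semilinear_operator.intro semilinear_operator_axioms.intro
    tau_t_module_axioms.intro frobenius_axioms)
  show "vector_space (fscale :: 'k \<Rightarrow> _)" by unfold_locales
  have tau: "skew_mult q (tau_poly q f) g = tau_poly q (skew_mult q f g)" for f g :: "'k poly"
    by (simp add: skew_mult_assoc flip: skew_mult_tau_left)
  have sm: "skew_mult q (Polynomial.smult c f) g = Polynomial.smult c (skew_mult q f g)" for c and f g :: "'k poly"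
    by (simp add: skew_mult_assoc flip: skew_mult_const_left)
  show "vec_tau q (x + y) = vec_tau q x + vec_tau q y" for x y :: "nat \<Rightarrow> 'k poly"
    by (simp add: vec_tau_def fun_eq_iff tau_poly_add)
  show "vec_tau q (fscale c x) = fscale (c ^ q ^ 1) (vec_tau q x)" for c and x :: "nat \<Rightarrow> 'k poly"
    by (simp add: vec_tau_def fscale_def tau_poly_smult)
  show "row_mult q d P (x + y) = row_mult q d P x + row_mult q d P y" for x y
    by (simp add: row_mult_def fun_eq_iff skew_mult_add_left sum.distrib)
  show "row_mult q d P (fscale c x) = fscale c (row_mult q d P x)" for c x
    by (simp add: row_mult_def fscale_def fun_eq_iff sm tau_poly.scale_sum_right)
  show "row_mult q d P (vec_tau q x) = vec_tau q (row_mult q d P x)" for x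
    by (simp add: row_mult_def vec_tau_def fun_eq_iff tau tau_poly.D_sum)
qed

end

text \<open>The motive of an almost strictly pure abelian t-module in terms of row vectors: \<open>P\<close> is the matrix of \<open>t\<close>, \<open>D\<close> the matrix of \<open>t\<^sup>n\<close>
  with invertible coefficient of \<open>\<tau>\<^sup>s\<close>, and \<open>e\<close> is a \<open>K[t]\<close>-basis. Nilpotence of \<open>t - \<theta>\<close> on the tangent space appears as
  \<open>(t - \<theta>)\<^sup>k M \<subseteq> \<tau>M\<close>.\<close>

locale pure_motive = frobenius field_type q
  for field_type :: "'k::alg_closed_field itself" and q :: nat +
  fixes P D :: "nat \<Rightarrow> nat \<Rightarrow> 'k poly" and e :: "nat \<Rightarrow> nat \<Rightarrow> 'k poly" and d n s r :: nat and \<theta> :: 'k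
  assumes d_pos: "0 < d" and n_pos: "0 < n"
    and t_pow: "f \<in> supp_below d \<Longrightarrow> (row_mult q d P ^^ n) f = row_mult q d D f"
    and D_deg: "k < d \<Longrightarrow> j < d \<Longrightarrow> i > s \<Longrightarrow> coeff (D k j) i = 0"
    and D_lead: "\<exists>E. \<forall>l<d. \<forall>j<d. (\<Sum>k<d. E l k * coeff (D k j) s) = (if l = j then 1 else 0)"
    and e_supp: "i < r \<Longrightarrow> e i \<in> supp_below d"
    and basis: "f \<in> supp_below d \<Longrightarrow> \<exists>!g. g \<in> supp_below r \<and> f = (\<Sum>i<r. poly_act fscale (row_mult q d P) (g i) (e i))"
    and nilp: "\<exists>k. \<forall>f\<in>supp_below d. \<exists>h\<in>supp_below d. poly_act fscale (row_mult q d P) ([:- \<theta>, 1:] ^ k) f = vec_tau q h"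
begin

abbreviation t where "t \<equiv> row_mult q d P"
abbreviation \<tau> :: "(nat \<Rightarrow> 'k poly) \<Rightarrow> (nat \<Rightarrow> 'k poly)" where "\<tau> \<equiv> vec_tau q"

sublocale X: tau_t_module fscale q \<tau> t
  by (rule tau_t_module_row_mult)

lemma t_supp: "t f \<in> supp_below d" by (rule row_mult_supp)
lemma tn_supp: "f \<in> supp_below d \<Longrightarrow> (t ^^ k) f \<in> supp_below d" by (induction k) (simp_all add: t_supp)
lemma tau_supp: "f \<in> supp_below d \<Longrightarrow> \<tau> f \<in> supp_below d" by (simp add: supp_below_def vec_tau_def tau_poly_def)
lemma taun_supp: "f \<in> supp_below d \<Longrightarrow> (\<tau> ^^ k) f \<in> supp_below d" by (induction k) (simp_all add: tau_supp)
lemma poly_act_supp: "f \<in> supp_below d \<Longrightarrow> poly_act fscale t p f \<in> supp_below d"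
  unfolding poly_act_def
  by (intro fscale.subspace_sum[OF supp_below_sub] fscale.subspace_scale[OF supp_below_sub] tn_supp)

definition comb :: "(nat \<Rightarrow> 'k poly) \<Rightarrow> (nat \<Rightarrow> 'k poly)" where
  "comb g = (\<Sum>i<r. poly_act fscale t (g i) (e i))"

definition coords :: "(nat \<Rightarrow> 'k poly) \<Rightarrow> (nat \<Rightarrow> 'k poly)" where
  "coords f = (THE g. g \<in> supp_below r \<and> f = comb g)"

definition A :: "nat \<Rightarrow> nat \<Rightarrow> 'k poly" where "A i = (if i < r then coords (\<tau> (e i)) else 0)"

lemma comb_supp: "comb g \<in> supp_below d"
  unfolding comb_def by (intro fscale.subspace_sum[OF supp_below_sub] poly_act_supp e_supp) simp

lemma basis': "f \<in> supp_below d \<Longrightarrow> \<exists>!g. g \<in> supp_below r \<and> f = comb g"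
  unfolding comb_def by (rule basis)

lemma coords_spec: assumes "f \<in> supp_below d" shows "coords f \<in> supp_below r" "comb (coords f) = f"
  using theI'[OF basis'[OF assms]] unfolding coords_def by simp_all

lemma coords_comb: "g \<in> supp_below r \<Longrightarrow> coords (comb g) = g"
  unfolding coords_def by (rule the1_equality[OF basis'[OF comb_supp]]) simp

lemma comb_add: "comb (f + g) = comb f + comb g"
  by (simp add: comb_def fscale.poly_act_add_left sum.distrib)

lemma comb_scale: "comb (fscale c f) = fscale c (comb f)"
  by (simp add: comb_def fscale.poly_act_smult fscale.scale_sum_right) (simp add: fscale_def fscale.poly_act_smult)

lemma comb_mult: "comb (\<lambda>i. p * g i) = poly_act fscale t p (comb g)"
  by (simp add: comb_def X.poly_act_t_mult X.t.poly_act_sum_right)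

lemma comb_sum: "comb (\<Sum>i\<in>I. f i) = (\<Sum>i\<in>I. comb (f i))"
  by (rule additive_sum[of comb, OF comb_add])

lemma coords_eqI: "g \<in> supp_below r \<Longrightarrow> comb g = f \<Longrightarrow> coords f = g"
  using coords_comb by blast

lemma coords_add: "f \<in> supp_below d \<Longrightarrow> g \<in> supp_below d \<Longrightarrow> coords (f + g) = coords f + coords g"
  by (intro coords_eqI fscale.subspace_add[OF supp_below_sub]) (simp_all add: coords_spec comb_add)

lemma coords_scale: "f \<in> supp_below d \<Longrightarrow> coords (fscale c f) = fscale c (coords f)"
  by (intro coords_eqI fscale.subspace_scale[OF supp_below_sub]) (simp_all add: coords_spec comb_scale)

lemma coords_poly_act:
  assumes "f \<in> supp_below d"
  shows "coords (poly_act fscale t p f) = (\<lambda>i. p * coords f i)"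
proof (rule coords_eqI)
  show "(\<lambda>i. p * coords f i) \<in> supp_below r"
    using supp_belowD[OF coords_spec(1)[OF assms]] by (simp add: supp_below_def)
qed (simp add: comb_mult coords_spec[OF assms])

lemma A_supp: "A i \<in> supp_below r"
  unfolding A_def using coords_spec(1)[OF tau_supp[OF e_supp]] by simp

lemma comb_A: "i < r \<Longrightarrow> comb (A i) = \<tau> (e i)"
  unfolding A_def using coords_spec(2)[OF tau_supp[OF e_supp]] by simp

lemma matrix_tau_supp: "matrix_tau q r A f \<in> supp_below r"
  using supp_belowD[OF A_supp] by (simp add: matrix_tau_def supp_below_def)

lemma comb_matrix_tau: "comb (matrix_tau q r A g) = \<tau> (comb g)"
proof -
  have "\<tau> (comb g) = (\<Sum>i<r. poly_act fscale t (frob_poly q (g i)) (\<tau> (e i)))"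
    by (simp add: comb_def X.D_sum X.tau_poly_act_t)
  also have "\<dots> = (\<Sum>i<r. comb (\<lambda>a. frob_poly q (g i) * A i a))"
    by (intro sum.cong) (simp_all add: comb_mult comb_A)
  also have "\<dots> = comb (\<Sum>i<r. (\<lambda>a. frob_poly q (g i) * A i a))" by (rule comb_sum[symmetric])
  also have "(\<Sum>i<r. (\<lambda>a. frob_poly q (g i) * A i a)) = matrix_tau q r A g"
    by (rule ext) (simp add: fscale_sum_apply matrix_tau_def mult.commute)
  finally show ?thesis ..
qed

lemma coords_tau: "f \<in> supp_below d \<Longrightarrow> coords (\<tau> f) = matrix_tau q r A (coords f)"
  by (intro coords_eqI matrix_tau_supp) (simp add: comb_matrix_tau coords_spec)

lemma comb_matrix_tau_funpow: "comb ((matrix_tau q r A ^^ k) g) = (\<tau> ^^ k) (comb g)"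
  by (induction k) (simp_all add: comb_matrix_tau)

lemma comb_inj: "g \<in> supp_below r \<Longrightarrow> comb g = 0 \<Longrightarrow> g = 0"
  using coords_comb[of g] coords_comb[OF fscale.subspace_0[OF supp_below_sub]] comb_add[of 0 0] by simp

lemma cokernel: "\<exists>k. \<forall>i<r. \<exists>f\<in>supp_below r. matrix_tau q r A f = unit_vec_poly i ([:- \<theta>, 1:] ^ k)"
proof -
  obtain k where k: "\<And>f. f \<in> supp_below d \<Longrightarrow> \<exists>h\<in>supp_below d. poly_act fscale t ([:- \<theta>, 1:] ^ k) f = \<tau> h"
    using nilp by blast
  show ?thesis
  proof (intro exI allI impI)
    fix i assume i: "i < r"
    obtain h where h: "h \<in> supp_below d" "poly_act fscale t ([:- \<theta>, 1:] ^ k) (e i) = \<tau> h"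
      using k[OF e_supp[OF i]] by blast
    have "comb (unit_vec_poly i ([:- \<theta>, 1:] ^ k))
        = (\<Sum>j<r. if j = i then poly_act fscale t ([:- \<theta>, 1:] ^ k) (e j) else 0)"
      unfolding comb_def by (intro sum.cong) (simp_all add: unit_vec_poly_def)
    hence "comb (unit_vec_poly i ([:- \<theta>, 1:] ^ k)) = \<tau> h" using i h(2) by simp
    hence "coords (\<tau> h) = unit_vec_poly i ([:- \<theta>, 1:] ^ k)"
      by (intro coords_eqI unit_vec_poly_supp[OF i])
    thus "\<exists>f\<in>supp_below r. matrix_tau q r A f = unit_vec_poly i ([:- \<theta>, 1:] ^ k)"
      using coords_tau[OF h(1)] coords_spec(1)[OF h(1)] by (intro bexI[of _ "coords h"]) simp_all
  qed
qed


text \<open>Right division by the matrix of \<open>t\<^sup>n\<close>, possible because its leading coefficient is invertible.\<close>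

lemma right_division:
  assumes "f \<in> supp_below d" "\<And>j i. i \<ge> m + s \<Longrightarrow> coeff (f j) i = 0"
  shows "\<exists>g\<in>supp_below d. (\<forall>j. \<forall>i\<ge>m. coeff (g j) i = 0) \<and> (\<forall>j. \<forall>i\<ge>s. coeff ((f - (t ^^ n) g) j) i = 0)"
  using assms
proof (induction m arbitrary: f)
  case 0
  have "(t ^^ n) (\<lambda>_. 0) = (\<lambda>_. 0)" using X.t.Dn_0[of n] by (simp only: zero_fun_def)
  thus ?case using 0(2) by (intro bexI[of _ "\<lambda>_. 0"]) (simp_all add: supp_below_def)
next
  case (Suc m)
  obtain E where E: "\<And>l j. l < d \<Longrightarrow> j < d \<Longrightarrow> (\<Sum>k<d. E l k * coeff (D k j) s) = (if l = j then 1 else 0)"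
    using D_lead by blast
  define c where "c j = coeff (f j) (m + s)" for j
  define u where "u k = (\<Sum>l<d. c l * E l k ^ (q ^ m))" for k
  define g0 where "g0 = (\<lambda>k. if k < d then monom (u k) m else 0)"
  have g0: "g0 \<in> supp_below d" by (simp add: g0_def supp_below_def)
  have coeff_t: "coeff ((t ^^ n) g0 j) i = (\<Sum>k<d. if i < m then 0 else u k * coeff (D k j) (i - m) ^ (q ^ m))"
    if "j < d" for i j
  proof -
    have "(t ^^ n) g0 j = (\<Sum>k<d. skew_mult q (monom (u k) m) (D k j))"
      unfolding t_pow[OF g0] using that by (simp add: row_mult_def g0_def)
    thus ?thesis
      by (simp add: coeff_sum skew_mult_eq_act tau_poly.poly_act_monom coeff_tau_poly_funpow if_distrib cong: if_cong)
  qed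
  have top: "coeff ((t ^^ n) g0 j) (m + s) = c j" if j: "j < d" for j
  proof -
    have "coeff ((t ^^ n) g0 j) (m + s) = (\<Sum>k<d. \<Sum>l<d. c l * (E l k * coeff (D k j) s) ^ (q ^ m))"
      by (simp add: coeff_t[OF j] u_def sum_distrib_right power_mult_distrib mult.assoc)
    also have "\<dots> = (\<Sum>l<d. c l * (\<Sum>k<d. E l k * coeff (D k j) s) ^ (q ^ m))"
      by (subst sum.swap) (simp add: q_power_sum sum_distrib_left)
    also have "\<dots> = (\<Sum>l<d. if l = j then c l else 0)"
      by (intro sum.cong) (simp_all add: E j)
    finally show ?thesis using j by simp
  qed
  have high: "coeff ((t ^^ n) g0 j) i = 0" if "j < d" "i > m + s" for i j
    using that D_deg by (simp add: coeff_t)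
  define f1 where "f1 = f - (t ^^ n) g0"
  have f1: "f1 \<in> supp_below d"
    unfolding f1_def by (intro fscale.subspace_diff[OF supp_below_sub] Suc.prems(1) tn_supp g0)
  have "coeff (f1 j) i = 0" if i: "i \<ge> m + s" for i j
  proof (cases "j < d")
    case False
    hence "f1 j = 0" by (intro supp_belowD[OF f1]) simp
    thus ?thesis by simp
  next
    case True
    show ?thesis
    proof (cases "i = m + s")
      case True
      thus ?thesis using top[OF \<open>j < d\<close>] by (simp add: f1_def c_def)
    next
      case False
      thus ?thesis using high[OF True, of i] Suc.prems(2)[of i j] i by (simp add: f1_def)
    qed
  qed
  from Suc.IH[OF f1 this] obtain g1 where g1: "g1 \<in> supp_below d" "\<forall>j. \<forall>i\<ge>m. coeff (g1 j) i = 0"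
    "\<forall>j. \<forall>i\<ge>s. coeff ((f1 - (t ^^ n) g1) j) i = 0" by blast
  have "f1 - (t ^^ n) g1 = f - (t ^^ n) (g0 + g1)" unfolding f1_def X.t.Dn_add by (rule diff_diff_eq)
  hence "\<forall>j. \<forall>i\<ge>s. coeff ((f - (t ^^ n) (g0 + g1)) j) i = 0" using g1(3) by (simp only:)
  moreover have "\<forall>j. \<forall>i\<ge>Suc m. coeff ((g0 + g1) j) i = 0" using g1(2) by (simp add: g0_def)
  moreover have "g0 + g1 \<in> supp_below d" by (rule fscale.subspace_add[OF supp_below_sub g0 g1(1)])
  ultimately show ?case by blast
qed

lemma r_pos: "0 < r"
proof (rule ccontr)
  assume "\<not> 0 < r"
  hence "{..<r} = {}" by simp
  hence comb0: "comb g = 0" for g by (simp only: comb_def sum.empty)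
  define u where "u = unit_vec_poly 0 (1 :: 'k poly)"
  have u: "u \<in> supp_below d" unfolding u_def by (rule unit_vec_poly_supp[OF d_pos])
  have "u = comb (coords u)" using coords_spec(2)[OF u] by simp
  also have "\<dots> = 0" by (rule comb0)
  finally have "u 0 = 0" by (simp only: zero_fun_apply)
  thus False by (simp add: u_def unit_vec_poly_def)
qed

lemma comb_t_funpow: "(t ^^ k) (comb g) = comb (\<lambda>i. monom 1 k * g i)"
  by (simp add: comb_mult fscale.poly_act_monom)

lemma s_pos: "0 < s"
proof (rule ccontr)
  assume "\<not> 0 < s"
  hence s: "s = 0" by simp
  define u where "u = comb (unit_vec_poly 0 (1 :: 'k poly))"
  have u: "u \<in> supp_below d" unfolding u_def by (rule comb_supp)
  obtain b where b: "deg_le b u" using deg_le_exists[OF u] by blast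
  have "coeff (u j) i = 0" if "i \<ge> nat \<lceil>b\<rceil> + 1 + s" for j i
  proof (rule ccontr)
    assume "coeff (u j) i \<noteq> 0"
    hence "real i \<le> b" using b by (simp add: deg_le_def)
    thus False using that by linarith
  qed
  from right_division[OF u this] obtain g where g: "g \<in> supp_below d"
    "\<forall>j. \<forall>i\<ge>s. coeff ((u - (t ^^ n) g) j) i = 0" by blast
  have "(u - (t ^^ n) g) j = 0" for j by (rule poly_eqI) (use g(2) s in simp)
  hence "u = (t ^^ n) g" by (simp add: fun_eq_iff)
  hence "coords u = coords ((t ^^ n) (comb (coords g)))" by (simp only: coords_spec(2)[OF g(1)])
  also have "\<dots> = (\<lambda>i. monom 1 n * coords g i)"
  proof (unfold comb_t_funpow, rule coords_comb)
    show "(\<lambda>i. monom 1 n * coords g i) \<in> supp_below r"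
      using supp_belowD[OF coords_spec(1)[OF g(1)]] by (simp add: supp_below_def)
  qed
  finally have "coords u 0 = monom 1 n * coords g 0" by simp
  moreover have "coords u = unit_vec_poly 0 1" unfolding u_def by (rule coords_comb[OF unit_vec_poly_supp[OF r_pos]])
  ultimately have "coeff (monom 1 n * coords g 0) 0 = 1" by (simp add: unit_vec_poly_def)
  thus False using n_pos by (simp add: coeff_monom_mult)
qed

definition w :: real where "w = real n / real s"

lemma w_pos: "0 < w" using s_pos n_pos by (simp add: w_def)

lemma deg_le_monom_mult:
  assumes "deg_le b g"
  shows "deg_le (real m + b) (\<lambda>i. monom 1 m * g i)"
  unfolding deg_le_def
proof (intro allI impI)
  fix i k assume "coeff (monom 1 m * g i) k \<noteq> 0"
  hence "m \<le> k" "coeff (g i) (k - m) \<noteq> 0" by (auto simp: coeff_monom_mult split: if_splits)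
  hence "real (k - m) \<le> b" using assms unfolding deg_le_def by blast
  thus "real k \<le> real m + b" using \<open>m \<le> k\<close> by simp
qed

text \<open>Dividing repeatedly by the matrix of \<open>t\<^sup>n\<close> lowers the \<open>\<tau>\<close>-degree by \<open>s\<close> and costs a factor \<open>t\<^sup>n\<close>. Hence \<open>\<tau>\<close>-degree \<open>b\<close>
  translates into \<open>t\<close>-degree at most \<open>b n / s\<close>, up to a constant coming from the remainders.\<close>

lemma coords_degree: "\<exists>C\<ge>0. \<forall>f\<in>supp_below d. \<forall>b. deg_le b f \<longrightarrow> deg_le (w * b + C) (coords f)"
proof -
  let ?u = "\<lambda>p. unit_vec_poly (fst p) (monom 1 (snd p)) :: nat \<Rightarrow> 'k poly"
  let ?I = "{..<d} \<times> {..<s}"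
  have uI: "?u p \<in> supp_below d" if "p \<in> ?I" for p using that by (intro unit_vec_poly_supp) auto
  have "\<exists>C\<ge>0. \<forall>p\<in>?I. deg_le C (coords (?u p))"
  proof (rule deg_le_common)
    fix p assume "p \<in> ?I"
    thus "\<exists>b. deg_le b (coords (?u p))" by (intro deg_le_exists[OF coords_spec(1)] uI)
  qed simp
  then obtain C where C: "C \<ge> 0" "\<And>p. p \<in> ?I \<Longrightarrow> deg_le C (coords (?u p))" by blast
  have low: "deg_le C (coords f)" if f: "f \<in> supp_below d" "\<And>j i. i \<ge> s \<Longrightarrow> coeff (f j) i = 0" for f
  proof -
    have "comb (\<Sum>p\<in>?I. fscale (coeff (f (fst p)) (snd p)) (coords (?u p)))
        = (\<Sum>p\<in>?I. fscale (coeff (f (fst p)) (snd p)) (?u p))"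
      unfolding comb_sum by (intro sum.cong refl) (simp only: comb_scale coords_spec(2)[OF uI])
    also have "\<dots> = f" by (rule vector_expand[OF f, symmetric])
    finally have "coords f = (\<Sum>p\<in>?I. fscale (coeff (f (fst p)) (snd p)) (coords (?u p)))"
      by (intro coords_eqI fscale.subspace_sum[OF supp_below_sub] fscale.subspace_scale[OF supp_below_sub] coords_spec(1) uI)
    thus ?thesis by (rule ssubst[where P = "deg_le C"]) (intro deg_le_sum deg_le_fscale C(2))
  qed
  have step: "deg_le (real (n * k) + C) (coords f)"
    if "f \<in> supp_below d" "\<And>j i. i \<ge> k * s \<Longrightarrow> coeff (f j) i = 0" for k f
    using that
  proof (induction k arbitrary: f)
    case 0
    thus ?case using low[of f] by simp
  next
    case (Suc k)
    have "coeff (f j) i = 0" if "i \<ge> k * s + s" for j i using Suc.prems(2) that by simp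
    from right_division[OF Suc.prems(1) this] obtain g where g: "g \<in> supp_below d"
      "\<And>j i. i \<ge> k * s \<Longrightarrow> coeff (g j) i = 0" "\<And>j i. i \<ge> s \<Longrightarrow> coeff ((f - (t ^^ n) g) j) i = 0" by blast
    let ?h = "f - (t ^^ n) g"
    have hS: "?h \<in> supp_below d" by (intro fscale.subspace_diff[OF supp_below_sub] Suc.prems(1) tn_supp g(1))
    have "coords ((t ^^ n) g) = (\<lambda>i. monom 1 n * coords g i)"
      using coords_poly_act[OF g(1), of "monom 1 n"] by (simp add: fscale.poly_act_monom)
    moreover have "deg_le (real n + (real (n * k) + C)) (\<lambda>i. monom 1 n * coords g i)"
      by (intro deg_le_monom_mult Suc.IH[OF g(1,2)])
    ultimately have "deg_le (real (n * Suc k) + C) (coords ((t ^^ n) g))" by (simp add: algebra_simps)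
    moreover have "deg_le (real (n * Suc k) + C) (coords ?h)"
      by (rule deg_le_mono[OF low[OF hS g(3)] add_increasing[OF of_nat_0_le_iff order_refl]])
    moreover have "coords f = coords ((t ^^ n) g) + coords ?h"
    proof -
      have "(t ^^ n) g + ?h = f" by simp
      thus ?thesis using coords_add[OF tn_supp[OF g(1), of n] hS] by metis
    qed
    ultimately show ?case using deg_le_add by metis
  qed
  have "deg_le (w * b + (real n + C)) (coords f)" if f: "f \<in> supp_below d" and b: "deg_le b f" for f b
  proof (cases "b < 0")
    case True
    have "coeff (f j) i = 0" for j i
    proof (rule ccontr)
      assume "coeff (f j) i \<noteq> 0"
      hence "real i \<le> b" using b by (simp add: deg_le_def)
      thus False using True by linarith
    qed
    hence "f j = 0" for j by (intro poly_eqI) simp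
    hence "f = 0" by (simp add: fun_eq_iff)
    hence "coords f = 0"
      using coords_eqI[OF fscale.subspace_0[OF supp_below_sub], of f] comb_add[of 0 0] by simp
    thus ?thesis by (simp only: deg_le_0)
  next
    case False
    define k where "k = nat \<lfloor>b / real s\<rfloor> + 1"
    have "real k = real_of_int \<lfloor>b / real s\<rfloor> + 1" using False s_pos by (simp add: k_def)
    hence k1: "b / real s < real k" and k2: "real k \<le> b / real s + 1" by linarith+
    have bk: "b < real (k * s)" using k1 s_pos by (simp add: pos_divide_less_eq)
    have "coeff (f j) i = 0" if "i \<ge> k * s" for j i
    proof (rule ccontr)
      assume "coeff (f j) i \<noteq> 0"
      hence "real i \<le> b" using b by (simp add: deg_le_def)
      thus False using bk that by linarith
    qed
    hence "deg_le (real (n * k) + C) (coords f)" by (rule step[OF f])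
    moreover have "real (n * k) \<le> w * b + real n"
    proof -
      have "real (n * k) \<le> real n * (b / real s + 1)" using mult_left_mono[OF k2, of "real n"] by simp
      also have "\<dots> = w * b + real n" by (simp add: w_def distrib_left)
      finally show ?thesis .
    qed
    hence "real (n * k) + C \<le> w * b + (real n + C)" by linarith
    ultimately show ?thesis by (rule deg_le_mono)
  qed
  moreover have "real n + C \<ge> 0" using C(1) by simp
  ultimately show ?thesis by blast
qed

lemma deg_le_t_pow:
  assumes f: "f \<in> supp_below d" and b: "deg_le b f"
  shows "deg_le (b + real s) ((t ^^ n) f)"
  unfolding deg_le_def
proof (intro allI impI)
  fix j i assume *: "coeff ((t ^^ n) f j) i \<noteq> 0"
  have j: "j < d" using * supp_belowD[OF tn_supp[OF f], of j n] by (cases "j < d") auto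
  define F where "F k l = coeff (f k) l * (if i < l then 0 else coeff (D k j) (i - l) ^ (q ^ l))" for k l
  have "coeff ((t ^^ n) f j) i = (\<Sum>k<d. \<Sum>l\<le>degree (f k). F k l)"
    using j by (simp add: t_pow[OF f] row_mult_def coeff_sum skew_mult_eq_act poly_act_def coeff_tau_poly_funpow F_def)
  hence "(\<Sum>k<d. \<Sum>l\<le>degree (f k). F k l) \<noteq> 0" using * by simp
  then obtain k where k: "k \<in> {..<d}" "(\<Sum>l\<le>degree (f k). F k l) \<noteq> 0"
    by (rule sum.not_neutral_contains_not_neutral)
  from k(2) obtain l where "F k l \<noteq> 0" by (rule sum.not_neutral_contains_not_neutral)
  hence l: "coeff (f k) l \<noteq> 0" "l \<le> i" "coeff (D k j) (i - l) \<noteq> 0" by (auto simp: F_def split: if_splits)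
  have "real l \<le> b" using b l(1) unfolding deg_le_def by blast
  moreover have "\<not> i - l > s" using l(3) D_deg[of k j "i - l"] k(1) j by auto
  ultimately show "real i \<le> b + real s" using l(2) by linarith
qed

text \<open>Conversely each factor \<open>t\<^sup>n\<close> raises the \<open>\<tau>\<close>-degree by at most \<open>s\<close>.\<close>

lemma comb_degree: "\<exists>C\<ge>0. \<forall>g\<in>supp_below r. \<forall>b. deg_le b g \<longrightarrow> deg_le (b / w + C) (comb g)"
proof -
  let ?I = "{..<r} \<times> {..<n}"
  have "\<exists>C\<ge>0. \<forall>p\<in>?I. deg_le C ((t ^^ snd p) (e (fst p)))"
  proof (rule deg_le_common)
    fix p assume "p \<in> ?I"
    thus "\<exists>b. deg_le b ((t ^^ snd p) (e (fst p)))" by (intro deg_le_exists[OF tn_supp[OF e_supp]]) auto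
  qed simp
  then obtain C where C: "C \<ge> 0" "\<And>p. p \<in> ?I \<Longrightarrow> deg_le C ((t ^^ snd p) (e (fst p)))" by blast
  have pow: "deg_le (C + real (s * k)) ((t ^^ (n * k + j)) (e i))" if "i < r" "j < n" for i j k
  proof (induction k)
    case 0
    show ?case using C(2)[of "(i, j)"] that by simp
  next
    case (Suc k)
    have "deg_le (C + real (s * k) + real s) ((t ^^ n) ((t ^^ (n * k + j)) (e i)))"
      by (intro deg_le_t_pow tn_supp e_supp that(1) Suc)
    moreover have "n * Suc k + j = n + (n * k + j)" by simp
    hence "(t ^^ (n * Suc k + j)) (e i) = (t ^^ n) ((t ^^ (n * k + j)) (e i))"
      by (simp only: funpow_add o_apply)
    moreover have "C + real (s * Suc k) = C + real (s * k) + real s" by (simp add: algebra_simps)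
    ultimately show ?case by metis
  qed
  have pow': "deg_le (real m / w + C) ((t ^^ m) (e i))" if "i < r" for i m
  proof -
    have "deg_le (C + real (s * (m div n))) ((t ^^ (n * (m div n) + m mod n)) (e i))"
      by (rule pow[OF that]) (use n_pos in simp)
    hence "deg_le (C + real (s * (m div n))) ((t ^^ m) (e i))" by (simp only: mult_div_mod_eq)
    moreover have "real (s * (m div n)) \<le> real m / w"
    proof -
      have "n * (m div n) \<le> m" by simp
      hence "real (n * (m div n)) \<le> real m" by (rule of_nat_mono)
      moreover have "real (s * (m div n)) * w = real (n * (m div n))" using s_pos by (simp add: w_def)
      ultimately show ?thesis using w_pos by (simp only: pos_le_divide_eq)
    qed
    hence "C + real (s * (m div n)) \<le> real m / w + C" by linarith
    ultimately show ?thesis by (rule deg_le_mono)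
  qed
  have "deg_le (b / w + C) (comb g)" if b: "deg_le b g" for g b
    unfolding comb_def poly_act_def
  proof (intro deg_le_sum)
    fix i m assume i: "i \<in> {..<r}"
    show "deg_le (b / w + C) (fscale (coeff (g i) m) ((t ^^ m) (e i)))"
    proof (cases "coeff (g i) m = 0")
      case True
      thus ?thesis by (simp only: fscale.scale_zero_left deg_le_0)
    next
      case False
      hence "real m \<le> b" using b by (simp add: deg_le_def)
      hence "real m / w \<le> b / w" using w_pos by (simp add: divide_right_mono)
      hence "deg_le (b / w + C) ((t ^^ m) (e i))" using i by (intro deg_le_mono[OF pow']) simp_all
      thus ?thesis by (rule deg_le_fscale)
    qed
  qed
  thus ?thesis using C(1) by blast
qed

lemma deg_le_taun: "deg_le (b + real k) ((\<tau> ^^ k) f) \<longleftrightarrow> deg_le b f"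
proof -
  have *: "(\<tau> ^^ k) f = (\<lambda>i. (tau_poly q ^^ k) (f i))" by (induction k) (simp_all add: vec_tau_def)
  show ?thesis
  proof
    assume a: "deg_le (b + real k) ((\<tau> ^^ k) f)"
    show "deg_le b f" unfolding deg_le_def
    proof (intro allI impI)
      fix i m assume "coeff (f i) m \<noteq> 0"
      hence "coeff ((\<tau> ^^ k) f i) (m + k) \<noteq> 0" unfolding * by (simp add: coeff_tau_poly_funpow)
      hence "real (m + k) \<le> b + real k" using a unfolding deg_le_def by blast
      thus "real m \<le> b" by simp
    qed
  next
    assume a: "deg_le b f"
    show "deg_le (b + real k) ((\<tau> ^^ k) f)" unfolding deg_le_def
    proof (intro allI impI)
      fix i m assume "coeff ((\<tau> ^^ k) f i) m \<noteq> 0"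
      hence "k \<le> m" "coeff (f i) (m - k) \<noteq> 0" unfolding * by (auto simp: coeff_tau_poly_funpow split: if_splits)
      hence "real (m - k) \<le> b" using a unfolding deg_le_def by blast
      thus "real m \<le> b + real k" using \<open>k \<le> m\<close> by simp
    qed
  qed
qed

text \<open>In the coordinates of \<open>K{\<tau>}\<^sup>d\<close> the effect of \<open>\<tau>\<^sup>k\<close> on degrees is exact. Translating back and forth with the two
  bounds above, the error remains bounded independently of \<open>k\<close>.\<close>

lemma matrix_tau_degree:
  "\<exists>C\<ge>0. \<forall>g\<in>supp_below r. \<forall>k b. (deg_le b g \<longrightarrow> deg_le (b + real k * w + C) ((matrix_tau q r A ^^ k) g)) \<and>
     (deg_le b ((matrix_tau q r A ^^ k) g) \<longrightarrow> deg_le (b - real k * w + C) g)"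
proof -
  obtain C1 where C1: "C1 \<ge> 0" "\<And>f b. f \<in> supp_below d \<Longrightarrow> deg_le b f \<Longrightarrow> deg_le (w * b + C1) (coords f)"
    using coords_degree by blast
  obtain C2 where C2: "C2 \<ge> 0" "\<And>g b. g \<in> supp_below r \<Longrightarrow> deg_le b g \<Longrightarrow> deg_le (b / w + C2) (comb g)"
    using comb_degree by blast
  show ?thesis
  proof (intro exI[of _ "w * C2 + C1"] conjI ballI allI impI)
    show "w * C2 + C1 \<ge> 0" using C1(1) C2(1) w_pos by simp
  next
    fix g :: "nat \<Rightarrow> 'k poly" and k b assume g: "g \<in> supp_below r" and b: "deg_le b g"
    have gk: "(matrix_tau q r A ^^ k) g \<in> supp_below r"
      using g matrix_tau_supp by (cases k) simp_all
    have "deg_le (b / w + C2 + real k) ((\<tau> ^^ k) (comb g))" by (simp only: deg_le_taun C2(2)[OF g b])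
    hence "deg_le (w * (b / w + C2 + real k) + C1) (coords ((\<tau> ^^ k) (comb g)))"
      by (rule C1(2)[OF taun_supp[OF comb_supp]])
    moreover have "coords ((\<tau> ^^ k) (comb g)) = (matrix_tau q r A ^^ k) g"
      unfolding comb_matrix_tau_funpow[symmetric] by (rule coords_comb[OF gk])
    moreover have "w * (b / w + C2 + real k) + C1 = b + real k * w + (w * C2 + C1)"
      using w_pos by (simp add: distrib_left)
    ultimately show "deg_le (b + real k * w + (w * C2 + C1)) ((matrix_tau q r A ^^ k) g)" by simp
  next
    fix g :: "nat \<Rightarrow> 'k poly" and k b assume g: "g \<in> supp_below r" and b: "deg_le b ((matrix_tau q r A ^^ k) g)"
    have gk: "(matrix_tau q r A ^^ k) g \<in> supp_below r"
      using g matrix_tau_supp by (cases k) simp_all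
    have "deg_le (b / w + C2) ((\<tau> ^^ k) (comb g))"
      using C2(2)[OF gk b] by (simp only: comb_matrix_tau_funpow)
    hence "deg_le ((b / w + C2 - real k) + real k) ((\<tau> ^^ k) (comb g))" by simp
    hence "deg_le (b / w + C2 - real k) (comb g)" by (simp only: deg_le_taun)
    hence "deg_le (w * (b / w + C2 - real k) + C1) (coords (comb g))" by (rule C1(2)[OF comb_supp])
    moreover have "w * (b / w + C2 - real k) + C1 = b - real k * w + (w * C2 + C1)"
      using w_pos by (simp add: distrib_left right_diff_distrib)
    ultimately show "deg_le (b - real k * w + (w * C2 + C1)) g" by (simp add: coords_comb[OF g])
  qed
qed

lemma linear_bound_archimedean:
  fixes a b c :: real
  assumes "\<And>m :: nat. a * real m \<le> b * real m + c"
  shows "a \<le> b"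
proof (rule ccontr)
  assume "\<not> a \<le> b"
  hence "a - b > 0" by simp
  then obtain m :: nat where "c < real m * (a - b)" using reals_Archimedean3 by blast
  thus False using assms[of m] by (simp add: algebra_simps)
qed

lemma deg_le_nat: "deg_le b f \<Longrightarrow> i \<ge> nat (\<lfloor>b\<rfloor> + 1) \<Longrightarrow> coeff (f k) i = 0"
proof (rule ccontr)
  assume "deg_le b f" "i \<ge> nat (\<lfloor>b\<rfloor> + 1)" "coeff (f k) i \<noteq> 0"
  hence "real i \<le> b" by (simp add: deg_le_def)
  thus False using \<open>i \<ge> nat (\<lfloor>b\<rfloor> + 1)\<close> by linarith
qed

lemma nat_deg_le:
  assumes "\<And>k i. i \<ge> m \<Longrightarrow> coeff (f k) i = 0"
  shows "deg_le (real m) f"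
  unfolding deg_le_def
proof (intro allI impI)
  fix k i assume "coeff (f k) i \<noteq> 0"
  hence "\<not> i \<ge> m" using assms by blast
  thus "real i \<le> real m" by simp
qed

text \<open>Counting dimensions of elements of bounded \<open>\<tau>\<close>-degree and of bounded \<open>t\<close>-degree.\<close>

lemma weight_eq: "real d = real r * w"
proof (rule antisym)
  obtain C where C: "C \<ge> 0" "\<And>f b. f \<in> supp_below d \<Longrightarrow> deg_le b f \<Longrightarrow> deg_le (w * b + C) (coords f)"
    using coords_degree by blast
  show "real d \<le> real r * w"
  proof (rule linear_bound_archimedean)
    fix m :: nat
    define m' where "m' = nat (\<lfloor>w * real m + C\<rfloor> + 1)"
    have "d * m \<le> r * m'"
    proof (rule dimension_le[of d coords])
      fix x :: "nat \<Rightarrow> 'k poly" assume x: "x \<in> supp_below d" "coords x = 0"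
      have "comb 0 = 0" using comb_add[of 0 0] by simp
      thus "x = 0" using coords_spec(2)[OF x(1)] x(2) by metis
    next
      fix f :: "nat \<Rightarrow> 'k poly" assume f: "f \<in> supp_below d" "\<And>k i. i \<ge> m \<Longrightarrow> coeff (f k) i = 0"
      have "deg_le (w * real m + C) (coords f)" by (rule C(2)[OF f(1) nat_deg_le[OF f(2)]])
      thus "coords f \<in> supp_below r \<and> (\<forall>k. \<forall>i\<ge>m'. coeff (coords f k) i = 0)"
        unfolding m'_def by (intro conjI allI impI coords_spec(1)[OF f(1)]) (rule deg_le_nat)
    qed (simp_all add: coords_add coords_scale)
    hence "real d * real m \<le> real r * real m'" by (simp only: of_nat_mult[symmetric] of_nat_le_iff)
    also have "real m' \<le> w * real m + C + 1"
    proof -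
      have "0 \<le> w * real m + C" using w_pos C(1) by simp
      hence "real m' = real_of_int \<lfloor>w * real m + C\<rfloor> + 1" by (simp add: m'_def)
      thus ?thesis by linarith
    qed
    hence "real r * real m' \<le> real r * (w * real m + C + 1)" by (rule mult_left_mono) simp
    finally show "real d * real m \<le> real r * w * real m + real r * (C + 1)" by (simp add: algebra_simps)
  qed
next
  obtain C where C: "C \<ge> 0" "\<And>g b. g \<in> supp_below r \<Longrightarrow> deg_le b g \<Longrightarrow> deg_le (b / w + C) (comb g)"
    using comb_degree by blast
  have "real r \<le> real d / w"
  proof (rule linear_bound_archimedean)
    fix m :: nat
    define m' where "m' = nat (\<lfloor>real m / w + C\<rfloor> + 1)"
    have "r * m \<le> d * m'"
    proof (rule dimension_le[of r comb])
      fix f :: "nat \<Rightarrow> 'k poly" assume f: "f \<in> supp_below r" "\<And>k i. i \<ge> m \<Longrightarrow> coeff (f k) i = 0"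
      have "deg_le (real m / w + C) (comb f)" by (rule C(2)[OF f(1) nat_deg_le[OF f(2)]])
      thus "comb f \<in> supp_below d \<and> (\<forall>k. \<forall>i\<ge>m'. coeff (comb f k) i = 0)"
        unfolding m'_def by (intro conjI allI impI comb_supp) (rule deg_le_nat)
    qed (simp_all add: comb_add comb_scale comb_inj)
    hence "real r * real m \<le> real d * real m'" by (simp only: of_nat_mult[symmetric] of_nat_le_iff)
    also have "real m' \<le> real m / w + C + 1"
    proof -
      have "0 \<le> real m / w + C" using w_pos C(1) by simp
      hence "real m' = real_of_int \<lfloor>real m / w + C\<rfloor> + 1" by (simp add: m'_def)
      thus ?thesis by linarith
    qed
    hence "real d * real m' \<le> real d * (real m / w + C + 1)" by (rule mult_left_mono) simp
    finally show "real r * real m \<le> real d / w * real m + real d * (C + 1)" by (simp add: algebra_simps)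
  qed
  thus "real r * w \<le> real d" using w_pos by (simp add: field_simps)
qed

end

section \<open>Frobenius structures on free K[t]-modules\<close>

definition t_shift :: "(nat \<Rightarrow> 'k::field poly) \<Rightarrow> (nat \<Rightarrow> 'k poly)" where
  "t_shift f = (\<lambda>i. pCons 0 (f i))"

text \<open>What purity leaves in \<open>K[t]\<close>-coordinates: \<open>\<tau>\<^sup>k\<close> raises \<open>t\<close>-degrees by \<open>k w\<close>, up to an error that does not depend on \<open>k\<close>, and the
  cokernel of \<open>\<tau>\<close> is killed by a power of \<open>t - \<theta>\<close>. Both conditions pass to tensor products.\<close>

locale weighted_frobenius = frobenius field_type q
  for field_type :: "'k::alg_closed_field itself" and q :: nat +
  fixes A :: "nat \<Rightarrow> nat \<Rightarrow> 'k poly" and r :: nat and w :: real and \<theta> :: 'k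
  assumes A_supp: "A i \<in> supp_below r" and r_pos: "0 < r" and w_pos: "0 < w"
    and degree_bounds: "\<exists>C\<ge>0. \<forall>g\<in>supp_below r. \<forall>k b. (deg_le b g \<longrightarrow> deg_le (b + real k * w + C) ((matrix_tau q r A ^^ k) g)) \<and>
     (deg_le b ((matrix_tau q r A ^^ k) g) \<longrightarrow> deg_le (b - real k * w + C) g)"
    and cokernel: "\<exists>k. \<forall>i<r. \<exists>f\<in>supp_below r. matrix_tau q r A f = unit_vec_poly i ([:- \<theta>, 1:] ^ k)"

context frobenius
begin

lemma frob_poly_smult: "frob_poly q (Polynomial.smult (c::'k) p) = Polynomial.smult (c ^ q) (frob_poly q p)"
  by (simp add: poly_eq_iff power_mult_distrib)

lemma frob_poly_pCons_0: "frob_poly q (pCons 0 (p :: 'k poly)) = pCons 0 (frob_poly q p)"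
  by (rule poly_eqI) (simp add: coeff_pCons split: nat.split)

lemma tau_t_module_matrix_tau: "tau_t_module (fscale :: 'k \<Rightarrow> _) q (matrix_tau q r A) t_shift"
proof (intro tau_t_module.intro tau_module.intro semilinear_operator.intro semilinear_operator_axioms.intro
    tau_t_module_axioms.intro frobenius_axioms)
  show "vector_space (fscale :: 'k \<Rightarrow> _)" by unfold_locales
  fix x y :: "nat \<Rightarrow> 'k poly" and c :: 'k
  show "matrix_tau q r A (x + y) = matrix_tau q r A x + matrix_tau q r A y"
    by (simp add: matrix_tau_def fun_eq_iff frob_poly_add distrib_left sum.distrib)
  show "matrix_tau q r A (fscale c x) = fscale (c ^ q ^ 1) (matrix_tau q r A x)"
    by (simp add: matrix_tau_def fun_eq_iff fscale_def frob_poly_smult tau_poly.scale_sum_right)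
  show "t_shift (x + y) = t_shift x + t_shift y" by (simp add: t_shift_def fun_eq_iff)
  show "t_shift (fscale c x) = fscale c (t_shift x)" by (simp add: t_shift_def fun_eq_iff fscale_def)
  have sh: "pCons 0 (\<Sum>i<r. f i) = (\<Sum>i<r. pCons 0 (f i :: 'k poly))" for f
    by (rule additive_sum[of "pCons 0"]) simp
  have "(\<Sum>i<r. A i a * pCons 0 (frob_poly q (x i))) = pCons 0 (\<Sum>i<r. A i a * frob_poly q (x i))" for a
    unfolding sh by simp
  thus "t_shift (matrix_tau q r A x) = matrix_tau q r A (t_shift x)"
    by (simp add: matrix_tau_def t_shift_def fun_eq_iff frob_poly_pCons_0)
qed

text \<open>The matrix \<open>A \<cdot> A\<^sup>(\<^sup>1\<^sup>) \<cdots> A\<^sup>(\<^sup>k\<^sup>-\<^sup>1\<^sup>)\<close> of \<open>\<tau>\<^sup>k\<close>, by its columns.\<close>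

definition tau_matrix_power :: "nat \<Rightarrow> (nat \<Rightarrow> nat \<Rightarrow> 'k poly) \<Rightarrow> nat \<Rightarrow> nat \<Rightarrow> (nat \<Rightarrow> 'k poly)" where
  "tau_matrix_power r A k i = (matrix_tau q r A ^^ k) (unit_vec_poly i 1)"

lemma tau_matrix_power_0: "tau_matrix_power r A 0 i a = (if a = i then 1 else 0)"
  by (simp add: tau_matrix_power_def unit_vec_poly_def)

lemma tau_matrix_power_Suc:
  "tau_matrix_power r A (Suc k) i a = (\<Sum>c<r. A c a * frob_poly q (tau_matrix_power r A k i c))"
  by (simp add: tau_matrix_power_def matrix_tau_def)

lemma matrix_tau_funpow:
  assumes f: "f \<in> supp_below r"
  shows "(matrix_tau q r A ^^ k) f = (\<lambda>a. \<Sum>i<r. tau_matrix_power r A k i a * (frob_poly q ^^ k) (f i))"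
proof (induction k)
  case 0
  show ?case
  proof
    fix a
    have "((matrix_tau q r A ^^ 0) f) a = (\<Sum>i<r. if i = a then f i else 0)"
      using supp_belowD[OF f, of a] by simp
    also have "\<dots> = (\<Sum>i<r. tau_matrix_power r A 0 i a * (frob_poly q ^^ 0) (f i))"
      by (intro sum.cong) (simp_all add: tau_matrix_power_0)
    finally show "((matrix_tau q r A ^^ 0) f) a = (\<Sum>i<r. tau_matrix_power r A 0 i a * (frob_poly q ^^ 0) (f i))" .
  qed
next
  case (Suc k)
  show ?case
  proof
    fix a
    have "(matrix_tau q r A ^^ Suc k) f a = (\<Sum>c<r. \<Sum>i<r. A c a * frob_poly q (tau_matrix_power r A k i c) * (frob_poly q ^^ Suc k) (f i))"
      unfolding funpow.simps(2) o_apply Suc.IH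
      by (simp add: matrix_tau_def frob_poly_sum frob_poly_mult sum_distrib_left mult.assoc)
    also have "\<dots> = (\<Sum>i<r. tau_matrix_power r A (Suc k) i a * (frob_poly q ^^ Suc k) (f i))"
      by (subst sum.swap) (simp add: tau_matrix_power_Suc sum_distrib_right)
    finally show "(matrix_tau q r A ^^ Suc k) f a = (\<Sum>i<r. tau_matrix_power r A (Suc k) i a * (frob_poly q ^^ Suc k) (f i))" .
  qed
qed

lemma matrix_tau_lincomb:
  fixes A :: "nat \<Rightarrow> nat \<Rightarrow> 'k poly"
  shows "matrix_tau q r A (\<Sum>i\<in>I. (\<lambda>a. p i * u i a)) = (\<Sum>i\<in>I. (\<lambda>a. frob_poly q (p i) * matrix_tau q r A (u i) a))"
proof
  fix a
  have "matrix_tau q r A (\<Sum>i\<in>I. (\<lambda>a. p i * u i a)) a = (\<Sum>c<r. \<Sum>i\<in>I. A c a * (frob_poly q (p i) * frob_poly q (u i c)))"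
    by (simp add: matrix_tau_def fscale_sum_apply frob_poly_sum frob_poly_mult sum_distrib_left)
  also have "\<dots> = (\<Sum>i\<in>I. frob_poly q (p i) * matrix_tau q r A (u i) a)"
    by (subst sum.swap) (simp add: matrix_tau_def sum_distrib_left mult.left_commute)
  finally show "matrix_tau q r A (\<Sum>i\<in>I. (\<lambda>a. p i * u i a)) a = (\<Sum>i\<in>I. (\<lambda>a. frob_poly q (p i) * matrix_tau q r A (u i) a)) a"
    by (simp only: fscale_sum_apply)
qed

end

context weighted_frobenius
begin

abbreviation \<tau> where "\<tau> \<equiv> matrix_tau q r A"

sublocale Y: tau_t_module fscale q \<tau> t_shift
  by (rule tau_t_module_matrix_tau)

lemma tau_supp: "\<tau> f \<in> supp_below r"
  using supp_belowD[OF A_supp] by (simp add: matrix_tau_def supp_below_def)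

lemma taun_supp: "f \<in> supp_below r \<Longrightarrow> (\<tau> ^^ k) f \<in> supp_below r"
  using tau_supp by (cases k) simp_all

lemma t_shift_supp: "f \<in> supp_below r \<Longrightarrow> t_shift f \<in> supp_below r"
  by (simp add: t_shift_def supp_below_def)

text \<open>Since \<open>(t - \<theta>)\<^sup>k K[t]\<^sup>r\<close> is contained in the image of \<open>\<tau>\<close>, division with remainder by \<open>(t - \<theta>)\<^sup>k\<close> in every
  coordinate gives representatives of bounded degree.\<close>

lemma remainder_mod_tau:
  "\<exists>k. \<forall>x\<in>supp_below r. \<exists>y\<in>supp_below r. deg_le (real k) (x - \<tau> y)"
proof -
  obtain k where k: "\<And>i. i < r \<Longrightarrow> \<exists>f\<in>supp_below r. \<tau> f = unit_vec_poly i ([:- \<theta>, 1:] ^ k)"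
    using cokernel by blast
  hence "\<forall>i. \<exists>f. i < r \<longrightarrow> (f \<in> supp_below r \<and> \<tau> f = unit_vec_poly i ([:- \<theta>, 1:] ^ k))" by blast
  from choice[OF this] obtain u where
    "\<forall>i. i < r \<longrightarrow> (u i \<in> supp_below r \<and> \<tau> (u i) = unit_vec_poly i ([:- \<theta>, 1:] ^ k))" ..
  hence u: "u i \<in> supp_below r" "\<tau> (u i) = unit_vec_poly i ([:- \<theta>, 1:] ^ k)" if "i < r" for i
    using that by blast+
  let ?g = "[:- \<theta>, 1:] ^ k"
  show ?thesis
  proof (intro exI[of _ k] ballI)
    fix x :: "nat \<Rightarrow> 'k poly" assume x: "x \<in> supp_below r"
    have "\<forall>p. \<exists>h. frob_poly q h = (p :: 'k poly)" using frob_poly_funpow_surj[of 1] by simp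
    from choice[OF this] obtain h where h: "\<And>p :: 'k poly. frob_poly q (h p) = p" by blast
    define y where "y = (\<Sum>i<r. (\<lambda>a. h (x i div ?g) * u i a))"
    have yS: "y \<in> supp_below r" unfolding y_def
    proof (rule fscale.subspace_sum[OF supp_below_sub])
      fix i assume "i \<in> {..<r}"
      hence "i < r" by simp
      thus "(\<lambda>a. h (x i div ?g) * u i a) \<in> supp_below r"
        using supp_belowD[OF u(1)] by (simp add: supp_below_def)
    qed
    have ty: "\<tau> y = (\<Sum>i<r. (\<lambda>a. (x i div ?g) * \<tau> (u i) a))"
      unfolding y_def by (simp only: matrix_tau_lincomb h)
    have ty': "\<tau> y a = (x a div ?g) * ?g" if "a < r" for a
    proof -
      have "\<tau> y a = (\<Sum>i<r. if i = a then (x i div ?g) * ?g else 0)"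
        unfolding ty fscale_sum_apply by (intro sum.cong) (simp_all add: u(2) unit_vec_poly_def)
      thus ?thesis using that by simp
    qed
    have "deg_le (real k) (x - \<tau> y)"
      unfolding deg_le_def
    proof (intro allI impI)
      fix a n assume c: "coeff ((x - \<tau> y) a) n \<noteq> 0"
      have dS: "x - \<tau> y \<in> supp_below r" by (rule fscale.subspace_diff[OF supp_below_sub x tau_supp])
      have a: "a < r" using c supp_belowD[OF dS, of a] by (cases "a < r") auto
      have "(x - \<tau> y) a = x a mod ?g" using ty'[OF a] by (simp add: minus_div_mult_eq_mod)
      moreover have "degree (x a mod ?g) \<le> k"
        using degree_mod_less'[of ?g "x a"] by (cases "x a mod ?g = 0") (simp_all add: degree_linear_power)
      ultimately show "real n \<le> real k" using le_degree[OF c] by simp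
    qed
    thus "\<exists>y\<in>supp_below r. deg_le (real k) (x - \<tau> y)" using yS by blast
  qed
qed

text \<open>The filtration counts the \<open>t\<close>-degree of \<open>\<tau>\<^sup>k f\<close> in the limit of large \<open>k\<close>: \<open>f\<close> lies in \<open>B m\<close> if eventually
  \<open>s deg (\<tau>\<^sup>k f) < m - c\<^sub>0 + k N\<close>. Passing to the limit makes \<open>\<tau>\<close> raise it by exactly \<open>N = s w\<close>, whereas the degree of \<open>f\<close>
  itself is raised only approximately. The degree bounds compare this filtration with the ordinary degree and give the
  finiteness conditions; the shift \<open>c\<^sub>0\<close> is chosen so that \<open>B 0\<close> vanishes.\<close>

lemma strictly_pure_basis_exists:
  assumes N: "0 < N" and s: "0 < s" and Ns: "real N = real s * w"
  shows "\<exists>d \<kappa> D. (\<forall>i<d. \<kappa> i \<in> supp_below r) \<and> (\<forall>x\<in>supp_below r. \<exists>f. x = (\<Sum>i<d::nat. poly_act fscale \<tau> (f i) (\<kappa> i))) \<and>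
     (\<forall>f. (\<Sum>i<d. poly_act fscale \<tau> (f i) (\<kappa> i)) = 0 \<longrightarrow> (\<forall>i<d. f i = 0)) \<and>
     (\<forall>i<d. (t_shift ^^ N) (\<kappa> i) = (\<Sum>j<d. poly_act fscale \<tau> (D i j) (\<kappa> j))) \<and>
     (\<forall>i<d. \<forall>j<d. \<forall>n>s. coeff (D i j) n = 0) \<and>
     (\<forall>c. (\<forall>j<d. (\<Sum>i<d. c i * coeff (D i j) s) = 0) \<longrightarrow> (\<forall>i<d. c i = 0))"
proof -
  obtain C where C: "C \<ge> 0"
    "\<And>g k b. g \<in> supp_below r \<Longrightarrow> deg_le b g \<Longrightarrow> deg_le (b + real k * w + C) ((\<tau> ^^ k) g)"
    "\<And>g k b. g \<in> supp_below r \<Longrightarrow> deg_le b ((\<tau> ^^ k) g) \<Longrightarrow> deg_le (b - real k * w + C) g"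
    using degree_bounds by blast
  define c0 where "c0 = \<lceil>real s * C\<rceil> + 1"
  define small :: "int \<Rightarrow> nat \<Rightarrow> (nat \<Rightarrow> 'k poly) \<Rightarrow> bool" where
    "small m k f \<longleftrightarrow> (\<forall>i n. coeff ((\<tau> ^^ k) f i) n \<noteq> 0 \<longrightarrow> int s * int n < m - c0 + int k * int N)" for m k f
  define B where "B m = {f \<in> supp_below r. \<exists>k0. \<forall>k\<ge>k0. small m k f}" for m
  have smallI: "f \<in> B m" if "f \<in> supp_below r" "\<And>k. k \<ge> k0 \<Longrightarrow> small m k f" for f m k0
    using that unfolding B_def by blast
  have B_supp: "f \<in> supp_below r" if "f \<in> B m" for f m using that unfolding B_def by blast
  have smallE: "\<exists>k0. \<forall>k\<ge>k0. small m k f" if "f \<in> B m" for f m using that unfolding B_def by blast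
  have B_lower: "deg_le ((real_of_int m - real_of_int c0) / real s + C) f" if f: "f \<in> B m" for f m
  proof -
    obtain k where k: "small m k f" using smallE[OF f] by blast
    let ?b = "(real_of_int m - real_of_int c0) / real s + real k * w"
    have "deg_le ?b ((\<tau> ^^ k) f)" unfolding deg_le_def
    proof (intro allI impI)
      fix i n assume "coeff ((\<tau> ^^ k) f i) n \<noteq> 0"
      hence "int s * int n < m - c0 + int k * int N" using k unfolding small_def by blast
      hence "real_of_int (int s * int n) < real_of_int (m - c0 + int k * int N)" by (simp only: of_int_less_iff)
      hence "real s * real n \<le> real_of_int m - real_of_int c0 + real k * (real s * w)" by (simp flip: Ns)
      moreover have "?b * real s = real_of_int m - real_of_int c0 + real k * (real s * w)"
        using s by (simp add: distrib_right)
      ultimately have "real n * real s \<le> ?b * real s" by (simp only: mult.commute)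
      thus "real n \<le> ?b" by (rule mult_right_le_imp_le) (use s in simp)
    qed
    from C(3)[OF B_supp[OF f] this] show ?thesis by simp
  qed
  have B_upper: "f \<in> B m" if f: "f \<in> supp_below r" "deg_le b f" and m: "real s * b + real s * C + real_of_int c0 < real_of_int m" for f b m
  proof (rule smallI[OF f(1), of 0])
    fix k
    show "small m k f" unfolding small_def
    proof (intro allI impI)
      fix i n assume "coeff ((\<tau> ^^ k) f i) n \<noteq> 0"
      hence "real n \<le> b + real k * w + C" using C(2)[OF f] unfolding deg_le_def by blast
      hence "real s * real n \<le> real s * (b + real k * w + C)" by (rule mult_left_mono) simp
      also have "\<dots> = real s * b + real s * C + real k * real N" by (simp add: Ns algebra_simps)
      finally have "real s * real n < real_of_int m - real_of_int c0 + real k * real N" using m by linarith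
      hence "real_of_int (int s * int n) < real_of_int (m - c0 + int k * int N)" by simp
      thus "int s * int n < m - c0 + int k * int N" by (simp only: of_int_less_iff)
    qed
  qed
  have B0: "f = 0" if f: "f \<in> B 0" for f
  proof
    fix i
    have "real s * C \<le> real_of_int c0 - 1" unfolding c0_def by linarith
    hence "C < real_of_int c0 / real s" using s by (simp add: pos_less_divide_eq mult.commute)
    hence neg: "(real_of_int 0 - real_of_int c0) / real s + C < 0" by simp
    have "coeff (f i) n = 0" for n
    proof (rule ccontr)
      assume "coeff (f i) n \<noteq> 0"
      hence "real n \<le> (real_of_int 0 - real_of_int c0) / real s + C"
        using B_lower[OF f] unfolding deg_le_def by blast
      thus False using neg by linarith
    qed
    thus "f i = 0 i" by (simp add: poly_eq_iff)
  qed
  interpret F: filtered_t_module fscale q \<tau> t_shift "supp_below r" B N s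
  proof
    show "fscale.subspace (supp_below r)" by (rule supp_below_sub)
    show "t_shift x \<in> supp_below r" if "x \<in> supp_below r" for x using that by (rule t_shift_supp)
    show "\<tau> x \<in> supp_below r" for x by (rule tau_supp)
    show "0 < N" "0 < s" by (rule N, rule s)
    show "B m \<subseteq> supp_below r" for m using B_supp by blast
    show "fscale.subspace (B m)" for m
    proof (rule fscale.subspaceI)
      have "small m k 0" for k by (simp only: small_def Y.Dn_0) simp
      thus "0 \<in> B m" by (intro smallI) simp_all
    next
      fix x y assume x: "x \<in> B m" and y: "y \<in> B m"
      obtain k1 where k1: "\<forall>k\<ge>k1. small m k x" using smallE[OF x] by blast
      obtain k2 where k2: "\<forall>k\<ge>k2. small m k y" using smallE[OF y] by blast
      have "small m k (x + y)" if k: "k \<ge> max k1 k2" for k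
        unfolding small_def Y.Dn_add
      proof (intro allI impI)
        fix i n assume "coeff (((\<tau> ^^ k) x + (\<tau> ^^ k) y) i) n \<noteq> 0"
        hence "coeff ((\<tau> ^^ k) x i) n \<noteq> 0 \<or> coeff ((\<tau> ^^ k) y i) n \<noteq> 0" by auto
        moreover have "small m k x" "small m k y" using k k1 k2 by simp_all
        ultimately show "int s * int n < m - c0 + int k * int N" unfolding small_def by blast
      qed
      thus "x + y \<in> B m"
        by (intro smallI[of _ "max k1 k2"] fscale.subspace_add[OF supp_below_sub] B_supp[OF x] B_supp[OF y])
    next
      fix c x assume x: "x \<in> B m"
      obtain k1 where k1: "\<forall>k\<ge>k1. small m k x" using smallE[OF x] by blast
      have "small m k (fscale c x)" if k: "k \<ge> k1" for k
        unfolding small_def Y.Dn_scale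
      proof (intro allI impI)
        fix i n assume "coeff (fscale (c ^ q ^ (1 * k)) ((\<tau> ^^ k) x) i) n \<noteq> 0"
        hence "coeff ((\<tau> ^^ k) x i) n \<noteq> 0" by (auto simp: fscale_def)
        moreover have "small m k x" using k k1 by simp
        ultimately show "int s * int n < m - c0 + int k * int N" unfolding small_def by blast
      qed
      thus "fscale c x \<in> B m"
        by (intro smallI[of _ k1] fscale.subspace_scale[OF supp_below_sub] B_supp[OF x])
    qed
    show "B m \<subseteq> B m'" if "m \<le> m'" for m m'
    proof
      fix x assume x: "x \<in> B m"
      obtain k1 where k1: "\<forall>k\<ge>k1. small m k x" using smallE[OF x] by blast
      have "small m' k x" if k: "k \<ge> k1" for k
        unfolding small_def
      proof (intro allI impI)
        fix i n assume "coeff ((\<tau> ^^ k) x i) n \<noteq> 0"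
        hence "int s * int n < m - c0 + int k * int N" using k k1 unfolding small_def by blast
        thus "int s * int n < m' - c0 + int k * int N" using \<open>m \<le> m'\<close> by linarith
      qed
      thus "x \<in> B m'" by (intro smallI[of _ k1] B_supp[OF x])
    qed
    show "t_shift x \<in> B (m + int s) \<longleftrightarrow> x \<in> B m" if x: "x \<in> supp_below r" for x m
    proof -
      have *: "small (m + int s) k (t_shift x) \<longleftrightarrow> small m k x" for k
      proof -
        have "(\<tau> ^^ k) (t_shift x) = t_shift ((\<tau> ^^ k) x)" by (rule Y.t_tau_funpow[symmetric])
        hence "small (m + int s) k (t_shift x) \<longleftrightarrow>
            (\<forall>i n. coeff (pCons 0 ((\<tau> ^^ k) x i)) n \<noteq> 0 \<longrightarrow> int s * int n < m + int s - c0 + int k * int N)"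
          by (simp add: small_def t_shift_def)
        also have "\<dots> \<longleftrightarrow> (\<forall>i n. coeff ((\<tau> ^^ k) x i) n \<noteq> 0 \<longrightarrow> int s * int (Suc n) < m + int s - c0 + int k * int N)"
        proof (intro iffI allI impI)
          fix i n assume a: "\<forall>i n. coeff (pCons 0 ((\<tau> ^^ k) x i)) n \<noteq> 0 \<longrightarrow> int s * int n < m + int s - c0 + int k * int N"
            and c: "coeff ((\<tau> ^^ k) x i) n \<noteq> 0"
          show "int s * int (Suc n) < m + int s - c0 + int k * int N"
            using a[rule_format, of i "Suc n"] c by simp
        next
          fix i n assume a: "\<forall>i n. coeff ((\<tau> ^^ k) x i) n \<noteq> 0 \<longrightarrow> int s * int (Suc n) < m + int s - c0 + int k * int N"
            and c: "coeff (pCons 0 ((\<tau> ^^ k) x i)) n \<noteq> 0"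
          obtain n' where n': "n = Suc n'" using c by (cases n) simp_all
          show "int s * int n < m + int s - c0 + int k * int N"
            using a[rule_format, of i n'] c unfolding n' by simp
        qed
        also have "\<dots> \<longleftrightarrow> small m k x"
        proof -
          have "int s * int (Suc n) < m + int s - c0 + int k * int N \<longleftrightarrow> int s * int n < m - c0 + int k * int N" for n
            by (simp add: algebra_simps)
          thus ?thesis unfolding small_def by simp
        qed
        finally show ?thesis .
      qed
      show ?thesis unfolding B_def using x t_shift_supp[OF x] * by simp
    qed
    show "\<tau> x \<in> B (m + int N) \<longleftrightarrow> x \<in> B m" if x: "x \<in> supp_below r" for x m
    proof -
      have *: "small (m + int N) k (\<tau> x) \<longleftrightarrow> small m (Suc k) x" for k
      proof -
        have "(\<tau> ^^ k) (\<tau> x) = (\<tau> ^^ Suc k) x" by (simp add: funpow_swap1)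
        moreover have "m + int N - c0 + int k * int N = m - c0 + int (Suc k) * int N" by (simp add: algebra_simps)
        ultimately show ?thesis unfolding small_def by (simp only:)
      qed
      show ?thesis
      proof
        assume "\<tau> x \<in> B (m + int N)"
        then obtain k0 where k0: "\<forall>k\<ge>k0. small (m + int N) k (\<tau> x)" using smallE by blast
        show "x \<in> B m"
        proof (rule smallI[OF x, of "Suc k0"])
          fix k assume "k \<ge> Suc k0"
          then obtain k' where "k = Suc k'" "k' \<ge> k0" by (cases k) auto
          thus "small m k x" using k0 * by blast
        qed
      next
        assume "x \<in> B m"
        then obtain k0 where k0: "\<forall>k\<ge>k0. small m k x" using smallE by blast
        show "\<tau> x \<in> B (m + int N)"
          by (rule smallI[OF tau_supp, of k0]) (use k0 * in simp)
      qed
    qed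
    show "B 0 = {0}"
    proof
      show "B 0 \<subseteq> {0}" using B0 by blast
      have "small 0 k 0" for k by (simp only: small_def Y.Dn_0) simp
      hence "0 \<in> B 0" by (intro smallI) simp_all
      thus "{0} \<subseteq> B 0" by blast
    qed
    show "\<exists>m. x \<in> B m" if x: "x \<in> supp_below r" for x
    proof -
      obtain b where b: "deg_le b x" using deg_le_exists[OF x] by blast
      have "x \<in> B (\<lfloor>real s * b + real s * C + real_of_int c0\<rfloor> + 1)"
        by (rule B_upper[OF x b]) linarith
      thus ?thesis ..
    qed
    show "\<exists>P. finite P \<and> B m \<subseteq> fscale.span P" for m
    proof -
      define b where "b = (real_of_int m - real_of_int c0) / real s + C"
      define m' where "m' = nat (\<lfloor>b\<rfloor> + 1)"
      let ?P = "(\<lambda>p. unit_vec_poly (fst p) (monom 1 (snd p)) :: nat \<Rightarrow> 'k poly) ` ({..<r} \<times> {..<m'})"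
      have "B m \<subseteq> fscale.span ?P"
      proof
        fix x assume x: "x \<in> B m"
        have "coeff (x k) i = 0" if "i \<ge> m'" for k i
        proof (rule ccontr)
          assume "coeff (x k) i \<noteq> 0"
          hence "real i \<le> b" using B_lower[OF x] unfolding deg_le_def b_def by blast
          thus False using that unfolding m'_def by linarith
        qed
        hence "x = (\<Sum>p\<in>{..<r} \<times> {..<m'}. fscale (coeff (x (fst p)) (snd p)) (unit_vec_poly (fst p) (monom 1 (snd p))))"
          by (rule vector_expand[OF B_supp[OF x]])
        also have "\<dots> \<in> fscale.span ?P"
          by (intro fscale.span_sum fscale.span_scale fscale.span_base imageI)
        finally show "x \<in> fscale.span ?P" .
      qed
      thus ?thesis by (intro exI[of _ ?P]) simp
    qed
    show "\<exists>c. \<forall>x\<in>supp_below r. \<exists>y\<in>supp_below r. x - t_shift (\<tau> y) \<in> B c"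
    proof -
      obtain k where k: "\<And>x. x \<in> supp_below r \<Longrightarrow> \<exists>y\<in>supp_below r. deg_le (real k) (x - \<tau> y)"
        using remainder_mod_tau by blast
      define c where "c = \<lfloor>real s * (real k + 1) + real s * C + real_of_int c0\<rfloor> + 1"
      show ?thesis
      proof (intro exI[of _ c] ballI)
        fix x :: "nat \<Rightarrow> 'k poly" assume x: "x \<in> supp_below r"
        define z where "z i = poly_shift 1 (x i)" for i
        have z: "z \<in> supp_below r" using supp_belowD[OF x] by (simp add: z_def supp_below_def)
        obtain y where y: "y \<in> supp_below r" "deg_le (real k) (z - \<tau> y)" using k[OF z] by blast
        have "x - t_shift (\<tau> y) \<in> B c"
        proof (rule B_upper)
          show "x - t_shift (\<tau> y) \<in> supp_below r"
            by (intro fscale.subspace_diff[OF supp_below_sub] x t_shift_supp tau_supp)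
          show "deg_le (real k + 1) (x - t_shift (\<tau> y))" unfolding deg_le_def
          proof (intro allI impI)
            fix i n assume c: "coeff ((x - t_shift (\<tau> y)) i) n \<noteq> 0"
            show "real n \<le> real k + 1"
            proof (cases n)
              case (Suc n')
              have "coeff ((z - \<tau> y) i) n' \<noteq> 0" using c by (simp add: Suc t_shift_def z_def coeff_poly_shift)
              hence "real n' \<le> real k" using y(2) unfolding deg_le_def by blast
              thus ?thesis using Suc by simp
            qed simp
          qed
          show "real s * (real k + 1) + real s * C + real_of_int c0 < real_of_int c"
            unfolding c_def by linarith
        qed
        thus "\<exists>y\<in>supp_below r. x - t_shift (\<tau> y) \<in> B c" using y(1) by blast
      qed
    qed
  qed
  obtain L where L: "F.good L" "F.V \<subseteq> F.emb_plus L" using F.good_complement_exists by blast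
  interpret G: complemented_t_module fscale q \<tau> t_shift "supp_below r" B N s L
    by unfold_locales (rule L)+
  show ?thesis by (rule G.strictly_pure_basis)
qed

end

text \<open>The pair \<open>(i, j)\<close> of indices is stored as \<open>i * r2 + j\<close>.\<close>

definition kronecker :: "nat \<Rightarrow> nat \<Rightarrow> (nat \<Rightarrow> nat \<Rightarrow> 'k::field poly) \<Rightarrow> (nat \<Rightarrow> nat \<Rightarrow> 'k poly) \<Rightarrow> nat \<Rightarrow> nat \<Rightarrow> 'k poly" where
  "kronecker r1 r2 A1 A2 = (\<lambda>i a. if a < r1 * r2 then A1 (i div r2) (a div r2) * A2 (i mod r2) (a mod r2) else 0)"

lemma sum_div_mod: "(\<Sum>p<r1 * r2. F (p div r2) (p mod r2)) = (\<Sum>i<r1. \<Sum>j<r2. F i (j::nat) :: 'b :: comm_monoid_add)"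
proof (cases "r2 = 0")
  case False
  have "(\<Sum>p<r1 * r2. F (p div r2) (p mod r2)) = (\<Sum>(i, j)\<in>{..<r1} \<times> {..<r2}. F i j)"
  proof (rule sum.reindex_bij_witness[of _ "\<lambda>(i, j). i * r2 + j" "\<lambda>p. (p div r2, p mod r2)"])
    fix x assume x: "x \<in> {..<r1} \<times> {..<r2}"
    then obtain i j where ij: "x = (i, j)" "i < r1" "j < r2" by auto
    have "i * r2 + j < (i + 1) * r2" using ij by simp
    also have "\<dots> \<le> r1 * r2" using ij by (intro mult_right_mono) simp_all
    finally show "(case x of (i, j) \<Rightarrow> i * r2 + j) \<in> {..<r1 * r2}" using ij by simp
    show "((case x of (i, j) \<Rightarrow> i * r2 + j) div r2, (case x of (i, j) \<Rightarrow> i * r2 + j) mod r2) = x"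
      using ij by simp
  next
    fix p assume "p \<in> {..<r1 * r2}"
    thus "(p div r2, p mod r2) \<in> {..<r1} \<times> {..<r2}" using False by (simp add: less_mult_imp_div_less)
  qed (use False in auto)
  thus ?thesis by (simp add: sum.cartesian_product)
qed simp


lemma index_pair_less: "a < r1 \<Longrightarrow> b < r2 \<Longrightarrow> a * r2 + b < r1 * (r2::nat)"
proof -
  assume "a < r1" "b < r2"
  hence "a * r2 + b < (a + 1) * r2" by simp
  also have "\<dots> \<le> r1 * r2" using \<open>a < r1\<close> by (intro mult_right_mono) simp_all
  finally show ?thesis .
qed

context frobenius
begin

lemma tau_matrix_power_kronecker:
  assumes "r2 > 0" "p' < r1 * r2" "p < r1 * r2"
  shows "tau_matrix_power (r1 * r2) (kronecker r1 r2 A1 A2) k p' p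
    = tau_matrix_power r1 A1 k (p' div r2) (p div r2) * tau_matrix_power r2 A2 k (p' mod r2) (p mod r2)"
  using assms(3)
proof (induction k arbitrary: p)
  case 0
  have "p = p' \<longleftrightarrow> p div r2 = p' div r2 \<and> p mod r2 = p' mod r2"
    by (metis div_mult_mod_eq)
  thus ?case by (simp add: tau_matrix_power_0)
next
  case (Suc k)
  let ?F = "\<lambda>i j. A1 i (p div r2) * frob_poly q (tau_matrix_power r1 A1 k (p' div r2) i)
     * (A2 j (p mod r2) * frob_poly q (tau_matrix_power r2 A2 k (p' mod r2) j))"
  have "tau_matrix_power (r1 * r2) (kronecker r1 r2 A1 A2) (Suc k) p' p
      = (\<Sum>c<r1 * r2. ?F (c div r2) (c mod r2))"
    unfolding tau_matrix_power_Suc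
  proof (rule sum.cong[OF refl])
    fix c assume "c \<in> {..<r1 * r2}"
    hence IH: "tau_matrix_power (r1 * r2) (kronecker r1 r2 A1 A2) k p' c
        = tau_matrix_power r1 A1 k (p' div r2) (c div r2) * tau_matrix_power r2 A2 k (p' mod r2) (c mod r2)"
      by (intro Suc.IH) simp
    have "kronecker r1 r2 A1 A2 c p = A1 (c div r2) (p div r2) * A2 (c mod r2) (p mod r2)"
      by (simp add: kronecker_def Suc.prems)
    thus "kronecker r1 r2 A1 A2 c p * frob_poly q (tau_matrix_power (r1 * r2) (kronecker r1 r2 A1 A2) k p' c)
        = ?F (c div r2) (c mod r2)"
      unfolding IH by (simp only: frob_poly_mult mult_ac)
  qed
  also have "\<dots> = (\<Sum>i<r1. \<Sum>j<r2. ?F i j)" by (rule sum_div_mod)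
  also have "\<dots> = tau_matrix_power r1 A1 (Suc k) (p' div r2) (p div r2) * tau_matrix_power r2 A2 (Suc k) (p' mod r2) (p mod r2)"
    unfolding tau_matrix_power_Suc by (rule sum_product[symmetric])
  finally show ?case .
qed

text \<open>The power \<open>\<tau>\<^sup>k\<close> of the tensor product first acts like \<open>\<tau>\<^sup>k\<close> of the first factor on every column. Undoing the
  twist of the coefficients, it then acts like \<open>\<tau>\<^sup>k\<close> of the second factor on every row.\<close>

lemma kronecker_rows:
  fixes f :: "nat \<Rightarrow> 'k poly" and A1 A2 :: "nat \<Rightarrow> nat \<Rightarrow> 'k poly"
  assumes r2: "r2 > 0" and f: "f \<in> supp_below (r1 * r2)"
  shows "\<exists>y. (\<forall>a::nat. y a \<in> supp_below r2) \<and>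
    (\<forall>a. \<forall>j<r2. (frob_poly q ^^ k) (y a j) = (matrix_tau q r1 A1 ^^ k) (\<lambda>i. if i < r1 then f (i * r2 + j) else 0) a) \<and>
    (\<forall>p<r1 * r2. (matrix_tau q (r1 * r2) (kronecker r1 r2 A1 A2) ^^ k) f p
      = (matrix_tau q r2 A2 ^^ k) (y (p div r2)) (p mod r2))"
proof -
  let ?A = "kronecker r1 r2 A1 A2"
  define col where "col j = (\<lambda>i. if i < r1 then f (i * r2 + j) else 0)" for j
  have colS: "col j \<in> supp_below r1" for j by (simp add: col_def supp_below_def)
  have "\<forall>p. \<exists>h. (frob_poly q ^^ k) h = (p :: 'k poly)" using frob_poly_funpow_surj by blast
  from choice[OF this] obtain h where h: "\<forall>p :: 'k poly. (frob_poly q ^^ k) (h p) = p" ..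
  define y :: "nat \<Rightarrow> nat \<Rightarrow> 'k poly" where "y a = (\<lambda>j. if j < r2 then h ((matrix_tau q r1 A1 ^^ k) (col j) a) else 0)" for a
  have yS: "y a \<in> supp_below r2" for a by (simp add: y_def supp_below_def)
  have fy: "(frob_poly q ^^ k) (y a j) = (matrix_tau q r1 A1 ^^ k) (col j) a" if "j < r2" for a j
    using that h by (simp add: y_def)
  have "(matrix_tau q (r1 * r2) ?A ^^ k) f p = (matrix_tau q r2 A2 ^^ k) (y (p div r2)) (p mod r2)"
    if p: "p < r1 * r2" for p
  proof -
    let ?F = "\<lambda>i j. tau_matrix_power r1 A1 k i (p div r2) * tau_matrix_power r2 A2 k j (p mod r2) * (frob_poly q ^^ k) (f (i * r2 + j))"
    have "(matrix_tau q (r1 * r2) ?A ^^ k) f p = (\<Sum>p'<r1 * r2. ?F (p' div r2) (p' mod r2))"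
      unfolding matrix_tau_funpow[OF f]
      by (intro sum.cong refl) (simp add: tau_matrix_power_kronecker[OF r2 _ p])
    also have "\<dots> = (\<Sum>i<r1. \<Sum>j<r2. ?F i j)" by (rule sum_div_mod)
    also have "\<dots> = (\<Sum>j<r2. \<Sum>i<r1. ?F i j)" by (rule sum.swap)
    also have "\<dots> = (\<Sum>j<r2. tau_matrix_power r2 A2 k j (p mod r2) * (frob_poly q ^^ k) (y (p div r2) j))"
    proof (rule sum.cong[OF refl])
      fix j assume "j \<in> {..<r2}"
      hence "(frob_poly q ^^ k) (y (p div r2) j) = (\<Sum>i<r1. tau_matrix_power r1 A1 k i (p div r2) * (frob_poly q ^^ k) (f (i * r2 + j)))"
        by (simp add: fy matrix_tau_funpow[OF colS]) (simp add: col_def)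
      thus "(\<Sum>i<r1. ?F i j) = tau_matrix_power r2 A2 k j (p mod r2) * (frob_poly q ^^ k) (y (p div r2) j)"
        by (simp add: sum_distrib_left mult_ac)
    qed
    also have "\<dots> = (matrix_tau q r2 A2 ^^ k) (y (p div r2)) (p mod r2)"
      by (simp only: matrix_tau_funpow[OF yS])
    finally show ?thesis .
  qed
  thus ?thesis using yS fy unfolding col_def by (intro exI[of _ y]) simp
qed

end

text \<open>Applying \<open>\<tau>\<^sup>k\<close> first along the columns and then along the rows adds the two degree bounds, so the weights add up. A
  power of \<open>t - \<theta>\<close> that works for the tensor product is the product of powers that work for the factors.\<close>

lemma weighted_frobenius_kronecker:
  fixes A1 A2 :: "nat \<Rightarrow> nat \<Rightarrow> 'k::alg_closed_field poly"
  assumes W1: "weighted_frobenius q A1 r1 w1 \<theta>" and W2: "weighted_frobenius q A2 r2 w2 \<theta>"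
  shows "weighted_frobenius q (kronecker r1 r2 A1 A2) (r1 * r2) (w1 + w2) \<theta>"
proof -
  interpret W1: weighted_frobenius "TYPE('k)" q A1 r1 w1 \<theta> by (rule W1)
  interpret W2: weighted_frobenius "TYPE('k)" q A2 r2 w2 \<theta> by (rule W2)
  note r2 = W2.r_pos
  let ?A = "kronecker r1 r2 A1 A2" and ?R = "r1 * r2"
  have AS: "?A i \<in> supp_below ?R" for i by (simp add: kronecker_def supp_below_def)
  have mS: "matrix_tau q ?R ?A f \<in> supp_below ?R" for f
    using supp_belowD[OF AS] by (simp add: matrix_tau_def supp_below_def)
  have mkS: "(matrix_tau q ?R ?A ^^ k) f \<in> supp_below ?R" if "f \<in> supp_below ?R" for f k
    using that mS by (cases k) simp_all
  obtain C1 where C1: "C1 \<ge> 0"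
    "\<And>g k b. g \<in> supp_below r1 \<Longrightarrow> deg_le b g \<Longrightarrow> deg_le (b + real k * w1 + C1) ((matrix_tau q r1 A1 ^^ k) g)"
    "\<And>g k b. g \<in> supp_below r1 \<Longrightarrow> deg_le b ((matrix_tau q r1 A1 ^^ k) g) \<Longrightarrow> deg_le (b - real k * w1 + C1) g"
    using W1.degree_bounds by blast
  obtain C2 where C2: "C2 \<ge> 0"
    "\<And>g k b. g \<in> supp_below r2 \<Longrightarrow> deg_le b g \<Longrightarrow> deg_le (b + real k * w2 + C2) ((matrix_tau q r2 A2 ^^ k) g)"
    "\<And>g k b. g \<in> supp_below r2 \<Longrightarrow> deg_le b ((matrix_tau q r2 A2 ^^ k) g) \<Longrightarrow> deg_le (b - real k * w2 + C2) g"
    using W2.degree_bounds by blast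
  show ?thesis
  proof (intro weighted_frobenius.intro weighted_frobenius_axioms.intro W1.frobenius_axioms AS)
    show "0 < ?R" using W1.r_pos W2.r_pos by simp
    show "0 < w1 + w2" using W1.w_pos W2.w_pos by simp
    show "\<exists>C\<ge>0. \<forall>g\<in>supp_below ?R. \<forall>k b. (deg_le b g \<longrightarrow> deg_le (b + real k * (w1 + w2) + C) ((matrix_tau q ?R ?A ^^ k) g)) \<and>
       (deg_le b ((matrix_tau q ?R ?A ^^ k) g) \<longrightarrow> deg_le (b - real k * (w1 + w2) + C) g)"
    proof (intro exI[of _ "C1 + C2"] conjI ballI allI)
      show "0 \<le> C1 + C2" using C1(1) C2(1) by simp
      fix f :: "nat \<Rightarrow> 'k poly" and k b assume f: "f \<in> supp_below ?R"
      define col where "col j = (\<lambda>i. if i < r1 then f (i * r2 + j) else 0)" for j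
      have colS: "col j \<in> supp_below r1" for j by (simp add: col_def supp_below_def)
      obtain y where yS: "\<And>a. y a \<in> supp_below r2"
        and fy: "\<And>a j. j < r2 \<Longrightarrow> (frob_poly q ^^ k) (y a j) = (matrix_tau q r1 A1 ^^ k) (col j) a"
        and ty: "\<And>p. p < ?R \<Longrightarrow> (matrix_tau q ?R ?A ^^ k) f p = (matrix_tau q r2 A2 ^^ k) (y (p div r2)) (p mod r2)"
        using W1.kronecker_rows[OF r2 f, of k A1 A2] unfolding col_def by blast
      have cy: "coeff ((matrix_tau q r1 A1 ^^ k) (col j) a) n = coeff (y a j) n ^ (q ^ k)" if "j < r2" for a j n
        using fy[OF that, of a] by (metis W1.coeff_frob_poly_funpow)
      show "deg_le b f \<longrightarrow> deg_le (b + real k * (w1 + w2) + (C1 + C2)) ((matrix_tau q ?R ?A ^^ k) f)"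
      proof
        assume b: "deg_le b f"
        have "deg_le (b + real k * w1 + C1) (y a)" for a
          unfolding deg_le_def
        proof (intro allI impI)
          fix j n assume c: "coeff (y a j) n \<noteq> 0"
          have j: "j < r2" using c supp_belowD[OF yS, of j a] by (cases "j < r2") auto
          have "deg_le b (col j)" using b unfolding deg_le_def col_def by simp
          hence "deg_le (b + real k * w1 + C1) ((matrix_tau q r1 A1 ^^ k) (col j))" by (rule C1(2)[OF colS])
          moreover have "coeff ((matrix_tau q r1 A1 ^^ k) (col j) a) n \<noteq> 0" using c cy[OF j] by simp
          ultimately show "real n \<le> b + real k * w1 + C1" unfolding deg_le_def by blast
        qed
        hence up: "deg_le (b + real k * w1 + C1 + real k * w2 + C2) ((matrix_tau q r2 A2 ^^ k) (y a))" for a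
          by (rule C2(2)[OF yS])
        show "deg_le (b + real k * (w1 + w2) + (C1 + C2)) ((matrix_tau q ?R ?A ^^ k) f)"
          unfolding deg_le_def
        proof (intro allI impI)
          fix p n assume c: "coeff ((matrix_tau q ?R ?A ^^ k) f p) n \<noteq> 0"
          have p: "p < ?R" using c supp_belowD[OF mkS[OF f], of p k] by (cases "p < ?R") auto
          have "real n \<le> b + real k * w1 + C1 + real k * w2 + C2"
            using up c unfolding ty[OF p] deg_le_def by blast
          thus "real n \<le> b + real k * (w1 + w2) + (C1 + C2)" by (simp add: distrib_left)
        qed
      qed
      show "deg_le b ((matrix_tau q ?R ?A ^^ k) f) \<longrightarrow> deg_le (b - real k * (w1 + w2) + (C1 + C2)) f"
      proof
        assume b: "deg_le b ((matrix_tau q ?R ?A ^^ k) f)"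
        have y_le: "deg_le (b - real k * w2 + C2) (y a)" if a: "a < r1" for a
        proof (rule C2(3)[OF yS])
          show "deg_le b ((matrix_tau q r2 A2 ^^ k) (y a))" unfolding deg_le_def
          proof (intro allI impI)
            fix j n assume c: "coeff ((matrix_tau q r2 A2 ^^ k) (y a) j) n \<noteq> 0"
            have j: "j < r2" using c supp_belowD[OF W2.taun_supp[OF yS], of j k a] by (cases "j < r2") auto
            have "(matrix_tau q ?R ?A ^^ k) f (a * r2 + j) = (matrix_tau q r2 A2 ^^ k) (y a) j"
              using ty[OF index_pair_less[OF a j]] j by simp
            hence "coeff ((matrix_tau q ?R ?A ^^ k) f (a * r2 + j)) n \<noteq> 0" using c by simp
            thus "real n \<le> b" using b unfolding deg_le_def by blast
          qed
        qed
        have col_le: "deg_le (b - real k * w2 + C2 - real k * w1 + C1) (col j)" if j: "j < r2" for j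
        proof (rule C1(3)[OF colS])
          show "deg_le (b - real k * w2 + C2) ((matrix_tau q r1 A1 ^^ k) (col j))" unfolding deg_le_def
          proof (intro allI impI)
            fix a n assume c: "coeff ((matrix_tau q r1 A1 ^^ k) (col j) a) n \<noteq> 0"
            have a: "a < r1" using c supp_belowD[OF W1.taun_supp[OF colS], of a k j] by (cases "a < r1") auto
            have "coeff (y a j) n \<noteq> 0" using c cy[OF j] by auto
            thus "real n \<le> b - real k * w2 + C2" using y_le[OF a] unfolding deg_le_def by blast
          qed
        qed
        show "deg_le (b - real k * (w1 + w2) + (C1 + C2)) f" unfolding deg_le_def
        proof (intro allI impI)
          fix p n assume c: "coeff (f p) n \<noteq> 0"
          have p: "p < ?R" using c supp_belowD[OF f, of p] by (cases "p < ?R") auto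
          have "p div r2 < r1" "p mod r2 < r2" using p r2 by (simp_all add: less_mult_imp_div_less)
          hence "col (p mod r2) (p div r2) = f p" by (simp add: col_def)
          hence "coeff (col (p mod r2) (p div r2)) n \<noteq> 0" using c by simp
          hence "real n \<le> b - real k * w2 + C2 - real k * w1 + C1"
            using col_le[OF \<open>p mod r2 < r2\<close>] unfolding deg_le_def by blast
          thus "real n \<le> b - real k * (w1 + w2) + (C1 + C2)" by (simp add: distrib_left)
        qed
      qed
    qed
    show "\<exists>k. \<forall>i<?R. \<exists>f\<in>supp_below ?R. matrix_tau q ?R ?A f = unit_vec_poly i ([:- \<theta>, 1:] ^ k)"
    proof -
      obtain k1 where k1: "\<And>i. i < r1 \<Longrightarrow> \<exists>f\<in>supp_below r1. matrix_tau q r1 A1 f = unit_vec_poly i ([:- \<theta>, 1:] ^ k1)"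
        using W1.cokernel by blast
      obtain k2 where k2: "\<And>i. i < r2 \<Longrightarrow> \<exists>f\<in>supp_below r2. matrix_tau q r2 A2 f = unit_vec_poly i ([:- \<theta>, 1:] ^ k2)"
        using W2.cokernel by blast
      show ?thesis
      proof (intro exI[of _ "k1 + k2"] allI impI)
        fix p assume p: "p < ?R"
        have pd: "p div r2 < r1" "p mod r2 < r2" using p r2 by (simp_all add: less_mult_imp_div_less)
        obtain f1 where f1: "f1 \<in> supp_below r1" "matrix_tau q r1 A1 f1 = unit_vec_poly (p div r2) ([:- \<theta>, 1:] ^ k1)"
          using k1[OF pd(1)] by blast
        obtain f2 where f2: "f2 \<in> supp_below r2" "matrix_tau q r2 A2 f2 = unit_vec_poly (p mod r2) ([:- \<theta>, 1:] ^ k2)"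
          using k2[OF pd(2)] by blast
        define f where "f c = (if c < ?R then f1 (c div r2) * f2 (c mod r2) else 0)" for c
        have fS: "f \<in> supp_below ?R" by (simp add: f_def supp_below_def)
        have "matrix_tau q ?R ?A f a = unit_vec_poly p ([:- \<theta>, 1:] ^ (k1 + k2)) a" for a
        proof (cases "a < ?R")
          case False
          thus ?thesis using supp_belowD[OF mS, of a f] p by (auto simp: unit_vec_poly_def)
        next
          case True
          let ?F = "\<lambda>i j. A1 i (a div r2) * frob_poly q (f1 i) * (A2 j (a mod r2) * frob_poly q (f2 j))"
          have "matrix_tau q ?R ?A f a = (\<Sum>c<?R. ?F (c div r2) (c mod r2))"
            unfolding matrix_tau_def
            by (intro sum.cong refl) (simp add: kronecker_def f_def True W1.frob_poly_mult mult_ac)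
          also have "\<dots> = (\<Sum>i<r1. \<Sum>j<r2. ?F i j)" by (rule sum_div_mod)
          also have "\<dots> = matrix_tau q r1 A1 f1 (a div r2) * matrix_tau q r2 A2 f2 (a mod r2)"
            unfolding matrix_tau_def by (rule sum_product[symmetric])
          also have "\<dots> = unit_vec_poly p ([:- \<theta>, 1:] ^ (k1 + k2)) a"
          proof -
            have "a = p \<longleftrightarrow> a div r2 = p div r2 \<and> a mod r2 = p mod r2" by (metis div_mult_mod_eq)
            thus ?thesis unfolding f1(2) f2(2) by (simp add: unit_vec_poly_def power_add)
          qed
          finally show ?thesis .
        qed
        hence "matrix_tau q ?R ?A f = unit_vec_poly p ([:- \<theta>, 1:] ^ (k1 + k2))" by (rule ext)
        thus "\<exists>f\<in>supp_below ?R. matrix_tau q ?R ?A f = unit_vec_poly p ([:- \<theta>, 1:] ^ (k1 + k2))"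
          using fS by blast
      qed
    qed
  qed
qed

lemma (in pure_motive) weighted_frobenius: "weighted_frobenius q A r w \<theta>"
  by (intro weighted_frobenius.intro weighted_frobenius_axioms.intro frobenius_axioms A_supp r_pos w_pos
      matrix_tau_degree cokernel)

section \<open>The motive of a t-module\<close>

declare One_nat_def [simp del]

definition row_fun :: "nat \<Rightarrow> 'k::field poly mat \<Rightarrow> (nat \<Rightarrow> 'k poly)" where
  "row_fun d x = (\<lambda>j. if j < d then x $$ (0, j) else 0)"

definition fun_row :: "nat \<Rightarrow> (nat \<Rightarrow> 'k::field poly) \<Rightarrow> 'k poly mat" where
  "fun_row d f = mat 1 d (\<lambda>(i, j). f j)"

definition mat_fun :: "'a mat \<Rightarrow> nat \<Rightarrow> nat \<Rightarrow> 'a" where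
  "mat_fun A i j = A $$ (i, j)"

lemma row_fun_supp: "row_fun d x \<in> supp_below d"
  by (simp add: row_fun_def supp_below_def)

lemma fun_row_carrier [simp]: "fun_row d f \<in> carrier_mat 1 d"
  by (simp add: fun_row_def)

lemma row_fun_fun_row: "f \<in> supp_below d \<Longrightarrow> row_fun d (fun_row d f) = f"
  by (rule ext) (simp add: row_fun_def fun_row_def supp_below_def)

lemma fun_row_row_fun: "x \<in> carrier_mat 1 d \<Longrightarrow> fun_row d (row_fun d x) = x"
  by (rule eq_matI) (auto simp: row_fun_def fun_row_def)

lemma bij_betw_row_fun: "bij_betw (row_fun d) (carrier_mat 1 d) (supp_below d)"
  by (rule bij_betwI[where g = "fun_row d"]) (simp_all add: row_fun_supp row_fun_fun_row fun_row_row_fun Pi_def)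

lemma row_fun_add:
  "x \<in> carrier_mat 1 d \<Longrightarrow> y \<in> carrier_mat 1 d \<Longrightarrow> row_fun d (x + y) = row_fun d x + row_fun d y"
  by (rule ext) (simp add: row_fun_def)

lemma row_fun_zero: "row_fun d (0\<^sub>m 1 d) = 0"
  by (rule ext) (simp add: row_fun_def)

lemma row_fun_mult:
  assumes "x \<in> carrier_mat 1 d" "A \<in> carrier_mat d d"
  shows "skew_mat_mult q x A \<in> carrier_mat 1 d"
    and "row_fun d (skew_mat_mult q x A) = row_mult q d (mat_fun A) (row_fun d x)"
  using assms by (auto simp: skew_mat_mult_def row_fun_def row_mult_def mat_fun_def fun_eq_iff)

lemma row_fun_mult_funpow:
  assumes "x \<in> carrier_mat 1 d" "A \<in> carrier_mat d d"
  shows "((\<lambda>y. skew_mat_mult q y A) ^^ n) x \<in> carrier_mat 1 d"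
    and "row_fun d (((\<lambda>y. skew_mat_mult q y A) ^^ n) x) = (row_mult q d (mat_fun A) ^^ n) (row_fun d x)"
  using assms by (induction n) (simp_all add: row_fun_mult)

context frobenius
begin

lemma poly_act_vec_tau:
  "poly_act fscale (vec_tau q) f g = (\<lambda>j. skew_mult q f (g j :: 'k poly))"
proof
  fix j
  have "(vec_tau q ^^ i) g = (\<lambda>j. (tau_poly q ^^ i) (g j))" for i
    by (induction i) (simp_all add: vec_tau_def)
  thus "poly_act fscale (vec_tau q) f g j = skew_mult q f (g j)"
    by (simp add: poly_act_def fscale_sum_apply skew_mult_eq_act fscale_def)
qed

lemma motive_smult:
  fixes \<phi> :: "'k poly \<Rightarrow> 'k poly mat"
  assumes \<phi>: "\<phi> [:0, 1:] \<in> carrier_mat d d" and x: "x \<in> carrier_mat 1 d"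
  shows "a \<odot>\<^bsub>motive q d \<phi>\<^esub> x \<in> carrier_mat 1 d"
    and "row_fun d (a \<odot>\<^bsub>motive q d \<phi>\<^esub> x)
      = skew_act fscale (vec_tau q) (row_mult q d (mat_fun (\<phi> [:0, 1:]))) q a (row_fun d x)"
proof -
  let ?M = "module_mat TYPE('k poly) 1 d"
  let ?y = "\<lambda>j. ((\<lambda>y. skew_mat_mult q y (\<phi> [:0, 1:])) ^^ j) x"
  have am: "abelian_monoid ?M" using abelian_group_mat[where 'a = "'k poly", of 1 d] by (simp add: abelian_group_def)
  have c: "map_mat (skew_mult q (a j)) (?y j) \<in> carrier ?M" for j
    using row_fun_mult_funpow(1)[OF x \<phi>] by (simp add: module_mat_simps)
  have eq: "a \<odot>\<^bsub>motive q d \<phi>\<^esub> x = finsum ?M (\<lambda>j. map_mat (skew_mult q (a j)) (?y j)) {..deg (skew_ring q) a}"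
    by (simp add: motive_def)
  have "finsum ?M (\<lambda>j. map_mat (skew_mult q (a j)) (?y j)) {..deg (skew_ring q) a} \<in> carrier ?M"
    by (rule abelian_monoid.finsum_closed[OF am]) (use c in blast)
  thus "a \<odot>\<^bsub>motive q d \<phi>\<^esub> x \<in> carrier_mat 1 d" unfolding eq by (simp add: module_mat_simps)
  have "row_fun d (finsum ?M (\<lambda>j. map_mat (skew_mult q (a j)) (?y j)) {..deg (skew_ring q) a})
      = (\<Sum>j\<le>deg (skew_ring q) a. row_fun d (map_mat (skew_mult q (a j)) (?y j)))"
  proof (rule finsum_transport[OF am])
    show "row_fun d \<zero>\<^bsub>?M\<^esub> = 0" by (simp only: module_mat_simps row_fun_zero)
    show "row_fun d (x \<oplus>\<^bsub>?M\<^esub> y) = row_fun d x + row_fun d y" if "x \<in> carrier ?M" "y \<in> carrier ?M" for x y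
      using that unfolding module_mat_simps by (rule row_fun_add)
  qed (rule c)
  also have "\<dots> = (\<Sum>j\<le>deg (skew_ring q) a. poly_act fscale (vec_tau q) (a j) (row_fun d (?y j)))"
  proof (rule sum.cong[OF refl])
    fix j
    show "row_fun d (map_mat (skew_mult q (a j)) (?y j)) = poly_act fscale (vec_tau q) (a j) (row_fun d (?y j))"
      using row_fun_mult_funpow(1)[OF x \<phi>, where n = j and q = q]
      by (auto simp: poly_act_vec_tau row_fun_def fun_eq_iff)
  qed
  finally show "row_fun d (a \<odot>\<^bsub>motive q d \<phi>\<^esub> x)
      = skew_act fscale (vec_tau q) (row_mult q d (mat_fun (\<phi> [:0, 1:]))) q a (row_fun d x)"
    unfolding eq skew_act_def row_fun_mult_funpow(2)[OF x \<phi>] .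
qed

lemma left_module_motive:
  fixes \<phi> :: "'k poly \<Rightarrow> 'k poly mat"
  assumes \<phi>: "\<phi> [:0, 1:] \<in> carrier_mat d d"
  shows "left_module (skew_ring_t q) (motive q d \<phi>)"
proof -
  interpret X: tau_t_module fscale q "vec_tau q" "row_mult q d (mat_fun (\<phi> [:0, 1:]))"
    by (rule tau_t_module_row_mult)
  have C: "carrier (motive q d \<phi>) = carrier_mat 1 d" and Z: "\<zero>\<^bsub>motive q d \<phi>\<^esub> = 0\<^sub>m 1 d"
    and P: "\<And>x y. x \<oplus>\<^bsub>motive q d \<phi>\<^esub> y = x + y" by (simp_all add: motive_def)
  show ?thesis
  proof (rule left_module_transport[where \<Theta> = "row_fun d" and S = "supp_below d"
        and act = "skew_act fscale (vec_tau q) (row_mult q d (mat_fun (\<phi> [:0, 1:]))) q"])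
    show "bij_betw (row_fun d) (carrier (motive q d \<phi>)) (supp_below d)"
      unfolding C by (rule bij_betw_row_fun)
    show "- x \<in> supp_below d" if "x \<in> supp_below d" for x :: "nat \<Rightarrow> 'k poly"
      using that by (simp add: supp_below_def)
  qed (simp_all add: C Z P row_fun_zero row_fun_add motive_smult[where \<phi> = \<phi>, OF \<phi>] ring_skew_ring_t
      X.skew_act_add_left X.skew_act_add_right X.skew_act_mult X.skew_act_one)
qed

definition K_t_elem :: "'k poly \<Rightarrow> (nat \<Rightarrow> 'k poly)" where
  "K_t_elem p = (\<lambda>j. [:coeff p j:])"

lemma K_t_elem_carrier: "K_t_elem p \<in> carrier (skew_ring_t q)"
  by (auto simp: K_t_elem_def carrier_skew_ring_t intro!: exI[of _ "degree p"] coeff_eq_0)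

lemma K_t_elem_K_t: "K_t_elem p \<in> K_t q"
  using K_t_elem_carrier by (simp add: K_t_def K_t_elem_def)

lemma K_t_elem_inj: "K_t_elem p = K_t_elem p' \<Longrightarrow> p = p'"
  by (rule poly_eqI) (auto simp: K_t_elem_def fun_eq_iff)

lemma K_t_elem_surj:
  assumes "a \<in> K_t q"
  shows "\<exists>p. K_t_elem p = (a :: nat \<Rightarrow> 'k poly)"
proof -
  obtain n where n: "\<And>m. m > n \<Longrightarrow> a m = 0" using assms by (auto simp: K_t_def carrier_skew_ring_t)
  have d: "degree (a j) = 0" for j using assms by (simp add: K_t_def)
  have "coeff (\<Sum>i\<le>n. monom (coeff (a i) 0) i) j = coeff (a j) 0" for j
    using n[of j] by (cases "j \<le> n") (auto simp: coeff_sum)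
  moreover have "[:coeff (a j) 0:] = a j" for j
    by (rule degree_eq_zeroE[OF d[of j]]) simp
  ultimately have "K_t_elem (\<Sum>i\<le>n. monom (coeff (a i) 0) i) = a"
    unfolding K_t_elem_def by (simp add: fun_eq_iff)
  thus ?thesis ..
qed

end

context tau_t_module
begin

lemma skew_act_K_t_elem: "skew_act scale \<tau> t q (K_t_elem p) x = poly_act scale t p x"
proof -
  have "skew_act scale \<tau> t q (K_t_elem p) x = (\<Sum>j\<le>degree p. poly_act scale \<tau> (K_t_elem p j) ((t ^^ j) x))"
    by (rule skew_act_bound[OF K_t_elem_carrier]) (simp add: K_t_elem_def coeff_eq_0)
  thus ?thesis by (simp add: K_t_elem_def poly_act_def[of scale t])
qed

end

lemma (in frobenius) const_coeff_skew_mult: "coeff (skew_mult q f g) 0 = coeff f 0 * coeff (g :: 'k poly) 0"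
proof -
  obtain c h where f: "f = pCons c h" by (cases f) auto
  have "skew_mult q (pCons c h) g = Polynomial.smult c g + skew_mult q h (tau_poly q g)"
    by (simp add: skew_mult_eq_act tau_poly.poly_act_pCons_right)
  moreover have "coeff (skew_mult q h (tau_poly q g)) 0 = 0"
    by (simp add: skew_mult_eq_act poly_act_def coeff_sum coeff_tau_poly_funpow funpow_swap1[symmetric] flip: funpow.simps(2))
       (simp add: coeff_tau_poly_funpow coeff_tau_poly)
  ultimately show ?thesis by (simp add: f)
qed

locale motive_setting =
  fixes F :: "'k::alg_closed_field set" and q :: nat and \<theta> :: 'k and d :: nat and \<phi> :: "'k poly \<Rightarrow> 'k poly mat"
  assumes F: "subfield F (ring_of_type_algebra :: 'k ring)" and finF: "finite F" and q: "q = card F"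
    and tm: "t_module F \<theta> d \<phi>" and asp: "almost_strictly_pure \<phi>"
begin

sublocale frobenius "TYPE('k)" q
  unfolding q by (rule frobenius_card_subfield[OF F finF])

lemma d_pos: "0 < d" and hom: "\<phi> \<in> Ring.ring_hom (poly_ring_over F) (skew_mat_ring q d)"
  and nil: "\<exists>k. (coeff_mat (\<phi> [:0, 1:]) 0 - \<theta> \<cdot>\<^sub>m 1\<^sub>m d) ^\<^sub>m k = 0\<^sub>m d d"
  using tm unfolding t_module_def q by blast+

lemma monom_F: "monom 1 n \<in> carrier (poly_ring_over F)"
  using subfield_of_typeD(1,2)[OF F] by (simp add: poly_ring_over_def)

lemma x_F: "[:0, 1:] \<in> carrier (poly_ring_over F)"
  using monom_F[of "Suc 0"] by (simp add: monom_Suc monom_0)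

lemma phi_carrier: "a \<in> carrier (poly_ring_over F) \<Longrightarrow> \<phi> a \<in> carrier_mat d d"
  using ring_hom_closed[OF hom, of a] by (simp add: skew_mat_ring_def)

lemma phi_monom_Suc: "\<phi> (monom 1 (Suc n)) = skew_mat_mult q (\<phi> (monom 1 n)) (\<phi> [:0, 1:])"
proof -
  have "monom (1::'k) (Suc n) = monom 1 n * [:0, 1:]" by (simp add: monom_Suc)
  thus ?thesis using ring_hom_mult[OF hom monom_F[of n] x_F]
    by (simp add: skew_mat_ring_def poly_ring_over_def)
qed

abbreviation P where "P \<equiv> mat_fun (\<phi> [:0, 1:])"

sublocale X: tau_t_module fscale q "vec_tau q" "row_mult q d P"
  by (rule tau_t_module_row_mult)

lemma t_pow:
  assumes f: "f \<in> supp_below d"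
  shows "(row_mult q d P ^^ n) f = row_mult q d (mat_fun (\<phi> (monom 1 n))) f"
proof (induction n)
  case 0
  have "\<phi> 1 = 1\<^sub>m d" using ring_hom_one[OF hom] by (simp add: skew_mat_ring_def poly_ring_over_def)
  hence one: "\<phi> (monom 1 0) = 1\<^sub>m d" by (simp add: monom_0 one_pCons)
  show ?case
  proof
    fix j
    show "(row_mult q d P ^^ 0) f j = row_mult q d (mat_fun (\<phi> (monom 1 0))) f j"
    proof (cases "j < d")
      case True
      have "(\<Sum>k<d. skew_mult q (f k) (1\<^sub>m d $$ (k, j))) = (\<Sum>k<d. if k = j then f k else 0)"
        using True by (intro sum.cong) auto
      thus ?thesis unfolding one using True by (simp add: row_mult_def mat_fun_def)
    qed (use supp_belowD[OF f, of j] in \<open>simp add: row_mult_def\<close>)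
  qed
next
  case (Suc n)
  let ?D = "\<phi> (monom 1 n)"
  have D: "?D \<in> carrier_mat d d" "\<phi> [:0, 1:] \<in> carrier_mat d d" using phi_carrier monom_F x_F by blast+
  show ?case
  proof
    fix j
    show "(row_mult q d P ^^ Suc n) f j = row_mult q d (mat_fun (\<phi> (monom 1 (Suc n)))) f j"
    proof (cases "j < d")
      case True
      have "(row_mult q d P ^^ Suc n) f j = (\<Sum>k<d. \<Sum>l<d. skew_mult q (skew_mult q (f l) (?D $$ (l, k))) (\<phi> [:0, 1:] $$ (k, j)))"
        using True by (simp add: Suc row_mult_def mat_fun_def skew_mult_sum_left)
      also have "\<dots> = (\<Sum>l<d. skew_mult q (f l) (\<Sum>k<d. skew_mult q (?D $$ (l, k)) (\<phi> [:0, 1:] $$ (k, j))))"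
        by (subst sum.swap) (simp add: skew_mult_assoc skew_mult_sum_right)
      also have "\<dots> = row_mult q d (mat_fun (\<phi> (monom 1 (Suc n)))) f j"
        using True D by (simp add: phi_monom_Suc row_mult_def mat_fun_def skew_mat_mult_def)
      finally show ?thesis .
    qed (simp add: row_mult_def)
  qed
qed

text \<open>Taking constant coefficients turns the right multiplication by \<open>\<phi>\<^sub>t\<close> into the constant matrix \<open>\<partial>\<phi>\<^sub>t\<close>. A power of the
  nilpotent matrix \<open>\<partial>\<phi>\<^sub>t - \<theta>\<close> kills the constant coefficients of every vector, and what remains is a multiple of \<open>\<tau>\<close>.\<close>

lemma t_minus_theta_nilpotent:
  "\<exists>k. \<forall>f\<in>supp_below d. \<exists>h\<in>supp_below d. poly_act fscale (row_mult q d P) ([:- \<theta>, 1:] ^ k) f = vec_tau q h"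
proof -
  let ?t = "row_mult q d P"
  let ?N = "coeff_mat (\<phi> [:0, 1:]) 0 - \<theta> \<cdot>\<^sub>m 1\<^sub>m d"
  have Pc: "\<phi> [:0, 1:] \<in> carrier_mat d d" by (rule phi_carrier[OF x_F])
  have N: "?N \<in> carrier_mat d d" by (intro minus_carrier_mat) simp
  have N_entry: "?N $$ (k, j) = coeff (\<phi> [:0, 1:] $$ (k, j)) 0 - (if k = j then \<theta> else 0)" if "k < d" "j < d" for k j
    using that Pc by (simp add: coeff_mat_def)
  define v where "v f = mat 1 d (\<lambda>(i, j). coeff (f j :: 'k poly) 0)" for f
  have vc: "v f \<in> carrier_mat 1 d" for f by (simp add: v_def)
  have step: "v (poly_act fscale ?t [:- \<theta>, 1:] f) = v f * ?N" for f
  proof (rule eq_matI)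
    fix i j assume "i < dim_row (v f * ?N)" "j < dim_col (v f * ?N)"
    hence ij: "i = 0" "j < d" using Pc by (simp_all add: v_def coeff_mat_def)
    have "(v f * ?N) $$ (i, j) = (\<Sum>k<d. coeff (f k) 0 * (coeff (\<phi> [:0, 1:] $$ (k, j)) 0 - (if k = j then \<theta> else 0)))"
    proof -
      have "(v f * ?N) $$ (i, j) = (\<Sum>k<d. v f $$ (0, k) * ?N $$ (k, j))"
        using ij N vc[of f] by (simp only: times_mat_def) (simp add: scalar_prod_def atLeast0LessThan)
      also have "\<dots> = (\<Sum>k<d. coeff (f k) 0 * (coeff (\<phi> [:0, 1:] $$ (k, j)) 0 - (if k = j then \<theta> else 0)))"
        by (intro sum.cong refl) (simp only: N_entry[OF _ ij(2)] lessThan_iff, simp add: v_def)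
      finally show ?thesis .
    qed
    also have "\<dots> = (\<Sum>k<d. coeff (f k) 0 * coeff (\<phi> [:0, 1:] $$ (k, j)) 0) - (\<Sum>k<d. if k = j then coeff (f k) 0 * \<theta> else 0)"
      unfolding sum_subtractf[symmetric] by (intro sum.cong) (simp_all add: right_diff_distrib)
    also have "\<dots> = coeff (poly_act fscale ?t [:- \<theta>, 1:] f j) 0"
      using ij by (simp add: fscale.poly_act_pCons_right fscale_def row_mult_def mat_fun_def coeff_sum const_coeff_skew_mult mult.commute)
    finally show "v (poly_act fscale ?t [:- \<theta>, 1:] f) $$ (i, j) = (v f * ?N) $$ (i, j)"
      using ij by (simp add: v_def)
  qed (use Pc in \<open>simp_all add: v_def coeff_mat_def\<close>)
  have iter: "v (poly_act fscale ?t ([:- \<theta>, 1:] ^ k) f) = v f * ?N ^\<^sub>m k" for k f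
  proof (induction k)
    case 0
    show ?case using Pc vc[of f] by (simp add: coeff_mat_def)
  next
    case (Suc k)
    have "v (poly_act fscale ?t ([:- \<theta>, 1:] ^ Suc k) f) = v (poly_act fscale ?t ([:- \<theta>, 1:] ^ k) f) * ?N"
      by (simp only: power_Suc X.poly_act_t_mult step)
    also have "\<dots> = v f * (?N ^\<^sub>m k * ?N)"
      unfolding Suc by (rule assoc_mult_mat[OF vc pow_carrier_mat[OF N] N])
    finally show ?case by simp
  qed
  obtain k where k: "?N ^\<^sub>m k = 0\<^sub>m d d" using nil by blast
  show ?thesis
  proof (intro exI[of _ k] ballI)
    fix f :: "nat \<Rightarrow> 'k poly" assume f: "f \<in> supp_below d"
    let ?g = "poly_act fscale ?t ([:- \<theta>, 1:] ^ k) f"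
    have g: "?g \<in> supp_below d" unfolding poly_act_def
    proof (intro fscale.subspace_sum[OF supp_below_sub] fscale.subspace_scale[OF supp_below_sub])
      fix i show "(?t ^^ i) f \<in> supp_below d" using f by (cases i) (simp_all add: row_mult_supp)
    qed
    have v0: "v ?g = 0\<^sub>m 1 d" unfolding iter k using vc[of f] by simp
    have c0: "coeff (?g j) 0 = 0" for j
    proof (cases "j < d")
      case True
      thus ?thesis using arg_cong[OF v0, of "\<lambda>A. A $$ (0, j)"] by (simp add: v_def)
    qed (use supp_belowD[OF g, of j] in simp)
    have "\<forall>j. \<exists>p. tau_poly q p = ?g j \<and> (?g j = 0 \<longrightarrow> p = 0)"
    proof
      fix j
      obtain c p where cp: "?g j = pCons c p" by (cases "?g j") auto
      have "c = 0" using c0[of j] unfolding cp by simp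
      obtain p' where p': "(frob_poly q ^^ Suc 0) p' = p" using frob_poly_funpow_surj by blast
      have e: "tau_poly q p' = ?g j" unfolding cp \<open>c = 0\<close> using p' by (simp add: tau_poly_def)
      have "tau_poly q 0 = (0 :: 'k poly)" by (simp add: tau_poly_def)
      thus "\<exists>p. tau_poly q p = ?g j \<and> (?g j = 0 \<longrightarrow> p = 0)"
      proof (cases "?g j = 0")
        case True
        thus ?thesis using \<open>tau_poly q 0 = 0\<close> by (intro exI[of _ 0]) simp
      next
        case False
        thus ?thesis using e by (intro exI[of _ p']) simp
      qed
    qed
    from choice[OF this] obtain h where h: "\<forall>j. tau_poly q (h j) = ?g j \<and> (?g j = 0 \<longrightarrow> h j = 0)" ..
    have "h \<in> supp_below d" using h supp_belowD[OF g] by (simp add: supp_below_def)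
    moreover have "?g = vec_tau q h" using h by (simp add: vec_tau_def fun_eq_iff)
    ultimately show "\<exists>h\<in>supp_below d. ?g = vec_tau q h" by blast
  qed
qed

lemma leading_coefficient:
  "\<exists>n s. 0 < n \<and> (\<forall>k<d. \<forall>j<d. \<forall>i>s. coeff (mat_fun (\<phi> (monom 1 n)) k j) i = 0) \<and>
     (\<exists>E. \<forall>l<d. \<forall>j<d. (\<Sum>k<d. E l k * coeff (mat_fun (\<phi> (monom 1 n)) k j) s) = (if l = j then 1 else 0))"
proof -
  obtain n where n: "n \<ge> 1" "invertible_leading_coeff (\<phi> (monom 1 n))"
    using asp unfolding almost_strictly_pure_def by blast
  let ?D = "\<phi> (monom 1 n)"
  have D: "?D \<in> carrier_mat d d" by (rule phi_carrier[OF monom_F])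
  obtain s where s: "\<And>j. j > s \<Longrightarrow> coeff_mat ?D j = 0\<^sub>m d d" "invertible_mat (coeff_mat ?D s)"
    using n(2) D unfolding invertible_leading_coeff_def by auto
  obtain E where E: "inverts_mat E (coeff_mat ?D s)" "inverts_mat (coeff_mat ?D s) E"
    using s(2) unfolding invertible_mat_def by blast
  have Ds: "coeff_mat ?D s \<in> carrier_mat d d" using D by (simp add: coeff_mat_def)
  have eq: "E * coeff_mat ?D s = 1\<^sub>m (dim_row E)" using E(1) by (simp add: inverts_mat_def)
  have dr: "dim_row E = d" using arg_cong[OF eq, of dim_col] Ds by simp
  have eq': "coeff_mat ?D s * E = 1\<^sub>m d" using E(2) Ds by (simp add: inverts_mat_def)
  have dc: "dim_col E = d" using arg_cong[OF eq', of dim_col] by simp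
  have "coeff (mat_fun ?D k j) i = 0" if "k < d" "j < d" "i > s" for k j i
    using arg_cong[OF s(1)[OF that(3)], of "\<lambda>A. A $$ (k, j)"] that D by (simp add: coeff_mat_def mat_fun_def)
  moreover have "(\<Sum>k<d. E $$ (l, k) * coeff (mat_fun ?D k j) s) = (if l = j then 1 else 0)" if "l < d" "j < d" for l j
    using arg_cong[OF eq, of "\<lambda>A. A $$ (l, j)"] that D dr dc
    by (simp add: scalar_prod_def coeff_mat_def mat_fun_def atLeast0LessThan)
  ultimately show ?thesis using n(1)
    by (intro exI[of _ n] exI[of _ s] conjI exI[of _ "\<lambda>l k. E $$ (l, k)"]) simp_all
qed

lemma free_basis_row_fun:
  assumes b: "free_basis (K_t q) (motive q d \<phi>) r b"
  shows "i < r \<Longrightarrow> row_fun d (b i) \<in> supp_below d"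
    and "f \<in> supp_below d \<Longrightarrow> \<exists>!g. g \<in> supp_below r \<and> f = (\<Sum>i<r. poly_act fscale (row_mult q d P) (g i) (row_fun d (b i)))"
proof -
  show "row_fun d (b i) \<in> supp_below d" by (rule row_fun_supp)
next
  assume f: "f \<in> supp_below d"
  have Pc: "\<phi> [:0, 1:] \<in> carrier_mat d d" by (rule phi_carrier[OF x_F])
  interpret L: left_module "skew_ring_t q" "motive q d \<phi>" by (rule left_module_motive[where \<phi> = \<phi>, OF Pc])
  have C: "carrier (motive q d \<phi>) = carrier_mat 1 d" and Z: "\<zero>\<^bsub>motive q d \<phi>\<^esub> = 0\<^sub>m 1 d"
    and Pl: "\<And>x y. x \<oplus>\<^bsub>motive q d \<phi>\<^esub> y = x + y" by (simp_all add: motive_def)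
  have bc: "b i \<in> carrier_mat 1 d" if "i < r" for i using b that unfolding free_basis_def C by auto
  have am: "abelian_monoid (motive q d \<phi>)" by (rule L.M.abelian_monoid_axioms)
  let ?s = "\<lambda>c. finsum (motive q d \<phi>) (\<lambda>i. c i \<odot>\<^bsub>motive q d \<phi>\<^esub> b i) {..<r}"
  let ?t = "row_mult q d P"
  have term_c: "c i \<odot>\<^bsub>motive q d \<phi>\<^esub> b i \<in> carrier (motive q d \<phi>)" if "i \<in> {..<r}" for c i
    unfolding C using that by (intro motive_smult(1)[where \<phi> = \<phi>, OF Pc] bc) simp
  have s_c: "?s c \<in> carrier_mat 1 d" for c
    using abelian_monoid.finsum_closed[OF am, of "\<lambda>i. c i \<odot>\<^bsub>motive q d \<phi>\<^esub> b i" "{..<r}"] term_c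
    unfolding C by blast
  have rs: "row_fun d (?s c) = (\<Sum>i<r. poly_act fscale ?t (g i) (row_fun d (b i)))"
    if cg: "\<And>i. i < r \<Longrightarrow> c i = K_t_elem (g i)" for c g
  proof -
    have "row_fun d (?s c) = (\<Sum>i<r. row_fun d (c i \<odot>\<^bsub>motive q d \<phi>\<^esub> b i))"
    proof (rule finsum_transport[OF am])
      show "row_fun d \<zero>\<^bsub>motive q d \<phi>\<^esub> = 0" unfolding Z by (rule row_fun_zero)
      show "row_fun d (x \<oplus>\<^bsub>motive q d \<phi>\<^esub> y) = row_fun d x + row_fun d y"
        if "x \<in> carrier (motive q d \<phi>)" "y \<in> carrier (motive q d \<phi>)" for x y
        using that unfolding C Pl by (rule row_fun_add)
    qed (rule term_c)
    also have "\<dots> = (\<Sum>i<r. poly_act fscale ?t (g i) (row_fun d (b i)))"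
      by (intro sum.cong refl) (simp add: motive_smult(2)[where \<phi> = \<phi>, OF Pc bc] cg X.skew_act_K_t_elem)
    finally show ?thesis .
  qed
  define c_of :: "(nat \<Rightarrow> 'k poly) \<Rightarrow> nat \<Rightarrow> nat \<Rightarrow> 'k poly" where "c_of g = (\<lambda>i\<in>{..<r}. K_t_elem (g i))" for g
  have c_of: "c_of g \<in> {..<r} \<rightarrow>\<^sub>E K_t q" for g unfolding c_of_def using K_t_elem_K_t by auto
  have rs': "row_fun d (?s (c_of g)) = (\<Sum>i<r. poly_act fscale ?t (g i) (row_fun d (b i)))" for g
    by (rule rs) (simp add: c_of_def)
  have ex1: "\<exists>!c. c \<in> {..<r} \<rightarrow>\<^sub>E K_t q \<and> fun_row d f = ?s c"
    using b unfolding free_basis_def C by simp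
  show "\<exists>!g. g \<in> supp_below r \<and> f = (\<Sum>i<r. poly_act fscale ?t (g i) (row_fun d (b i)))"
  proof (rule ex_ex1I)
    obtain c where c: "c \<in> {..<r} \<rightarrow>\<^sub>E K_t q" "fun_row d f = ?s c"
      using ex1_implies_ex[OF ex1] by (elim exE conjE)
    have "\<forall>i. \<exists>p. i < r \<longrightarrow> K_t_elem p = c i"
    proof
      fix i
      show "\<exists>p. i < r \<longrightarrow> K_t_elem p = c i"
      proof (cases "i < r")
        case True
        hence "c i \<in> K_t q" by (intro PiE_mem[OF c(1)]) simp
        thus ?thesis using K_t_elem_surj by blast
      qed simp
    qed
    from choice[OF this] obtain g where g: "\<forall>i. i < r \<longrightarrow> K_t_elem (g i) = c i" ..
    define g' where "g' i = (if i < r then g i else 0)" for i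
    have "f = row_fun d (?s c)" using row_fun_fun_row[OF f] c(2) by simp
    also have "\<dots> = (\<Sum>i<r. poly_act fscale ?t (g' i) (row_fun d (b i)))"
      by (rule rs) (use g in \<open>simp add: g'_def\<close>)
    finally show "\<exists>g. g \<in> supp_below r \<and> f = (\<Sum>i<r. poly_act fscale ?t (g i) (row_fun d (b i)))"
      by (intro exI[of _ g']) (simp add: g'_def supp_below_def)
  next
    fix g g' assume g: "g \<in> supp_below r \<and> f = (\<Sum>i<r. poly_act fscale ?t (g i) (row_fun d (b i)))"
      and g': "g' \<in> supp_below r \<and> f = (\<Sum>i<r. poly_act fscale ?t (g' i) (row_fun d (b i)))"
    have rep: "c_of h \<in> {..<r} \<rightarrow>\<^sub>E K_t q \<and> fun_row d f = ?s (c_of h)"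
      if h: "f = (\<Sum>i<r. poly_act fscale ?t (h i) (row_fun d (b i)))" for h
    proof
      have "fun_row d (row_fun d (?s (c_of h))) = ?s (c_of h)" by (rule fun_row_row_fun[OF s_c])
      thus "fun_row d f = ?s (c_of h)" unfolding rs' h[symmetric] .
    qed (rule c_of)
    obtain c0 where c0: "\<forall>y. y \<in> {..<r} \<rightarrow>\<^sub>E K_t q \<and> fun_row d f = ?s y \<longrightarrow> y = c0"
      using ex1 unfolding Ex1_def by (elim exE conjE)
    have "c_of g = c0" by (rule c0[rule_format], rule rep, rule conjunct2[OF g])
    moreover have "c_of g' = c0" by (rule c0[rule_format], rule rep, rule conjunct2[OF g'])
    ultimately have eq: "c_of g = c_of g'" by simp
    have "K_t_elem (g i) = K_t_elem (g' i)" if "i < r" for i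
      using fun_cong[OF eq, of i] that by (simp add: c_of_def)
    hence "g i = g' i" if "i < r" for i using that K_t_elem_inj by blast
    moreover have "g i = g' i" if "\<not> i < r" for i
      using that g g' supp_belowD[of g r i] supp_belowD[of g' r i] by simp
    ultimately show "g = g'" by blast
  qed
qed

lemma pure_motive_of_basis:
  "\<exists>D n s. \<forall>r b. free_basis (K_t q) (motive q d \<phi>) r b \<longrightarrow>
     pure_motive q P D (\<lambda>i. row_fun d (b i)) d n s r \<theta>"
proof -
  obtain n s where ns: "0 < n" "\<forall>k<d. \<forall>j<d. \<forall>i>s. coeff (mat_fun (\<phi> (monom 1 n)) k j) i = 0"
     "\<exists>E. \<forall>l<d. \<forall>j<d. (\<Sum>k<d. E l k * coeff (mat_fun (\<phi> (monom 1 n)) k j) s) = (if l = j then 1 else 0)"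
    using leading_coefficient by blast
  have "pure_motive q P (mat_fun (\<phi> (monom 1 n))) (\<lambda>i. row_fun d (b i)) d n s r \<theta>"
    if b: "free_basis (K_t q) (motive q d \<phi>) r b" for r b
  proof (intro pure_motive.intro pure_motive_axioms.intro)
    show "frobenius TYPE('k) q" by (rule frobenius_axioms)
    show "0 < d" "0 < n" by (rule d_pos, rule ns(1))
    show "(row_mult q d P ^^ n) f = row_mult q d (mat_fun (\<phi> (monom 1 n))) f" if "f \<in> supp_below d" for f
      using that by (rule t_pow)
    show "coeff (mat_fun (\<phi> (monom 1 n)) k j) i = 0" if "k < d" "j < d" "i > s" for k j i
      using ns(2) that by blast
    show "\<exists>E. \<forall>l<d. \<forall>j<d. (\<Sum>k<d. E l k * coeff (mat_fun (\<phi> (monom 1 n)) k j) s) = (if l = j then 1 else 0)"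
      by (rule ns(3))
    show "row_fun d (b i) \<in> supp_below d" for i by (rule row_fun_supp)
    show "\<exists>!g. g \<in> supp_below r \<and> f = (\<Sum>i<r. poly_act fscale (row_mult q d P) (g i) (row_fun d (b i)))"
      if "f \<in> supp_below d" for f using that by (rule free_basis_row_fun(2)[OF b])
    show "\<exists>k. \<forall>f\<in>supp_below d. \<exists>h\<in>supp_below d. poly_act fscale (row_mult q d P) ([:- \<theta>, 1:] ^ k) f = vec_tau q h"
      by (rule t_minus_theta_nilpotent)
  qed
  thus ?thesis by blast
qed

text \<open>The weight is determined by the degree count \<open>d = r n / s\<close>, which also shows that all \<open>K[t]\<close>-bases have the same length.\<close>

lemma motive_coordinates:
  assumes ab: "abelian_t_module q d \<phi>"
  shows "\<exists>D n s r b. free_basis (K_t q) (motive q d \<phi>) r b \<and>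
    pure_motive q P D (\<lambda>i. row_fun d (b i)) d n s r \<theta> \<and> weight q d \<phi> = of_nat d / of_nat r \<and>
    real d = real r * (real n / real s)"
proof -
  obtain D n s where pm: "\<And>r b. free_basis (K_t q) (motive q d \<phi>) r b \<Longrightarrow>
     pure_motive q P D (\<lambda>i. row_fun d (b i)) d n s r \<theta>"
    using pure_motive_of_basis by blast
  have w: "real d = real r * (real n / real s)" "0 < real n / real s"
    if b: "free_basis (K_t q) (motive q d \<phi>) r b" for r b
    using pure_motive.weight_eq[OF pm[OF b]] pure_motive.w_pos[OF pm[OF b]]
    unfolding pure_motive.w_def[OF pm[OF b]] by simp_all
  obtain r b where b: "free_basis (K_t q) (motive q d \<phi>) r b" using ab unfolding abelian_t_module_def by blast
  have uniq: "r' = r" if b': "free_basis (K_t q) (motive q d \<phi>) r' b'" for r' b'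
  proof -
    have "real r' * (real n / real s) = real r * (real n / real s)" using w(1)[OF b] w(1)[OF b'] by simp
    thus ?thesis using w(2)[OF b] by (cases "n = 0"; cases "s = 0") auto
  qed
  have "free_rank (K_t q) (motive q d \<phi>) = r"
    unfolding free_rank_def by (rule the_equality) (use b uniq in blast)+
  hence "weight q d \<phi> = of_nat d / of_nat r" by (simp add: weight_def)
  thus ?thesis using b pm[OF b] w(1)[OF b] by blast
qed

end

section \<open>Coordinates on the tensor product\<close>

definition pure_tensor :: "nat \<Rightarrow> nat \<Rightarrow> (nat \<Rightarrow> 'k::field poly) \<Rightarrow> (nat \<Rightarrow> 'k poly) \<Rightarrow> (nat \<Rightarrow> 'k poly)" where
  "pure_tensor r1 r2 f g = (\<lambda>p. if p < r1 * r2 then f (p div r2) * g (p mod r2) else 0)"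

lemma pure_tensor_supp: "pure_tensor r1 r2 f g \<in> supp_below (r1 * r2)"
  by (simp add: pure_tensor_def supp_below_def)

text \<open>The tensor product over \<open>S\<close> of two modules that are free of ranks \<open>r1\<close> and \<open>r2\<close>, each identified with vectors of
  polynomials. Only the additive structure of the modules and the action of \<open>S\<close> through the polynomials \<open>pol a\<close> matter for
  the underlying group.\<close>

locale tensor_coordinates =
  fixes S :: "'r set" and M1 :: "('r, 'm) module" and M2 :: "('r, 'n) module"
    and \<Gamma>1 :: "'m \<Rightarrow> (nat \<Rightarrow> 'k::field poly)" and \<Gamma>2 :: "'n \<Rightarrow> (nat \<Rightarrow> 'k poly)" and r1 r2 :: nat
    and pol :: "'r \<Rightarrow> 'k poly"
  assumes bij1: "bij_betw \<Gamma>1 (carrier M1) (supp_below r1)" and bij2: "bij_betw \<Gamma>2 (carrier M2) (supp_below r2)"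
    and add_closed1: "x \<in> carrier M1 \<Longrightarrow> x' \<in> carrier M1 \<Longrightarrow> x \<oplus>\<^bsub>M1\<^esub> x' \<in> carrier M1"
    and add_closed2: "y \<in> carrier M2 \<Longrightarrow> y' \<in> carrier M2 \<Longrightarrow> y \<oplus>\<^bsub>M2\<^esub> y' \<in> carrier M2"
    and add1: "x \<in> carrier M1 \<Longrightarrow> x' \<in> carrier M1 \<Longrightarrow> \<Gamma>1 (x \<oplus>\<^bsub>M1\<^esub> x') = \<Gamma>1 x + \<Gamma>1 x'"
    and add2: "y \<in> carrier M2 \<Longrightarrow> y' \<in> carrier M2 \<Longrightarrow> \<Gamma>2 (y \<oplus>\<^bsub>M2\<^esub> y') = \<Gamma>2 y + \<Gamma>2 y'"
    and smult_closed1: "a \<in> S \<Longrightarrow> x \<in> carrier M1 \<Longrightarrow> a \<odot>\<^bsub>M1\<^esub> x \<in> carrier M1"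
    and smult_closed2: "a \<in> S \<Longrightarrow> y \<in> carrier M2 \<Longrightarrow> a \<odot>\<^bsub>M2\<^esub> y \<in> carrier M2"
    and smult1: "a \<in> S \<Longrightarrow> x \<in> carrier M1 \<Longrightarrow> \<Gamma>1 (a \<odot>\<^bsub>M1\<^esub> x) = (\<lambda>i. pol a * \<Gamma>1 x i)"
    and smult2: "a \<in> S \<Longrightarrow> y \<in> carrier M2 \<Longrightarrow> \<Gamma>2 (a \<odot>\<^bsub>M2\<^esub> y) = (\<lambda>i. pol a * \<Gamma>2 y i)"
    and pol_surj: "\<exists>a\<in>S. pol a = p"
    and r2_pos: "0 < r2"
begin

abbreviation "S12 \<equiv> carrier M1 \<times> carrier M2"
abbreviation "G \<equiv> free_Abelian_group S12"
abbreviation "N \<equiv> tensor_kernel S M1 M2"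
abbreviation "TG \<equiv> tensor_group S M1 M2"

definition \<iota>1 :: "(nat \<Rightarrow> 'k poly) \<Rightarrow> 'm" where "\<iota>1 = inv_into (carrier M1) \<Gamma>1"
definition \<iota>2 :: "(nat \<Rightarrow> 'k poly) \<Rightarrow> 'n" where "\<iota>2 = inv_into (carrier M2) \<Gamma>2"

lemma \<iota>1: "f \<in> supp_below r1 \<Longrightarrow> \<iota>1 f \<in> carrier M1" "f \<in> supp_below r1 \<Longrightarrow> \<Gamma>1 (\<iota>1 f) = f"
  using bij_betwE[OF bij_betw_inv_into[OF bij1]] bij_betw_inv_into_right[OF bij1] by (auto simp: \<iota>1_def)

lemma \<iota>2: "f \<in> supp_below r2 \<Longrightarrow> \<iota>2 f \<in> carrier M2" "f \<in> supp_below r2 \<Longrightarrow> \<Gamma>2 (\<iota>2 f) = f"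
  using bij_betwE[OF bij_betw_inv_into[OF bij2]] bij_betw_inv_into_right[OF bij2] by (auto simp: \<iota>2_def)

lemma \<Gamma>1_supp: "x \<in> carrier M1 \<Longrightarrow> \<Gamma>1 x \<in> supp_below r1" using bij1 by (auto simp: bij_betw_def)
lemma \<Gamma>2_supp: "y \<in> carrier M2 \<Longrightarrow> \<Gamma>2 y \<in> supp_below r2" using bij2 by (auto simp: bij_betw_def)

lemma \<iota>1_eqI: "x \<in> carrier M1 \<Longrightarrow> \<Gamma>1 x = f \<Longrightarrow> \<iota>1 f = x"
  unfolding \<iota>1_def using bij_betw_inv_into_left[OF bij1] by blast

lemma \<iota>2_eqI: "y \<in> carrier M2 \<Longrightarrow> \<Gamma>2 y = f \<Longrightarrow> \<iota>2 f = y"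
  unfolding \<iota>2_def using bij_betw_inv_into_left[OF bij2] by blast

lemma rel_sub: "tensor_relations S M1 M2 \<subseteq> carrier G"
proof
  fix z assume "z \<in> tensor_relations S M1 M2"
  thus "z \<in> carrier G"
    unfolding tensor_relations_def
    by (auto intro!: subset_trans[OF keys_diff] simp: add_closed1 add_closed2 smult_closed1 smult_closed2 dest!: set_mp[OF keys_diff])
qed

lemma N_subgroup: "subgroup N G"
  unfolding tensor_kernel_def by (rule group.generate_is_subgroup[OF group_free_Abelian_group rel_sub])

lemma N_carrier: assumes "z \<in> N" shows "Poly_Mapping.keys z \<subseteq> S12"
proof -
  have "z \<in> carrier G" by (rule subgroup.mem_carrier[OF N_subgroup assms])
  thus ?thesis by (simp only: carrier_free_Abelian_group_iff)
qed

lemma frag_group_induct [consumes 1, case_names 1 2 3]: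
  assumes k: "Poly_Mapping.keys z \<subseteq> S12" and zero: "P 0"
    and diff: "\<And>z z'. Poly_Mapping.keys z \<subseteq> S12 \<Longrightarrow> Poly_Mapping.keys z' \<subseteq> S12 \<Longrightarrow> P z \<Longrightarrow> P z' \<Longrightarrow> P (z - z')"
    and fr: "\<And>a. a \<in> S12 \<Longrightarrow> P (frag_of a)"
  shows "P z"
  using k zero diff fr by (rule free_Abelian_group_induct)

lemma N_0: "0 \<in> N"
  using subgroup.one_closed[OF N_subgroup] by (simp only: one_free_Abelian_group)
lemma N_add: "z \<in> N \<Longrightarrow> z' \<in> N \<Longrightarrow> z + z' \<in> N"
  using subgroup.m_closed[OF N_subgroup, of z z'] by (simp only: mult_free_Abelian_group)
lemma N_minus: "z \<in> N \<Longrightarrow> - z \<in> N"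
  using subgroup.m_inv_closed[OF N_subgroup, of z] by (simp only: inv_free_Abelian_group N_carrier)
lemma N_diff: "z \<in> N \<Longrightarrow> z' \<in> N \<Longrightarrow> z - z' \<in> N"
  using N_add[of z "- z'"] N_minus[of z'] by (simp only: diff_conv_add_uminus)

lemma N_rel: "z \<in> tensor_relations S M1 M2 \<Longrightarrow> z \<in> N"
  unfolding tensor_kernel_def by (rule generate.incl)

definition eqv :: "('m \<times> 'n \<Rightarrow>\<^sub>0 int) \<Rightarrow> ('m \<times> 'n \<Rightarrow>\<^sub>0 int) \<Rightarrow> bool" (infix "\<asymp>" 50) where
  "z \<asymp> z' \<longleftrightarrow> z - z' \<in> N"

lemma eqv_refl: "z \<asymp> z" by (simp add: eqv_def N_0)
lemma eqv_sym: "z \<asymp> z' \<Longrightarrow> z' \<asymp> z" using N_minus[of "z - z'"] by (simp add: eqv_def)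
lemma eqv_trans [trans]: "z \<asymp> z' \<Longrightarrow> z' \<asymp> z'' \<Longrightarrow> z \<asymp> z''" using N_add[of "z - z'" "z' - z''"] by (simp add: eqv_def)
lemma eqv_add: "z \<asymp> z' \<Longrightarrow> y \<asymp> y' \<Longrightarrow> z + y \<asymp> z' + y'"
  using N_add[of "z - z'" "y - y'"] by (simp add: eqv_def algebra_simps)
lemma eqv_diff: "z \<asymp> z' \<Longrightarrow> y \<asymp> y' \<Longrightarrow> z - y \<asymp> z' - y'"
  using N_diff[of "z - z'" "y - y'"] by (simp add: eqv_def algebra_simps)
lemma eqv_sum: "(\<And>i. i \<in> I \<Longrightarrow> f i \<asymp> g i) \<Longrightarrow> (\<Sum>i\<in>I. f i) \<asymp> (\<Sum>i\<in>I. g i)"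
  by (induction I rule: infinite_finite_induct) (simp_all add: eqv_refl eqv_add)

lemma eqv_add_left:
  assumes "x \<in> carrier M1" "x' \<in> carrier M1" "y \<in> carrier M2"
  shows "frag_of (x \<oplus>\<^bsub>M1\<^esub> x', y) \<asymp> frag_of (x, y) + frag_of (x', y)"
proof -
  have "frag_of (x \<oplus>\<^bsub>M1\<^esub> x', y) - frag_of (x, y) - frag_of (x', y) \<in> N"
    by (rule N_rel) (use assms in \<open>unfold tensor_relations_def, blast\<close>)
  thus ?thesis by (simp add: eqv_def diff_diff_eq)
qed

lemma eqv_add_right:
  assumes "x \<in> carrier M1" "y \<in> carrier M2" "y' \<in> carrier M2"
  shows "frag_of (x, y \<oplus>\<^bsub>M2\<^esub> y') \<asymp> frag_of (x, y) + frag_of (x, y')"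
proof -
  have "frag_of (x, y \<oplus>\<^bsub>M2\<^esub> y') - frag_of (x, y) - frag_of (x, y') \<in> N"
    by (rule N_rel) (use assms in \<open>unfold tensor_relations_def, blast\<close>)
  thus ?thesis by (simp add: eqv_def diff_diff_eq)
qed

lemma eqv_balanced:
  assumes "a \<in> S" "x \<in> carrier M1" "y \<in> carrier M2"
  shows "frag_of (a \<odot>\<^bsub>M1\<^esub> x, y) \<asymp> frag_of (x, a \<odot>\<^bsub>M2\<^esub> y)"
  unfolding eqv_def by (rule N_rel) (use assms in \<open>unfold tensor_relations_def, blast\<close>)

definition br :: "(nat \<Rightarrow> 'k poly) \<Rightarrow> (nat \<Rightarrow> 'k poly) \<Rightarrow> ('m \<times> 'n \<Rightarrow>\<^sub>0 int)" where
  "br f g = frag_of (\<iota>1 f, \<iota>2 g)"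

lemma br_add_left:
  assumes "f \<in> supp_below r1" "f' \<in> supp_below r1" "g \<in> supp_below r2"
  shows "br (f + f') g \<asymp> br f g + br f' g"
proof -
  have "\<iota>1 (f + f') = \<iota>1 f \<oplus>\<^bsub>M1\<^esub> \<iota>1 f'"
    using assms by (intro \<iota>1_eqI) (simp_all only: add_closed1 add1 \<iota>1)
  thus ?thesis unfolding br_def using eqv_add_left[of "\<iota>1 f" "\<iota>1 f'" "\<iota>2 g"] assms by (simp only: \<iota>1 \<iota>2)
qed

lemma br_add_right:
  assumes "f \<in> supp_below r1" "g \<in> supp_below r2" "g' \<in> supp_below r2"
  shows "br f (g + g') \<asymp> br f g + br f g'"
proof -
  have "\<iota>2 (g + g') = \<iota>2 g \<oplus>\<^bsub>M2\<^esub> \<iota>2 g'"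
    using assms by (intro \<iota>2_eqI) (simp_all only: add_closed2 add2 \<iota>2)
  thus ?thesis unfolding br_def using eqv_add_right[of "\<iota>1 f" "\<iota>2 g" "\<iota>2 g'"] assms by (simp only: \<iota>1 \<iota>2)
qed

lemma br_mult:
  assumes f: "f \<in> supp_below r1" and g: "g \<in> supp_below r2"
  shows "br f (\<lambda>i. p * g i) \<asymp> br (\<lambda>i. p * f i) g"
proof -
  obtain a where a: "a \<in> S" "pol a = p" using pol_surj by blast
  have "\<iota>1 (\<lambda>i. p * f i) = a \<odot>\<^bsub>M1\<^esub> \<iota>1 f"
    using smult_closed1[OF a(1) \<iota>1(1)[OF f]] smult1[OF a(1) \<iota>1(1)[OF f]] a(2) \<iota>1(2)[OF f] by (intro \<iota>1_eqI) simp_all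
  moreover have "\<iota>2 (\<lambda>i. p * g i) = a \<odot>\<^bsub>M2\<^esub> \<iota>2 g"
    using smult_closed2[OF a(1) \<iota>2(1)[OF g]] smult2[OF a(1) \<iota>2(1)[OF g]] a(2) \<iota>2(2)[OF g] by (intro \<iota>2_eqI) simp_all
  ultimately show ?thesis
    unfolding br_def using eqv_sym[OF eqv_balanced[OF a(1) \<iota>1(1)[OF f] \<iota>2(1)[OF g]]] by simp
qed

lemma br_zero_left: "g \<in> supp_below r2 \<Longrightarrow> br 0 g \<asymp> 0"
proof -
  assume g: "g \<in> supp_below r2"
  have "br (0 + 0) g \<asymp> br 0 g + br 0 g" by (rule br_add_left[OF zero_supp_below zero_supp_below g])
  hence "br 0 g - (br 0 g + br 0 g) \<in> N" unfolding eqv_def by (simp only: add_0_left)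
  hence "- (br 0 g - (br 0 g + br 0 g)) \<in> N" by (rule N_minus)
  thus ?thesis by (simp add: eqv_def)
qed

lemma br_zero_right: "f \<in> supp_below r1 \<Longrightarrow> br f 0 \<asymp> 0"
proof -
  assume f: "f \<in> supp_below r1"
  have "br f (0 + 0) \<asymp> br f 0 + br f 0" by (rule br_add_right[OF f zero_supp_below zero_supp_below])
  hence "br f 0 - (br f 0 + br f 0) \<in> N" unfolding eqv_def by (simp only: add_0_left)
  hence "- (br f 0 - (br f 0 + br f 0)) \<in> N" by (rule N_minus)
  thus ?thesis by (simp add: eqv_def)
qed

lemma br_sum_left:
  assumes "finite I" "\<And>i. i \<in> I \<Longrightarrow> f i \<in> supp_below r1" "g \<in> supp_below r2"
  shows "br (\<Sum>i\<in>I. f i) g \<asymp> (\<Sum>i\<in>I. br (f i) g)"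
  using assms
proof (induction I rule: finite_induct)
  case empty
  show ?case by (simp only: sum.empty br_zero_left[OF empty.prems(2)])
next
  case (insert i I)
  have "br (f i + (\<Sum>i\<in>I. f i)) g \<asymp> br (f i) g + br (\<Sum>i\<in>I. f i) g"
    by (intro br_add_left fscale.subspace_sum[OF supp_below_sub] insert.prems) simp_all
  also have "br (f i) g + br (\<Sum>i\<in>I. f i) g \<asymp> br (f i) g + (\<Sum>i\<in>I. br (f i) g)"
    by (intro eqv_add eqv_refl insert.IH insert.prems) simp
  finally show ?case by (simp only: sum.insert[OF insert.hyps])
qed

lemma br_sum_right:
  assumes "finite I" "\<And>i. i \<in> I \<Longrightarrow> g i \<in> supp_below r2" "f \<in> supp_below r1"
  shows "br f (\<Sum>i\<in>I. g i) \<asymp> (\<Sum>i\<in>I. br f (g i))"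
  using assms
proof (induction I rule: finite_induct)
  case empty
  show ?case by (simp only: sum.empty br_zero_right[OF empty.prems(2)])
next
  case (insert i I)
  have "br f (g i + (\<Sum>i\<in>I. g i)) \<asymp> br f (g i) + br f (\<Sum>i\<in>I. g i)"
    by (intro br_add_right fscale.subspace_sum[OF supp_below_sub] insert.prems) simp_all
  also have "br f (g i) + br f (\<Sum>i\<in>I. g i) \<asymp> br f (g i) + (\<Sum>i\<in>I. br f (g i))"
    by (intro eqv_add eqv_refl insert.IH insert.prems) simp
  finally show ?case by (simp only: sum.insert[OF insert.hyps])
qed

lemma unit_expand: "f \<in> supp_below r \<Longrightarrow> f = (\<Sum>i<r. unit_vec_poly i (f i))"
proof
  fix j assume f: "f \<in> supp_below r"
  have "(\<Sum>i<r. unit_vec_poly i (f i)) j = (\<Sum>i<r. if i = j then f i else 0)"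
    unfolding fscale_sum_apply by (intro sum.cong) (simp_all add: unit_vec_poly_def)
  thus "f j = (\<Sum>i<r. unit_vec_poly i (f i)) j" using supp_belowD[OF f, of j] by simp
qed

text \<open>A representative built from the pure tensors of basis vectors, with all coefficients moved to the left factor.\<close>

definition canon :: "(nat \<Rightarrow> 'k poly) \<Rightarrow> ('m \<times> 'n \<Rightarrow>\<^sub>0 int)" where
  "canon Z = (\<Sum>p<r1 * r2. br (unit_vec_poly (p div r2) (Z p)) (unit_vec_poly (p mod r2) 1))"

lemma canon_term_supp:
  assumes "p < r1 * r2"
  shows "unit_vec_poly (p div r2) c \<in> supp_below r1" "unit_vec_poly (p mod r2) c \<in> supp_below r2"
  using assms r2_pos by (auto intro!: unit_vec_poly_supp simp: less_mult_imp_div_less)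

lemma canon_add: "canon (Z + Z') \<asymp> canon Z + canon Z'"
proof -
  have "canon (Z + Z') \<asymp> (\<Sum>p<r1 * r2. br (unit_vec_poly (p div r2) (Z p)) (unit_vec_poly (p mod r2) 1)
      + br (unit_vec_poly (p div r2) (Z' p)) (unit_vec_poly (p mod r2) 1))"
    unfolding canon_def
  proof (rule eqv_sum)
    fix p assume "p \<in> {..<r1 * r2}"
    hence p: "p < r1 * r2" by simp
    have "unit_vec_poly (p div r2) ((Z + Z') p) = unit_vec_poly (p div r2) (Z p) + unit_vec_poly (p div r2) (Z' p)"
      by (rule ext) (simp add: unit_vec_poly_def)
    thus "br (unit_vec_poly (p div r2) ((Z + Z') p)) (unit_vec_poly (p mod r2) 1)
      \<asymp> br (unit_vec_poly (p div r2) (Z p)) (unit_vec_poly (p mod r2) 1)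
      + br (unit_vec_poly (p div r2) (Z' p)) (unit_vec_poly (p mod r2) 1)"
      using br_add_left[OF canon_term_supp(1)[OF p] canon_term_supp(1)[OF p] canon_term_supp(2)[OF p]] by simp
  qed
  thus ?thesis by (simp only: sum.distrib canon_def)
qed

lemma canon_diff: "canon (Z - Z') \<asymp> canon Z - canon Z'"
proof -
  have "canon ((Z - Z') + Z') \<asymp> canon (Z - Z') + canon Z'" by (rule canon_add)
  hence "canon Z \<asymp> canon (Z - Z') + canon Z'" by (simp only: diff_add_cancel)
  hence "canon Z - canon Z' \<asymp> canon (Z - Z') + canon Z' - canon Z'" by (rule eqv_diff[OF _ eqv_refl])
  hence "canon Z - canon Z' \<asymp> canon (Z - Z')" by (simp only: add_diff_cancel_right')
  thus ?thesis by (rule eqv_sym)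
qed

lemma canon_0: "canon 0 \<asymp> 0"
proof -
  have "canon (0 - 0) \<asymp> canon 0 - canon 0" by (rule canon_diff)
  thus ?thesis by (simp only: diff_self)
qed

text \<open>Expanding both factors in basis vectors and moving the coefficients to the left uses precisely the defining relations.\<close>

lemma frag_of_eqv_canon:
  assumes x: "x \<in> carrier M1" and y: "y \<in> carrier M2"
  shows "frag_of (x, y) \<asymp> canon (pure_tensor r1 r2 (\<Gamma>1 x) (\<Gamma>2 y))"
proof -
  let ?f = "\<Gamma>1 x" and ?g = "\<Gamma>2 y"
  have f: "?f \<in> supp_below r1" and g: "?g \<in> supp_below r2" using \<Gamma>1_supp[OF x] \<Gamma>2_supp[OF y] by simp_all
  have "frag_of (x, y) = br ?f ?g"
    unfolding br_def using \<iota>1_eqI[OF x refl] \<iota>2_eqI[OF y refl] by simp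
  also have "\<dots> = br (\<Sum>i<r1. unit_vec_poly i (?f i)) ?g" by (simp only: unit_expand[OF f, symmetric])
  also have "\<dots> \<asymp> (\<Sum>i<r1. br (unit_vec_poly i (?f i)) ?g)"
    by (rule br_sum_left[OF _ _ g]) (simp_all add: unit_vec_poly_supp)
  also have "\<dots> \<asymp> (\<Sum>i<r1. \<Sum>j<r2. br (unit_vec_poly i (?f i * ?g j)) (unit_vec_poly j 1))"
  proof (rule eqv_sum)
    fix i assume i: "i \<in> {..<r1}"
    hence u: "unit_vec_poly i c \<in> supp_below r1" for c by (simp add: unit_vec_poly_supp)
    have "br (unit_vec_poly i (?f i)) ?g = br (unit_vec_poly i (?f i)) (\<Sum>j<r2. unit_vec_poly j (?g j))"
      by (simp only: unit_expand[OF g, symmetric])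
    also have "\<dots> \<asymp> (\<Sum>j<r2. br (unit_vec_poly i (?f i)) (unit_vec_poly j (?g j)))"
      by (rule br_sum_right[OF _ _ u]) (simp_all add: unit_vec_poly_supp)
    also have "\<dots> \<asymp> (\<Sum>j<r2. br (unit_vec_poly i (?f i * ?g j)) (unit_vec_poly j 1))"
    proof (rule eqv_sum)
      fix j assume "j \<in> {..<r2}"
      hence v: "unit_vec_poly j 1 \<in> supp_below r2" by (simp add: unit_vec_poly_supp)
      have "(\<lambda>k. ?g j * unit_vec_poly j 1 k) = unit_vec_poly j (?g j)"
        "(\<lambda>k. ?g j * unit_vec_poly i (?f i) k) = unit_vec_poly i (?f i * ?g j)"
        by (simp_all add: unit_vec_poly_def fun_eq_iff mult.commute)
      thus "br (unit_vec_poly i (?f i)) (unit_vec_poly j (?g j)) \<asymp> br (unit_vec_poly i (?f i * ?g j)) (unit_vec_poly j 1)"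
        using br_mult[OF u v, of "?f i" "?g j"] by simp
    qed
    finally show "br (unit_vec_poly i (?f i)) ?g \<asymp> (\<Sum>j<r2. br (unit_vec_poly i (?f i * ?g j)) (unit_vec_poly j 1))" .
  qed
  also have "(\<Sum>i<r1. \<Sum>j<r2. br (unit_vec_poly i (?f i * ?g j)) (unit_vec_poly j 1)) = canon (pure_tensor r1 r2 ?f ?g)"
  proof -
    have "canon (pure_tensor r1 r2 ?f ?g) = (\<Sum>p<r1 * r2. br (unit_vec_poly (p div r2) (?f (p div r2) * ?g (p mod r2))) (unit_vec_poly (p mod r2) 1))"
      unfolding canon_def by (intro sum.cong) (simp_all add: pure_tensor_def)
    also have "\<dots> = (\<Sum>i<r1. \<Sum>j<r2. br (unit_vec_poly i (?f i * ?g j)) (unit_vec_poly j 1))"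
      by (rule sum_div_mod)
    finally show ?thesis ..
  qed
  finally show ?thesis .
qed

lemma fhom_exists:
  "\<exists>h. (\<forall>z z'. Poly_Mapping.keys z \<subseteq> S12 \<longrightarrow> Poly_Mapping.keys z' \<subseteq> S12 \<longrightarrow> h (z + z') = h z + h z') \<and>
     (\<forall>x\<in>carrier M1. \<forall>y\<in>carrier M2. h (frag_of (x, y)) = pure_tensor r1 r2 (\<Gamma>1 x) (\<Gamma>2 y))"
proof -
  let ?A = "\<lparr>carrier = UNIV, monoid.mult = (+), one = (0 :: nat \<Rightarrow> 'k poly)\<rparr>"
  have "comm_group ?A"
  proof (rule comm_groupI)
    fix x :: "nat \<Rightarrow> 'k poly" assume "x \<in> carrier ?A"
    show "\<exists>y\<in>carrier ?A. y \<otimes>\<^bsub>?A\<^esub> x = \<one>\<^bsub>?A\<^esub>" by (rule bexI[of _ "- x"]) simp_all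
  qed (simp_all add: add_ac)
  from comm_group.free_Abelian_group_universal[OF this, of "\<lambda>(x, y). pure_tensor r1 r2 (\<Gamma>1 x) (\<Gamma>2 y)" S12]
  obtain h where h: "h \<in> hom G ?A" "\<And>x. x \<in> S12 \<Longrightarrow> h (frag_of x) = (case x of (x, y) \<Rightarrow> pure_tensor r1 r2 (\<Gamma>1 x) (\<Gamma>2 y))"
    by auto
  have "h (z + z') = h z + h z'" if "Poly_Mapping.keys z \<subseteq> S12" "Poly_Mapping.keys z' \<subseteq> S12" for z z'
    using hom_mult[OF h(1), of z z'] that by simp
  thus ?thesis using h(2) by (intro exI[of _ h]) auto
qed

definition fhom :: "('m \<times> 'n \<Rightarrow>\<^sub>0 int) \<Rightarrow> (nat \<Rightarrow> 'k poly)" where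
  "fhom = (SOME h. (\<forall>z z'. Poly_Mapping.keys z \<subseteq> S12 \<longrightarrow> Poly_Mapping.keys z' \<subseteq> S12 \<longrightarrow> h (z + z') = h z + h z') \<and>
     (\<forall>x\<in>carrier M1. \<forall>y\<in>carrier M2. h (frag_of (x, y)) = pure_tensor r1 r2 (\<Gamma>1 x) (\<Gamma>2 y)))"

lemma fhom_add: "Poly_Mapping.keys z \<subseteq> S12 \<Longrightarrow> Poly_Mapping.keys z' \<subseteq> S12 \<Longrightarrow> fhom (z + z') = fhom z + fhom z'"
  and fhom_of: "x \<in> carrier M1 \<Longrightarrow> y \<in> carrier M2 \<Longrightarrow> fhom (frag_of (x, y)) = pure_tensor r1 r2 (\<Gamma>1 x) (\<Gamma>2 y)"
  using someI_ex[OF fhom_exists] unfolding fhom_def[symmetric] by blast+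

lemma fhom_0: "fhom 0 = 0"
proof -
  have "fhom (0 + 0) = fhom 0 + fhom 0" by (rule fhom_add) simp_all
  hence "fhom 0 + 0 = fhom 0 + fhom 0" by (simp only: add_0_left add_0_right)
  thus ?thesis by (simp only: add_left_cancel)
qed

lemma fhom_diff:
  assumes z: "Poly_Mapping.keys z \<subseteq> S12" and z': "Poly_Mapping.keys z' \<subseteq> S12"
  shows "fhom (z - z') = fhom z - fhom z'"
proof -
  have "Poly_Mapping.keys (z - z') \<subseteq> S12" using keys_diff[of z z'] z z' by blast
  hence "fhom (z - z' + z') = fhom (z - z') + fhom z'" by (rule fhom_add[OF _ z'])
  thus ?thesis by (simp only: diff_add_cancel eq_diff_eq)
qed

lemma fhom_supp: "Poly_Mapping.keys z \<subseteq> S12 \<Longrightarrow> fhom z \<in> supp_below (r1 * r2)"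
proof (induction z rule: frag_group_induct)
  case 1 show ?case unfolding fhom_0 by (rule zero_supp_below)
next
  case (2 z z') thus ?case by (simp only: fhom_diff fscale.subspace_diff[OF supp_below_sub])
next
  case (3 a) thus ?case by (auto simp: fhom_of pure_tensor_supp)
qed

lemma eqv_canon: "Poly_Mapping.keys z \<subseteq> S12 \<Longrightarrow> z \<asymp> canon (fhom z)"
proof (induction z rule: frag_group_induct)
  case 1 show ?case unfolding fhom_0 by (rule eqv_sym[OF canon_0])
next
  case (2 z z')
  have "z - z' \<asymp> canon (fhom z) - canon (fhom z')" by (rule eqv_diff[OF 2(3,4)])
  also have "\<dots> \<asymp> canon (fhom z - fhom z')" by (rule eqv_sym[OF canon_diff])
  finally show ?case by (simp only: fhom_diff[OF 2(1,2)])
next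
  case (3 a)
  thus ?case by (cases a) (simp add: fhom_of frag_of_eqv_canon)
qed

lemma pure_tensor_add_left: "pure_tensor r1 r2 (f + f') g = pure_tensor r1 r2 f g + pure_tensor r1 r2 f' g"
  by (rule ext) (simp add: pure_tensor_def distrib_right)
lemma pure_tensor_add_right: "pure_tensor r1 r2 f (g + g') = pure_tensor r1 r2 f g + pure_tensor r1 r2 f g'"
  by (rule ext) (simp add: pure_tensor_def distrib_left)
lemma pure_tensor_balanced: "pure_tensor r1 r2 (\<lambda>i. p * f i) g = pure_tensor r1 r2 f (\<lambda>i. p * g i)"
  by (rule ext) (simp add: pure_tensor_def mult_ac)

lemma fhom_relation:
  assumes z: "z \<in> tensor_relations S M1 M2"
  shows "fhom z = 0"
proof -
  have fo: "Poly_Mapping.keys (frag_of (x, y)) \<subseteq> S12" if "x \<in> carrier M1" "y \<in> carrier M2" for x y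
    using that by simp
  have fd: "Poly_Mapping.keys (frag_of (x, y) - frag_of (x', y')) \<subseteq> S12"
    if "x \<in> carrier M1" "y \<in> carrier M2" "x' \<in> carrier M1" "y' \<in> carrier M2" for x y x' y'
    using keys_diff[of "frag_of (x, y)" "frag_of (x', y')"] fo that by blast
  from z consider
    (1) x x' y where "x \<in> carrier M1" "x' \<in> carrier M1" "y \<in> carrier M2"
      "z = frag_of (x \<oplus>\<^bsub>M1\<^esub> x', y) - frag_of (x, y) - frag_of (x', y)"
  | (2) x y y' where "x \<in> carrier M1" "y \<in> carrier M2" "y' \<in> carrier M2"
      "z = frag_of (x, y \<oplus>\<^bsub>M2\<^esub> y') - frag_of (x, y) - frag_of (x, y')"
  | (3) a x y where "a \<in> S" "x \<in> carrier M1" "y \<in> carrier M2" "z = frag_of (a \<odot>\<^bsub>M1\<^esub> x, y) - frag_of (x, a \<odot>\<^bsub>M2\<^esub> y)"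
    unfolding tensor_relations_def by blast
  thus ?thesis
  proof cases
    case 1
    thus ?thesis by (simp only: fhom_diff fd fo add_closed1 fhom_of add1 pure_tensor_add_left) simp
  next
    case 2
    thus ?thesis by (simp only: fhom_diff fd fo add_closed2 fhom_of add2 pure_tensor_add_right) simp
  next
    case 3
    thus ?thesis by (simp only: fhom_diff fo smult_closed1 smult_closed2 fhom_of smult1 smult2 pure_tensor_balanced) simp
  qed
qed

text \<open>The relations lie in the kernel of \<open>fhom\<close>. Conversely every element is congruent to the representative determined by its
  image, so an element of the kernel is congruent to zero.\<close>

lemma N_eq_kernel: "z \<in> N \<longleftrightarrow> Poly_Mapping.keys z \<subseteq> S12 \<and> fhom z = 0"
proof
  assume z: "z \<in> N"
  have "fhom z = 0"
    using z unfolding tensor_kernel_def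
  proof (induction z rule: generate.induct)
    case one show ?case by (simp only: one_free_Abelian_group fhom_0)
  next
    case (incl h) thus ?case by (rule fhom_relation)
  next
    case (inv h)
    have k: "Poly_Mapping.keys h \<subseteq> S12" by (rule N_carrier[OF N_rel[OF inv]])
    have "fhom (0 - h) = fhom 0 - fhom h" by (rule fhom_diff[OF _ k]) simp
    thus ?case by (simp only: inv_free_Abelian_group[OF k] fhom_0 fhom_relation[OF inv]) simp
  next
    case (eng h1 h2)
    have "h1 \<in> N" "h2 \<in> N" using eng(1,2) unfolding tensor_kernel_def by simp_all
    hence "Poly_Mapping.keys h1 \<subseteq> S12" "Poly_Mapping.keys h2 \<subseteq> S12" by (auto dest: N_carrier)
    thus ?case by (simp only: mult_free_Abelian_group fhom_add eng.IH) simp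
  qed
  thus "Poly_Mapping.keys z \<subseteq> S12 \<and> fhom z = 0" using N_carrier[OF z] by simp
next
  assume z: "Poly_Mapping.keys z \<subseteq> S12 \<and> fhom z = 0"
  hence "z \<asymp> canon 0" using eqv_canon[of z] by simp
  also have "canon 0 \<asymp> 0" by (rule canon_0)
  finally show "z \<in> N" by (simp add: eqv_def)
qed

subsection \<open>The quotient group\<close>

abbreviation coset where "coset z \<equiv> r_coset G N z"

text \<open>\<open>fhom\<close> is constant on cosets, so any member may be used.\<close>

definition \<Theta> :: "('m \<times> 'n \<Rightarrow>\<^sub>0 int) set \<Rightarrow> (nat \<Rightarrow> 'k poly)" where
  "\<Theta> W = fhom (SOME z. z \<in> W)"

lemma coset_eq: "coset z = {h + z | h. h \<in> N}"
  by (auto simp: r_coset_def)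

lemma fhom_coset:
  assumes z: "Poly_Mapping.keys z \<subseteq> S12" and x: "x \<in> coset z"
  shows "Poly_Mapping.keys x \<subseteq> S12" "fhom x = fhom z"
proof -
  obtain h where h: "h \<in> N" "x = h + z" using x unfolding coset_eq by blast
  have hk: "Poly_Mapping.keys h \<subseteq> S12" "fhom h = 0" using h(1) unfolding N_eq_kernel by simp_all
  show "Poly_Mapping.keys x \<subseteq> S12" unfolding h(2) using keys_add[of h z] hk(1) z by blast
  show "fhom x = fhom z" unfolding h(2) fhom_add[OF hk(1) z] hk(2) by simp
qed

lemma \<Theta>_coset: assumes z: "Poly_Mapping.keys z \<subseteq> S12" shows "\<Theta> (coset z) = fhom z"
proof -
  have "z \<in> coset z" unfolding coset_eq using N_0 by (auto intro!: exI[of _ 0])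
  hence "(SOME x. x \<in> coset z) \<in> coset z" by (rule someI)
  thus ?thesis unfolding \<Theta>_def by (rule fhom_coset(2)[OF z])
qed

lemma coset_eqI:
  assumes z: "Poly_Mapping.keys z \<subseteq> S12" and z': "Poly_Mapping.keys z' \<subseteq> S12" and eq: "fhom z = fhom z'"
  shows "coset z = coset z'"
proof -
  have d: "z - z' \<in> N" unfolding N_eq_kernel using keys_diff[of z z'] z z' fhom_diff[OF z z'] eq by auto
  show ?thesis
  proof (intro equalityI subsetI)
    fix x assume "x \<in> coset z"
    then obtain h where h: "h \<in> N" "x = h + z" unfolding coset_eq by blast
    have "x = (h + (z - z')) + z'" using h(2) by simp
    thus "x \<in> coset z'" unfolding coset_eq using N_add[OF h(1) d] by blast
  next
    fix x assume "x \<in> coset z'"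
    then obtain h where h: "h \<in> N" "x = h + z'" unfolding coset_eq by blast
    have "x = (h - (z - z')) + z" using h(2) by simp
    thus "x \<in> coset z" unfolding coset_eq using N_diff[OF h(1) d] by blast
  qed
qed

lemma TG_carrier: "W \<in> carrier TG \<longleftrightarrow> (\<exists>z. Poly_Mapping.keys z \<subseteq> S12 \<and> W = coset z)"
  by (simp only: tensor_group_def carrier_FactGroup image_iff Bex_def carrier_free_Abelian_group_iff)

lemma normal_N: "N \<lhd> G"
  by (rule comm_group.subgroup_imp_normal[OF abelian_free_Abelian_group N_subgroup])

lemma TG_comm_group: "comm_group TG"
  unfolding tensor_group_def by (rule comm_group.abelian_FactGroup[OF abelian_free_Abelian_group N_subgroup])

lemma TG_mult:
  assumes "Poly_Mapping.keys z \<subseteq> S12" "Poly_Mapping.keys z' \<subseteq> S12"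
  shows "coset z \<otimes>\<^bsub>TG\<^esub> coset z' = coset (z + z')"
  unfolding tensor_group_def using normal.rcos_sum[OF normal_N, of z z'] assms by simp

lemma \<Theta>_mult: "W \<in> carrier TG \<Longrightarrow> V \<in> carrier TG \<Longrightarrow> \<Theta> (W \<otimes>\<^bsub>TG\<^esub> V) = \<Theta> W + \<Theta> V"
proof -
  assume "W \<in> carrier TG" "V \<in> carrier TG"
  then obtain z z' where z: "Poly_Mapping.keys z \<subseteq> S12" "W = coset z" and z': "Poly_Mapping.keys z' \<subseteq> S12" "V = coset z'"
    unfolding TG_carrier by blast
  have "Poly_Mapping.keys (z + z') \<subseteq> S12" using keys_add[of z z'] z(1) z'(1) by blast
  thus ?thesis unfolding z(2) z'(2) TG_mult[OF z(1) z'(1)] using z(1) z'(1) by (simp only: \<Theta>_coset fhom_add)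
qed

lemma \<Theta>_one: "\<Theta> \<one>\<^bsub>TG\<^esub> = 0"
proof -
  have "\<one>\<^bsub>TG\<^esub> = coset 0" unfolding tensor_group_def coset_eq by (simp add: FactGroup_def)
  thus ?thesis using \<Theta>_coset[of 0] fhom_0 by simp
qed

lemma canon_keys: "Poly_Mapping.keys (canon Z) \<subseteq> S12"
proof -
  have "canon Z \<in> carrier G" unfolding canon_def br_def
  proof (rule sum_closed_free_Abelian_group)
    fix p assume "p \<in> {..<r1 * r2}"
    hence p: "p < r1 * r2" by simp
    show "frag_of (\<iota>1 (unit_vec_poly (p div r2) (Z p)), \<iota>2 (unit_vec_poly (p mod r2) 1)) \<in> carrier G"
      using \<iota>1(1)[OF canon_term_supp(1)[OF p]] \<iota>2(1)[OF canon_term_supp(2)[OF p]] by simp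
  qed
  thus ?thesis by simp
qed

lemma fhom_sum:
  assumes "finite I" "\<And>i. i \<in> I \<Longrightarrow> Poly_Mapping.keys (f i) \<subseteq> S12"
  shows "fhom (\<Sum>i\<in>I. f i) = (\<Sum>i\<in>I. fhom (f i))"
  using assms
proof (induction I rule: finite_induct)
  case empty show ?case by (simp only: sum.empty fhom_0)
next
  case (insert i I)
  have "(\<Sum>i\<in>I. f i) \<in> carrier G" by (rule sum_closed_free_Abelian_group) (use insert.prems in simp)
  hence "fhom (f i + (\<Sum>i\<in>I. f i)) = fhom (f i) + fhom (\<Sum>i\<in>I. f i)"
    using insert.prems by (intro fhom_add) simp_all
  moreover have "fhom (\<Sum>i\<in>I. f i) = (\<Sum>i\<in>I. fhom (f i))" using insert.prems by (intro insert.IH) simp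
  ultimately show ?case by (simp only: sum.insert[OF insert.hyps])
qed

lemma fhom_canon: assumes Z: "Z \<in> supp_below (r1 * r2)" shows "fhom (canon Z) = Z"
proof -
  have tm: "fhom (br (unit_vec_poly (p div r2) (Z p)) (unit_vec_poly (p mod r2) 1)) = unit_vec_poly p (Z p)"
    "Poly_Mapping.keys (br (unit_vec_poly (p div r2) (Z p)) (unit_vec_poly (p mod r2) 1)) \<subseteq> S12"
    if "p \<in> {..<r1 * r2}" for p
  proof -
    have p: "p < r1 * r2" using that by simp
    note c = \<iota>1[OF canon_term_supp(1)[OF p]] \<iota>2[OF canon_term_supp(2)[OF p]]
    have "fhom (br (unit_vec_poly (p div r2) (Z p)) (unit_vec_poly (p mod r2) 1))
      = pure_tensor r1 r2 (unit_vec_poly (p div r2) (Z p)) (unit_vec_poly (p mod r2) 1)"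
      unfolding br_def by (simp only: fhom_of c)
    also have "\<dots> = unit_vec_poly p (Z p)"
    proof
      fix a
      have "a = p \<longleftrightarrow> a div r2 = p div r2 \<and> a mod r2 = p mod r2" by (metis div_mult_mod_eq)
      thus "pure_tensor r1 r2 (unit_vec_poly (p div r2) (Z p)) (unit_vec_poly (p mod r2) 1) a = unit_vec_poly p (Z p) a"
        using p by (auto simp: pure_tensor_def unit_vec_poly_def)
    qed
    finally show "fhom (br (unit_vec_poly (p div r2) (Z p)) (unit_vec_poly (p mod r2) 1)) = unit_vec_poly p (Z p)" .
    show "Poly_Mapping.keys (br (unit_vec_poly (p div r2) (Z p)) (unit_vec_poly (p mod r2) 1)) \<subseteq> S12"
      unfolding br_def by (simp add: c)
  qed
  have "fhom (canon Z) = (\<Sum>p<r1 * r2. fhom (br (unit_vec_poly (p div r2) (Z p)) (unit_vec_poly (p mod r2) 1)))"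
    unfolding canon_def by (rule fhom_sum[OF _ tm(2)]) simp_all
  also have "\<dots> = (\<Sum>p<r1 * r2. unit_vec_poly p (Z p))"
    by (intro sum.cong refl tm(1))
  also have "\<dots> = Z" by (rule unit_expand[OF Z, symmetric])
  finally show ?thesis .
qed

lemma bij_\<Theta>: "bij_betw \<Theta> (carrier TG) (supp_below (r1 * r2))"
proof (rule bij_betwI[where g = "\<lambda>Z. coset (canon Z)"])
  show "\<Theta> \<in> carrier TG \<rightarrow> supp_below (r1 * r2)"
  proof
    fix W assume "W \<in> carrier TG"
    then obtain z where z: "Poly_Mapping.keys z \<subseteq> S12" "W = coset z" unfolding TG_carrier by blast
    show "\<Theta> W \<in> supp_below (r1 * r2)" unfolding z(2) \<Theta>_coset[OF z(1)] by (rule fhom_supp[OF z(1)])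
  qed
  show "(\<lambda>Z. coset (canon Z)) \<in> supp_below (r1 * r2) \<rightarrow> carrier TG"
    using canon_keys unfolding TG_carrier Pi_iff by blast
  show "coset (canon (\<Theta> W)) = W" if W: "W \<in> carrier TG" for W
  proof -
    obtain z where z: "Poly_Mapping.keys z \<subseteq> S12" "W = coset z" using W unfolding TG_carrier by blast
    show ?thesis unfolding z(2) \<Theta>_coset[OF z(1)]
      by (rule coset_eqI[OF canon_keys z(1) fhom_canon[OF fhom_supp[OF z(1)]]])
  qed
  show "\<Theta> (coset (canon Z)) = Z" if "Z \<in> supp_below (r1 * r2)" for Z
    using that by (simp only: \<Theta>_coset canon_keys fhom_canon)
qed

text \<open>It is enough to compare the two sides on pure tensors, since they generate the group and both sides are additive.\<close>

lemma tensor_map_\<Theta>: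
  assumes u: "\<And>x. x \<in> carrier M1 \<Longrightarrow> u x \<in> carrier M1" and v: "\<And>y. y \<in> carrier M2 \<Longrightarrow> v y \<in> carrier M2"
    and op_add: "\<And>Z Z'. op (Z + Z') = op Z + op Z'"
    and op: "\<And>x y. x \<in> carrier M1 \<Longrightarrow> y \<in> carrier M2 \<Longrightarrow>
      op (pure_tensor r1 r2 (\<Gamma>1 x) (\<Gamma>2 y)) = pure_tensor r1 r2 (\<Gamma>1 (u x)) (\<Gamma>2 (v y))"
    and W: "W \<in> carrier TG"
  shows "tensor_map S M1 M2 u v W \<in> carrier TG" "\<Theta> (tensor_map S M1 M2 u v W) = op (\<Theta> W)"
proof -
  let ?e = "frag_extend (\<lambda>(x, y). frag_of (u x, v y))"
  have op0: "op 0 = 0" by (rule additive_zero[of op, OF op_add])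
  have op_diff: "op (Z - Z') = op Z - op Z'" for Z Z' by (rule additive_diff[of op, OF op_add])
  have e: "Poly_Mapping.keys (?e z) \<subseteq> S12 \<and> fhom (?e z) = op (fhom z)" if "Poly_Mapping.keys z \<subseteq> S12" for z
    using that
  proof (induction z rule: frag_group_induct)
    case 1 show ?case by (simp only: frag_extend_0 fhom_0 op0) simp
  next
    case (2 z z')
    have k: "Poly_Mapping.keys (?e z) \<subseteq> S12" "Poly_Mapping.keys (?e z') \<subseteq> S12" using 2(3,4) by simp_all
    have "fhom (?e z - ?e z') = op (fhom z - fhom z')"
      unfolding fhom_diff[OF k] op_diff using 2(3,4) by simp
    moreover have "Poly_Mapping.keys (?e z - ?e z') \<subseteq> S12" using keys_diff[of "?e z" "?e z'"] k by blast
    ultimately show ?case unfolding frag_extend_diff fhom_diff[OF 2(1,2)] by blast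
  next
    case (3 a)
    obtain x y where a: "a = (x, y)" by (cases a)
    hence xy: "x \<in> carrier M1" "y \<in> carrier M2" using 3 by simp_all
    show ?case unfolding a frag_extend_of using u[OF xy(1)] v[OF xy(2)] op[OF xy] fhom_of[OF xy] fhom_of[OF u[OF xy(1)] v[OF xy(2)]] by simp
  qed
  obtain z where z: "Poly_Mapping.keys z \<subseteq> S12" "W = coset z" using W unfolding TG_carrier by blast
  have "tensor_map S M1 M2 u v W = coset (?e z)"
    unfolding tensor_map_def z(2)
  proof -
    have "coset (?e x) = coset (?e z)" if x: "x \<in> coset z" for x
      using e[OF fhom_coset(1)[OF z(1) x]] e[OF z(1)] fhom_coset(2)[OF z(1) x] by (intro coset_eqI) simp_all
    moreover have "z \<in> coset z" unfolding coset_eq using N_0 by (auto intro!: exI[of _ 0])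
    ultimately show "(\<Union>x\<in>coset z. coset (?e x)) = coset (?e z)" by blast
  qed
  thus "tensor_map S M1 M2 u v W \<in> carrier TG" "\<Theta> (tensor_map S M1 M2 u v W) = op (\<Theta> W)"
    using e[OF z(1)] unfolding z(2) TG_carrier by (blast, simp only: \<Theta>_coset z(1))
qed

lemma \<Theta>_finprod:
  assumes "\<And>i. i \<in> I \<Longrightarrow> f i \<in> carrier TG"
  shows "finprod TG f I \<in> carrier TG" "\<Theta> (finprod TG f I) = (\<Sum>i\<in>I. \<Theta> (f i))"
proof -
  have cm: "comm_monoid TG" using TG_comm_group by (simp add: comm_group_def)
  show "finprod TG f I \<in> carrier TG" by (rule comm_monoid.finprod_closed[OF cm]) (use assms in blast)
  show "\<Theta> (finprod TG f I) = (\<Sum>i\<in>I. \<Theta> (f i))"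
    using assms
  proof (induction I rule: infinite_finite_induct)
    case (infinite I)
    thus ?case by (simp only: comm_monoid.finprod_infinite[OF cm] sum.infinite \<Theta>_one not_False_eq_True)
  next
    case empty
    show ?case by (simp only: comm_monoid.finprod_empty[OF cm] sum.empty \<Theta>_one)
  next
    case (insert i I)
    have fi: "f i \<in> carrier TG" by (rule insert.prems) simp
    have IH: "\<Theta> (finprod TG f I) = (\<Sum>i\<in>I. \<Theta> (f i))" by (rule insert.IH, rule insert.prems) simp
    have eq: "finprod TG f (insert i I) = f i \<otimes>\<^bsub>TG\<^esub> finprod TG f I"
      by (rule comm_monoid.finprod_insert[OF cm]) (use insert in auto)
    have cl: "finprod TG f I \<in> carrier TG"
      by (rule comm_monoid.finprod_closed[OF cm]) (use insert.prems in blast)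
    show ?case by (simp only: eq \<Theta>_mult[OF fi cl] IH sum.insert[OF insert.hyps])
  qed
qed

end

section \<open>Modules presented by Frobenius structures\<close>

text \<open>Coordinate functions that commute with scalars, with \<open>\<tau>\<close> and with \<open>t\<close> commute with the whole skew ring.\<close>

lemma additive_intertwines_funpow:
  assumes "\<And>x. h (D x) = D' (h x)"
  shows "h ((D ^^ n) x) = (D' ^^ n) (h x)"
  by (induction n) (simp_all add: assms)

lemma poly_act_intertwine:
  assumes add: "\<And>x y. h (x + y) = h x + h y" and sc: "\<And>c x. h (scale1 c x) = scale2 c (h x)"
    and D: "\<And>x. h (D x) = D' (h x)"
  shows "h (poly_act scale1 D f x) = poly_act scale2 D' f (h x)"
  unfolding poly_act_def additive_sum[of h, OF add] by (simp only: sc additive_intertwines_funpow[of h D D', OF D])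

lemma skew_act_intertwine:
  assumes add: "\<And>x y. h (x + y) = h x + h y" and sc: "\<And>c x. h (scale1 c x) = scale2 c (h x)"
    and tau: "\<And>x. h (\<tau> x) = \<tau>' (h x)" and t: "\<And>x. h (t x) = t' (h x)"
  shows "h (skew_act scale1 \<tau> t q a x) = skew_act scale2 \<tau>' t' q a (h x)"
  unfolding skew_act_def additive_sum[of h, OF add]
  by (simp only: poly_act_intertwine[of h scale1 scale2 \<tau> \<tau>', OF add sc tau] additive_intertwines_funpow[of h t t', OF t])

lemma funpow_mem: "x \<in> S \<Longrightarrow> (\<And>x. x \<in> S \<Longrightarrow> D x \<in> S) \<Longrightarrow> (D ^^ n) x \<in> S"
  by (induction n) simp_all

lemma poly_act_mem_supp:
  assumes "f \<in> supp_below r" "\<And>f. f \<in> supp_below r \<Longrightarrow> D f \<in> supp_below r"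
  shows "poly_act fscale D p f \<in> supp_below r"
  unfolding poly_act_def
  by (intro fscale.subspace_sum[OF supp_below_sub] fscale.subspace_scale[OF supp_below_sub] funpow_mem assms)

lemma t_shift_mem: "f \<in> supp_below r \<Longrightarrow> t_shift f \<in> supp_below r"
  by (simp add: t_shift_def supp_below_def)

lemma matrix_tau_mem: assumes "\<And>i. A i \<in> supp_below r" shows "matrix_tau q r A f \<in> supp_below r"
  using supp_belowD[OF assms] by (simp add: matrix_tau_def supp_below_def)

lemma skew_act_mem:
  assumes A: "\<And>i. A i \<in> supp_below r" and f: "f \<in> supp_below r"
  shows "skew_act fscale (matrix_tau q r A) t_shift q a f \<in> supp_below r"
  unfolding skew_act_def
  by (intro fscale.subspace_sum[OF supp_below_sub] poly_act_mem_supp funpow_mem f t_shift_mem matrix_tau_mem A)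

lemma poly_act_t_shift: "poly_act fscale t_shift p f = (\<lambda>i. p * f i)"
proof (induction p arbitrary: f)
  case 0
  show ?case by (simp only: fscale.poly_act_0_left) (simp add: fun_eq_iff)
next
  case (pCons c p)
  show ?case unfolding fscale.poly_act_pCons_right pCons.IH
    by (rule ext) (simp add: fscale_def t_shift_def)
qed

lemma poly_act_x: "poly_act fscale D [:0, 1:] f = D (f :: nat \<Rightarrow> 'k::field poly)"
  unfolding fscale.poly_act_pCons_right fscale.poly_act_0_left fscale.scale_zero_left fscale.scale_one
  by (simp only: add_0_left add_0_right)

text \<open>\<open>\<Gamma>\<close> identifies the abstract module with \<open>K[t]\<^sup>r\<close>, on which \<open>t\<close> acts by multiplication and \<open>\<tau>\<close> through the matrix \<open>A\<close>. Motives
  and their tensor products are of this kind, so the construction of a pure basis applies to both.\<close>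

locale frobenius_coordinates = frobenius field_type q
  for field_type :: "'k::alg_closed_field itself" and q :: nat +
  fixes M :: "(nat \<Rightarrow> 'k poly, 'm) module" and r :: nat and A :: "nat \<Rightarrow> nat \<Rightarrow> 'k poly" and \<Gamma> :: "'m \<Rightarrow> (nat \<Rightarrow> 'k poly)"
  assumes A_supp: "A i \<in> supp_below r"
    and bij: "bij_betw \<Gamma> (carrier M) (supp_below r)"
    and zero_closed: "\<zero>\<^bsub>M\<^esub> \<in> carrier M" and zero: "\<Gamma> \<zero>\<^bsub>M\<^esub> = 0"
    and add_closed: "x \<in> carrier M \<Longrightarrow> y \<in> carrier M \<Longrightarrow> x \<oplus>\<^bsub>M\<^esub> y \<in> carrier M"
    and add: "x \<in> carrier M \<Longrightarrow> y \<in> carrier M \<Longrightarrow> \<Gamma> (x \<oplus>\<^bsub>M\<^esub> y) = \<Gamma> x + \<Gamma> y"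
    and smult_closed: "a \<in> carrier (skew_ring_t q) \<Longrightarrow> x \<in> carrier M \<Longrightarrow> a \<odot>\<^bsub>M\<^esub> x \<in> carrier M"
    and smult: "a \<in> carrier (skew_ring_t q) \<Longrightarrow> x \<in> carrier M \<Longrightarrow>
      \<Gamma> (a \<odot>\<^bsub>M\<^esub> x) = skew_act fscale (matrix_tau q r A) t_shift q a (\<Gamma> x)"
begin

abbreviation T where "T \<equiv> matrix_tau q r A"

sublocale Z: tau_t_module fscale q T t_shift by (rule tau_t_module_matrix_tau)

lemma \<Gamma>_supp: "x \<in> carrier M \<Longrightarrow> \<Gamma> x \<in> supp_below r" using bij by (auto simp: bij_betw_def)

lemma \<Gamma>_inj: "x \<in> carrier M \<Longrightarrow> y \<in> carrier M \<Longrightarrow> \<Gamma> x = \<Gamma> y \<Longrightarrow> x = y"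
  using bij_betw_imp_inj_on[OF bij] by (rule inj_onD)

lemma left_module: "left_module (skew_ring_t q) M"
proof (rule left_module_transport[where \<Theta> = \<Gamma> and S = "supp_below r" and act = "skew_act fscale T t_shift q", OF ring_skew_ring_t bij])
  show "- x \<in> supp_below r" if "x \<in> supp_below r" for x :: "nat \<Rightarrow> 'k poly"
    using that by (simp add: supp_below_def)
qed (simp_all only: zero_closed zero add_closed add smult_closed smult Z.skew_act_add_left Z.skew_act_add_right
    Z.skew_act_mult Z.skew_act_one)

lemma abelian_monoid: "abelian_monoid M"
  using left_module by (simp add: left_module_def abelian_group_def)

lemma finsum_closed: "(\<And>i. i \<in> I \<Longrightarrow> f i \<in> carrier M) \<Longrightarrow> finsum M f I \<in> carrier M"
  by (rule abelian_monoid.finsum_closed[OF abelian_monoid]) blast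

lemma \<Gamma>_finsum: "(\<And>i. i \<in> I \<Longrightarrow> f i \<in> carrier M) \<Longrightarrow> \<Gamma> (finsum M f I) = (\<Sum>i\<in>I. \<Gamma> (f i))"
  by (rule finsum_transport[OF abelian_monoid zero add])

lemma smult_in_tau: "x \<in> carrier M \<Longrightarrow> \<Gamma> (in_tau q f \<odot>\<^bsub>M\<^esub> x) = poly_act fscale T f (\<Gamma> x)"
  by (simp only: smult in_tau_closed Z.skew_act_in_tau)

lemma smult_const: "x \<in> carrier M \<Longrightarrow> \<Gamma> (const_elem q c \<odot>\<^bsub>M\<^esub> x) = fscale c (\<Gamma> x)"
  unfolding const_elem_def by (simp only: smult_in_tau fscale.poly_act_const)

lemma smult_tau: "x \<in> carrier M \<Longrightarrow> \<Gamma> (tau_elem q \<odot>\<^bsub>M\<^esub> x) = T (\<Gamma> x)"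
  unfolding tau_elem_def by (simp only: smult_in_tau poly_act_x)

lemma smult_t: "x \<in> carrier M \<Longrightarrow> \<Gamma> (t_elem q \<odot>\<^bsub>M\<^esub> x) = t_shift (\<Gamma> x)"
  by (simp only: smult t_elem_closed Z.skew_act_t_elem)

lemma smult_t_pow:
  assumes x: "x \<in> carrier M"
  shows "(t_elem q [^]\<^bsub>skew_ring_t q\<^esub> (n::nat)) \<odot>\<^bsub>M\<^esub> x \<in> carrier M"
    "\<Gamma> ((t_elem q [^]\<^bsub>skew_ring_t q\<^esub> n) \<odot>\<^bsub>M\<^esub> x) = (t_shift ^^ n) (\<Gamma> x)"
proof -
  have mon: "monoid (skew_ring_t q :: (_, nat \<Rightarrow> 'k poly) up_ring)"
    using ring_skew_ring_t by (simp add: ring.is_monoid)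
  have cl: "t_elem q [^]\<^bsub>skew_ring_t q\<^esub> n \<in> carrier (skew_ring_t q :: (_, nat \<Rightarrow> 'k poly) up_ring)" for n :: nat
    by (rule monoid.nat_pow_closed[OF mon t_elem_closed])
  show "(t_elem q [^]\<^bsub>skew_ring_t q\<^esub> n) \<odot>\<^bsub>M\<^esub> x \<in> carrier M" by (rule smult_closed[OF cl x])
  have "skew_act fscale T t_shift q (t_elem q [^]\<^bsub>skew_ring_t q\<^esub> n) f = (t_shift ^^ n) f" for f
  proof (induction n arbitrary: f)
    case 0
    show ?case by (simp only: monoid.nat_pow_0[OF mon] Z.skew_act_one funpow_0)
  next
    case (Suc n)
    show ?case
      unfolding monoid.nat_pow_Suc[OF mon] Z.skew_act_mult[OF cl t_elem_closed] Z.skew_act_t_elem Suc.IH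
      by (simp only: funpow_Suc_right comp_apply)
  qed
  thus "\<Gamma> ((t_elem q [^]\<^bsub>skew_ring_t q\<^esub> n) \<odot>\<^bsub>M\<^esub> x) = (t_shift ^^ n) (\<Gamma> x)"
    by (simp only: smult[OF cl x])
qed

end

lemma (in motive_setting) motive_frobenius_coordinates:
  assumes ab: "abelian_t_module q d \<phi>"
  shows "\<exists>r A w \<Gamma>. frobenius_coordinates q (motive q d \<phi>) r A \<Gamma> \<and> weighted_frobenius q A r w \<theta> \<and>
    weight q d \<phi> = of_nat d / of_nat r \<and> real d = real r * w"
proof -
  obtain D n s r b where b: "pure_motive q P D (\<lambda>i. row_fun d (b i)) d n s r \<theta>"
    "weight q d \<phi> = of_nat d / of_nat r" "real d = real r * (real n / real s)"
    using motive_coordinates[OF ab] by blast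
  interpret pm: pure_motive "TYPE('k)" q P D "\<lambda>i. row_fun d (b i)" d n s r \<theta> by (rule b(1))
  let ?\<Gamma> = "\<lambda>x. pm.coords (row_fun d x)"
  let ?M = "motive q d \<phi>"
  have C: "carrier ?M = carrier_mat 1 d" and Z: "\<zero>\<^bsub>?M\<^esub> = 0\<^sub>m 1 d"
    and Pl: "\<And>x y. x \<oplus>\<^bsub>?M\<^esub> y = x + y" by (simp_all add: motive_def)
  have Pc: "\<phi> [:0, 1:] \<in> carrier_mat d d" by (rule phi_carrier[OF x_F])
  have coords_act: "pm.coords (skew_act fscale (vec_tau q) (row_mult q d P) q a f)
      = skew_act fscale (matrix_tau q r pm.A) t_shift q a (pm.coords f)" if f: "f \<in> supp_below d" for a f
  proof -
    have "pm.comb (skew_act fscale (matrix_tau q r pm.A) t_shift q a (pm.coords f))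
        = skew_act fscale (vec_tau q) (row_mult q d P) q a (pm.comb (pm.coords f))"
    proof (rule skew_act_intertwine[of pm.comb fscale fscale "matrix_tau q r pm.A" "vec_tau q" t_shift "row_mult q d P", OF pm.comb_add pm.comb_scale pm.comb_matrix_tau])
      fix g :: "nat \<Rightarrow> 'k poly"
      have "t_shift g = (\<lambda>i. [:0, 1:] * g i)" by (simp add: t_shift_def)
      hence "pm.comb (t_shift g) = poly_act fscale (row_mult q d P) [:0, 1:] (pm.comb g)" by (simp only: pm.comb_mult)
      thus "pm.comb (t_shift g) = row_mult q d P (pm.comb g)"
        by (simp only: poly_act_x)
    qed
    hence "pm.comb (skew_act fscale (matrix_tau q r pm.A) t_shift q a (pm.coords f))
        = skew_act fscale (vec_tau q) (row_mult q d P) q a f" by (simp only: pm.coords_spec(2)[OF f])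
    thus ?thesis by (intro pm.coords_eqI skew_act_mem pm.A_supp pm.coords_spec(1)[OF f])
  qed
  have "frobenius_coordinates q ?M r pm.A ?\<Gamma>"
  proof (intro frobenius_coordinates.intro frobenius_coordinates_axioms.intro)
    show "frobenius TYPE('k) q" by (rule frobenius_axioms)
    show "pm.A i \<in> supp_below r" for i by (rule pm.A_supp)
    show "bij_betw ?\<Gamma> (carrier ?M) (supp_below r)"
      unfolding C
    proof (rule bij_betwI[where g = "\<lambda>g. fun_row d (pm.comb g)"])
      show "?\<Gamma> \<in> carrier_mat 1 d \<rightarrow> supp_below r" using pm.coords_spec(1)[OF row_fun_supp] by blast
      show "(\<lambda>g. fun_row d (pm.comb g)) \<in> supp_below r \<rightarrow> carrier_mat 1 d" using fun_row_carrier by blast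
      show "fun_row d (pm.comb (?\<Gamma> x)) = x" if "x \<in> carrier_mat 1 d" for x
        by (simp only: pm.coords_spec(2)[OF row_fun_supp] fun_row_row_fun[OF that])
      show "?\<Gamma> (fun_row d (pm.comb g)) = g" if "g \<in> supp_below r" for g
        by (simp only: row_fun_fun_row pm.comb_supp pm.coords_comb[OF that])
    qed
    show "\<zero>\<^bsub>?M\<^esub> \<in> carrier ?M" unfolding C Z by simp
    show "?\<Gamma> \<zero>\<^bsub>?M\<^esub> = 0" unfolding Z row_fun_zero
      by (intro pm.coords_eqI zero_supp_below additive_zero[of pm.comb, OF pm.comb_add])
    show "x \<oplus>\<^bsub>?M\<^esub> y \<in> carrier ?M" if "x \<in> carrier ?M" "y \<in> carrier ?M" for x y
      unfolding C Pl by (rule add_carrier_mat[OF that(2)[unfolded C]])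
    show "?\<Gamma> (x \<oplus>\<^bsub>?M\<^esub> y) = ?\<Gamma> x + ?\<Gamma> y" if "x \<in> carrier ?M" "y \<in> carrier ?M" for x y
      using that unfolding C Pl by (simp only: row_fun_add pm.coords_add row_fun_supp)
    show "a \<odot>\<^bsub>?M\<^esub> x \<in> carrier ?M" if "x \<in> carrier ?M" for a x
      using that unfolding C by (rule motive_smult(1)[where \<phi> = \<phi>, OF Pc])
    show "?\<Gamma> (a \<odot>\<^bsub>?M\<^esub> x) = skew_act fscale (matrix_tau q r pm.A) t_shift q a (?\<Gamma> x)" if "x \<in> carrier ?M" for a x
      using that unfolding C by (simp only: motive_smult(2)[where \<phi> = \<phi>, OF Pc] coords_act[OF row_fun_supp])
  qed
  moreover have "real d = real r * pm.w" by (simp only: pm.w_def b(3)[symmetric])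
  ultimately show ?thesis using pm.weighted_frobenius b(2) by blast
qed

subsection \<open>The tensor product\<close>

lemma pure_tensor_fscale: "pure_tensor r1 r2 (fscale c f) g = fscale c (pure_tensor r1 r2 f g)"
  by (rule ext) (simp add: pure_tensor_def fscale_def)

lemma pure_tensor_t_shift: "pure_tensor r1 r2 (t_shift f) g = t_shift (pure_tensor r1 r2 f g)"
  by (rule ext) (simp add: pure_tensor_def t_shift_def)

lemma (in frobenius) pure_tensor_matrix_tau:
  fixes A1 A2 :: "nat \<Rightarrow> nat \<Rightarrow> 'k poly"
  shows "matrix_tau q (r1 * r2) (kronecker r1 r2 A1 A2) (pure_tensor r1 r2 f g)
    = pure_tensor r1 r2 (matrix_tau q r1 A1 f) (matrix_tau q r2 A2 g)"
proof
  fix a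
  show "matrix_tau q (r1 * r2) (kronecker r1 r2 A1 A2) (pure_tensor r1 r2 f g) a
    = pure_tensor r1 r2 (matrix_tau q r1 A1 f) (matrix_tau q r2 A2 g) a"
  proof (cases "a < r1 * r2")
    case True
    let ?F = "\<lambda>i j. (A1 i (a div r2) * frob_poly q (f i)) * (A2 j (a mod r2) * frob_poly q (g j))"
    have "matrix_tau q (r1 * r2) (kronecker r1 r2 A1 A2) (pure_tensor r1 r2 f g) a = (\<Sum>p<r1 * r2. ?F (p div r2) (p mod r2))"
      unfolding matrix_tau_def using True by (intro sum.cong refl) (simp add: kronecker_def pure_tensor_def frob_poly_mult)
    also have "\<dots> = (\<Sum>i<r1. \<Sum>j<r2. ?F i j)" by (rule sum_div_mod)
    also have "\<dots> = pure_tensor r1 r2 (matrix_tau q r1 A1 f) (matrix_tau q r2 A2 g) a"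
      using True by (simp only: pure_tensor_def matrix_tau_def if_True sum_product)
    finally show ?thesis .
  qed (simp add: matrix_tau_def kronecker_def pure_tensor_def)
qed

text \<open>On pure tensors the constants, \<open>\<tau>\<close> and \<open>t\<close> act as prescribed by the Kronecker product; the action of a general element is a
  finite product of compositions of these three.\<close>

lemma motive_tensor_coordinates:
  assumes M1: "frobenius_coordinates q M1 r1 A1 \<Gamma>1" and M2: "frobenius_coordinates q M2 r2 A2 \<Gamma>2" and r2: "0 < r2"
  shows "\<exists>\<Theta>. frobenius_coordinates q (motive_tensor q M1 M2) (r1 * r2) (kronecker r1 r2 A1 (A2 :: _ \<Rightarrow> _ \<Rightarrow> 'k::alg_closed_field poly)) \<Theta>"
proof -
  interpret M1: frobenius_coordinates "TYPE('k)" q M1 r1 A1 \<Gamma>1 by (rule M1)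
  interpret M2: frobenius_coordinates "TYPE('k)" q M2 r2 A2 \<Gamma>2 by (rule M2)
  define pol where "pol a = (SOME p. M1.K_t_elem p = a)" for a
  have pol: "M1.K_t_elem (pol a) = a" if "a \<in> K_t q" for a
    unfolding pol_def by (rule someI_ex[OF M1.K_t_elem_surj[OF that]])
  have K_t: "a \<in> carrier (skew_ring_t q)" if "a \<in> K_t q" for a :: "nat \<Rightarrow> 'k poly"
    using that by (simp add: K_t_def)
  have pol_elem: "pol (M1.K_t_elem p) = p" for p
    by (rule M1.K_t_elem_inj[OF pol[OF M1.K_t_elem_K_t]])
  have act1: "\<Gamma>1 (a \<odot>\<^bsub>M1\<^esub> x) = (\<lambda>i. pol a * \<Gamma>1 x i)" if a: "a \<in> K_t q" and x: "x \<in> carrier M1" for a x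
    using M1.Z.skew_act_K_t_elem[of "pol a" "\<Gamma>1 x"] unfolding pol[OF a] M1.smult[OF K_t[OF a] x, symmetric] poly_act_t_shift .
  have act2: "\<Gamma>2 (a \<odot>\<^bsub>M2\<^esub> x) = (\<lambda>i. pol a * \<Gamma>2 x i)" if a: "a \<in> K_t q" and x: "x \<in> carrier M2" for a x
    using M2.Z.skew_act_K_t_elem[of "pol a" "\<Gamma>2 x"] unfolding pol[OF a] M2.smult[OF K_t[OF a] x, symmetric] poly_act_t_shift .
  interpret tc: tensor_coordinates "K_t q" M1 M2 \<Gamma>1 \<Gamma>2 r1 r2 pol
  proof (intro tensor_coordinates.intro)
    show "\<exists>a\<in>K_t q. pol a = p" for p using pol_elem M1.K_t_elem_K_t by blast
  qed (simp_all only: M1.bij M2.bij M1.add_closed M2.add_closed M1.add M2.add K_t M1.smult_closed M2.smult_closed act1 act2 r2)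
  let ?A = "kronecker r1 r2 A1 A2" and ?R = "r1 * r2" and ?M = "motive_tensor q M1 M2"
  let ?T = "matrix_tau q ?R ?A"
  interpret Z: tau_t_module fscale q ?T t_shift by (rule M1.tau_t_module_matrix_tau)
  define scal where "scal c = tensor_map (K_t q) M1 M2 (module.smult M1 (const_elem q c)) id" for c
  define ta where "ta = tensor_map (K_t q) M1 M2 (module.smult M1 (tau_elem q)) (module.smult M2 (tau_elem q))"
  define te where "te = tensor_map (K_t q) M1 M2 (module.smult M1 (t_elem q)) id"
  have const_cl: "const_elem q c \<in> carrier (skew_ring_t q)" "tau_elem q \<in> carrier (skew_ring_t q :: (_, nat \<Rightarrow> 'k poly) up_ring)" for c :: 'k
    unfolding const_elem_def tau_elem_def by (rule in_tau_closed)+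
  have scal: "scal c W \<in> carrier tc.TG" "tc.\<Theta> (scal c W) = fscale c (tc.\<Theta> W)" if W: "W \<in> carrier tc.TG" for c W
    unfolding scal_def
    by (rule tc.tensor_map_\<Theta>[where op = "fscale c", OF _ _ _ _ W];
        simp only: M1.smult_closed const_cl id_apply fscale.scale_right_distrib M1.smult_const pure_tensor_fscale)+
  have te: "te W \<in> carrier tc.TG" "tc.\<Theta> (te W) = t_shift (tc.\<Theta> W)" if W: "W \<in> carrier tc.TG" for W
    unfolding te_def
    by (rule tc.tensor_map_\<Theta>[where op = t_shift, OF _ _ _ _ W];
        simp only: M1.smult_closed t_elem_closed id_apply Z.t_add M1.smult_t pure_tensor_t_shift)+
  have ta: "ta W \<in> carrier tc.TG" "tc.\<Theta> (ta W) = ?T (tc.\<Theta> W)" if W: "W \<in> carrier tc.TG" for W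
    unfolding ta_def
    by (rule tc.tensor_map_\<Theta>[where op = ?T, OF _ _ _ _ W];
        simp only: M1.smult_closed M2.smult_closed const_cl Z.D_add M1.smult_tau M2.smult_tau M1.pure_tensor_matrix_tau)+
  have te_pow: "(te ^^ j) W \<in> carrier tc.TG \<and> tc.\<Theta> ((te ^^ j) W) = (t_shift ^^ j) (tc.\<Theta> W)" if W: "W \<in> carrier tc.TG" for j W
    using W by (induction j) (simp_all add: te)
  have ta_pow: "(ta ^^ j) W \<in> carrier tc.TG \<and> tc.\<Theta> ((ta ^^ j) W) = (?T ^^ j) (tc.\<Theta> W)" if W: "W \<in> carrier tc.TG" for j W
    using W by (induction j) (simp_all add: ta)
  have C: "carrier ?M = carrier tc.TG" and Zr: "\<zero>\<^bsub>?M\<^esub> = \<one>\<^bsub>tc.TG\<^esub>"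
    and Pl: "W \<oplus>\<^bsub>?M\<^esub> V = W \<otimes>\<^bsub>tc.TG\<^esub> V"
    and Sm: "a \<odot>\<^bsub>?M\<^esub> W = (\<Otimes>\<^bsub>tc.TG\<^esub>j\<in>{..deg (skew_ring q) a}. \<Otimes>\<^bsub>tc.TG\<^esub>i\<in>{..degree (a j)}.
         scal (Polynomial.coeff (a j) i) ((ta ^^ i) ((te ^^ j) W)))" for W V a
    unfolding motive_tensor_def Let_def scal_def ta_def te_def by simp_all
  have mon: "comm_monoid tc.TG" using tc.TG_comm_group by (simp add: comm_group_def)
  have "frobenius_coordinates q ?M ?R ?A tc.\<Theta>"
  proof (intro frobenius_coordinates.intro frobenius_coordinates_axioms.intro)
    show "frobenius TYPE('k) q" by (rule M1.frobenius_axioms)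
    show "?A i \<in> supp_below ?R" for i by (simp add: kronecker_def supp_below_def)
    show "bij_betw tc.\<Theta> (carrier ?M) (supp_below ?R)" unfolding C by (rule tc.bij_\<Theta>)
    show "\<zero>\<^bsub>?M\<^esub> \<in> carrier ?M" unfolding C Zr using mon by (simp add: comm_monoid_def monoid.one_closed)
    show "tc.\<Theta> \<zero>\<^bsub>?M\<^esub> = 0" unfolding Zr by (rule tc.\<Theta>_one)
    show "x \<oplus>\<^bsub>?M\<^esub> y \<in> carrier ?M" if "x \<in> carrier ?M" "y \<in> carrier ?M" for x y
      using that mon unfolding C Pl by (simp add: comm_monoid_def monoid.m_closed)
    show "tc.\<Theta> (x \<oplus>\<^bsub>?M\<^esub> y) = tc.\<Theta> x + tc.\<Theta> y" if "x \<in> carrier ?M" "y \<in> carrier ?M" for x y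
      using that unfolding C Pl by (rule tc.\<Theta>_mult)
    fix a W assume "W \<in> carrier ?M"
    hence W: "W \<in> carrier tc.TG" unfolding C .
    let ?y = "\<lambda>j i. scal (Polynomial.coeff (a j) i) ((ta ^^ i) ((te ^^ j) W))"
    have y: "?y j i \<in> carrier tc.TG" "tc.\<Theta> (?y j i) = fscale (Polynomial.coeff (a j) i) ((?T ^^ i) ((t_shift ^^ j) (tc.\<Theta> W)))" for j i
      using te_pow[OF W, of j] ta_pow[of "(te ^^ j) W" i] scal[of "(ta ^^ i) ((te ^^ j) W)" "Polynomial.coeff (a j) i"]
      by simp_all
    note y' = tc.\<Theta>_finprod[OF y(1)]
    show "a \<odot>\<^bsub>?M\<^esub> W \<in> carrier ?M" unfolding C Sm by (rule tc.\<Theta>_finprod(1)[OF y'(1)])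
    show "tc.\<Theta> (a \<odot>\<^bsub>?M\<^esub> W) = skew_act fscale ?T t_shift q a (tc.\<Theta> W)"
      unfolding Sm tc.\<Theta>_finprod(2)[OF y'(1)] y'(2) y(2) skew_act_def poly_act_def ..
  qed
  thus ?thesis by (rule exI[of _ tc.\<Theta>])
qed

section \<open>The t-module attached to a pure basis\<close>

lemma invertible_mat_of_trivial_left_kernel:
  fixes E :: "'k::field mat"
  assumes E: "E \<in> carrier_mat d d"
    and ker: "\<And>c. (\<And>j. j < d \<Longrightarrow> (\<Sum>i<d. c i * E $$ (i, j)) = 0) \<Longrightarrow> \<forall>i<d. c i = 0"
  shows "invertible_mat E"
proof -
  have Et: "transpose_mat E \<in> carrier_mat d d" using E by simp
  have "det (transpose_mat E) \<noteq> 0"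
  proof
    assume "det (transpose_mat E) = 0"
    then obtain v where v: "v \<in> carrier_vec d" "v \<noteq> 0\<^sub>v d" "transpose_mat E *\<^sub>v v = 0\<^sub>v d"
      using det_0_iff_vec_prod_zero_field[OF Et] by blast
    have "(\<Sum>i<d. v $ i * E $$ (i, j)) = 0" if j: "j < d" for j
    proof -
      have "(transpose_mat E *\<^sub>v v) $ j = 0" unfolding v(3) using j by simp
      hence "(\<Sum>i = 0..<d. E $$ (i, j) * v $ i) = 0" using j E v(1) by (simp add: scalar_prod_def)
      thus ?thesis by (simp only: atLeast0LessThan mult.commute)
    qed
    from ker[OF this] have "v = 0\<^sub>v d" using v(1) by (intro eq_vecI) auto
    thus False using v(2) by contradiction
  qed
  hence "det E \<noteq> 0" by (simp only: det_transpose[OF E] not_False_eq_True)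
  from det_non_zero_imp_unit[OF E this, of "()"]
  obtain B where B: "B \<in> carrier_mat d d" "B * E = 1\<^sub>m d" "E * B = 1\<^sub>m d"
    unfolding Units_def by (auto simp: ring_mat_def)
  show ?thesis unfolding invertible_mat_def inverts_mat_def
    using E B by (intro conjI exI[of _ B]) (simp_all add: square_mat.simps)
qed

lemma mat_mult_entry:
  assumes "B \<in> carrier_mat d d" "E \<in> carrier_mat d d" "i < d" "j < d"
  shows "(B * E) $$ (i, j) = (\<Sum>k<d. B $$ (i, k) * E $$ (k, j))"
  using assms by (simp add: scalar_prod_def atLeast0LessThan)

text \<open>\<open>\<kappa>\<close> is a \<open>K{\<tau>}\<close>-basis, written in \<open>K[t]\<close>-coordinates, in which \<open>t\<^sup>N\<close> has the matrix \<open>D\<close> of degree \<open>s\<close> with invertible leading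
  coefficient.\<close>

locale pure_basis = frobenius_coordinates field_type q M r A \<Gamma> + W: weighted_frobenius field_type q A r w \<theta>
  for field_type :: "'k::alg_closed_field itself" and q :: nat and M :: "(nat \<Rightarrow> 'k poly, 'm) module"
    and r :: nat and A :: "nat \<Rightarrow> nat \<Rightarrow> 'k poly" and \<Gamma> :: "'m \<Rightarrow> (nat \<Rightarrow> 'k poly)" and w :: real and \<theta> :: 'k +
  fixes N s d :: nat and \<kappa> :: "nat \<Rightarrow> (nat \<Rightarrow> 'k poly)" and D :: "nat \<Rightarrow> nat \<Rightarrow> 'k poly"
  assumes N_pos: "0 < N"
    and \<kappa>_supp: "i < d \<Longrightarrow> \<kappa> i \<in> supp_below r"
    and generates: "x \<in> supp_below r \<Longrightarrow> \<exists>f. x = (\<Sum>i<d. poly_act fscale T (f i) (\<kappa> i))"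
    and independent: "(\<Sum>i<d. poly_act fscale T (f i) (\<kappa> i)) = 0 \<Longrightarrow> i < d \<Longrightarrow> f i = 0"
    and t_power: "i < d \<Longrightarrow> (t_shift ^^ N) (\<kappa> i) = (\<Sum>j<d. poly_act fscale T (D i j) (\<kappa> j))"
    and D_degree: "i < d \<Longrightarrow> j < d \<Longrightarrow> n > s \<Longrightarrow> coeff (D i j) n = 0"
    and D_leading: "(\<And>j. j < d \<Longrightarrow> (\<Sum>i<d. c i * coeff (D i j) s) = 0) \<Longrightarrow> \<forall>i<d. c i = 0"
begin

definition lin :: "(nat \<Rightarrow> 'k poly) \<Rightarrow> (nat \<Rightarrow> 'k poly)" where
  "lin f = (\<Sum>i<d. poly_act fscale T (f i) (\<kappa> i))"

lemma T_supp: "f \<in> supp_below r \<Longrightarrow> T f \<in> supp_below r" by (rule matrix_tau_mem[OF A_supp])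

lemma lin_supp: "lin f \<in> supp_below r"
  unfolding lin_def by (intro fscale.subspace_sum[OF supp_below_sub] poly_act_mem_supp T_supp \<kappa>_supp) simp_all

lemma lin_add: "lin (f + g) = lin f + lin g"
  unfolding lin_def by (simp only: plus_fun_apply fscale.poly_act_add_left sum.distrib)

lemma lin_fscale: "lin (fscale c f) = fscale c (lin f)"
  unfolding lin_def fscale_def[of c f] by (simp only: fscale.poly_act_smult fscale.scale_sum_right)

lemma lin_tau: "lin (vec_tau q f) = T (lin f)"
  unfolding lin_def vec_tau_def by (simp only: Z.poly_act_tau_left Z.D_sum)

lemma lin_cong: "(\<And>i. i < d \<Longrightarrow> f i = g i) \<Longrightarrow> lin f = lin g"
  unfolding lin_def by (intro sum.cong) simp_all

lemma lin_inj: assumes "f \<in> supp_below d" "g \<in> supp_below d" "lin f = lin g" shows "f = g"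
proof
  fix i
  have "lin (f - g) = lin f - lin g" by (rule additive_diff[of lin, OF lin_add])
  hence "lin (f - g) = 0" by (simp only: assms(3) diff_self)
  hence "(f - g) i = 0" if "i < d" using independent[of "f - g" i] that unfolding lin_def by blast
  thus "f i = g i" using assms(1,2) by (cases "i < d") (simp_all add: supp_belowD[of _ d])
qed

definition coordinates :: "(nat \<Rightarrow> 'k poly) \<Rightarrow> (nat \<Rightarrow> 'k poly)" where
  "coordinates x = (SOME f. f \<in> supp_below d \<and> lin f = x)"

lemma coordinates:
  assumes "x \<in> supp_below r"
  shows "coordinates x \<in> supp_below d" "lin (coordinates x) = x"
proof -
  obtain f where f: "x = lin f" using generates[OF assms] unfolding lin_def by blast
  have "(\<lambda>i. if i < d then f i else 0) \<in> supp_below d \<and> lin (\<lambda>i. if i < d then f i else 0) = x"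
    unfolding f by (intro conjI lin_cong) (simp_all add: supp_below_def)
  hence "\<exists>f. f \<in> supp_below d \<and> lin f = x" by (rule exI[of _ "\<lambda>i. if i < d then f i else 0"])
  from someI_ex[OF this] show "coordinates x \<in> supp_below d" "lin (coordinates x) = x"
    unfolding coordinates_def by (rule conjunct1, rule conjunct2)
qed

lemma coordinates_eqI: assumes f: "f \<in> supp_below d" and x: "lin f = x" shows "coordinates x = f"
proof (rule lin_inj[OF _ f])
  have "x \<in> supp_below r" unfolding x[symmetric] by (rule lin_supp)
  thus "coordinates x \<in> supp_below d" "lin (coordinates x) = lin f" unfolding x by (rule coordinates)+
qed

lemma coordinates_add: "x \<in> supp_below r \<Longrightarrow> y \<in> supp_below r \<Longrightarrow> coordinates (x + y) = coordinates x + coordinates y"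
  by (intro coordinates_eqI fscale.subspace_add[OF supp_below_sub]) (simp_all only: coordinates lin_add)

lemma d_pos: "0 < d"
proof (rule ccontr)
  assume "\<not> 0 < d"
  hence "unit_vec_poly 0 1 = (0 :: nat \<Rightarrow> 'k poly)"
    using generates[OF unit_vec_poly_supp[OF W.r_pos, of 1]] by simp
  from fun_cong[OF this, of 0] show False by (simp add: unit_vec_poly_def)
qed

definition D_mat :: "'k poly mat" where "D_mat = mat d d (\<lambda>(i, j). D i j)"

lemma invertible_leading_coeff_D: "invertible_leading_coeff D_mat"
proof -
  have E: "coeff_mat D_mat s \<in> carrier_mat d d" by (simp add: D_mat_def coeff_mat_def)
  have entry: "coeff_mat D_mat n $$ (i, j) = coeff (D i j) n" if "i < d" "j < d" for i j n
    using that by (simp add: D_mat_def coeff_mat_def)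
  have "coeff_mat D_mat j = 0\<^sub>m d d" if "j > s" for j
    using D_degree that by (intro eq_matI) (simp_all add: D_mat_def coeff_mat_def)
  moreover have "coeff_mat D_mat s \<noteq> 0\<^sub>m d d"
  proof
    assume z: "coeff_mat D_mat s = 0\<^sub>m d d"
    have "coeff (D i j) s = 0" if "i < d" "j < d" for i j
      using entry[OF that, of s] that unfolding z by simp
    hence "\<forall>i<d. (1 :: 'k) = 0" by (intro D_leading) simp
    thus False using d_pos by simp
  qed
  moreover have "invertible_mat (coeff_mat D_mat s)"
  proof (rule invertible_mat_of_trivial_left_kernel[OF E])
    fix c :: "nat \<Rightarrow> 'k" assume c: "\<And>j. j < d \<Longrightarrow> (\<Sum>i<d. c i * coeff_mat D_mat s $$ (i, j)) = 0"
    show "\<forall>i<d. c i = 0"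
    proof (rule D_leading)
      fix j assume j: "j < d"
      have "(\<Sum>i<d. c i * coeff (D i j) s) = (\<Sum>i<d. c i * coeff_mat D_mat s $$ (i, j))"
        using j by (intro sum.cong) (simp_all add: entry)
      thus "(\<Sum>i<d. c i * coeff (D i j) s) = 0" by (simp only: c[OF j])
    qed
  qed
  ultimately show ?thesis unfolding invertible_leading_coeff_def
    by (intro exI[of _ s]) (simp add: D_mat_def)
qed

subsection \<open>Purity with respect to the basis\<close>

definition basis_elem :: "nat \<Rightarrow> 'm" where
  "basis_elem i = inv_into (carrier M) \<Gamma> (\<kappa> i)"

lemma basis_elem: assumes "i < d" shows "basis_elem i \<in> carrier M" "\<Gamma> (basis_elem i) = \<kappa> i"
proof -
  have "\<kappa> i \<in> \<Gamma> ` carrier M" using bij_betw_imp_surj_on[OF bij] \<kappa>_supp[OF assms] by (simp only:)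
  thus "basis_elem i \<in> carrier M" "\<Gamma> (basis_elem i) = \<kappa> i"
    unfolding basis_elem_def by (rule inv_into_into, rule f_inv_into_f)
qed

lemma basis_combination:
  "(\<Oplus>\<^bsub>M\<^esub>i\<in>{..<d}. in_tau q (f i) \<odot>\<^bsub>M\<^esub> basis_elem i) \<in> carrier M"
  "\<Gamma> (\<Oplus>\<^bsub>M\<^esub>i\<in>{..<d}. in_tau q (f i) \<odot>\<^bsub>M\<^esub> basis_elem i) = lin f"
proof -
  have cl: "in_tau q (f i) \<odot>\<^bsub>M\<^esub> basis_elem i \<in> carrier M" if "i \<in> {..<d}" for i
    using that by (intro smult_closed in_tau_closed basis_elem(1)) simp
  show "(\<Oplus>\<^bsub>M\<^esub>i\<in>{..<d}. in_tau q (f i) \<odot>\<^bsub>M\<^esub> basis_elem i) \<in> carrier M" by (rule finsum_closed[OF cl])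
  have "\<Gamma> (\<Oplus>\<^bsub>M\<^esub>i\<in>{..<d}. in_tau q (f i) \<odot>\<^bsub>M\<^esub> basis_elem i) = (\<Sum>i<d. \<Gamma> (in_tau q (f i) \<odot>\<^bsub>M\<^esub> basis_elem i))"
    by (rule \<Gamma>_finsum[OF cl])
  also have "\<dots> = lin f" unfolding lin_def
    by (intro sum.cong refl) (simp only: lessThan_iff smult_in_tau basis_elem)
  finally show "\<Gamma> (\<Oplus>\<^bsub>M\<^esub>i\<in>{..<d}. in_tau q (f i) \<odot>\<^bsub>M\<^esub> basis_elem i) = lin f" .
qed

lemma finsum_cong_basis:
  assumes "\<And>i. i < d \<Longrightarrow> a i = in_tau q (f i)"
  shows "(\<Oplus>\<^bsub>M\<^esub>i\<in>{..<d}. a i \<odot>\<^bsub>M\<^esub> basis_elem i) = (\<Oplus>\<^bsub>M\<^esub>i\<in>{..<d}. in_tau q (f i) \<odot>\<^bsub>M\<^esub> basis_elem i)"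
proof (rule abelian_monoid.finsum_cong'[OF abelian_monoid refl])
  show "(\<lambda>i. in_tau q (f i) \<odot>\<^bsub>M\<^esub> basis_elem i) \<in> {..<d} \<rightarrow> carrier M"
    using smult_closed[OF in_tau_closed basis_elem(1)] by simp
qed (simp only: assms lessThan_iff)

lemma free_basis_basis_elem: "free_basis (K_tau q) M d basis_elem"
  unfolding free_basis_def
proof (intro conjI ballI)
  show "basis_elem \<in> {..<d} \<rightarrow> carrier M" using basis_elem(1) by simp
  fix x assume x: "x \<in> carrier M"
  let ?f = "coordinates (\<Gamma> x)"
  show "\<exists>!c. c \<in> {..<d} \<rightarrow>\<^sub>E K_tau q \<and> x = (\<Oplus>\<^bsub>M\<^esub>i\<in>{..<d}. c i \<odot>\<^bsub>M\<^esub> basis_elem i)"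
  proof (rule ex1I[of _ "\<lambda>i\<in>{..<d}. in_tau q (?f i)"])
    have "x = (\<Oplus>\<^bsub>M\<^esub>i\<in>{..<d}. in_tau q (?f i) \<odot>\<^bsub>M\<^esub> basis_elem i)"
      by (rule \<Gamma>_inj[OF x basis_combination(1)]) (simp only: basis_combination(2) coordinates(2)[OF \<Gamma>_supp[OF x]])
    also have "\<dots> = (\<Oplus>\<^bsub>M\<^esub>i\<in>{..<d}. (\<lambda>i\<in>{..<d}. in_tau q (?f i)) i \<odot>\<^bsub>M\<^esub> basis_elem i)"
      by (rule finsum_cong_basis[symmetric]) simp
    finally show "(\<lambda>i\<in>{..<d}. in_tau q (?f i)) \<in> {..<d} \<rightarrow>\<^sub>E K_tau q \<and>
        x = (\<Oplus>\<^bsub>M\<^esub>i\<in>{..<d}. (\<lambda>i\<in>{..<d}. in_tau q (?f i)) i \<odot>\<^bsub>M\<^esub> basis_elem i)"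
      by (intro conjI) (auto simp: K_tau_def)
  next
    fix c assume c: "c \<in> {..<d} \<rightarrow>\<^sub>E K_tau q \<and> x = (\<Oplus>\<^bsub>M\<^esub>i\<in>{..<d}. c i \<odot>\<^bsub>M\<^esub> basis_elem i)"
    define g where "g i = (if i < d then SOME p. c i = in_tau q p else 0)" for i
    have g: "c i = in_tau q (g i)" if i: "i < d" for i
    proof -
      have "c i \<in> K_tau q" using c i by (auto simp: PiE_def Pi_def)
      hence "\<exists>p. c i = in_tau q p" unfolding K_tau_def by blast
      thus ?thesis unfolding g_def using i someI_ex[of "\<lambda>p. c i = in_tau q p"] by (simp only: if_True)
    qed
    have gS: "g \<in> supp_below d" by (simp add: g_def supp_below_def)
    have "x = (\<Oplus>\<^bsub>M\<^esub>i\<in>{..<d}. in_tau q (g i) \<odot>\<^bsub>M\<^esub> basis_elem i)"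
      using conjunct2[OF c] finsum_cong_basis[of c g, OF g] by simp
    hence "\<Gamma> x = lin g" by (simp only: basis_combination(2))
    hence "?f = g" by (intro coordinates_eqI gS) simp
    show "c = (\<lambda>i\<in>{..<d}. in_tau q (?f i))"
    proof
      fix i
      show "c i = (\<lambda>i\<in>{..<d}. in_tau q (?f i)) i"
        using c g[of i] unfolding \<open>?f = g\<close> by (cases "i < d") (auto simp: PiE_def extensional_def)
    qed
  qed
qed

lemma pure_wrt_basis: "pure_wrt_basis_at N q M d basis_elem"
  unfolding pure_wrt_basis_at_def
proof (intro conjI left_module free_basis_basis_elem bexI[of _ D_mat] allI impI invertible_leading_coeff_D)
  show "D_mat \<in> carrier_mat d d" by (simp add: D_mat_def)
  fix i assume i: "i < d"
  have "(\<Oplus>\<^bsub>M\<^esub>j\<in>{..<d}. in_tau q (D_mat $$ (i, j)) \<odot>\<^bsub>M\<^esub> basis_elem j)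
      = (\<Oplus>\<^bsub>M\<^esub>j\<in>{..<d}. in_tau q (D i j) \<odot>\<^bsub>M\<^esub> basis_elem j)"
    by (rule finsum_cong_basis) (use i in \<open>simp add: D_mat_def\<close>)
  moreover have "(t_elem q [^]\<^bsub>skew_ring_t q\<^esub> N) \<odot>\<^bsub>M\<^esub> basis_elem i = (\<Oplus>\<^bsub>M\<^esub>j\<in>{..<d}. in_tau q (D i j) \<odot>\<^bsub>M\<^esub> basis_elem j)"
    by (rule \<Gamma>_inj[OF smult_t_pow(1)[OF basis_elem(1)[OF i]] basis_combination(1)])
      (simp only: smult_t_pow(2)[OF basis_elem(1)[OF i]] basis_combination(2) basis_elem(2)[OF i] t_power[OF i] lin_def)
  ultimately show "(t_elem q [^]\<^bsub>skew_ring_t q\<^esub> N) \<odot>\<^bsub>M\<^esub> basis_elem i = (\<Oplus>\<^bsub>M\<^esub>j\<in>{..<d}. in_tau q (D_mat $$ (i, j)) \<odot>\<^bsub>M\<^esub> basis_elem j)"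
    by (simp only:)
qed

subsection \<open>The t-module\<close>

text \<open>The \<open>i\<close>-th row of \<open>\<rho>\<^sub>a\<close> consists of the \<open>K{\<tau>}\<close>-coordinates of \<open>a(t) \<kappa>\<^sub>i\<close>.\<close>

definition \<rho> :: "'k poly \<Rightarrow> 'k poly mat" where
  "\<rho> a = mat d d (\<lambda>(i, j). coordinates (poly_act fscale t_shift a (\<kappa> i)) j)"

lemma \<rho>_carrier: "\<rho> a \<in> carrier_mat d d" by (simp add: \<rho>_def)

lemma t_act_supp: "i < d \<Longrightarrow> poly_act fscale t_shift a (\<kappa> i) \<in> supp_below r"
  by (intro poly_act_mem_supp t_shift_mem \<kappa>_supp)

lemma \<rho>_row: assumes i: "i < d" shows "lin (mat_fun (\<rho> a) i) = poly_act fscale t_shift a (\<kappa> i)"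
proof -
  have "lin (mat_fun (\<rho> a) i) = lin (coordinates (poly_act fscale t_shift a (\<kappa> i)))"
    by (rule lin_cong) (use i in \<open>simp add: mat_fun_def \<rho>_def\<close>)
  thus ?thesis by (simp only: coordinates(2)[OF t_act_supp[OF i]])
qed

lemma \<rho>_eqI:
  assumes B: "B \<in> carrier_mat d d" and row: "\<And>i. i < d \<Longrightarrow> lin (mat_fun B i) = poly_act fscale t_shift a (\<kappa> i)"
  shows "\<rho> a = B"
proof (rule eq_matI)
  fix i j assume "i < dim_row B" "j < dim_col B"
  hence ij: "i < d" "j < d" using B by simp_all
  let ?g = "\<lambda>j. if j < d then mat_fun B i j else 0"
  have "lin ?g = lin (mat_fun B i)" by (rule lin_cong) simp
  hence "lin ?g = poly_act fscale t_shift a (\<kappa> i)" by (simp only: row[OF ij(1)])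
  hence "coordinates (poly_act fscale t_shift a (\<kappa> i)) = ?g" by (intro coordinates_eqI) (simp_all add: supp_below_def)
  thus "\<rho> a $$ (i, j) = B $$ (i, j)" using ij by (simp add: \<rho>_def mat_fun_def)
qed (use B in \<open>simp_all add: \<rho>_def\<close>)

text \<open>A \<open>K{\<tau>}\<close>-linear map acts on \<open>K{\<tau>}\<close>-coordinates by right multiplication with the matrix of the images of the basis.\<close>

lemma lin_row_mult:
  assumes B: "\<And>k. k < d \<Longrightarrow> lin (B k) = h (\<kappa> k)"
    and h: "\<And>x y. h (x + y) = h x + h y" "\<And>f x. h (poly_act fscale T f x) = poly_act fscale T f (h x)"
  shows "lin (row_mult q d B f) = h (lin f)"
proof -
  have "lin (row_mult q d B f) = (\<Sum>j<d. poly_act fscale T (\<Sum>k<d. skew_mult q (f k) (B k j)) (\<kappa> j))"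
    unfolding lin_def by (intro sum.cong refl) (simp add: row_mult_def)
  also have "\<dots> = (\<Sum>k<d. poly_act fscale T (f k) (lin (B k)))"
    unfolding lin_def by (simp only: fscale.poly_act_sum_left Z.poly_act_skew_mult Z.poly_act_sum_right) (rule sum.swap)
  also have "\<dots> = (\<Sum>k<d. h (poly_act fscale T (f k) (\<kappa> k)))"
    by (intro sum.cong refl) (simp only: lessThan_iff B h(2))
  also have "\<dots> = h (lin f)" unfolding lin_def by (rule additive_sum[of h, OF h(1), symmetric])
  finally show ?thesis .
qed

abbreviation P where "P \<equiv> mat_fun (\<rho> [:0, 1:])"

lemma lin_t: "lin (row_mult q d P f) = t_shift (lin f)"
proof (rule lin_row_mult[OF _ Z.t_add Z.t_poly_act])
  fix k assume "k < d"
  thus "lin (P k) = t_shift (\<kappa> k)" by (simp only: \<rho>_row poly_act_x)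
qed

sublocale R: tau_t_module fscale q "vec_tau q" "row_mult q d P" by (rule tau_t_module_row_mult)

lemma lin_poly_act_t: "lin (poly_act fscale (row_mult q d P) p f) = poly_act fscale t_shift p (lin f)"
  by (rule poly_act_intertwine[of lin fscale fscale "row_mult q d P" t_shift, OF lin_add lin_fscale lin_t])

lemma isomorphic_motive: "isomorphic_modules (skew_ring_t q) M (motive q d \<rho>)"
  unfolding isomorphic_modules_def
proof (intro exI[of _ "\<lambda>x. fun_row d (coordinates (\<Gamma> x))"] conjI ballI)
  let ?M = "motive q d \<rho>"
  have C: "carrier ?M = carrier_mat 1 d" and Pl: "\<And>x y. x \<oplus>\<^bsub>?M\<^esub> y = x + y" by (simp_all add: motive_def)
  let ?h = "\<lambda>x. fun_row d (coordinates (\<Gamma> x))"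
  have row_inj: "x = y" if "x \<in> carrier_mat 1 d" "y \<in> carrier_mat 1 d" "row_fun d x = row_fun d y" for x y :: "'k poly mat"
  proof -
    have "fun_row d (row_fun d x) = fun_row d (row_fun d y)" by (simp only: that(3))
    thus ?thesis by (simp only: fun_row_row_fun that(1,2))
  qed
  have cS: "coordinates (\<Gamma> x) \<in> supp_below d" if "x \<in> carrier M" for x
    by (rule coordinates(1)[OF \<Gamma>_supp[OF that]])
  have bij_c: "bij_betw coordinates (supp_below r) (supp_below d)"
  proof (rule bij_betwI[where g = lin])
    show "coordinates \<in> supp_below r \<rightarrow> supp_below d" using coordinates(1) by blast
    show "lin \<in> supp_below d \<rightarrow> supp_below r" using lin_supp by blast
    show "lin (coordinates x) = x" if "x \<in> supp_below r" for x by (rule coordinates(2)[OF that])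
    show "coordinates (lin f) = f" if "f \<in> supp_below d" for f by (rule coordinates_eqI[OF that refl])
  qed
  have bij_f: "bij_betw (fun_row d) (supp_below d) (carrier_mat 1 d :: 'k poly mat set)"
  proof (rule bij_betwI[where g = "row_fun d"])
    show "fun_row d \<in> supp_below d \<rightarrow> (carrier_mat 1 d :: 'k poly mat set)" using fun_row_carrier by blast
    show "row_fun d \<in> (carrier_mat 1 d :: 'k poly mat set) \<rightarrow> supp_below d" using row_fun_supp by blast
  qed (rule row_fun_fun_row, assumption, rule fun_row_row_fun, assumption)
  show "bij_betw ?h (carrier M) (carrier ?M)"
    using bij_betw_trans[OF bij bij_betw_trans[OF bij_c bij_f]] unfolding C comp_def .
  show "?h (x \<oplus>\<^bsub>M\<^esub> y) = ?h x \<oplus>\<^bsub>?M\<^esub> ?h y" if x: "x \<in> carrier M" and y: "y \<in> carrier M" for x y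
    unfolding Pl
    by (rule row_inj[OF fun_row_carrier add_carrier_mat[OF fun_row_carrier]])
      (simp only: row_fun_add fun_row_carrier row_fun_fun_row fscale.subspace_add[OF supp_below_sub] cS x y add_closed add coordinates_add \<Gamma>_supp)
  show "?h (a \<odot>\<^bsub>M\<^esub> x) = a \<odot>\<^bsub>?M\<^esub> ?h x" if a: "a \<in> carrier (skew_ring_t q)" and x: "x \<in> carrier M" for a x
  proof (rule row_inj[OF fun_row_carrier motive_smult(1)[OF \<rho>_carrier fun_row_carrier]])
    let ?f = "coordinates (\<Gamma> x)"
    let ?y = "row_fun d (a \<odot>\<^bsub>?M\<^esub> ?h x)"
    have "lin ?y = lin (skew_act fscale (vec_tau q) (row_mult q d P) q a ?f)"
      by (simp only: motive_smult(2)[OF \<rho>_carrier fun_row_carrier] row_fun_fun_row[OF cS[OF x]])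
    also have "\<dots> = skew_act fscale T t_shift q a (lin ?f)"
      by (rule skew_act_intertwine[of lin fscale fscale "vec_tau q" T "row_mult q d P" t_shift, OF lin_add lin_fscale lin_tau lin_t])
    also have "\<dots> = \<Gamma> (a \<odot>\<^bsub>M\<^esub> x)" by (simp only: coordinates(2)[OF \<Gamma>_supp[OF x]] smult[OF a x])
    finally have "coordinates (\<Gamma> (a \<odot>\<^bsub>M\<^esub> x)) = ?y" by (rule coordinates_eqI[OF row_fun_supp])
    thus "row_fun d (?h (a \<odot>\<^bsub>M\<^esub> x)) = ?y" by (simp only: row_fun_fun_row row_fun_supp)
  qed
qed

lemma almost_strictly_pure_\<rho>: "almost_strictly_pure \<rho>"
proof -
  have "\<rho> (monom 1 N) = D_mat"
  proof (rule \<rho>_eqI)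
    show "D_mat \<in> carrier_mat d d" by (simp add: D_mat_def)
    fix i assume i: "i < d"
    have "lin (mat_fun D_mat i) = lin (D i)" by (rule lin_cong) (use i in \<open>simp add: mat_fun_def D_mat_def\<close>)
    also have "\<dots> = poly_act fscale t_shift (monom 1 N) (\<kappa> i)"
      unfolding lin_def fscale.poly_act_monom fscale.scale_one by (rule t_power[OF i, symmetric])
    finally show "lin (mat_fun D_mat i) = poly_act fscale t_shift (monom 1 N) (\<kappa> i)" .
  qed
  hence "invertible_leading_coeff (\<rho> (monom 1 N))" using invertible_leading_coeff_D by (simp only:)
  moreover have "N \<ge> 1" using N_pos by simp
  ultimately show ?thesis unfolding almost_strictly_pure_def by blast
qed

lemma t_minus_theta_image:
  "\<exists>k. \<forall>f\<in>supp_below r. \<exists>h\<in>supp_below r. poly_act fscale t_shift ([:- \<theta>, 1:] ^ k) f = T h"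
proof -
  obtain k where k: "\<forall>i<r. \<exists>f\<in>supp_below r. T f = unit_vec_poly i ([:- \<theta>, 1:] ^ k)"
    using W.cokernel by blast
  then obtain u where u: "\<And>i. i < r \<Longrightarrow> u i \<in> supp_below r" "\<And>i. i < r \<Longrightarrow> T (u i) = unit_vec_poly i ([:- \<theta>, 1:] ^ k)"
    by metis
  have "\<forall>p. \<exists>g. frob_poly q g = (p :: 'k poly)"
    using frob_poly_funpow_surj[of "Suc 0"] by simp
  from choice[OF this] obtain root where root: "\<And>p. frob_poly q (root p) = (p :: 'k poly)" by blast
  have "\<exists>h\<in>supp_below r. poly_act fscale t_shift ([:- \<theta>, 1:] ^ k) f = T h" if f: "f \<in> supp_below r" for f
  proof (rule bexI[of _ "\<Sum>i<r. (\<lambda>a. root (f i) * u i a)"])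
    show "(\<Sum>i<r. (\<lambda>a. root (f i) * u i a)) \<in> supp_below r"
      by (rule fscale.subspace_sum[OF supp_below_sub]) (use supp_belowD[OF u(1)] in \<open>simp add: supp_below_def\<close>)
    have "T (\<Sum>i<r. (\<lambda>a. root (f i) * u i a)) a = [:- \<theta>, 1:] ^ k * f a" for a
    proof -
      have "T (\<Sum>i<r. (\<lambda>a. root (f i) * u i a)) a = (\<Sum>i<r. f i * T (u i) a)"
        unfolding matrix_tau_lincomb fscale_sum_apply by (simp only: root)
      also have "\<dots> = (\<Sum>i<r. if i = a then f i * [:- \<theta>, 1:] ^ k else 0)"
        by (intro sum.cong refl) (simp add: u(2) unit_vec_poly_def)
      also have "\<dots> = [:- \<theta>, 1:] ^ k * f a" using supp_belowD[OF f, of a] by (cases "a < r") simp_all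
      finally show ?thesis .
    qed
    thus "poly_act fscale t_shift ([:- \<theta>, 1:] ^ k) f = T (\<Sum>i<r. (\<lambda>a. root (f i) * u i a))"
      unfolding poly_act_t_shift by (simp add: fun_eq_iff)
  qed
  thus ?thesis by blast
qed

text \<open>The \<open>i\<close>-th row of \<open>(\<partial>\<rho>\<^sub>t - \<theta>)\<^sup>k\<close> consists of the constant coefficients of \<open>(t - \<theta>)\<^sup>k \<kappa>\<^sub>i\<close>. They vanish as soon as
  \<open>(t - \<theta>)\<^sup>k M\<close> is contained in \<open>\<tau>M\<close>.\<close>

lemma nilpotent: "\<exists>k. (coeff_mat (\<rho> [:0, 1:]) 0 - \<theta> \<cdot>\<^sub>m 1\<^sub>m d) ^\<^sub>m k = 0\<^sub>m d d"
proof -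
  let ?N = "coeff_mat (\<rho> [:0, 1:]) 0 - \<theta> \<cdot>\<^sub>m 1\<^sub>m d"
  let ?t = "row_mult q d P"
  have N: "?N \<in> carrier_mat d d" by (intro minus_carrier_mat) simp
  have Nij: "?N $$ (i, j) = coeff (P i j) 0 - (if i = j then \<theta> else 0)" if "i < d" "j < d" for i j
    using that \<rho>_carrier[of "[:0, 1:]"] by (simp add: coeff_mat_def mat_fun_def)
  let ?c = "\<lambda>m i. poly_act fscale ?t ([:- \<theta>, 1:] ^ m) (unit_vec_poly i 1)"
  have supp_c: "?c m i \<in> supp_below d" if "i < d" for m i
    by (rule poly_act_mem_supp[OF unit_vec_poly_supp[OF that] row_mult_supp])
  have power: "coeff (?c m i j) 0 = (?N ^\<^sub>m m) $$ (i, j)" if i: "i < d" and "j < d" for m i j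
    using that(2)
  proof (induction m arbitrary: j)
    case 0
    have "dim_row ?N = d" using N by blast
    thus ?case using i 0 by (simp add: unit_vec_poly_def)
  next
    case (Suc m)
    have Nm: "?N ^\<^sub>m m \<in> carrier_mat d d" by (rule pow_carrier_mat[OF N])
    have "?c (Suc m) i = poly_act fscale ?t [:- \<theta>, 1:] (?c m i)"
      unfolding power_Suc by (rule R.poly_act_t_mult)
    also have "\<dots> = fscale (- \<theta>) (?c m i) + ?t (?c m i)"
      unfolding fscale.poly_act_pCons_right fscale.poly_act_0_left fscale.scale_one by (simp only: add_0_right)
    finally have step: "?c (Suc m) i = fscale (- \<theta>) (?c m i) + ?t (?c m i)" .
    have "coeff (?c (Suc m) i j) 0 = (\<Sum>k<d. coeff (?c m i k) 0 * coeff (P k j) 0) - \<theta> * coeff (?c m i j) 0"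
      unfolding step using Suc.prems by (simp add: fscale_def row_mult_def coeff_sum const_coeff_skew_mult)
    also have "(\<Sum>k<d. coeff (?c m i k) 0 * coeff (P k j) 0) = (\<Sum>k<d. (?N ^\<^sub>m m) $$ (i, k) * coeff (P k j) 0)"
      by (intro sum.cong refl) (simp only: lessThan_iff Suc.IH)
    also have "\<theta> * coeff (?c m i j) 0 = (\<Sum>k<d. if k = j then (?N ^\<^sub>m m) $$ (i, k) * \<theta> else 0)"
      using Suc.prems by (simp only: Suc.IH sum.delta finite_lessThan lessThan_iff if_True mult.commute)
    also have "(\<Sum>k<d. (?N ^\<^sub>m m) $$ (i, k) * coeff (P k j) 0) - (\<Sum>k<d. if k = j then (?N ^\<^sub>m m) $$ (i, k) * \<theta> else 0)
        = (\<Sum>k<d. (?N ^\<^sub>m m) $$ (i, k) * ?N $$ (k, j))"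
      unfolding sum_subtractf[symmetric]
    proof (intro sum.cong refl)
      fix k assume "k \<in> {..<d}"
      hence k: "k < d" by simp
      show "(?N ^\<^sub>m m) $$ (i, k) * coeff (P k j) 0 - (if k = j then (?N ^\<^sub>m m) $$ (i, k) * \<theta> else 0) = (?N ^\<^sub>m m) $$ (i, k) * ?N $$ (k, j)"
        unfolding Nij[OF k Suc.prems] right_diff_distrib by (cases "k = j") (simp_all only: simp_thms if_True if_False mult_zero_right)
    qed
    also have "\<dots> = (?N ^\<^sub>m m * ?N) $$ (i, j)"
      by (rule mat_mult_entry[OF Nm N i Suc.prems, symmetric])
    also have "?N ^\<^sub>m m * ?N = ?N ^\<^sub>m Suc m" by (simp only: pow_mat.simps)
    finally show ?case .
  qed
  obtain k where k: "\<And>f. f \<in> supp_below r \<Longrightarrow> \<exists>h\<in>supp_below r. poly_act fscale t_shift ([:- \<theta>, 1:] ^ k) f = T h"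
    using t_minus_theta_image by blast
  have "coeff (?c k i j) 0 = 0" if ij: "i < d" "j < d" for i j
  proof -
    obtain h where h: "h \<in> supp_below r" "poly_act fscale t_shift ([:- \<theta>, 1:] ^ k) (lin (unit_vec_poly i 1)) = T h"
      using k[OF lin_supp] by blast
    have "lin (?c k i) = T (lin (coordinates h))" by (simp only: lin_poly_act_t h(2) coordinates(2)[OF h(1)])
    also have "\<dots> = lin (vec_tau q (coordinates h))" by (rule lin_tau[symmetric])
    finally have eq: "lin (?c k i) = lin (vec_tau q (coordinates h))" .
    have "vec_tau q (coordinates h) \<in> supp_below d"
      using coordinates(1)[OF h(1)] by (simp add: supp_below_def vec_tau_def tau_poly_def)
    from lin_inj[OF supp_c[OF ij(1)] this eq] have "?c k i = vec_tau q (coordinates h)" .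
    thus ?thesis by (simp add: vec_tau_def coeff_tau_poly)
  qed
  hence entry: "(?N ^\<^sub>m k) $$ (i, j) = 0" if "i < d" "j < d" for i j
    using power[OF that, of k] that by (simp only:)
  have "?N ^\<^sub>m k \<in> carrier_mat d d" by (rule pow_carrier_mat[OF N])
  hence "?N ^\<^sub>m k = 0\<^sub>m d d"
    by (intro eq_matI) (simp_all only: carrier_matD index_zero_mat entry)
  thus ?thesis ..
qed

text \<open>Multiplication by a polynomial over \<open>F\<close> commutes with \<open>\<tau>\<close>, because its coefficients are fixed by the Frobenius map. It is
  therefore \<open>K{\<tau>}\<close>-linear, and the composition of such maps corresponds to the product of their matrices.\<close>

lemma t_module_\<rho>:
  assumes F: "subfield F (ring_of_type_algebra :: 'k ring)" and finF: "finite F" and q: "q = card F"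
  shows "t_module F \<theta> d \<rho>"
  unfolding t_module_def q[symmetric]
proof (intro conjI d_pos nilpotent ballI)
  have comm: "poly_act fscale t_shift b (poly_act fscale T f x) = poly_act fscale T f (poly_act fscale t_shift b x)"
    if b: "b \<in> carrier (poly_ring_over F)" for b f and x :: "nat \<Rightarrow> 'k poly"
  proof (rule poly_act_intertwine[of "poly_act fscale t_shift b" fscale fscale T T])
    have fb: "frob_poly q b = b"
    proof (rule poly_eqI)
      fix n
      have "coeff b n \<in> F" using b by (simp add: poly_ring_over_def)
      thus "coeff (frob_poly q b) n = coeff b n" by (simp only: coeff_frob_poly finite_subfield_power_card[OF F finF, folded q])
    qed
    show "poly_act fscale t_shift b (x + y) = poly_act fscale t_shift b x + poly_act fscale t_shift b y" for x y
      by (rule Z.t.poly_act_add_right)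
    show "poly_act fscale t_shift b (fscale c x) = fscale c (poly_act fscale t_shift b x)" for c x
      unfolding poly_act_t_shift fscale_def by (simp only: mult_smult_right)
    show "poly_act fscale t_shift b (T x) = T (poly_act fscale t_shift b x)" for x
      using Z.tau_poly_act_t[of b x] by (simp only: fb)
  qed
  show "\<rho> \<in> Ring.ring_hom (poly_ring_over F) (skew_mat_ring q d)"
  proof (rule ring_hom_memI)
    fix a assume a: "a \<in> carrier (poly_ring_over F)"
    show "\<rho> a \<in> carrier (skew_mat_ring q d)" using \<rho>_carrier[of a] by (simp add: skew_mat_ring_def)
    fix b assume b: "b \<in> carrier (poly_ring_over F)"
    have "\<rho> (a * b) = skew_mat_mult q (\<rho> a) (\<rho> b)"
    proof (rule \<rho>_eqI)
      show "skew_mat_mult q (\<rho> a) (\<rho> b) \<in> carrier_mat d d" by (simp add: skew_mat_mult_def \<rho>_def)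
      fix i assume i: "i < d"
      have "lin (mat_fun (skew_mat_mult q (\<rho> a) (\<rho> b)) i) = lin (row_mult q d (mat_fun (\<rho> b)) (mat_fun (\<rho> a) i))"
        by (rule lin_cong) (use i \<rho>_carrier[of a] \<rho>_carrier[of b] in \<open>simp add: skew_mat_mult_def mat_fun_def row_mult_def\<close>)
      also have "\<dots> = poly_act fscale t_shift b (lin (mat_fun (\<rho> a) i))"
        by (rule lin_row_mult[OF \<rho>_row Z.t.poly_act_add_right comm[OF b]])
      also have "\<dots> = poly_act fscale t_shift (a * b) (\<kappa> i)"
        by (simp only: \<rho>_row[OF i] Z.poly_act_t_mult[symmetric] mult.commute)
      finally show "lin (mat_fun (skew_mat_mult q (\<rho> a) (\<rho> b)) i) = poly_act fscale t_shift (a * b) (\<kappa> i)" .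
    qed
    thus "\<rho> (a \<otimes>\<^bsub>poly_ring_over F\<^esub> b) = \<rho> a \<otimes>\<^bsub>skew_mat_ring q d\<^esub> \<rho> b"
      by (simp add: poly_ring_over_def skew_mat_ring_def)
    have "\<rho> (a + b) = \<rho> a + \<rho> b"
    proof (rule \<rho>_eqI)
      show "\<rho> a + \<rho> b \<in> carrier_mat d d" by (rule add_carrier_mat[OF \<rho>_carrier])
      fix i assume i: "i < d"
      have "lin (mat_fun (\<rho> a + \<rho> b) i) = lin (mat_fun (\<rho> a) i + mat_fun (\<rho> b) i)"
        by (rule lin_cong) (use i \<rho>_carrier[of a] \<rho>_carrier[of b] in \<open>simp add: mat_fun_def\<close>)
      thus "lin (mat_fun (\<rho> a + \<rho> b) i) = poly_act fscale t_shift (a + b) (\<kappa> i)"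
        by (simp only: lin_add \<rho>_row[OF i] fscale.poly_act_add_left)
    qed
    thus "\<rho> (a \<oplus>\<^bsub>poly_ring_over F\<^esub> b) = \<rho> a \<oplus>\<^bsub>skew_mat_ring q d\<^esub> \<rho> b"
      by (simp add: poly_ring_over_def skew_mat_ring_def)
  next
    have "\<rho> 1 = 1\<^sub>m d"
    proof (rule \<rho>_eqI)
      fix i assume i: "i < d"
      have "lin (mat_fun (1\<^sub>m d) i) = (\<Sum>j<d. if j = i then \<kappa> j else 0)"
        unfolding lin_def
        by (intro sum.cong refl) (use i in \<open>simp only: mat_fun_def index_one_mat lessThan_iff if_True fscale.poly_act_1 fscale.poly_act_0_left split: if_split, simp\<close>)
      also have "\<dots> = \<kappa> i" using i by (simp only: sum.delta' finite_lessThan lessThan_iff if_True sum.delta)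
      finally show "lin (mat_fun (1\<^sub>m d) i) = poly_act fscale t_shift 1 (\<kappa> i)" by (simp only: fscale.poly_act_1)
    qed simp
    thus "\<rho> \<one>\<^bsub>poly_ring_over F\<^esub> = \<one>\<^bsub>skew_mat_ring q d\<^esub>"
      by (simp add: poly_ring_over_def skew_mat_ring_def)
  qed
  show "\<rho> (Polynomial.smult c a) = map_mat (Polynomial.smult c) (\<rho> a)" for c a
  proof (rule \<rho>_eqI)
    show "map_mat (Polynomial.smult c) (\<rho> a) \<in> carrier_mat d d" using \<rho>_carrier[of a] by simp
    fix i assume i: "i < d"
    have "lin (mat_fun (map_mat (Polynomial.smult c) (\<rho> a)) i) = lin (fscale c (mat_fun (\<rho> a) i))"
      by (rule lin_cong) (use i \<rho>_carrier[of a] in \<open>simp add: mat_fun_def fscale_def\<close>)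
    thus "lin (mat_fun (map_mat (Polynomial.smult c) (\<rho> a)) i) = poly_act fscale t_shift (Polynomial.smult c a) (\<kappa> i)"
      by (simp only: lin_fscale \<rho>_row[OF i] fscale.poly_act_smult)
  qed
qed

end

lemma pure_basis_exists:
  assumes M: "frobenius_coordinates q M r A \<Gamma>" and W: "weighted_frobenius q A r w (\<theta> :: 'k::alg_closed_field)"
    and N: "0 < N" and s: "0 < s" and Ns: "real N = real s * w"
  shows "\<exists>d \<kappa> D. pure_basis q M r A \<Gamma> w \<theta> N s d \<kappa> D"
proof -
  interpret W: weighted_frobenius "TYPE('k)" q A r w \<theta> by (rule W)
  obtain d \<kappa> D where b: "\<forall>i<d. \<kappa> i \<in> supp_below r"
    "\<forall>x\<in>supp_below r. \<exists>f. x = (\<Sum>i<d::nat. poly_act fscale (matrix_tau q r A) (f i) (\<kappa> i))"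
    "\<forall>f. (\<Sum>i<d. poly_act fscale (matrix_tau q r A) (f i) (\<kappa> i)) = 0 \<longrightarrow> (\<forall>i<d. f i = 0)"
    "\<forall>i<d. (t_shift ^^ N) (\<kappa> i) = (\<Sum>j<d. poly_act fscale (matrix_tau q r A) (D i j) (\<kappa> j))"
    "\<forall>i<d. \<forall>j<d. \<forall>n>s. coeff (D i j) n = 0"
    "\<forall>c. (\<forall>j<d. (\<Sum>i<d. c i * coeff (D i j) s) = 0) \<longrightarrow> (\<forall>i<d. c i = 0)"
    using W.strictly_pure_basis_exists[OF N s Ns] by (elim exE conjE) (rule that; assumption)
  have "pure_basis q M r A \<Gamma> w \<theta> N s d \<kappa> D"
  proof (intro pure_basis.intro M W pure_basis_axioms.intro N)
    show "\<kappa> i \<in> supp_below r" if "i < d" for i using b(1) that by blast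
    show "\<exists>f. x = (\<Sum>i<d. poly_act fscale (matrix_tau q r A) (f i) (\<kappa> i))" if "x \<in> supp_below r" for x
      using b(2) that by blast
    show "f i = 0" if "(\<Sum>i<d. poly_act fscale (matrix_tau q r A) (f i) (\<kappa> i)) = 0" "i < d" for f i
      using b(3) that by blast
    show "(t_shift ^^ N) (\<kappa> i) = (\<Sum>j<d. poly_act fscale (matrix_tau q r A) (D i j) (\<kappa> j))" if "i < d" for i
      using b(4) that by blast
    show "coeff (D i j) n = 0" if "i < d" "j < d" "n > s" for i j n using b(5) that by blast
    show "\<forall>i<d. c i = 0" if "\<And>j. j < d \<Longrightarrow> (\<Sum>i<d. c i * coeff (D i j) s) = 0" for c
      using b(6) that by blast
  qed
  thus ?thesis by blast
qed

section \<open>Tensor products of almost strictly pure t-modules\<close>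

theorem theorem3:
  fixes F :: "'k::alg_closed_field set" and q :: nat and \<theta> :: 'k
    and d\<^sub>\<phi> d\<^sub>\<psi> :: nat and \<phi> \<psi> :: "'k poly \<Rightarrow> 'k poly mat"
  assumes "subfield F (ring_of_type_algebra :: 'k ring)" and "finite F" and "q = card F"
    and "t_module F \<theta> d\<^sub>\<phi> \<phi>" and "abelian_t_module q d\<^sub>\<phi> \<phi>" and "almost_strictly_pure \<phi>"
    and "t_module F \<theta> d\<^sub>\<psi> \<psi>" and "abelian_t_module q d\<^sub>\<psi> \<psi>" and "almost_strictly_pure \<psi>"
  defines "M \<equiv> motive_tensor q (motive q d\<^sub>\<phi> \<phi>) (motive q d\<^sub>\<psi> \<psi>)"
  shows "(\<exists>d \<rho>. t_module F \<theta> d \<rho> \<and> almost_strictly_pure \<rho> \<and>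
            isomorphic_modules (skew_ring_t q) M (motive q d \<rho>)) \<and>
         (\<exists>d \<kappa>. almost_strictly_pure_wrt q M d \<kappa>) \<and>
         (1 / (weight q d\<^sub>\<phi> \<phi> + weight q d\<^sub>\<psi> \<psi>) \<in> \<int> \<longrightarrow> (\<exists>d \<kappa>. strictly_pure_wrt q M d \<kappa>))"
proof -
  interpret \<phi>: motive_setting F q \<theta> d\<^sub>\<phi> \<phi> by (rule motive_setting.intro[OF assms(1-4,6)])
  interpret \<psi>: motive_setting F q \<theta> d\<^sub>\<psi> \<psi> by (rule motive_setting.intro[OF assms(1-3,7,9)])
  obtain r1 A1 w1 \<Gamma>1 where m1: "frobenius_coordinates q (motive q d\<^sub>\<phi> \<phi>) r1 A1 \<Gamma>1" "weighted_frobenius q A1 r1 w1 \<theta>"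
    "weight q d\<^sub>\<phi> \<phi> = of_nat d\<^sub>\<phi> / of_nat r1" "real d\<^sub>\<phi> = real r1 * w1"
    using \<phi>.motive_frobenius_coordinates[OF assms(5)] by (elim exE conjE) (rule that; assumption)
  obtain r2 A2 w2 \<Gamma>2 where m2: "frobenius_coordinates q (motive q d\<^sub>\<psi> \<psi>) r2 A2 \<Gamma>2" "weighted_frobenius q A2 r2 w2 \<theta>"
    "weight q d\<^sub>\<psi> \<psi> = of_nat d\<^sub>\<psi> / of_nat r2" "real d\<^sub>\<psi> = real r2 * w2"
    using \<psi>.motive_frobenius_coordinates[OF assms(8)] by (elim exE conjE) (rule that; assumption)
  have r1: "0 < r1" and r2: "0 < r2"
    using weighted_frobenius.r_pos[OF m1(2)] weighted_frobenius.r_pos[OF m2(2)] by simp_all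
  let ?A = "kronecker r1 r2 A1 A2" and ?w = "w1 + w2"
  obtain \<Theta> where \<Theta>: "frobenius_coordinates q M (r1 * r2) ?A \<Theta>"
    using exE[OF motive_tensor_coordinates[OF m1(1) m2(1) r2, folded M_def]] .
  have W: "weighted_frobenius q ?A (r1 * r2) ?w \<theta>"
    by (rule weighted_frobenius_kronecker[OF m1(2) m2(2)])
  have "real r1 \<noteq> 0" "real r2 \<noteq> 0" using r1 r2 by simp_all
  hence w: "w1 = real d\<^sub>\<phi> / real r1" "w2 = real d\<^sub>\<psi> / real r2"
    unfolding m1(4) m2(4) by (simp_all only: nonzero_mult_div_cancel_left not_False_eq_True)
  \<comment> \<open>\<open>N / s\<close> is the sum of the weights, brought to a common denominator.\<close>
  let ?N = "d\<^sub>\<phi> * r2 + d\<^sub>\<psi> * r1" and ?s = "r1 * r2"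
  have Ns: "real ?N = real ?s * ?w" unfolding of_nat_add of_nat_mult m1(4) m2(4) by (simp only: distrib_left mult_ac)
  have N: "0 < ?N" and s: "0 < ?s" using \<phi>.d_pos r1 r2 by simp_all
  from pure_basis_exists[OF \<Theta> W N s Ns]
  obtain d \<kappa> D where "pure_basis q M (r1 * r2) ?A \<Theta> ?w \<theta> ?N ?s d \<kappa> D" by (elim exE)
  then interpret B: pure_basis "TYPE('k)" q M "r1 * r2" ?A \<Theta> ?w \<theta> ?N ?s d \<kappa> D .
  have t_module: "\<exists>d \<rho>. t_module F \<theta> d \<rho> \<and> almost_strictly_pure \<rho> \<and> isomorphic_modules (skew_ring_t q) M (motive q d \<rho>)"
    by (intro exI[of _ d] exI[of _ B.\<rho>] conjI B.t_module_\<rho>[OF assms(1-3)] B.almost_strictly_pure_\<rho> B.isomorphic_motive)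
  have almost: "\<exists>d \<kappa>. almost_strictly_pure_wrt q M d \<kappa>"
  proof -
    have "?N \<ge> 1" using N by linarith
    thus ?thesis unfolding almost_strictly_pure_wrt_def
      by (intro exI[of _ d] exI[of _ B.basis_elem] exI[of _ ?N] conjI B.pure_wrt_basis)
  qed
  have strict: "\<exists>d \<kappa>. strictly_pure_wrt q M d \<kappa>" if int: "1 / (weight q d\<^sub>\<phi> \<phi> + weight q d\<^sub>\<psi> \<psi>) \<in> \<int>"
  proof -
    obtain m where m: "1 / (weight q d\<^sub>\<phi> \<phi> + weight q d\<^sub>\<psi> \<psi>) = of_int m" using int by (rule Ints_cases)
    have wt: "of_rat (weight q d\<^sub>\<phi> \<phi> + weight q d\<^sub>\<psi> \<psi>) = ?w"
      unfolding m1(3) m2(3) w by (simp add: of_rat_add of_rat_divide)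
    have "of_rat (1 / (weight q d\<^sub>\<phi> \<phi> + weight q d\<^sub>\<psi> \<psi>)) = (1 / ?w :: real)"
      by (simp only: of_rat_divide of_rat_1 wt)
    hence mw: "real_of_int m = 1 / ?w" unfolding m by simp
    have wpos: "0 < ?w" using weighted_frobenius.w_pos[OF W] .
    have "0 < real_of_int m" unfolding mw using wpos by simp
    hence mpos: "0 < nat m" and mr: "real (nat m) = real_of_int m" by simp_all
    have one: "real (1::nat) = real (nat m) * ?w" unfolding mr mw using wpos by simp
    have "\<exists>d \<kappa> D. pure_basis q M (r1 * r2) ?A \<Theta> ?w \<theta> 1 (nat m) d \<kappa> D"
      by (rule pure_basis_exists[OF \<Theta> W _ mpos one]) simp
    then obtain d \<kappa> D where "pure_basis q M (r1 * r2) ?A \<Theta> ?w \<theta> 1 (nat m) d \<kappa> D" by (elim exE)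
    then interpret S: pure_basis "TYPE('k)" q M "r1 * r2" ?A \<Theta> ?w \<theta> 1 "nat m" d \<kappa> D .
    show ?thesis unfolding strictly_pure_wrt_def by (intro exI[of _ d] exI[of _ S.basis_elem] S.pure_wrt_basis)
  qed
  show ?thesis by (intro conjI impI t_module almost strict)
qed

end
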